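(* Let $\{P,M,G,\pi\}$ be a principal fibre bundle with connection form $\omega$, and let $\alpha\in(1/2,1]$. Given an $\alpha$-Hölder continuous path $x:[0,T]\to M$ and an element $u$ of the fibre $\pi^{-1}(x_0)$, there exists, up to an explosion time, a unique horizontal lift $\widetilde{x}:[0,T]\to P$ of $x$ with $\widetilde{x}_0=u$.
   Context: $\{P,M,G,\pi\}$ is a principal fibre bundle with base $M$ a smooth, connected, paracompact manifold, structure (Lie) group $G$ with Lie algebra $\mathfrak{g}$, total space $P$, and projection $\pi:P\to M$; $G$ acts freely on $P$ on the right by $R_g(u)=ug$. For $A\in\mathfrak{g}$, $A^*$ is the vector field on $P$ given by $A^*u=\frac{d}{dt}R_{\exp(tA)}u\big|_{t=0}$. The vertical space is $VT_uP=\ker d\pi_u$. A connection form is a $\mathfrak{g}$-valued $1$-form $\omega$ on $P$ such that (i) $\omega\,dR_g=\mathrm{Ad}(g^{-1})\omega$ for all $g\in G$, and (ii) $\omega(A^* )=A$ for all $A\in\mathfrak{g}$. The horizontal space is $HT_uP=\ker\omega_u$, and $T_uP=HT_uP\oplus VT_uP$. Paths are $\alpha$-Hölder with respect to some (equivalently, any, on compact sets) Riemannian metric. The integral of a $1$-form $\beta=\sum_i\beta_i\,dy^i$ along an $\alpha$-Hölder path $y_t$ is $\sum_i\int\beta_i(y_t)\,dy^i_t$ in charts (Young/Riemann–Stieltjes integrals); for $\omega$ this is taken componentwise in $\mathfrak{g}$. A horizontal lift of $x$ starting at $u\in\pi^{-1}(x_0)$ is an ($\alpha$-Hölder continuous)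 path $\widetilde{x}$ in $P$ such that $\widetilde{x}_0=u$, $\pi(\widetilde{x}_t)=x_t$ for all $t$, and $\int_0^t\omega\,d\widetilde{x}_s=0$ for all $t$. "Up to an explosion time" means that the lift is defined on a maximal interval, which is the whole of $[0,T]$ if there is no explosion in the fibre. *)

theory Defs
  imports "HOL-Analysis.Analysis"
begin

section \<open>Finite-dimensional model spaces\<close>

text \<open>Charts take values in a finite-dimensional normed space. The library class
  \<open>euclidean_space\<close> is not used because it forces the dimension to be positive, whereas a
  structure group may well be discrete (dimension \<open>0\<close>); the class below contains all Euclidean
  spaces, is closed under products, and admits the zero space.\<close>

class finite_dim_normed = real_normed_vector +
  assumes finite_span_sum: "\<exists>B. finite B \<and> (\<forall>x. \<exists>c. x = (\<Sum>b\<in>B. c b *\<^sub>R b))"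

lemma finite_span: "\<exists>B::'a::finite_dim_normed set. finite B \<and> span B = UNIV"
proof -
  obtain B :: "'a set" where B: "finite B" "\<And>x. \<exists>c. x = (\<Sum>b\<in>B. c b *\<^sub>R b)"
    using finite_span_sum by blast
  have "x \<in> span B" for x
  proof -
    obtain c where c: "x = (\<Sum>b\<in>B. c b *\<^sub>R b)" using B(2) by blast
    show ?thesis unfolding c by (intro span_sum span_scale span_base)
  qed
  then show ?thesis using B(1) by blast
qed

lemma finite_dim_normedI:
  assumes "finite (B :: 'a::real_normed_vector set)" "span B = UNIV"
  shows "\<exists>B::'a set. finite B \<and> (\<forall>x. \<exists>c. x = (\<Sum>b\<in>B. c b *\<^sub>R b))"
  using assms span_finite[OF assms(1)] by (intro exI[of _ B]) auto

instance euclidean_space \<subseteq> finite_dim_normed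
  by standard (rule finite_dim_normedI[OF finite_Basis span_Basis])

instance prod :: (finite_dim_normed, finite_dim_normed) finite_dim_normed
proof
  obtain B :: "'a set" where B: "finite B" "span B = UNIV" using finite_span by blast
  obtain C :: "'b set" where C: "finite C" "span C = UNIV" using finite_span by blast
  let ?D = "(\<lambda>x. (x, 0)) ` B \<union> (\<lambda>y. (0, y)) ` C :: ('a \<times> 'b) set"
  have l1: "linear (\<lambda>x::'a. (x, 0::'b))" by (rule linearI) auto
  have l2: "linear (\<lambda>y::'b. (0::'a, y))" by (rule linearI) auto
  have "z \<in> span ?D" for z
  proof -
    have "(fst z, 0) \<in> span ((\<lambda>x. (x, 0::'b)) ` B)"
      unfolding linear_span_image[OF l1] using B by auto
    moreover have "(0, snd z) \<in> span ((\<lambda>y. (0::'a, y)) ` C)"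
      unfolding linear_span_image[OF l2] using C by auto
    ultimately have "(fst z, 0) + (0, snd z) \<in> span ?D"
      by (intro span_add) (use span_mono in blast)+
    then show ?thesis by simp
  qed
  then show "\<exists>B::('a \<times> 'b) set. finite B \<and> (\<forall>x. \<exists>c. x = (\<Sum>b\<in>B. c b *\<^sub>R b))"
    using B(1) C(1) by (intro finite_dim_normedI[of ?D]) auto
qed

definition coord_basis :: "'e::finite_dim_normed set" where
  "coord_basis = (SOME B. finite B \<and> independent B \<and> span B = UNIV)"

lemma coord_basis:
  "finite (coord_basis :: 'e::finite_dim_normed set)"
  "independent (coord_basis :: 'e::finite_dim_normed set)"
  "span (coord_basis :: 'e::finite_dim_normed set) = UNIV"
proof -
  obtain B :: "'e set" where B: "finite B" "span B = UNIV" using finite_span by blast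
  obtain C where "C \<subseteq> B" "independent C" "B \<subseteq> span C"
    using maximal_independent_subset[of B] by blast
  then have "finite C \<and> independent C \<and> span C = UNIV"
    using B span_mono[of B "span C"] finite_subset[of C B] by (auto simp: span_span)
  then have "finite (coord_basis :: 'e set) \<and> independent (coord_basis :: 'e set)
      \<and> span (coord_basis :: 'e set) = UNIV"
    unfolding coord_basis_def by (rule someI)
  then show "finite (coord_basis :: 'e set)" "independent (coord_basis :: 'e set)"
    "span (coord_basis :: 'e set) = UNIV" by auto
qed

text \<open>\<open>smooth_on\<close> is meant for open \<open>S\<close>. In finite dimension, continuity of all iterated
  directional derivatives up to order \<open>k\<close> is the same as being \<open>k\<close> times continuously
  differentiable.\<close>

primrec Ck_on :: "nat \<Rightarrow> 'e::real_normed_vector set \<Rightarrow> ('e \<Rightarrow> 'f::real_normed_vector) \<Rightarrow> bool" where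
  "Ck_on 0 S f \<longleftrightarrow> continuous_on S f"
| "Ck_on (Suc k) S f \<longleftrightarrow>
     (\<forall>x\<in>S. f differentiable (at x)) \<and> (\<forall>v. Ck_on k S (\<lambda>x. frechet_derivative f (at x) v))"

definition smooth_on :: "'e::real_normed_vector set \<Rightarrow> ('e \<Rightarrow> 'f::real_normed_vector) \<Rightarrow> bool" where
  "smooth_on S f \<longleftrightarrow> (\<forall>k. Ck_on k S f)"


section \<open>Smooth manifolds\<close>

text \<open>A smooth manifold is a (Hausdorff) topological type together with a smooth atlas, which
  need not be maximal; a chart is a pair of a domain and a coordinate map. The coordinate map is
  a total function, only its values on the domain matter.\<close>

type_synonym ('a, 'e) chart = "'a set \<times> ('a \<Rightarrow> 'e)"

abbreviation dom_of :: "('a, 'e) chart \<Rightarrow> 'a set" where "dom_of c \<equiv> fst c"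
abbreviation map_of_chart :: "('a, 'e) chart \<Rightarrow> 'a \<Rightarrow> 'e" where "map_of_chart c \<equiv> snd c"
abbreviation inv_chart :: "('a, 'e) chart \<Rightarrow> 'e \<Rightarrow> 'a" where
  "inv_chart c \<equiv> inv_into (fst c) (snd c)"

definition smooth_atlas ::
  "('a::t2_space, 'e::finite_dim_normed) chart set \<Rightarrow> bool" where
  "smooth_atlas A \<longleftrightarrow>
     (\<Union>c\<in>A. dom_of c) = UNIV \<and>
     (\<forall>c\<in>A. open (dom_of c) \<and> open (map_of_chart c ` dom_of c) \<and>
        homeomorphism (dom_of c) (map_of_chart c ` dom_of c) (map_of_chart c) (inv_chart c)) \<and>
     (\<forall>c\<in>A. \<forall>d\<in>A. smooth_on (map_of_chart c ` (dom_of c \<inter> dom_of d))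
        (\<lambda>z. map_of_chart d (inv_chart c z)))"

definition smooth_map_on ::
  "'a::t2_space set \<Rightarrow> ('a, 'e::finite_dim_normed) chart set \<Rightarrow>
   ('b::t2_space, 'f::finite_dim_normed) chart set \<Rightarrow> ('a \<Rightarrow> 'b) \<Rightarrow> bool" where
  "smooth_map_on W A B F \<longleftrightarrow>
     open W \<and> continuous_on W F \<and>
     (\<forall>c\<in>A. \<forall>d\<in>B. smooth_on (map_of_chart c ` (dom_of c \<inter> W \<inter> F -` dom_of d))
        (\<lambda>z. map_of_chart d (F (inv_chart c z))))"

definition prod_atlas ::
  "('a, 'e) chart set \<Rightarrow> ('b, 'f) chart set \<Rightarrow> ('a \<times> 'b, 'e \<times> 'f) chart set" where
  "prod_atlas A B =
     {(dom_of c \<times> dom_of d, map_prod (map_of_chart c) (map_of_chart d)) | c d. c \<in> A \<and> d \<in> B}"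

definition paracompact :: "'a::topological_space itself \<Rightarrow> bool" where
  "paracompact _ \<longleftrightarrow>
     (\<forall>\<U>::'a set set. (\<forall>U\<in>\<U>. open U) \<and> \<Union>\<U> = UNIV \<longrightarrow>
        (\<exists>\<V>. (\<forall>V\<in>\<V>. open V) \<and> \<Union>\<V> = UNIV \<and> (\<forall>V\<in>\<V>. \<exists>U\<in>\<U>. V \<subseteq> U) \<and>
             locally_finite_in euclidean \<V>))"


section \<open>Tangent vectors\<close>

text \<open>A tangent vector at \<open>p\<close> acts by differentiation on the real functions that are smooth
  near \<open>p\<close>; the value on all other functions is fixed to be \<open>0\<close>, so that equality of tangent
  vectors is equality of functionals. The tangent space is a vector space under the pointwise
  operations, with zero \<open>\<lambda>_. 0\<close>.\<close>

type_synonym 'a tangent = "('a \<Rightarrow> real) \<Rightarrow> real"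

definition smooth_near :: "('a::t2_space, 'e::finite_dim_normed) chart set \<Rightarrow> 'a \<Rightarrow> ('a \<Rightarrow> real) \<Rightarrow> bool"
  where
  "smooth_near A p f \<longleftrightarrow>
     (\<exists>W. open W \<and> p \<in> W \<and>
        (\<forall>c\<in>A. smooth_on (map_of_chart c ` (dom_of c \<inter> W)) (\<lambda>z. f (inv_chart c z))))"

text \<open>\<open>coord_vec A c p v\<close> is \<open>\<Sum>\<^sub>i v\<^sup>i \<partial>/\<partial>y\<^sup>i\<close> at \<open>p\<close> for the coordinates \<open>y\<close> of the chart \<open>c\<close>.\<close>

definition coord_vec ::
  "('a::t2_space, 'e::finite_dim_normed) chart set \<Rightarrow> ('a, 'e) chart \<Rightarrow> 'a \<Rightarrow> 'e \<Rightarrow> 'a tangent" where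
  "coord_vec A c p v =
     (\<lambda>f. if smooth_near A p f
          then frechet_derivative (\<lambda>z. f (inv_chart c z)) (at (map_of_chart c p)) v else 0)"

definition tangent_space ::
  "('a::t2_space, 'e::finite_dim_normed) chart set \<Rightarrow> 'a \<Rightarrow> 'a tangent set" where
  "tangent_space A p = {coord_vec A c p v | c v. c \<in> A \<and> p \<in> dom_of c}"

definition differential ::
  "('a::t2_space, 'e::finite_dim_normed) chart set \<Rightarrow> ('b::t2_space, 'f::finite_dim_normed) chart set \<Rightarrow>
   ('a \<Rightarrow> 'b) \<Rightarrow> 'a \<Rightarrow> 'a tangent \<Rightarrow> 'b tangent" where
  "differential A B F p X = (\<lambda>f. if smooth_near B (F p) f then X (\<lambda>q. f (F q)) else 0)"

text \<open>Test functions are unconstrained away from the base point, so \<open>has_velocity\<close> forces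
  continuity of the curve at \<open>t\<close> (use as test function the indicator of the complement of a
  neighbourhood).\<close>

definition has_velocity ::
  "('a::t2_space, 'e::finite_dim_normed) chart set \<Rightarrow> (real \<Rightarrow> 'a) \<Rightarrow> 'a tangent \<Rightarrow> real \<Rightarrow> bool" where
  "has_velocity A \<gamma> X t \<longleftrightarrow>
     X \<in> tangent_space A (\<gamma> t) \<and>
     (\<forall>f. smooth_near A (\<gamma> t) f \<longrightarrow> ((\<lambda>s. f (\<gamma> s)) has_real_derivative X f) (at t))"

definition velocity ::
  "('a::t2_space, 'e::finite_dim_normed) chart set \<Rightarrow> (real \<Rightarrow> 'a) \<Rightarrow> real \<Rightarrow> 'a tangent" where
  "velocity A \<gamma> t = (THE X. has_velocity A \<gamma> X t)"

definition linear_functional_on :: "'a tangent set \<Rightarrow> ('a tangent \<Rightarrow> real) \<Rightarrow> bool" where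
  "linear_functional_on V l \<longleftrightarrow>
     (\<forall>X\<in>V. \<forall>Y\<in>V. l (\<lambda>f. X f + Y f) = l X + l Y) \<and>
     (\<forall>r. \<forall>X\<in>V. l (\<lambda>f. r * X f) = r * l X)"

definition one_form ::
  "('a::t2_space, 'e::finite_dim_normed) chart set \<Rightarrow> ('a \<Rightarrow> 'a tangent \<Rightarrow> real) \<Rightarrow> bool" where
  "one_form A \<beta> \<longleftrightarrow>
     (\<forall>p. linear_functional_on (tangent_space A p) (\<beta> p)) \<and>
     (\<forall>c\<in>A. \<forall>v. smooth_on (map_of_chart c ` dom_of c)
        (\<lambda>z. \<beta> (inv_chart c z) (coord_vec A c (inv_chart c z) v)))"


section \<open>Riemannian metrics and Hoelder paths\<close>

definition riemannian_metric ::
  "('a::t2_space, 'e::finite_dim_normed) chart set \<Rightarrow> ('a \<Rightarrow> 'a tangent \<Rightarrow> 'a tangent \<Rightarrow> real) \<Rightarrow> bool"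
  where
  "riemannian_metric A g \<longleftrightarrow>
     (\<forall>p. \<forall>X\<in>tangent_space A p.
        linear_functional_on (tangent_space A p) (g p X) \<and>
        (\<forall>Y\<in>tangent_space A p. g p X Y = g p Y X) \<and>
        (X \<noteq> (\<lambda>_. 0) \<longrightarrow> g p X X > 0)) \<and>
     (\<forall>c\<in>A. \<forall>v w. smooth_on (map_of_chart c ` dom_of c)
        (\<lambda>z. g (inv_chart c z) (coord_vec A c (inv_chart c z) v) (coord_vec A c (inv_chart c z) w)))"

definition speed ::
  "('a::t2_space, 'e::finite_dim_normed) chart set \<Rightarrow> ('a \<Rightarrow> 'a tangent \<Rightarrow> 'a tangent \<Rightarrow> real) \<Rightarrow>
   (real \<Rightarrow> 'a) \<Rightarrow> real \<Rightarrow> real" where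
  "speed A g \<gamma> t = sqrt (g (\<gamma> t) (velocity A \<gamma> t) (velocity A \<gamma> t))"

text \<open>The library predicate \<open>piecewise_C1_differentiable_on\<close> puts no bound on the derivative near
  the finitely many exceptional points, so finiteness of the length has to be required.\<close>

definition piecewise_C1_curve ::
  "('a::t2_space, 'e::finite_dim_normed) chart set \<Rightarrow> ('a \<Rightarrow> 'a tangent \<Rightarrow> 'a tangent \<Rightarrow> real) \<Rightarrow>
   (real \<Rightarrow> 'a) \<Rightarrow> bool" where
  "piecewise_C1_curve A g \<gamma> \<longleftrightarrow>
     continuous_on {0..1} \<gamma> \<and>
     (\<forall>c\<in>A. \<forall>a b. 0 \<le> a \<and> a \<le> b \<and> b \<le> 1 \<and> \<gamma> ` {a..b} \<subseteq> dom_of c \<longrightarrow>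
        (\<lambda>t. map_of_chart c (\<gamma> t)) piecewise_C1_differentiable_on {a..b}) \<and>
     speed A g \<gamma> integrable_on {0..1}"

text \<open>The distance of points in different components is \<open>\<infinity>\<close>.\<close>

definition riemannian_dist ::
  "('a::t2_space, 'e::finite_dim_normed) chart set \<Rightarrow> ('a \<Rightarrow> 'a tangent \<Rightarrow> 'a tangent \<Rightarrow> real) \<Rightarrow>
   'a \<Rightarrow> 'a \<Rightarrow> ereal" where
  "riemannian_dist A g p q =
     (INF \<gamma>\<in>{\<gamma>. piecewise_C1_curve A g \<gamma> \<and> \<gamma> 0 = p \<and> \<gamma> 1 = q}.
        ereal (integral {0..1} (speed A g \<gamma>)))"

definition holder_path ::
  "('a::t2_space, 'e::finite_dim_normed) chart set \<Rightarrow> ('a \<Rightarrow> 'a tangent \<Rightarrow> 'a tangent \<Rightarrow> real) \<Rightarrow>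
   real \<Rightarrow> real set \<Rightarrow> (real \<Rightarrow> 'a) \<Rightarrow> bool" where
  "holder_path A g \<alpha> I y \<longleftrightarrow>
     (\<exists>C. \<forall>s\<in>I. \<forall>t\<in>I. riemannian_dist A g (y s) (y t) \<le> ereal (C * \<bar>t - s\<bar> powr \<alpha>))"


section \<open>Integration of 1-forms along paths\<close>

definition has_RS_integral ::
  "(real \<Rightarrow> real) \<Rightarrow> (real \<Rightarrow> real) \<Rightarrow> real \<Rightarrow> real \<Rightarrow> real \<Rightarrow> bool" where
  "has_RS_integral f h a b I \<longleftrightarrow>
     (\<forall>\<epsilon>>0. \<exists>\<delta>>0. \<forall>(n::nat) t \<xi>.
        t 0 = a \<and> t n = b \<and>
        (\<forall>k<n. t k \<le> \<xi> k \<and> \<xi> k \<le> t (Suc k) \<and> t (Suc k) - t k < \<delta>) \<longrightarrow>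
        \<bar>(\<Sum>k<n. f (\<xi> k) * (h (t (Suc k)) - h (t k))) - I\<bar> < \<epsilon>)"

text \<open>Over an interval mapped into one chart the integral is \<open>\<Sum>\<^sub>i \<integral> \<beta>\<^sub>i(y\<^sub>t) dy\<^sup>i\<^sub>t\<close>, where
  \<open>\<beta>\<^sub>i = \<beta>(\<partial>/\<partial>y\<^sup>i)\<close>; in general the interval is cut into finitely many such pieces.\<close>

inductive has_form_integral ::
  "('a::t2_space, 'e::finite_dim_normed) chart set \<Rightarrow> ('a \<Rightarrow> 'a tangent \<Rightarrow> real) \<Rightarrow> (real \<Rightarrow> 'a) \<Rightarrow>
   real \<Rightarrow> real \<Rightarrow> real \<Rightarrow> bool" for A \<beta> y where
  in_chart:
    "\<lbrakk>c \<in> A; a \<le> b; y ` {a..b} \<subseteq> dom_of c;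
      \<And>i. i \<in> coord_basis \<Longrightarrow>
        has_RS_integral (\<lambda>t. \<beta> (y t) (coord_vec A c (y t) i))
          (\<lambda>t. representation coord_basis (map_of_chart c (y t)) i) a b (I i)\<rbrakk>
     \<Longrightarrow> has_form_integral A \<beta> y a b (\<Sum>i\<in>coord_basis. I i)"
| join:
    "\<lbrakk>has_form_integral A \<beta> y a b I; has_form_integral A \<beta> y b c J\<rbrakk>
     \<Longrightarrow> has_form_integral A \<beta> y a c (I + J)"


section \<open>Lie groups\<close>

locale lie_group = group mul one ginv
  for A :: "('g::t2_space, 'k::finite_dim_normed) chart set"
  and mul :: "'g \<Rightarrow> 'g \<Rightarrow> 'g" and one :: 'g and ginv :: "'g \<Rightarrow> 'g" +
  assumes atlas: "smooth_atlas A"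
    and smooth_mul: "smooth_map_on UNIV (prod_atlas A A) A (\<lambda>(a, b). mul a b)"
    and smooth_inv: "smooth_map_on UNIV A A ginv"

abbreviation lie_algebra ::
  "('g::t2_space, 'k::finite_dim_normed) chart set \<Rightarrow> 'g \<Rightarrow> 'g tangent set" where
  "lie_algebra A one \<equiv> tangent_space A one"

text \<open>A homomorphism that is differentiable at \<open>0\<close> is automatically smooth, and it is determined
  by its velocity there.\<close>

definition one_parameter_subgroup ::
  "('g::t2_space, 'k::finite_dim_normed) chart set \<Rightarrow> ('g \<Rightarrow> 'g \<Rightarrow> 'g) \<Rightarrow> 'g tangent \<Rightarrow>
   (real \<Rightarrow> 'g) \<Rightarrow> bool" where
  "one_parameter_subgroup A mul Z \<sigma> \<longleftrightarrow>
     (\<forall>s t. \<sigma> (s + t) = mul (\<sigma> s) (\<sigma> t)) \<and> has_velocity A \<sigma> Z 0"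

definition lie_exp ::
  "('g::t2_space, 'k::finite_dim_normed) chart set \<Rightarrow> ('g \<Rightarrow> 'g \<Rightarrow> 'g) \<Rightarrow> 'g tangent \<Rightarrow> 'g" where
  "lie_exp A mul Z = (THE \<sigma>. one_parameter_subgroup A mul Z \<sigma>) 1"

definition Ad ::
  "('g::t2_space, 'k::finite_dim_normed) chart set \<Rightarrow> ('g \<Rightarrow> 'g \<Rightarrow> 'g) \<Rightarrow> 'g \<Rightarrow> ('g \<Rightarrow> 'g) \<Rightarrow>
   'g \<Rightarrow> 'g tangent \<Rightarrow> 'g tangent" where
  "Ad A mul one ginv a = differential A A (\<lambda>h. mul (mul a h) (ginv a)) one"


section \<open>Principal bundles and connections\<close>

locale principal_bundle = lie_group AG mul one ginv
  for AP :: "('p::t2_space, 'e::finite_dim_normed) chart set"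
  and AM :: "('m::t2_space, 'f::finite_dim_normed) chart set"
  and AG :: "('g::t2_space, 'k::finite_dim_normed) chart set"
  and mul :: "'g \<Rightarrow> 'g \<Rightarrow> 'g" and one :: 'g and ginv :: "'g \<Rightarrow> 'g"
  and act :: "'p \<Rightarrow> 'g \<Rightarrow> 'p" and proj :: "'p \<Rightarrow> 'm" +
  assumes atlas_P: "smooth_atlas AP"
    and atlas_M: "smooth_atlas AM"
    and connected_M: "connected (UNIV :: 'm set)"
    and paracompact_M: "paracompact TYPE('m)"
    and smooth_act: "smooth_map_on UNIV (prod_atlas AP AG) AP (\<lambda>(u, a). act u a)"
    and act_one: "act u one = u"
    and act_mul: "act (act u a) b = act u (mul a b)"
    and act_free: "act u a = u \<Longrightarrow> a = one"
    and smooth_proj: "smooth_map_on UNIV AP AM proj"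
    and surj_proj: "surj proj"
    and fibres: "proj u = proj v \<longleftrightarrow> (\<exists>a. v = act u a)"
    and locally_trivial:
      "\<exists>U \<psi>. open U \<and> x \<in> U \<and>
         (\<forall>u\<in>proj -` U. \<forall>a. \<psi> (act u a) = mul (\<psi> u) a) \<and>
         bij_betw (\<lambda>u. (proj u, \<psi> u)) (proj -` U) (U \<times> UNIV) \<and>
         smooth_map_on (proj -` U) AP (prod_atlas AM AG) (\<lambda>u. (proj u, \<psi> u)) \<and>
         smooth_map_on (U \<times> UNIV) (prod_atlas AM AG) AP
           (inv_into (proj -` U) (\<lambda>u. (proj u, \<psi> u)))"

text \<open>\<open>fundamental_field AP AG mul act Z u\<close> is the value at \<open>u\<close> of the vector field \<open>Z\<^sup>*\<close>.\<close>

definition fundamental_field ::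
  "('p::t2_space, 'e::finite_dim_normed) chart set \<Rightarrow> ('g::t2_space, 'k::finite_dim_normed) chart set \<Rightarrow>
   ('g \<Rightarrow> 'g \<Rightarrow> 'g) \<Rightarrow> ('p \<Rightarrow> 'g \<Rightarrow> 'p) \<Rightarrow> 'g tangent \<Rightarrow> 'p \<Rightarrow> 'p tangent" where
  "fundamental_field AP AG mul act Z u =
     velocity AP (\<lambda>t. act u (lie_exp AG mul (\<lambda>f. t * Z f))) 0"

text \<open>Linearity and smoothness of a form with values in the Lie algebra are those of its
  components, that is, of its compositions with the linear functionals on the Lie algebra; the
  same holds for its integral along a path.\<close>

definition lie_algebra_valued_form ::
  "('p::t2_space, 'e::finite_dim_normed) chart set \<Rightarrow> ('g::t2_space, 'k::finite_dim_normed) chart set \<Rightarrow>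
   'g \<Rightarrow> ('p \<Rightarrow> 'p tangent \<Rightarrow> 'g tangent) \<Rightarrow> bool" where
  "lie_algebra_valued_form AP AG one \<omega> \<longleftrightarrow>
     (\<forall>u. \<forall>X\<in>tangent_space AP u. \<omega> u X \<in> lie_algebra AG one) \<and>
     (\<forall>l. linear_functional_on (lie_algebra AG one) l \<longrightarrow> one_form AP (\<lambda>u X. l (\<omega> u X)))"

definition has_lie_integral ::
  "('p::t2_space, 'e::finite_dim_normed) chart set \<Rightarrow> ('g::t2_space, 'k::finite_dim_normed) chart set \<Rightarrow>
   'g \<Rightarrow> ('p \<Rightarrow> 'p tangent \<Rightarrow> 'g tangent) \<Rightarrow> (real \<Rightarrow> 'p) \<Rightarrow> real \<Rightarrow> real \<Rightarrow> 'g tangent \<Rightarrow> bool" where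
  "has_lie_integral AP AG one \<omega> y a b Z \<longleftrightarrow>
     Z \<in> lie_algebra AG one \<and>
     (\<forall>l. linear_functional_on (lie_algebra AG one) l \<longrightarrow>
        has_form_integral AP (\<lambda>u X. l (\<omega> u X)) y a b (l Z))"

definition connection_form ::
  "('p::t2_space, 'e::finite_dim_normed) chart set \<Rightarrow> ('g::t2_space, 'k::finite_dim_normed) chart set \<Rightarrow>
   ('g \<Rightarrow> 'g \<Rightarrow> 'g) \<Rightarrow> 'g \<Rightarrow> ('g \<Rightarrow> 'g) \<Rightarrow> ('p \<Rightarrow> 'g \<Rightarrow> 'p) \<Rightarrow>
   ('p \<Rightarrow> 'p tangent \<Rightarrow> 'g tangent) \<Rightarrow> bool" where
  "connection_form AP AG mul one ginv act \<omega> \<longleftrightarrow>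
     lie_algebra_valued_form AP AG one \<omega> \<and>
     (\<forall>a u. \<forall>X\<in>tangent_space AP u.
        \<omega> (act u a) (differential AP AP (\<lambda>v. act v a) u X) =
        Ad AG mul one ginv (ginv a) (\<omega> u X)) \<and>
     (\<forall>Z\<in>lie_algebra AG one. \<forall>u. \<omega> u (fundamental_field AP AG mul act Z u) = Z)"

text \<open>A horizontal lift of \<open>x\<close> from \<open>u\<close> on an interval \<open>J\<close> with left end point \<open>0\<close>. If \<open>J\<close> is
  half-open, Hoelder continuity is required on its compact subintervals.\<close>

definition horizontal_lift_on ::
  "('p::t2_space, 'e::finite_dim_normed) chart set \<Rightarrow> ('g::t2_space, 'k::finite_dim_normed) chart set \<Rightarrow>
   'g \<Rightarrow> ('p \<Rightarrow> 'm) \<Rightarrow> ('p \<Rightarrow> 'p tangent \<Rightarrow> 'g tangent) \<Rightarrow>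
   ('p \<Rightarrow> 'p tangent \<Rightarrow> 'p tangent \<Rightarrow> real) \<Rightarrow> real \<Rightarrow>
   (real \<Rightarrow> 'm) \<Rightarrow> 'p \<Rightarrow> real set \<Rightarrow> (real \<Rightarrow> 'p) \<Rightarrow> bool" where
  "horizontal_lift_on AP AG one proj \<omega> gP \<alpha> x u J y \<longleftrightarrow>
     y 0 = u \<and>
     (\<forall>t\<in>J. proj (y t) = x t) \<and>
     (\<forall>t\<in>J. holder_path AP gP \<alpha> {0..t} y) \<and>
     (\<forall>t\<in>J. has_lie_integral AP AG one \<omega> y 0 t (\<lambda>_. 0))"

text \<open>The lift leaves every compact set as the time tends to \<open>\<tau>\<close>. Since its projection stays in
  the compact image of \<open>x\<close>, this is an explosion in the fibre direction.\<close>

definition explodes_at :: "(real \<Rightarrow> 'p::topological_space) \<Rightarrow> real \<Rightarrow> bool" where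
  "explodes_at y \<tau> \<longleftrightarrow> (\<forall>K. compact K \<longrightarrow> (\<forall>\<^sub>F t in at_left \<tau>. y t \<notin> K))"

end

(* A path in P is horizontal iff its increments satisfy omega(y_s)(y_t - y_s) = O(|t - s|^(2 alpha)) in
charts: since 2 alpha > 1, Young integrals are characterised by such local estimates, and a path whose
increments are O(|t - s|^(2 alpha)) is constant. Locally x has a Hoelder lift q (a section of a
trivialisation), and every lift is q a for a path a in G. By axioms (i) and (ii), omega evaluated on the
increments of q a is, up to O(|t - s|^(2 alpha)), a sum of a part from q and a part from a, and q a is horizontal
iff a solves a Young differential equation driven by q in a chart of G around the unit; it is solved by
Euler polygons. Near any time this gives a horizontal lift on an interval whose length does not depend on
the initial point in the fibre, as right translation carries a horizontal lift from one point of the fibre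
to any other, so the local lifts concatenate to a lift on [0,T]: there is never an explosion. For
uniqueness, if q and q a are both horizontal, then the increments of a are O(|t - s|^(2 alpha)). *)

theory Submission
  imports Defs "HOL-Complex_Analysis.Great_Picard" "HOL-Real_Asymp.Real_Asymp"
begin

section \<open>Finite-dimensional normed spaces\<close>

text \<open>The solver \<open>davie_exists\<close> has three uses. It solves the equation of the
  lift; with a coefficient that ignores the state it produces indefinite integrals of forms; with
  \<open>\<alpha> = 1\<close> it produces integral curves of left-invariant fields. Its interval of
  existence depends only on the constants in the bounds. Three gaps separate chart estimates from
  the definitions. The Riemannian distance is an infimum over all curves, also those that leave a
  chart, so it is compared with chart norms from both sides (\<open>holder_path_lhol\<close>,
  \<open>lhol_holder_path\<close>). Axiom (ii) involves a definite description of the exponential,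
  so it says something about coordinates only after existence and uniqueness of one-parameter
  subgroups; the fundamental field then becomes a partial derivative of the action
  (\<open>om_fundamental\<close>). Axiom (i) is used in the form that right translation preserves
  equality of \<omega>-values: a vector may be exchanged for the vertical one with the same value,
  which bounds \<omega> after translation by \<omega> before it
  (\<open>om_translate_bound\<close>).\<close>

lemma convergent_subsequence_span:
  fixes B :: "'a::real_normed_vector set"
  assumes "finite B" "\<And>n. f n \<in> span B" "bounded (range f)"
  shows "\<exists>l\<in>span B. \<exists>r::nat \<Rightarrow> nat. strict_mono r \<and> (f \<circ> r) \<longlonglongrightarrow> l"
  using assms
proof (induction B arbitrary: f rule: finite_induct)
  case empty
  then have "f \<circ> id = (\<lambda>_. 0)" by (auto simp: fun_eq_iff)
  then show ?case by (auto intro!: exI[of _ id] simp: strict_mono_id)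
next
  case (insert b B)
  show ?case
  proof (cases "b \<in> span B")
    case True
    then show ?thesis using insert span_redundant[of b B] by auto
  next
    case False
    \<comment> \<open>A convergent sequence in the span is bounded, so the induction hypothesis
      applies to it. Closedness then keeps b at the positive distance \<eta> from the span.\<close>
    have "closed (span B)"
      unfolding closed_sequential_limits
    proof (intro allI impI)
      fix x l assume x: "(\<forall>n. x n \<in> span B) \<and> x \<longlonglongrightarrow> l"
      then obtain l' and r :: "nat \<Rightarrow> nat"
        where "l' \<in> span B" "strict_mono r" "(x \<circ> r) \<longlonglongrightarrow> l'"
        using insert.IH[of x] convergent_imp_bounded by blast
      then show "l \<in> span B"
        using x LIMSEQ_unique LIMSEQ_subseq_LIMSEQ by blast
    qed
    define \<eta> where "\<eta> = infdist b (span B)"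
    have \<eta>: "\<eta> > 0"
      unfolding \<eta>_def
      by (rule infdist_pos_not_in_closed) (use \<open>closed (span B)\<close> False span_0 in auto)
    have "\<forall>n. \<exists>k. f n - k *\<^sub>R b \<in> span B"
      using insert.prems(1) span_breakdown_eq by blast
    then obtain k where k: "\<And>n. f n - k n *\<^sub>R b \<in> span B" by metis
    obtain M where M: "\<And>n. norm (f n) \<le> M"
      using insert.prems(2) by (auto simp: bounded_iff)
    \<comment> \<open>For k n \<noteq> 0 the point b - f n / k n lies in the span of B, so \<eta> is
      at most norm (f n) / |k n|.\<close>
    have kM: "\<bar>k n\<bar> \<le> M / \<eta>" for n
    proof (cases "k n = 0")
      case True
      then show ?thesis using \<eta> M[of n] order_trans[OF norm_ge_zero M[of n]] by simp
    next
      case k0: False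
      let ?s = "(- inverse (k n)) *\<^sub>R (f n - k n *\<^sub>R b)"
      have "?s \<in> span B" using k by (intro span_scale)
      then have "\<eta> \<le> dist b ?s" unfolding \<eta>_def by (rule infdist_le)
      also have "b - ?s = inverse (k n) *\<^sub>R f n"
        using k0 by (simp add: algebra_simps)
      then have "dist b ?s = norm (f n) / \<bar>k n\<bar>"
        by (simp add: dist_norm divide_inverse mult.commute)
      finally show ?thesis using k0 \<eta> M[of n] by (simp add: field_simps)
    qed
    then have "bounded (range k)" by (auto simp: bounded_iff)
    then obtain a and r :: "nat \<Rightarrow> nat" where r: "strict_mono r" "(k \<circ> r) \<longlonglongrightarrow> a"
      using bounded_imp_convergent_subsequence by blast
    define s where "s n = f (r n) - k (r n) *\<^sub>R b" for n
    have "norm (s n) \<le> M + M / \<eta> * norm b" for n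
      unfolding s_def
      by (rule order_trans[OF norm_triangle_ineq4])
        (use M mult_right_mono[OF kM, of "norm b"] in \<open>auto intro!: add_mono\<close>)
    then have "bounded (range s)" by (auto simp: bounded_iff)
    then obtain l' and r' :: "nat \<Rightarrow> nat"
      where r': "l' \<in> span B" "strict_mono r'" "(s \<circ> r') \<longlonglongrightarrow> l'"
      using insert.IH[of s] k unfolding s_def by blast
    have "(\<lambda>n. (s \<circ> r') n + ((k \<circ> r) \<circ> r') n *\<^sub>R b) \<longlonglongrightarrow> l' + a *\<^sub>R b"
      by (intro tendsto_intros r' LIMSEQ_subseq_LIMSEQ[OF r(2) r'(2)])
    then have "(f \<circ> (r \<circ> r')) \<longlonglongrightarrow> l' + a *\<^sub>R b"
      by (simp add: s_def o_def)
    moreover have "l' + a *\<^sub>R b \<in> span (insert b B)"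
    proof (intro span_add span_scale)
      show "l' \<in> span (insert b B)" using r'(1) span_mono[of B "insert b B"] by auto
    qed (simp add: span_base)
    moreover have "strict_mono (r \<circ> r')" using r(1) r'(2) by (rule strict_mono_o)
    ultimately show ?thesis by blast
  qed
qed

text \<open>Compact balls turn continuity of derivatives into uniform bounds, and Arzela-Ascoli
  extracts limits of Euler polygons. Completeness follows from this as well.\<close>

instance finite_dim_normed \<subseteq> heine_borel
proof
  fix f :: "nat \<Rightarrow> 'a" assume "bounded (range f)"
  then show "\<exists>l r. strict_mono (r::nat\<Rightarrow>nat) \<and> (f \<circ> r) \<longlonglongrightarrow> l"
    using convergent_subsequence_span[OF coord_basis(1), of f] coord_basis(3) by blast
qed

instance finite_dim_normed \<subseteq> banach ..

lemma closed_span_finite: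
  fixes B :: "'a::real_normed_vector set"
  assumes "finite B" shows "closed (span B)"
  unfolding closed_sequential_limits
proof (intro allI impI)
  fix x l assume x: "(\<forall>n. x n \<in> span B) \<and> x \<longlonglongrightarrow> l"
  then obtain l' and r :: "nat \<Rightarrow> nat"
    where "l' \<in> span B" "strict_mono r" "(x \<circ> r) \<longlonglongrightarrow> l'"
    using convergent_subsequence_span[OF assms, of x] convergent_imp_bounded by blast
  then show "l \<in> span B"
    using x LIMSEQ_unique LIMSEQ_subseq_LIMSEQ by blast
qed

section \<open>Coordinates with respect to a basis and bounds for linear maps\<close>

abbreviation crd :: "'e::finite_dim_normed \<Rightarrow> 'e \<Rightarrow> real" where
  "crd \<equiv> representation coord_basis"

lemma crd_expand: "(\<Sum>b\<in>coord_basis. crd x b *\<^sub>R b) = (x::'e::finite_dim_normed)"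
  by (rule real_vector.sum_representation_eq)
    (use coord_basis[where ?'e='e] in auto)

lemma linear_crd: "linear (\<lambda>x::'e::finite_dim_normed. crd x b)"
  using coord_basis[where ?'e='e]
  by (intro linearI) (auto simp: real_vector.representation_add real_vector.representation_scale)

text \<open>As in \<open>convergent_subsequence_span\<close>, the coefficient of b is controlled by
  the positive distance of b from the closed span of the other basis vectors. Off the basis the
  coordinate is 0 by convention.\<close>

lemma crd_bound: "\<exists>M. \<forall>x::'e::finite_dim_normed. \<bar>crd x b\<bar> \<le> M * norm x"
proof (cases "b \<in> (coord_basis :: 'e set)")
  case False
  then have "crd x b = 0" for x :: 'e
    using real_vector.representation_ne_zero by blast
  then show ?thesis by (intro exI[of _ 0]) auto
next
  case b: True
  let ?B = "coord_basis - {b} :: 'e set"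
  have "b \<notin> span ?B"
    using coord_basis(2)[where ?'e='e] b by (auto simp: dependent_def)
  moreover have "closed (span ?B)" using coord_basis(1) by (intro closed_span_finite) auto
  ultimately have \<eta>: "infdist b (span ?B) > 0" (is "?\<eta> > 0")
    by (intro infdist_pos_not_in_closed) (use span_0 in auto)
  have "\<bar>crd x b\<bar> \<le> 1 / ?\<eta> * norm x" for x :: 'e
  proof (cases "crd x b = 0")
    case False
    let ?s = "(- inverse (crd x b)) *\<^sub>R (x - crd x b *\<^sub>R b)"
    have "x - crd x b *\<^sub>R b = (\<Sum>b\<in>?B. crd x b *\<^sub>R b)"
      using b coord_basis(1)[where ?'e='e] crd_expand[of x] by (simp add: sum_diff1)
    then have "?s \<in> span ?B"
      by (metis (no_types, lifting) span_scale span_sum span_base)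
    then have "?\<eta> \<le> dist b ?s" by (rule infdist_le)
    also have "b - ?s = inverse (crd x b) *\<^sub>R x"
      using False by (simp add: algebra_simps)
    then have "dist b ?s = norm x / \<bar>crd x b\<bar>"
      by (simp add: dist_norm divide_inverse mult.commute)
    finally show ?thesis using False \<eta> by (simp add: field_simps)
  qed (use \<eta> in auto)
  then show ?thesis by blast
qed

lemma bounded_linear_crd: "bounded_linear (\<lambda>x::'e::finite_dim_normed. crd x b)"
proof -
  obtain M where "\<forall>x::'e. \<bar>crd x b\<bar> \<le> M * norm x" using crd_bound by blast
  then show ?thesis
    using linear_crd[of b]
    by (auto simp: bounded_linear_def bounded_linear_axioms_def mult.commute)
qed

lemma linear_expand:
  assumes "linear (f :: 'e::finite_dim_normed \<Rightarrow> 'f::real_normed_vector)"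
  shows "f x = (\<Sum>b\<in>coord_basis. crd x b *\<^sub>R f b)"
proof -
  have "f x = f (\<Sum>b\<in>coord_basis. crd x b *\<^sub>R b)" by (simp only: crd_expand)
  then show ?thesis using assms by (simp add: linear_sum linear_scale)
qed

lemma linear_imp_bounded_linear:
  assumes "linear (f :: 'e::finite_dim_normed \<Rightarrow> 'f::real_normed_vector)"
  shows "bounded_linear f"
proof -
  have "bounded_linear (\<lambda>x. \<Sum>b\<in>coord_basis. crd x b *\<^sub>R f b)"
    by (intro bounded_linear_sum bounded_linear_scaleR_const bounded_linear_crd) 
  moreover have "f = (\<lambda>x. \<Sum>b\<in>coord_basis. crd x b *\<^sub>R f b)"
    by (rule ext) (rule linear_expand[OF assms])
  ultimately show ?thesis by metis
qed

text \<open>A linear map is determined by the finitely many basis vectors, and so is its bound. The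
  weight \<open>c\<close> is 1 for plain bounds; for Lipschitz bounds S consists of pairs of points
  and \<open>c\<close> is their distance.\<close>

lemma linear_family_bound:
  fixes A :: "'s \<Rightarrow> 'e::finite_dim_normed \<Rightarrow> 'f::real_normed_vector"
  assumes "\<And>z. z \<in> S \<Longrightarrow> linear (A z)"
    and "\<And>b. b \<in> coord_basis \<Longrightarrow> \<exists>K. \<forall>z\<in>S. norm (A z b) \<le> K * c z"
    and c: "\<And>z. z \<in> S \<Longrightarrow> c z \<ge> 0"
  shows "\<exists>K\<ge>0. \<forall>z\<in>S. \<forall>v. norm (A z v) \<le> K * c z * norm v"
proof -
  obtain K where K: "\<And>b z. b \<in> coord_basis \<Longrightarrow> z \<in> S \<Longrightarrow> norm (A z b) \<le> K b * c z"
    using assms(2) by metis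
  obtain M where M: "\<And>b (x::'e). \<bar>crd x b\<bar> \<le> M b * norm x"
    using crd_bound by metis
  define L where "L = (\<Sum>b\<in>coord_basis. \<bar>M b\<bar> * \<bar>K b\<bar>)"
  have "norm (A z v) \<le> L * c z * norm v" if z: "z \<in> S" for z v
  proof -
    have "norm (A z v) \<le> (\<Sum>b\<in>coord_basis. norm (crd v b *\<^sub>R A z b))"
      by (subst linear_expand[OF assms(1)[OF z]]) (rule norm_sum)
    also have "\<dots> \<le> (\<Sum>b\<in>coord_basis. (\<bar>M b\<bar> * norm v) * (\<bar>K b\<bar> * c z))"
    proof (rule sum_mono)
      fix b :: 'e assume b: "b \<in> coord_basis"
      have "\<bar>crd v b\<bar> \<le> \<bar>M b\<bar> * norm v"
        by (rule order_trans[OF M]) (auto intro: mult_right_mono)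
      moreover have "norm (A z b) \<le> \<bar>K b\<bar> * c z"
        by (rule order_trans[OF K[OF b z]]) (use c[OF z] in \<open>auto intro: mult_right_mono\<close>)
      ultimately show "norm (crd v b *\<^sub>R A z b) \<le> (\<bar>M b\<bar> * norm v) * (\<bar>K b\<bar> * c z)"
        unfolding norm_scaleR by (intro mult_mono) auto
    qed
    also have "\<dots> = L * c z * norm v"
      unfolding L_def sum_distrib_right by (intro sum.cong) (auto simp: algebra_simps)
    finally show ?thesis .
  qed
  moreover have "L \<ge> 0" unfolding L_def by (intro sum_nonneg) auto
  ultimately show ?thesis by blast
qed

section \<open>Smooth functions between finite-dimensional spaces\<close>

lemma has_derivative_cong_open:
  assumes "open S" "x \<in> S" "\<And>x. x \<in> S \<Longrightarrow> f x = g x"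
  shows "(f has_derivative D) (at x) \<longleftrightarrow> (g has_derivative D) (at x)"
  using assms has_derivative_transform_within_open by metis

text \<open>On an open set the derivative at a point depends only on nearby values, so the recursion
  of \<open>Ck_on\<close> respects equality on the set.\<close>

lemma Ck_on_cong:
  assumes "open S" "\<And>x. x \<in> S \<Longrightarrow> f x = g x"
  shows "Ck_on k S f \<longleftrightarrow> Ck_on k S g"
  using assms(2)
proof (induction k arbitrary: f g)
  case 0
  then have "continuous_on S f = continuous_on S g" by (intro continuous_on_cong) auto
  then show ?case by simp
next
  case (Suc k)
  have d: "(f has_derivative D) (at x) \<longleftrightarrow> (g has_derivative D) (at x)" if "x \<in> S" for x D
    using has_derivative_cong_open[OF assms(1) that] Suc.prems by blast
  have "frechet_derivative f (at x) = frechet_derivative g (at x)" if "x \<in> S" for x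
    unfolding frechet_derivative_def using d[OF that] by simp
  then have "Ck_on k S (\<lambda>x. frechet_derivative f (at x) v) \<longleftrightarrow>
      Ck_on k S (\<lambda>x. frechet_derivative g (at x) v)" for v
    by (intro Suc.IH) auto
  then show ?case using d by (auto simp: differentiable_def)
qed

text \<open>The recursion of \<open>Ck_on\<close> mentions \<open>frechet_derivative\<close>;
  uniqueness of derivatives lets an explicit formula D take its place.\<close>

lemma Ck_SucI:
  assumes "open S" "\<And>x. x \<in> S \<Longrightarrow> (f has_derivative D x) (at x)"
    and "\<And>v. Ck_on k S (\<lambda>x. D x v)"
  shows "Ck_on (Suc k) S f"
proof -
  have "frechet_derivative f (at x) = D x" if "x \<in> S" for x
    using frechet_derivative_at[OF assms(2)[OF that]] by simp
  then have "Ck_on k S (\<lambda>x. frechet_derivative f (at x) v)" for v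
    using assms(3)[of v] Ck_on_cong[OF assms(1), of "\<lambda>x. frechet_derivative f (at x) v"] by auto
  then show ?thesis using assms(2) by (auto simp: differentiable_def)
qed

lemma Ck_on_subset: "Ck_on k S f \<Longrightarrow> T \<subseteq> S \<Longrightarrow> Ck_on k T f"
  by (induction k arbitrary: f) (auto intro: continuous_on_subset)

lemma Ck_Suc_D: "Ck_on (Suc k) S f \<Longrightarrow> Ck_on k S f"
proof (induction k arbitrary: f)
  case 0
  then show ?case
    by (auto intro!: continuous_at_imp_continuous_on differentiable_imp_continuous_within)
next
  case (Suc k)
  have "Ck_on k S (\<lambda>x. frechet_derivative f (at x) v)" for v
    using Suc.prems by (intro Suc.IH) (simp only: Ck_on.simps, blast)
  then show ?case using Suc.prems by auto
qed

lemma Ck_const: "open S \<Longrightarrow> Ck_on k S (\<lambda>_. c)"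
proof (induction k arbitrary: c)
  case (Suc k)
  then show ?case by (intro Ck_SucI[where D="\<lambda>_ _. 0"]) auto
qed auto

lemma Ck_add: "open S \<Longrightarrow> Ck_on k S f \<Longrightarrow> Ck_on k S g \<Longrightarrow> Ck_on k S (\<lambda>x. f x + g x)"
proof (induction k arbitrary: f g)
  case (Suc k)
  then show ?case
    by (intro Ck_SucI[where D="\<lambda>x v. frechet_derivative f (at x) v + frechet_derivative g (at x) v"])
      (auto intro!: has_derivative_add simp: frechet_derivative_works)
qed (auto intro: continuous_on_add)

lemma Ck_sum:
  "finite I \<Longrightarrow> open S \<Longrightarrow> (\<And>i. i \<in> I \<Longrightarrow> Ck_on k S (f i)) \<Longrightarrow> Ck_on k S (\<lambda>x. \<Sum>i\<in>I. f i x)"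
  by (induction rule: finite_induct[consumes 1]) (auto intro: Ck_const Ck_add)

lemma Ck_linear:
  assumes "bounded_linear l" shows "open S \<Longrightarrow> Ck_on k S f \<Longrightarrow> Ck_on k S (\<lambda>x. l (f x))"
proof (induction k arbitrary: f)
  case 0
  then show ?case using bounded_linear.continuous_on[OF assms] by auto
next
  case (Suc k)
  then show ?case
    by (intro Ck_SucI[where D="\<lambda>x v. l (frechet_derivative f (at x) v)"])
      (auto intro!: bounded_linear.has_derivative[OF assms] simp: frechet_derivative_works)
qed

lemma Ck_scaleR:
  "open S \<Longrightarrow> Ck_on k S f \<Longrightarrow> Ck_on k S g \<Longrightarrow> Ck_on k S (\<lambda>x. (f x :: real) *\<^sub>R g x)"
proof (induction k arbitrary: f g)
  case (Suc k)
  have fg: "Ck_on k S f" "Ck_on k S g" using Suc.prems Ck_Suc_D by blast+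
  show ?case
    by (rule Ck_SucI[where D="\<lambda>x v. f x *\<^sub>R frechet_derivative g (at x) v
        + frechet_derivative f (at x) v *\<^sub>R g x"])
      (use Suc fg in \<open>auto intro!: has_derivative_scaleR Ck_add simp: frechet_derivative_works\<close>)
qed (auto intro: continuous_on_scaleR)

text \<open>The chain rule differentiates f in a direction that varies with x, whereas
  \<open>Ck_on\<close> speaks of fixed directions. Expanding the direction in coordinates leaves
  fixed basis directions with scalar coefficients, to which the product rule and the induction
  hypothesis apply.\<close>

lemma Ck_comp:
  fixes g :: "'a::real_normed_vector \<Rightarrow> 'b::finite_dim_normed"
  assumes "open S" "open T" "\<And>x. x \<in> S \<Longrightarrow> g x \<in> T"
  shows "Ck_on k S g \<Longrightarrow> Ck_on k T f \<Longrightarrow> Ck_on k S (\<lambda>x. f (g x))"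
proof (induction k arbitrary: f)
  case 0
  then show ?case using continuous_on_compose2[of T f S g] assms by auto
next
  case (Suc k)
  let ?f' = "\<lambda>y. frechet_derivative f (at y)" and ?g' = "\<lambda>x. frechet_derivative g (at x)"
  have g: "Ck_on k S g" using Suc.prems(1) Ck_Suc_D by blast
  have d: "(f has_derivative ?f' (g x)) (at (g x))" if "x \<in> S" for x
    using Suc.prems(2) assms(3)[OF that] by (auto simp: frechet_derivative_works)
  show ?case
  proof (rule Ck_SucI[OF assms(1), where D="\<lambda>x v. \<Sum>b\<in>coord_basis. crd (?g' x v) b *\<^sub>R ?f' (g x) b"])
    fix x assume x: "x \<in> S"
    have "(g has_derivative ?g' x) (at x)"
      using Suc.prems(1) x by (auto simp: frechet_derivative_works)
    from has_derivative_compose[OF this d[OF x]]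
    have "((\<lambda>x. f (g x)) has_derivative (\<lambda>v. ?f' (g x) (?g' x v))) (at x)" .
    moreover have "?f' (g x) (?g' x v) = (\<Sum>b\<in>coord_basis. crd (?g' x v) b *\<^sub>R ?f' (g x) b)" for v
      by (rule linear_expand[OF has_derivative_linear[OF d[OF x]]])
    ultimately show "((\<lambda>x. f (g x)) has_derivative
        (\<lambda>v. \<Sum>b\<in>coord_basis. crd (?g' x v) b *\<^sub>R ?f' (g x) b)) (at x)" by simp
  next
    fix v
    show "Ck_on k S (\<lambda>x. \<Sum>b\<in>coord_basis. crd (?g' x v) b *\<^sub>R ?f' (g x) b)"
      by (intro Ck_sum Ck_scaleR Ck_linear[OF bounded_linear_crd] Suc.IH g assms coord_basis)
        (use Suc.prems in auto)
  qed
qed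

lemma smooth_on_cong:
  "open S \<Longrightarrow> (\<And>x. x \<in> S \<Longrightarrow> f x = g x) \<Longrightarrow> smooth_on S f \<longleftrightarrow> smooth_on S g"
  unfolding smooth_on_def using Ck_on_cong by blast

lemma smooth_on_subset: "smooth_on S f \<Longrightarrow> T \<subseteq> S \<Longrightarrow> smooth_on T f"
  unfolding smooth_on_def using Ck_on_subset by blast

lemma smooth_on_comp:
  fixes g :: "'a::real_normed_vector \<Rightarrow> 'b::finite_dim_normed"
  assumes "open S" "open T" "\<And>x. x \<in> S \<Longrightarrow> g x \<in> T" "smooth_on S g" "smooth_on T f"
  shows "smooth_on S (\<lambda>x. f (g x))"
  using assms Ck_comp[of S T g] unfolding smooth_on_def by blast

lemma smooth_on_linear:
  "bounded_linear l \<Longrightarrow> open S \<Longrightarrow> smooth_on S f \<Longrightarrow> smooth_on S (\<lambda>x. l (f x))"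
  unfolding smooth_on_def using Ck_linear by blast

lemma smooth_on_const: "open S \<Longrightarrow> smooth_on S (\<lambda>_. c)"
  unfolding smooth_on_def using Ck_const by blast

lemma smooth_on_add:
  "open S \<Longrightarrow> smooth_on S f \<Longrightarrow> smooth_on S g \<Longrightarrow> smooth_on S (\<lambda>x. f x + g x)"
  unfolding smooth_on_def using Ck_add by blast

lemma Ck_id: "open S \<Longrightarrow> Ck_on k S (\<lambda>x. x)"
proof (cases k)
  case (Suc j)
  assume "open S"
  then show ?thesis
    unfolding Suc by (intro Ck_SucI[where D="\<lambda>_ v. v"]) (auto intro: Ck_const)
qed auto

lemma smooth_on_bounded_linear: "bounded_linear l \<Longrightarrow> open S \<Longrightarrow> smooth_on S l"
  using smooth_on_linear[of l S "\<lambda>x. x"] Ck_id unfolding smooth_on_def by blast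

lemma smooth_on_Pair:
  assumes "open S" "smooth_on S f" "smooth_on S g"
  shows "smooth_on S (\<lambda>x. (f x, g x))"
proof -
  have l: "bounded_linear (\<lambda>x. (x, 0))" "bounded_linear (\<lambda>y. (0, y))"
    by (auto intro!: bounded_linear_Pair bounded_linear_ident bounded_linear_zero)
  have "smooth_on S (\<lambda>x. (f x, 0) + (0, g x))"
    by (intro smooth_on_add assms smooth_on_linear[OF l(1)] smooth_on_linear[OF l(2)])
  then show ?thesis by simp
qed

lemma smooth_on_has_derivative:
  "smooth_on S f \<Longrightarrow> x \<in> S \<Longrightarrow> (f has_derivative frechet_derivative f (at x)) (at x)"
  unfolding smooth_on_def frechet_derivative_works[symmetric]
  using Ck_on.simps(2)[of 0 S f] by blast

lemma smooth_on_derivative: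
  "smooth_on S f \<Longrightarrow> smooth_on S (\<lambda>x. frechet_derivative f (at x) v)"
  unfolding smooth_on_def using Ck_on.simps(2) by blast

lemma smooth_on_continuous: "smooth_on S f \<Longrightarrow> continuous_on S f"
  unfolding smooth_on_def using Ck_on.simps(1) by blast

text \<open>Compactness bounds the derivative in each fixed direction; the basis directions suffice
  by \<open>linear_family_bound\<close>.\<close>

lemma smooth_on_derivative_bound:
  fixes f :: "'e::finite_dim_normed \<Rightarrow> 'f::real_normed_vector"
  assumes "smooth_on S f" "cball z0 r \<subseteq> S"
  shows "\<exists>K\<ge>0. \<forall>z\<in>cball z0 r. \<forall>v. norm (frechet_derivative f (at z) v) \<le> K * norm v"
proof -
  have "\<exists>K. \<forall>z\<in>cball z0 r. norm (frechet_derivative f (at z) b) \<le> K * 1" for b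
  proof -
    have "continuous_on (cball z0 r) (\<lambda>z. frechet_derivative f (at z) b)"
      using smooth_on_continuous[OF smooth_on_derivative[OF assms(1)]] assms(2)
        continuous_on_subset by blast
    then have "compact ((\<lambda>z. frechet_derivative f (at z) b) ` cball z0 r)"
      by (rule compact_continuous_image) (rule compact_cball)
    then have "bounded ((\<lambda>z. frechet_derivative f (at z) b) ` cball z0 r)"
      by (rule compact_imp_bounded)
    then show ?thesis by (auto simp: bounded_iff)
  qed
  then have "\<exists>K\<ge>0. \<forall>z\<in>cball z0 r. \<forall>v. norm (frechet_derivative f (at z) v) \<le> K * 1 * norm v"
    by (intro linear_family_bound)
      (use assms smooth_on_has_derivative has_derivative_linear in \<open>blast | auto\<close>)+
  then show ?thesis by simp
qed

lemma smooth_on_Lipschitz: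
  fixes f :: "'e::finite_dim_normed \<Rightarrow> 'f::real_normed_vector"
  assumes "smooth_on S f" "cball z0 r \<subseteq> S"
  shows "\<exists>K\<ge>0. \<forall>z\<in>cball z0 r. \<forall>z'\<in>cball z0 r. norm (f z' - f z) \<le> K * norm (z' - z)"
proof -
  obtain K where K: "K \<ge> 0"
    "\<And>z v. z \<in> cball z0 r \<Longrightarrow> norm (frechet_derivative f (at z) v) \<le> K * norm v"
    using smooth_on_derivative_bound[OF assms] by blast
  have "norm (f z' - f z) \<le> K * norm (z' - z)" if "z \<in> cball z0 r" "z' \<in> cball z0 r" for z z'
  proof (rule differentiable_bound[where S="cball z0 r" and f=f
        and f'="\<lambda>w. frechet_derivative f (at w)"])
    fix w assume w: "w \<in> cball z0 r"
    show "(f has_derivative frechet_derivative f (at w)) (at w within cball z0 r)"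
      using w assms(2)
      by (blast intro: has_derivative_at_withinI[OF smooth_on_has_derivative[OF assms(1)]])
    show "onorm (frechet_derivative f (at w)) \<le> K"
      using w K by (intro onorm_bound) blast+
  qed (use that in auto)
  then show ?thesis using K(1) by blast
qed

text \<open>The ball is convex, so the mean value inequality works along segments, and Lipschitz
  continuity of the derivative yields the quadratic remainder. One constant serves all four
  estimates because they are always used together.\<close>

lemma smooth_on_taylor:
  fixes f :: "'e::finite_dim_normed \<Rightarrow> 'f::real_normed_vector"
  assumes "smooth_on S f" "cball z0 r \<subseteq> S"
  shows "\<exists>K\<ge>0. \<forall>z\<in>cball z0 r. \<forall>z'\<in>cball z0 r.
     norm (f z' - f z) \<le> K * norm (z' - z) \<and>
     (\<forall>v. norm (frechet_derivative f (at z) v) \<le> K * norm v) \<and>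
     (\<forall>v. norm (frechet_derivative f (at z') v - frechet_derivative f (at z) v)
        \<le> K * norm (z' - z) * norm v) \<and>
     norm (f z' - f z - frechet_derivative f (at z) (z' - z)) \<le> K * (norm (z' - z))\<^sup>2"
proof -
  let ?D = "\<lambda>z. frechet_derivative f (at z)"
  obtain K1 where K1: "K1 \<ge> 0"
    "\<forall>z\<in>cball z0 r. \<forall>z'\<in>cball z0 r. norm (f z' - f z) \<le> K1 * norm (z' - z)"
    using smooth_on_Lipschitz[OF assms] by blast
  obtain K2 where K2: "K2 \<ge> 0" "\<forall>z\<in>cball z0 r. \<forall>v. norm (?D z v) \<le> K2 * norm v"
    using smooth_on_derivative_bound[OF assms] by blast
  have lin: "linear (?D z)" if "z \<in> cball z0 r" for z
    using smooth_on_has_derivative[OF assms(1)] assms(2) that has_derivative_linear by blast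
  have "\<exists>K\<ge>0. \<forall>p\<in>cball z0 r \<times> cball z0 r. \<forall>v. norm (?D (fst p) v - ?D (snd p) v)
      \<le> K * norm (fst p - snd p) * norm v"
  proof (rule linear_family_bound)
    show "linear (\<lambda>v. ?D (fst p) v - ?D (snd p) v)" if "p \<in> cball z0 r \<times> cball z0 r" for p
      using that lin by (intro linear_compose_sub) auto
    show "\<exists>K. \<forall>p\<in>cball z0 r \<times> cball z0 r. norm (?D (fst p) b - ?D (snd p) b)
        \<le> K * norm (fst p - snd p)" for b
      using smooth_on_Lipschitz[OF smooth_on_derivative[OF assms(1), of b] assms(2)]
      unfolding Ball_def mem_Times_iff by blast
  qed auto
  then obtain K3 where K3: "K3 \<ge> 0" "\<And>z z' v. z \<in> cball z0 r \<Longrightarrow> z' \<in> cball z0 r \<Longrightarrow>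
      norm (?D z' v - ?D z v) \<le> K3 * norm (z' - z) * norm v"
    unfolding Ball_def mem_Times_iff by (metis fst_conv snd_conv)
  have K4: "norm (f z' - f z - ?D z (z' - z)) \<le> K3 * (norm (z' - z))\<^sup>2"
    if z: "z \<in> cball z0 r" "z' \<in> cball z0 r" for z z'
  proof -
    have seg: "closed_segment z z' \<subseteq> cball z0 r"
      using z by (intro closed_segment_subset) auto
    have 1: "norm (f z' - f z - ?D z (z' - z)) \<le> norm (z' - z) * (K3 * norm (z' - z))"
    proof (rule differentiable_bound_linearization[where S="closed_segment z z'" and f=f and f'="?D"])
      show "z + t *\<^sub>R (z' - z) \<in> closed_segment z z'" if "t \<in> {0..1}" for t
        using that unfolding closed_segment_def by (auto intro!: exI[of _ t] simp: algebra_simps)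
      show "(f has_derivative ?D w) (at w within closed_segment z z')" if "w \<in> closed_segment z z'" for w
        using that seg assms(2)
        by (blast intro: has_derivative_at_withinI[OF smooth_on_has_derivative[OF assms(1)]])
      show "z \<in> closed_segment z z'" by simp
      fix w assume w: "w \<in> closed_segment z z'"
      then have wz: "norm (w - z) \<le> norm (z' - z)"
        using segment_bound(1)[of w z z'] by (simp add: dist_norm norm_minus_commute)
      show "onorm (?D w - ?D z) \<le> K3 * norm (z' - z)"
      proof (rule onorm_bound)
        fix v
        have "norm (?D w v - ?D z v) \<le> K3 * norm (w - z) * norm v"
          using w seg z by (intro K3(2)) blast+
        also have "\<dots> \<le> K3 * norm (z' - z) * norm v"
          using K3(1) wz by (intro mult_right_mono mult_left_mono) auto
        finally show "norm ((?D w - ?D z) v) \<le> K3 * norm (z' - z) * norm v" by simp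
      qed (use K3(1) in auto)
    qed
    then show ?thesis by (simp add: power2_eq_square mult_ac)
  qed
  show ?thesis
  proof (intro exI[of _ "K1 + K2 + K3"] conjI ballI allI)
    fix z z' v assume z: "z \<in> cball z0 r" "z' \<in> cball z0 r"
    have le: "a \<le> K * c \<Longrightarrow> K \<le> K1 + K2 + K3 \<Longrightarrow> c \<ge> 0 \<Longrightarrow> a \<le> (K1 + K2 + K3) * c" for a K c :: real
      by (meson mult_right_mono order_trans)
    show "norm (f z' - f z) \<le> (K1 + K2 + K3) * norm (z' - z)"
      using le[of _ K1] K1 K2 K3 z by simp
    show "norm (?D z v) \<le> (K1 + K2 + K3) * norm v"
      using le[of _ K2] K1 K2 K3 z by simp
    show "norm (?D z' v - ?D z v) \<le> (K1 + K2 + K3) * norm (z' - z) * norm v"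
      using le[of _ K3 "norm (z' - z) * norm v"] K1 K2 K3 z by (simp add: mult.assoc)
    show "norm (f z' - f z - ?D z (z' - z)) \<le> (K1 + K2 + K3) * (norm (z' - z))\<^sup>2"
      using le[of _ K3] K1 K2 K4 K3 z by simp
  qed (use K1 K2 K3 in auto)
qed

section \<open>Increments near the diagonal\<close>

text \<open>Both arguments approach \<tau> inside I, in either order and possibly equal. Estimates
  along this filter are therefore two-sided, also when \<tau> is an end point of I.\<close>

definition pairs :: "real \<Rightarrow> real set \<Rightarrow> (real \<times> real) filter" where
  "pairs \<tau> I = inf (nhds \<tau>) (principal I) \<times>\<^sub>F inf (nhds \<tau>) (principal I)"

lemma eventually_nhds_in:
  "eventually P (inf (nhds \<tau>) (principal I)) \<longleftrightarrow> (\<exists>d>0. \<forall>s\<in>I. \<bar>s - \<tau>\<bar> < d \<longrightarrow> P (s::real))"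
  unfolding eventually_inf_principal eventually_nhds_metric dist_real_def by blast

lemma eventually_pairs:
  "eventually P (pairs \<tau> I) \<longleftrightarrow>
     (\<exists>d>0. \<forall>s\<in>I. \<forall>t\<in>I. \<bar>s - \<tau>\<bar> < d \<longrightarrow> \<bar>t - \<tau>\<bar> < d \<longrightarrow> P (s, t))" (is "?L \<longleftrightarrow> ?R")
proof
  assume ?L
  then obtain Q R where "eventually Q (inf (nhds \<tau>) (principal I))" "eventually R (inf (nhds \<tau>) (principal I))"
    "\<And>s t. Q s \<Longrightarrow> R t \<Longrightarrow> P (s, t)"
    unfolding pairs_def eventually_prod_filter by blast
  then have "eventually (\<lambda>s. Q s \<and> R s) (inf (nhds \<tau>) (principal I))"
    "\<And>s t. Q s \<Longrightarrow> R t \<Longrightarrow> P (s, t)"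
    by (auto intro: eventually_conj)
  then show ?R unfolding eventually_nhds_in by metis
next
  assume ?R
  then obtain d where d: "d > 0" "\<forall>s\<in>I. \<forall>t\<in>I. \<bar>s - \<tau>\<bar> < d \<longrightarrow> \<bar>t - \<tau>\<bar> < d \<longrightarrow> P (s, t)" by blast
  then have "eventually (\<lambda>s. s \<in> I \<and> \<bar>s - \<tau>\<bar> < d) (inf (nhds \<tau>) (principal I))"
    unfolding eventually_nhds_in by blast
  then show ?L
    unfolding pairs_def eventually_prod_filter using d(2)
    by (intro exI[of _ "\<lambda>s. s \<in> I \<and> \<bar>s - \<tau>\<bar> < d"]) auto
qed

lemma eventually_pairs_subset:
  "eventually P (pairs \<tau> I) \<Longrightarrow> J \<subseteq> I \<Longrightarrow> eventually P (pairs \<tau> J)"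
  unfolding eventually_pairs by (meson subset_iff)

lemma eventually_pairs_in: "\<forall>\<^sub>F p in pairs \<tau> I. fst p \<in> I \<and> snd p \<in> I"
  unfolding eventually_pairs by (intro exI[of _ 1]) auto

lemma eventually_pairs_both:
  assumes "eventually P (inf (nhds \<tau>) (principal I))"
  shows "\<forall>\<^sub>F p in pairs \<tau> I. P (fst p) \<and> P (snd p)"
  using assms unfolding eventually_pairs eventually_nhds_in by auto

lemma eventually_pairs_continuous:
  assumes "continuous_on I y" "\<tau> \<in> I" "open W" "y \<tau> \<in> W"
  shows "\<forall>\<^sub>F p in pairs \<tau> I. y (fst p) \<in> W \<and> y (snd p) \<in> W"
proof -
  obtain A where A: "open A" "\<tau> \<in> A" "\<And>s. s \<in> I \<Longrightarrow> s \<in> A \<Longrightarrow> y s \<in> W"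
    using assms unfolding continuous_on_topological by metis
  obtain d where "d > 0" "ball \<tau> d \<subseteq> A" using A(1,2) open_contains_ball by blast
  then have "\<forall>\<^sub>F s in inf (nhds \<tau>) (principal I). y s \<in> W"
    unfolding eventually_nhds_in using A(3)
    by (intro exI[of _ d]) (auto simp: subset_iff dist_real_def abs_minus_commute)
  then show ?thesis by (rule eventually_pairs_both)
qed

text \<open>All estimates are local at a point of the diagonal; compactness of the interval makes them
  uniform (\<open>germO_uniform\<close>).\<close>

definition germO :: "real \<Rightarrow> real set \<Rightarrow> real \<Rightarrow> (real \<Rightarrow> real \<Rightarrow> 'a::real_normed_vector) \<Rightarrow> bool" where
  "germO \<tau> I \<theta> f \<longleftrightarrow>
     (\<exists>C. \<forall>\<^sub>F p in pairs \<tau> I. norm (f (fst p) (snd p)) \<le> C * \<bar>snd p - fst p\<bar> powr \<theta>)"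

lemma germO_subset: "germO \<tau> I \<theta> f \<Longrightarrow> J \<subseteq> I \<Longrightarrow> germO \<tau> J \<theta> f"
  unfolding germO_def using eventually_pairs_subset by blast

lemma germO_pos:
  assumes "germO \<tau> I \<theta> f"
  shows "\<exists>C\<ge>0. \<forall>\<^sub>F p in pairs \<tau> I. norm (f (fst p) (snd p)) \<le> C * \<bar>snd p - fst p\<bar> powr \<theta>"
proof -
  obtain C where "\<forall>\<^sub>F p in pairs \<tau> I. norm (f (fst p) (snd p)) \<le> C * \<bar>snd p - fst p\<bar> powr \<theta>"
    using assms unfolding germO_def by blast
  then have "\<forall>\<^sub>F p in pairs \<tau> I. norm (f (fst p) (snd p)) \<le> \<bar>C\<bar> * \<bar>snd p - fst p\<bar> powr \<theta>"
    by (rule eventually_mono) (meson abs_ge_self mult_right_mono order_trans powr_ge_zero)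
  then show ?thesis by (intro exI[of _ "\<bar>C\<bar>"]) auto
qed

lemma germO_mult:
  assumes "germO \<tau> I \<theta> g" "germO \<tau> I \<eta> h"
    and "\<forall>\<^sub>F p in pairs \<tau> I. norm (f (fst p) (snd p))
      \<le> K * (norm (g (fst p) (snd p)) * norm (h (fst p) (snd p)))"
  shows "germO \<tau> I (\<theta> + \<eta>) f"
proof -
  obtain C where C: "C \<ge> 0"
    "\<forall>\<^sub>F p in pairs \<tau> I. norm (g (fst p) (snd p)) \<le> C * \<bar>snd p - fst p\<bar> powr \<theta>"
    using germO_pos[OF assms(1)] by blast
  obtain D where D: "D \<ge> 0"
    "\<forall>\<^sub>F p in pairs \<tau> I. norm (h (fst p) (snd p)) \<le> D * \<bar>snd p - fst p\<bar> powr \<eta>"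
    using germO_pos[OF assms(2)] by blast
  note CD = C(1) D(1) C(2) D(2)
  have "\<forall>\<^sub>F p in pairs \<tau> I. norm (f (fst p) (snd p)) \<le> (\<bar>K\<bar> * (C * D)) * \<bar>snd p - fst p\<bar> powr (\<theta> + \<eta>)"
    using CD(3,4) assms(3)
  proof eventually_elim
    case (elim p)
    have "norm (f (fst p) (snd p)) \<le> \<bar>K\<bar> * (norm (g (fst p) (snd p)) * norm (h (fst p) (snd p)))"
      by (rule order_trans[OF elim(3)]) (auto intro!: mult_right_mono)
    also have "\<dots> \<le> \<bar>K\<bar> * ((C * \<bar>snd p - fst p\<bar> powr \<theta>) * (D * \<bar>snd p - fst p\<bar> powr \<eta>))"
      using elim CD(1,2) by (intro mult_left_mono mult_mono) auto
    finally show ?case by (simp add: powr_add mult_ac)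
  qed
  then show ?thesis unfolding germO_def by blast
qed

lemma germO_le:
  assumes "germO \<tau> I \<theta> g"
    and "\<forall>\<^sub>F p in pairs \<tau> I. norm (f (fst p) (snd p)) \<le> K * norm (g (fst p) (snd p))"
  shows "germO \<tau> I \<theta> f"
proof -
  obtain C where C: "C \<ge> 0"
    "\<forall>\<^sub>F p in pairs \<tau> I. norm (g (fst p) (snd p)) \<le> C * \<bar>snd p - fst p\<bar> powr \<theta>"
    using germO_pos[OF assms(1)] by blast
  have "\<forall>\<^sub>F p in pairs \<tau> I. norm (f (fst p) (snd p)) \<le> (\<bar>K\<bar> * C) * \<bar>snd p - fst p\<bar> powr \<theta>"
    using C(2) assms(2)
  proof eventually_elim
    case (elim p)
    have "norm (f (fst p) (snd p)) \<le> \<bar>K\<bar> * norm (g (fst p) (snd p))"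
      by (rule order_trans[OF elim(2)]) (auto intro!: mult_right_mono)
    also have "\<dots> \<le> \<bar>K\<bar> * (C * \<bar>snd p - fst p\<bar> powr \<theta>)"
      using elim by (intro mult_left_mono) auto
    finally show ?case by (simp add: mult_ac)
  qed
  then show ?thesis unfolding germO_def by blast
qed

lemma germO_le1:
  assumes "germO \<tau> I \<theta> g"
    and "\<forall>\<^sub>F p in pairs \<tau> I. norm (f (fst p) (snd p)) \<le> norm (g (fst p) (snd p))"
  shows "germO \<tau> I \<theta> f"
  using germO_le[of \<tau> I \<theta> g f 1] assms by simp

lemma germO_cong:
  assumes "germO \<tau> I \<theta> g" "\<forall>\<^sub>F p in pairs \<tau> I. f (fst p) (snd p) = g (fst p) (snd p)"
  shows "germO \<tau> I \<theta> f"
  by (rule germO_le1[OF assms(1)]) (rule eventually_mono[OF assms(2)], simp)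

lemma germO_add:
  assumes "germO \<tau> I \<theta> f" "germO \<tau> I \<theta> g"
  shows "germO \<tau> I \<theta> (\<lambda>s t. f s t + g s t)"
proof -
  obtain C D where
    "\<forall>\<^sub>F p in pairs \<tau> I. norm (f (fst p) (snd p)) \<le> C * \<bar>snd p - fst p\<bar> powr \<theta>"
    "\<forall>\<^sub>F p in pairs \<tau> I. norm (g (fst p) (snd p)) \<le> D * \<bar>snd p - fst p\<bar> powr \<theta>"
    using assms unfolding germO_def by blast
  then have "\<forall>\<^sub>F p in pairs \<tau> I. norm (f (fst p) (snd p) + g (fst p) (snd p))
      \<le> (C + D) * \<bar>snd p - fst p\<bar> powr \<theta>"
    by eventually_elim (rule order_trans[OF norm_triangle_ineq], simp add: algebra_simps)
  then show ?thesis unfolding germO_def by blast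
qed

lemma germO_minus: "germO \<tau> I \<theta> f \<Longrightarrow> germO \<tau> I \<theta> (\<lambda>s t. - f s t)"
  unfolding germO_def by simp

lemma germO_diff:
  "germO \<tau> I \<theta> f \<Longrightarrow> germO \<tau> I \<theta> g \<Longrightarrow> germO \<tau> I \<theta> (\<lambda>s t. f s t - g s t)"
  using germO_add[OF _ germO_minus, of \<tau> I \<theta> f g] by simp

lemma germO_zero: "germO \<tau> I \<theta> (\<lambda>_ _. 0)"
  unfolding germO_def by (intro exI[of _ 0]) simp

text \<open>If no uniform constant existed, there would be pairs with ever closer components and
  ever larger ratios. By compactness the first components accumulate at some \<tau>, the second ones
  follow, and the local constant at \<tau> is exceeded.\<close>

lemma germO_uniform:
  assumes "\<And>\<tau>. \<tau> \<in> {a..b} \<Longrightarrow> germO \<tau> {a..b} \<theta> f"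
  shows "\<exists>C\<ge>0. \<exists>\<delta>>0. \<forall>s\<in>{a..b}. \<forall>t\<in>{a..b}. \<bar>t - s\<bar> < \<delta> \<longrightarrow>
    norm (f s t) \<le> C * \<bar>t - s\<bar> powr \<theta>"
proof (rule ccontr)
  assume neg: "\<not> ?thesis"
  have "\<exists>s\<in>{a..b}. \<exists>t\<in>{a..b}. \<bar>t - s\<bar> < inverse (real (Suc n)) \<and>
      norm (f s t) > real (Suc n) * \<bar>t - s\<bar> powr \<theta>" for n
  proof (rule ccontr)
    assume "\<not> ?thesis"
    then have "\<forall>s\<in>{a..b}. \<forall>t\<in>{a..b}. \<bar>t - s\<bar> < inverse (real (Suc n)) \<longrightarrow>
      norm (f s t) \<le> real (Suc n) * \<bar>t - s\<bar> powr \<theta>" by (meson not_le)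
    moreover have "inverse (real (Suc n)) > 0" "real (Suc n) \<ge> 0" by auto
    ultimately show False using neg by blast
  qed
  then obtain s t where st: "\<And>n. s n \<in> {a..b}" "\<And>n. t n \<in> {a..b}"
    "\<And>n. \<bar>t n - s n\<bar> < inverse (real (Suc n))"
    "\<And>n. norm (f (s n) (t n)) > real (Suc n) * \<bar>t n - s n\<bar> powr \<theta>" by metis
  obtain \<tau> and r :: "nat \<Rightarrow> nat" where r: "\<tau> \<in> {a..b}" "strict_mono r" "(s \<circ> r) \<longlonglongrightarrow> \<tau>"
    using compact_Icc[of a b] st(1) unfolding compact_def by metis
  obtain C d where Cd: "d > 0" "\<And>s t. s \<in> {a..b} \<Longrightarrow> t \<in> {a..b} \<Longrightarrow> \<bar>s - \<tau>\<bar> < d \<Longrightarrow> \<bar>t - \<tau>\<bar> < d \<Longrightarrow>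
      norm (f s t) \<le> C * \<bar>t - s\<bar> powr \<theta>"
    using assms[OF r(1)] unfolding germO_def eventually_pairs fst_conv snd_conv by blast
  have "(\<lambda>n. inverse (real (Suc n))) \<longlonglongrightarrow> 0" by (rule LIMSEQ_inverse_real_of_nat)
  then have i0: "((\<lambda>n. inverse (real (Suc n))) \<circ> r) \<longlonglongrightarrow> 0" by (rule LIMSEQ_subseq_LIMSEQ[OF _ r(2)])
  have "\<forall>\<^sub>F n in sequentially. dist ((s \<circ> r) n) \<tau> < d / 2"
    by (rule tendstoD[OF r(3)]) (use Cd in auto)
  moreover have "\<forall>\<^sub>F n in sequentially. dist (((\<lambda>n. inverse (real (Suc n))) \<circ> r) n) 0 < d / 2"
    by (rule tendstoD[OF i0]) (use Cd in auto)
  moreover have "\<forall>\<^sub>F n in sequentially. real n \<ge> C" by real_asymp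
  ultimately have "\<forall>\<^sub>F n in sequentially. False"
  proof eventually_elim
    case (elim n)
    have n: "n \<le> r n" using r(2) seq_suble by blast
    have "\<bar>s (r n) - \<tau>\<bar> < d" using elim Cd(1) by (simp add: dist_real_def)
    moreover have "\<bar>t (r n) - \<tau>\<bar> < d"
      using elim(1,2) st(3)[of "r n"] unfolding dist_real_def o_def by linarith
    ultimately have "norm (f (s (r n)) (t (r n))) \<le> C * \<bar>t (r n) - s (r n)\<bar> powr \<theta>"
      using Cd(2) st(1,2) by blast
    also have "\<dots> \<le> real (Suc (r n)) * \<bar>t (r n) - s (r n)\<bar> powr \<theta>"
      using elim n by (intro mult_right_mono) auto
    finally show False using st(4)[of "r n"] by linarith
  qed
  then show False by simp
qed

text \<open>An exponent above 1 makes the difference quotients tend to 0, so the derivative vanishes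
  on the interval.\<close>

lemma constant_of_superlinear:
  fixes \<phi> :: "real \<Rightarrow> 'a::real_normed_vector"
  assumes "1 < \<theta>" "\<delta> > 0" "s \<in> {a..b}" "t \<in> {a..b}"
    and le: "\<And>s t. s \<in> {a..b} \<Longrightarrow> t \<in> {a..b} \<Longrightarrow> \<bar>t - s\<bar> < \<delta> \<Longrightarrow> norm (\<phi> t - \<phi> s) \<le> C * \<bar>t - s\<bar> powr \<theta>"
  shows "\<phi> s = \<phi> t"
proof -
  have "(\<phi> has_derivative (\<lambda>h. 0)) (at r within {a..b})" if r: "r \<in> {a..b}" for r
    unfolding has_derivative_at_within
  proof (intro conjI bounded_linear_zero)
    have "((\<lambda>q. C * \<bar>q - r\<bar> powr (\<theta> - 1)) \<longlongrightarrow> C * 0) (at r within {a..b})"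
    proof (intro tendsto_mult tendsto_const)
      show "((\<lambda>q. \<bar>q - r\<bar> powr (\<theta> - 1)) \<longlongrightarrow> 0) (at r within {a..b})"
        using assms(1) by (intro tendsto_zero_powrI[where b="\<theta> - 1"] tendsto_eq_intros) auto
    qed
    then have lim: "((\<lambda>q. C * \<bar>q - r\<bar> powr (\<theta> - 1)) \<longlongrightarrow> 0) (at r within {a..b})" by simp
    have "\<forall>\<^sub>F q in at r within {a..b}.
        norm ((\<phi> q - \<phi> r - 0) /\<^sub>R norm (q - r)) \<le> C * \<bar>q - r\<bar> powr (\<theta> - 1)"
      unfolding eventually_at
    proof (intro exI[of _ \<delta>] conjI ballI impI)
      fix q assume q: "q \<in> {a..b}" "q \<noteq> r \<and> dist q r < \<delta>"
      then have pos: "\<bar>q - r\<bar> > 0" by auto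
      have "norm (\<phi> q - \<phi> r) \<le> C * \<bar>q - r\<bar> powr \<theta>"
        using q r by (intro le) (auto simp: dist_real_def)
      also have "\<bar>q - r\<bar> powr \<theta> = \<bar>q - r\<bar> powr (\<theta> - 1) * \<bar>q - r\<bar>"
        using pos by (simp add: powr_diff)
      finally show "norm ((\<phi> q - \<phi> r - 0) /\<^sub>R norm (q - r)) \<le> C * \<bar>q - r\<bar> powr (\<theta> - 1)"
        using pos by (simp add: divide_inverse[symmetric] mult.assoc
            pos_divide_le_eq mult.commute[of "inverse _"])
    qed (use assms in auto)
    then show "((\<lambda>q. (\<phi> q - \<phi> r - 0) /\<^sub>R norm (q - r)) \<longlongrightarrow> 0) (at r within {a..b})"
      by (rule Lim_null_comparison[OF _ lim])
  qed
  then obtain c where "\<forall>r\<in>{a..b}. \<phi> r = c"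
    using has_derivative_zero_constant[of "{a..b}" \<phi>] by auto
  then show ?thesis using assms by simp
qed

section \<open>Riemann--Stieltjes sums\<close>

text \<open>One factor t (Suc k) - t k is kept and telescopes; the remaining power \<theta> - 1 > 0
  is bounded by the mesh. This is the reason why errors of order above 1 disappear in the limit of
  fine partitions.\<close>

lemma sum_superlinear_bound:
  fixes e :: "nat \<Rightarrow> 'a::real_normed_vector"
  assumes "1 < \<theta>" "C \<ge> 0" "\<And>k. k < n \<Longrightarrow> t k \<le> t (Suc k) \<and> t (Suc k) - t k \<le> \<delta>"
    and "\<And>k. k < n \<Longrightarrow> norm (e k) \<le> C * (t (Suc k) - t k) powr \<theta>"
  shows "norm (\<Sum>k<n. e k) \<le> C * \<delta> powr (\<theta> - 1) * (t n - t 0)"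
proof -
  have "norm (\<Sum>k<n. e k) \<le> (\<Sum>k<n. norm (e k))" by (rule norm_sum)
  also have "\<dots> \<le> (\<Sum>k<n. C * \<delta> powr (\<theta> - 1) * (t (Suc k) - t k))"
  proof (rule sum_mono)
    fix k assume "k \<in> {..<n}"
    then have k: "t k \<le> t (Suc k)" "t (Suc k) - t k \<le> \<delta>" "norm (e k) \<le> C * (t (Suc k) - t k) powr \<theta>"
      using assms(3,4) by auto
    have "(t (Suc k) - t k) powr \<theta> = (t (Suc k) - t k) powr (\<theta> - 1) * (t (Suc k) - t k)"
      using k(1) by (cases "t k = t (Suc k)") (auto simp: powr_diff)
    also have "\<dots> \<le> \<delta> powr (\<theta> - 1) * (t (Suc k) - t k)"
      using k assms(1) by (intro mult_right_mono powr_mono2) auto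
    finally show "norm (e k) \<le> C * \<delta> powr (\<theta> - 1) * (t (Suc k) - t k)"
      using k(3) assms(2) by (smt (verit, best) mult.assoc mult_left_mono)
  qed
  also have "\<dots> = C * \<delta> powr (\<theta> - 1) * (t n - t 0)"
    by (simp add: sum_distrib_left[symmetric] sum_lessThan_telescope)
  finally show ?thesis .
qed

lemma partition_in:
  fixes t :: "nat \<Rightarrow> real"
  assumes "t 0 = a" "t n = b" "\<And>k. k < n \<Longrightarrow> t k \<le> t (Suc k)" "k \<le> n"
  shows "t k \<in> {a..b}"
proof -
  have "i \<le> j \<Longrightarrow> j \<le> n \<Longrightarrow> t i \<le> t j" for i j
    by (induction j rule: nat_induct_at_least) (use assms(3) in \<open>auto intro: order_trans\<close>)
  from this[of 0 k] this[of k n] show ?thesis using assms by auto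
qed

lemma small_powr:
  assumes "\<eta> > 0" "\<epsilon> > 0" "C \<ge> 0" "\<delta>0 > 0"
  shows "\<exists>\<delta>>0. \<delta> \<le> \<delta>0 \<and> C * \<delta> powr \<eta> < (\<epsilon>::real)"
proof -
  have "((\<lambda>\<delta>. C * \<delta> powr \<eta>) \<longlongrightarrow> C * 0) (at_right 0)"
    using assms(1) by (intro tendsto_mult tendsto_const tendsto_zero_powrI[where b=\<eta>])
      (auto intro!: tendsto_eq_intros simp: eventually_at_filter)
  then have "\<forall>\<^sub>F \<delta> in at_right 0. C * \<delta> powr \<eta> < \<epsilon>"
    using order_tendstoD(2)[of _ "C * 0" _ \<epsilon>] assms(2) by auto
  moreover have "\<forall>\<^sub>F \<delta> in at_right 0. \<delta> > 0 \<and> \<delta> \<le> \<delta>0"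
    using assms(4) by (auto simp: eventually_at_right intro!: exI[of _ \<delta>0])
  ultimately have "\<forall>\<^sub>F \<delta> in at_right (0::real). \<delta> > 0 \<and> \<delta> \<le> \<delta>0 \<and> C * \<delta> powr \<eta> < \<epsilon>"
    by eventually_elim auto
  from eventually_happens[OF this] show ?thesis
    using trivial_limit_at_right_real[of "0::real"] by blast
qed

text \<open>The hypothesis makes \<Phi> an indefinite integral of f against h. The tag of a cell may
  lie inside it, so the estimate is applied from the tag to both end points; hence the constant 2 *
  C.\<close>

lemma has_RS_integralI:
  assumes \<theta>: "1 < \<theta>" and "\<delta>0 > 0" "a \<le> b" "C \<ge> 0"
    and le: "\<And>s t. s \<in> {a..b} \<Longrightarrow> t \<in> {a..b} \<Longrightarrow> \<bar>t - s\<bar> < \<delta>0 \<Longrightarrow>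
      \<bar>\<Phi> t - \<Phi> s - f s * (h t - h s)\<bar> \<le> C * \<bar>t - s\<bar> powr \<theta>"
  shows "has_RS_integral f h a b (\<Phi> b - \<Phi> a)"
  unfolding has_RS_integral_def
proof (intro allI impI)
  fix \<epsilon> :: real assume "\<epsilon> > 0"
  then obtain \<delta> where \<delta>: "\<delta> > 0" "\<delta> \<le> \<delta>0" "(2 * C * (b - a)) * \<delta> powr (\<theta> - 1) < \<epsilon>"
    using small_powr[of "\<theta> - 1" \<epsilon> "2 * C * (b - a)" \<delta>0] assms by auto
  show "\<exists>\<delta>>0. \<forall>n t \<xi>. t 0 = a \<and> t n = b \<and> (\<forall>k<n. t k \<le> \<xi> k \<and> \<xi> k \<le> t (Suc k) \<and> t (Suc k) - t k < \<delta>) \<longrightarrow>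
      \<bar>(\<Sum>k<n. f (\<xi> k) * (h (t (Suc k)) - h (t k))) - (\<Phi> b - \<Phi> a)\<bar> < \<epsilon>"
  proof (intro exI[of _ \<delta>] conjI allI impI)
    fix n :: nat and t \<xi> :: "nat \<Rightarrow> real"
    assume P: "t 0 = a \<and> t n = b \<and> (\<forall>k<n. t k \<le> \<xi> k \<and> \<xi> k \<le> t (Suc k) \<and> t (Suc k) - t k < \<delta>)"
    then have mono: "t k \<le> t (Suc k)" if "k < n" for k using that order_trans by blast
    have tin: "t k \<in> {a..b}" if "k \<le> n" for k
      using partition_in[of t a n b k] P mono that by blast
    let ?e = "\<lambda>k. f (\<xi> k) * (h (t (Suc k)) - h (t k)) - (\<Phi> (t (Suc k)) - \<Phi> (t k))"
    have "norm (\<Sum>k<n. ?e k) \<le> (2 * C) * \<delta> powr (\<theta> - 1) * (t n - t 0)"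
    proof (rule sum_superlinear_bound[OF \<theta>])
      fix k assume k: "k < n"
      show "t k \<le> t (Suc k) \<and> t (Suc k) - t k \<le> \<delta>" using mono P k by (simp add: less_imp_le)
      have in3: "t k \<in> {a..b}" "t (Suc k) \<in> {a..b}" using tin k by auto
      have \<xi>: "t k \<le> \<xi> k" "\<xi> k \<le> t (Suc k)" "t (Suc k) - t k < \<delta>" using P k by auto
      have 1: "\<bar>\<Phi> (t (Suc k)) - \<Phi> (\<xi> k) - f (\<xi> k) * (h (t (Suc k)) - h (\<xi> k))\<bar> \<le> C * \<bar>t (Suc k) - \<xi> k\<bar> powr \<theta>"
        using in3 \<xi> \<delta> by (intro le) auto
      have 2: "\<bar>\<Phi> (t k) - \<Phi> (\<xi> k) - f (\<xi> k) * (h (t k) - h (\<xi> k))\<bar> \<le> C * \<bar>t k - \<xi> k\<bar> powr \<theta>"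
        using in3 \<xi> \<delta> by (intro le) auto
      have "C * \<bar>t (Suc k) - \<xi> k\<bar> powr \<theta> \<le> C * (t (Suc k) - t k) powr \<theta>"
        "C * \<bar>t k - \<xi> k\<bar> powr \<theta> \<le> C * (t (Suc k) - t k) powr \<theta>"
        using \<xi> assms by (auto intro!: mult_left_mono powr_mono2)
      then show "norm (?e k) \<le> (2 * C) * (t (Suc k) - t k) powr \<theta>"
        using 1 2 by (simp add: algebra_simps)
    qed (use assms in auto)
    moreover have "(\<Sum>k<n. ?e k) = (\<Sum>k<n. f (\<xi> k) * (h (t (Suc k)) - h (t k))) - (\<Phi> b - \<Phi> a)"
      using P sum_lessThan_telescope[of "\<lambda>k. \<Phi> (t k)" n] by (simp only: sum_subtractf)
    moreover have "(2 * C) * \<delta> powr (\<theta> - 1) * (t n - t 0) < \<epsilon>"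
      using P \<delta>(3) by (simp only: mult_ac)
    ultimately show "\<bar>(\<Sum>k<n. f (\<xi> k) * (h (t (Suc k)) - h (t k))) - (\<Phi> b - \<Phi> a)\<bar> < \<epsilon>"
      by simp
  qed (use \<delta> in auto)
qed

text \<open>Only the sum of the products is compared with the increments of F, not the single
  integrals. All integrals are therefore evaluated along the same sequence of partitions and added
  before the limit is taken.\<close>

lemma has_RS_integral_sum_eq:
  fixes f h :: "'i \<Rightarrow> real \<Rightarrow> real"
  assumes \<theta>: "1 < \<theta>" and "\<delta>0 > 0" "a \<le> b" "C \<ge> 0"
    and le: "\<And>s t. s \<in> {a..b} \<Longrightarrow> t \<in> {a..b} \<Longrightarrow> \<bar>t - s\<bar> < \<delta>0 \<Longrightarrow>
      \<bar>F t - F s - (\<Sum>i\<in>B. f i s * (h i t - h i s))\<bar> \<le> C * \<bar>t - s\<bar> powr \<theta>"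
    and RS: "\<And>i. i \<in> B \<Longrightarrow> has_RS_integral (f i) (h i) a b (J i)"
  shows "(\<Sum>i\<in>B. J i) = F b - F a"
proof -
  \<comment> \<open>Uniform partitions with \<open>Suc n\<close> cells, which are meaningful for n =
    0 too; the tags are the left end points.\<close>
  define t where "t n k = a + real k * ((b - a) / real (Suc n))" for n k
  have t0: "t n 0 = a" and tn: "t n (Suc n) = b" for n
    unfolding t_def by (simp_all del: of_nat_Suc)
  have dt: "t n (Suc k) - t n k = (b - a) / real (Suc n)" for n k
    unfolding t_def of_nat_Suc[of k] distrib_right by simp
  have mono: "t n k \<le> t n (Suc k)" for n k
    using dt[of n k] assms(3) by (metis diff_ge_0_iff_ge divide_nonneg_nonneg of_nat_0_le_iff)
  have mesh: "\<forall>\<^sub>F n in sequentially. (b - a) / real (Suc n) < d" if "d > 0" for d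
    using that by real_asymp
  define S where "S i n = (\<Sum>k<Suc n. f i (t n k) * (h i (t n (Suc k)) - h i (t n k)))" for i n
  have "S i \<longlonglongrightarrow> J i" if i: "i \<in> B" for i
  proof (rule tendstoI)
    fix \<epsilon> :: real assume "\<epsilon> > 0"
    then obtain \<delta> where \<delta>: "\<delta> > 0" "\<And>(n::nat) t \<xi>. t 0 = a \<and> t n = b \<and>
        (\<forall>k<n. t k \<le> \<xi> k \<and> \<xi> k \<le> t (Suc k) \<and> t (Suc k) - t k < \<delta>) \<Longrightarrow>
        \<bar>(\<Sum>k<n. f i (\<xi> k) * (h i (t (Suc k)) - h i (t k))) - J i\<bar> < \<epsilon>"
      using RS[OF i] unfolding has_RS_integral_def by blast
    show "\<forall>\<^sub>F n in sequentially. dist (S i n) (J i) < \<epsilon>"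
      using mesh[OF \<delta>(1)]
    proof eventually_elim
      case (elim n)
      show ?case
        unfolding S_def dist_real_def
        by (rule \<delta>(2)) (use t0 tn mono dt elim in auto)
    qed
  qed
  then have 1: "(\<lambda>n. \<Sum>i\<in>B. S i n) \<longlonglongrightarrow> (\<Sum>i\<in>B. J i)" by (intro tendsto_sum)
  have "(\<lambda>n. (\<Sum>i\<in>B. S i n) - (F b - F a)) \<longlonglongrightarrow> 0"
  proof (rule Lim_null_comparison)
    show "(\<lambda>n. C * ((b - a) / real (Suc n)) powr (\<theta> - 1) * (b - a)) \<longlonglongrightarrow> 0"
    proof (cases "a = b")
      case False
      then have "b - a > 0" using assms(3) by auto
      then show ?thesis using \<theta> by real_asymp
    qed auto
    show "\<forall>\<^sub>F n in sequentially. norm ((\<Sum>i\<in>B. S i n) - (F b - F a))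
        \<le> C * ((b - a) / real (Suc n)) powr (\<theta> - 1) * (b - a)"
      using mesh[OF assms(2)]
    proof eventually_elim
      case (elim n)
      let ?e = "\<lambda>k. (\<Sum>i\<in>B. f i (t n k) * (h i (t n (Suc k)) - h i (t n k))) - (F (t n (Suc k)) - F (t n k))"
      have "norm (\<Sum>k<Suc n. ?e k) \<le> C * ((b - a) / real (Suc n)) powr (\<theta> - 1) * (t n (Suc n) - t n 0)"
      proof (rule sum_superlinear_bound[OF \<theta>])
        fix k assume k: "k < Suc n"
        have "t n k \<in> {a..b}" "t n (Suc k) \<in> {a..b}"
          using partition_in[of "t n" a "Suc n" b] t0 tn mono k by auto
        then have "\<bar>F (t n (Suc k)) - F (t n k) - (\<Sum>i\<in>B. f i (t n k) * (h i (t n (Suc k)) - h i (t n k)))\<bar>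
            \<le> C * \<bar>t n (Suc k) - t n k\<bar> powr \<theta>"
          using dt elim mono[of n k] by (intro le) auto
        then show "norm (?e k) \<le> C * (t n (Suc k) - t n k) powr \<theta>"
          using mono[of n k] by (simp add: abs_minus_commute)
      qed (use assms mono dt in auto)
      moreover have "(\<Sum>k<Suc n. ?e k) = (\<Sum>i\<in>B. S i n) - (F b - F a)"
      proof -
        have "(\<Sum>k<Suc n. F (t n (Suc k)) - F (t n k)) = F b - F a"
          using sum_lessThan_telescope[of "\<lambda>k. F (t n k)" "Suc n"] t0 tn by simp
        moreover have "(\<Sum>i\<in>B. S i n) = (\<Sum>k<Suc n. \<Sum>i\<in>B. f i (t n k) * (h i (t n (Suc k)) - h i (t n k)))"
          unfolding S_def by (rule sum.swap)
        ultimately show ?thesis by (simp only: sum_subtractf)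
      qed
      ultimately show ?case using t0 tn by simp
    qed
  qed
  then have "(\<lambda>n. \<Sum>i\<in>B. S i n) \<longlonglongrightarrow> F b - F a" by (rule LIM_zero_cancel)
  then show ?thesis using 1 LIMSEQ_unique by blast
qed

section \<open>Young differential equations: existence by Euler polygons\<close>

text \<open>\<open>Y n\<close> is the Euler polygon with \<open>n + 1\<close> steps and \<open>R n i j\<close> its error against a single step from
  \<open>i\<close> to \<open>j\<close>. Cutting an interval of length \<open>d\<close> into halves, of errors at most \<open>L (d/2)\<^sup>2\<^sup>\<alpha>\<close> each, bounds
  the error by \<open>2\<^sup>1\<^sup>-\<^sup>2\<^sup>\<alpha> L d\<^sup>2\<^sup>\<alpha>\<close> plus a defect, whence the condition on \<open>L\<close>. Since the
  bound is uniform in \<open>n\<close>, the theorem of Arzela and Ascoli applies.\<close>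

locale davie =
  fixes H :: "real \<Rightarrow> 'k::finite_dim_normed \<Rightarrow> 'v::real_normed_vector \<Rightarrow> 'k"
    and x :: "real \<Rightarrow> 'v" and a b K L r \<alpha> :: real and z0 z1 :: 'k
  assumes alpha: "1/2 < \<alpha>" "\<alpha> \<le> 1" and K: "K \<ge> 0"
    and L: "L \<ge> 0" "2 powr (1 - 2 * \<alpha>) * L + 2 * (K * K * (K * K + 2)) \<le> L"
    and ab: "a < b" and small: "L * (b - a) powr \<alpha> \<le> 1" "(3 * (K * K) + 1) * (b - a) powr \<alpha> \<le> r / 2"
    and x: "\<And>s t. s \<in> {a..b} \<Longrightarrow> t \<in> {a..b} \<Longrightarrow> norm (x t - x s) \<le> K * \<bar>t - s\<bar> powr \<alpha>"
    and Hlin: "\<And>s z. s \<in> {a..b} \<Longrightarrow> z \<in> cball z0 r \<Longrightarrow> linear (H s z)"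
    and Hbd: "\<And>s z v. s \<in> {a..b} \<Longrightarrow> z \<in> cball z0 r \<Longrightarrow> norm (H s z v) \<le> K * norm v"
    and HLip: "\<And>s u z w v. s \<in> {a..b} \<Longrightarrow> u \<in> {a..b} \<Longrightarrow> z \<in> cball z0 r \<Longrightarrow> w \<in> cball z0 r \<Longrightarrow>
      norm (H u w v - H s z v) \<le> K * (\<bar>u - s\<bar> powr \<alpha> + norm (w - z)) * norm v"
    and z1: "norm (z1 - z0) \<le> r / 2"
begin

definition step :: "nat \<Rightarrow> real" where "step n = (b - a) / real (Suc n)"
definition g :: "nat \<Rightarrow> nat \<Rightarrow> real" where "g n k = a + real k * step n"

primrec Y :: "nat \<Rightarrow> nat \<Rightarrow> 'k" where
  "Y n 0 = z1"
| "Y n (Suc k) = Y n k + H (g n k) (Y n k) (x (g n (Suc k)) - x (g n k))"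

definition R :: "nat \<Rightarrow> nat \<Rightarrow> nat \<Rightarrow> 'k" where
  "R n i j = Y n j - Y n i - H (g n i) (Y n i) (x (g n j) - x (g n i))"

lemma step_pos: "step n > 0" using ab by (simp add: step_def)

lemma g_in: "k \<le> Suc n \<Longrightarrow> g n k \<in> {a..b}"
proof -
  assume k: "k \<le> Suc n"
  have "real k * step n \<le> real (Suc n) * step n"
    using k step_pos by (intro mult_right_mono) (auto simp: less_imp_le)
  also have "\<dots> = b - a" by (simp add: step_def del: of_nat_Suc)
  finally show ?thesis using step_pos[of n] by (auto simp: g_def less_imp_le)
qed

lemma g_diff: "g n (i + d) - g n i = real d * step n"
  by (simp add: g_def algebra_simps)

lemma g_Suc_n: "g n (Suc n) = b" by (simp add: g_def step_def del: of_nat_Suc)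

lemma D_le: "d \<le> Suc n \<Longrightarrow> real d * step n \<le> b - a"
  using g_in[of d n] by (simp add: g_def)

lemma x_g: "i + d \<le> Suc n \<Longrightarrow> norm (x (g n (i + d)) - x (g n i)) \<le> K * (real d * step n) powr \<alpha>"
  using x[of "g n i" "g n (i + d)"] g_in[of i n] g_in[of "i + d" n] step_pos[of n]
  by (simp add: g_diff)

text \<open>The single Euler step contributes K * K. The error contributes 1, because
  \<open>small\<close> absorbs L times one factor of order \<alpha> and leaves the other.\<close>

lemma Y_of_R:
  assumes "norm (R n i (i + d)) \<le> L * (real d * step n) powr (2 * \<alpha>)" "Y n i \<in> cball z0 r" "i + d \<le> Suc n"
  shows "norm (Y n (i + d) - Y n i) \<le> (K * K + 1) * (real d * step n) powr \<alpha>"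
proof -
  let ?D = "real d * step n"
  have D: "0 \<le> ?D" "?D \<le> b - a" using step_pos[of n] D_le[of d n] assms(3) by auto
  have "norm (H (g n i) (Y n i) (x (g n (i + d)) - x (g n i))) \<le> K * (K * ?D powr \<alpha>)"
    using Hbd[of "g n i" "Y n i"] g_in[of i n] assms(2,3)
    by (intro order_trans[OF Hbd] mult_left_mono x_g K) auto
  moreover have "L * ?D powr (2 * \<alpha>) \<le> ?D powr \<alpha>"
  proof -
    have "?D powr (2 * \<alpha>) = ?D powr \<alpha> * ?D powr \<alpha>" by (simp flip: powr_add)
    moreover have "L * ?D powr \<alpha> \<le> 1"
      using D alpha L(1) by (intro order_trans[OF _ small(1)] mult_left_mono powr_mono2) auto
    ultimately show ?thesis
      using mult_right_mono[of "L * ?D powr \<alpha>" 1 "?D powr \<alpha>"] by (simp add: mult.assoc)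
  qed
  moreover have "Y n (i + d) - Y n i = R n i (i + d) + H (g n i) (Y n i) (x (g n (i + d)) - x (g n i))"
    by (simp add: R_def)
  ultimately have "norm (Y n (i + d) - Y n i) \<le> ?D powr \<alpha> + K * (K * ?D powr \<alpha>)"
    using assms(1) norm_triangle_le by (smt (verit))
  then show ?thesis by (simp add: algebra_simps)
qed

lemma R_bound:
  assumes ball: "\<And>k. k \<le> N \<Longrightarrow> Y n k \<in> cball z0 r" and N: "N \<le> Suc n"
  shows "i + d \<le> N \<Longrightarrow> norm (R n i (i + d)) \<le> L * (real d * step n) powr (2 * \<alpha>)"
proof (induction d arbitrary: i rule: less_induct)
  case (less d)
  have lin: "linear (H (g n k) (Y n k))" if "k \<le> N" for k
    using that N ball g_in by (intro Hlin) auto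
  have zero: "R n k k = 0" "R n k (Suc k) = 0" if "k \<le> N" for k
    using linear_0[OF lin[OF that]] by (auto simp: R_def)
  consider "d = 0" | "d = 1" | "2 \<le> d" by linarith
  then show ?case
  proof cases
    case 1 then show ?thesis using zero less.prems L(1) by simp
  next
    case 2 then show ?thesis using zero less.prems L(1) by simp
  next
    case 3
    \<comment> \<open>The block is cut into m cells, the single cell from u to \<open>Suc u\<close>,
      and d2 cells. A single cell has no error, and m and d2 are both at most d / 2, whether d is
      even or odd.\<close>
    define m where "m = d div 2"
    define u where "u = i + m"
    define d2 where "d2 = d - Suc m"
    let ?D = "real d * step n" and ?\<theta> = "2 * \<alpha>"
    have m: "m < d" "Suc m \<le> d" "2 * m \<le> d" "2 * d2 \<le> d" "d2 < d"
      using 3 unfolding m_def d2_def by linarith+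
    have j: "i + d = Suc u + d2" unfolding u_def d2_def using m by simp
    have D0: "?D \<ge> 0" using step_pos[of n] by simp
    have half: "L * (real e * step n) powr ?\<theta> \<le> L * (?D / 2) powr ?\<theta>" if "2 * e \<le> d" for e
    proof -
      have "2 * real e \<le> real d" using that by (metis of_nat_le_iff of_nat_mult of_nat_numeral)
      then have "2 * real e * step n \<le> real d * step n"
        using step_pos[of n] by (intro mult_right_mono) auto
      then show ?thesis using step_pos[of n] L(1) alpha by (intro mult_left_mono powr_mono2) auto
    qed
    have R1: "norm (R n i u) \<le> L * (?D / 2) powr ?\<theta>"
      unfolding u_def using less.IH[of m i] m less.prems half[of m] by simp
    have R2: "norm (R n (Suc u) (i + d)) \<le> L * (?D / 2) powr ?\<theta>"
      unfolding j using less.IH[of d2 "Suc u"] m less.prems half[of d2] j by simp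
    have R3: "R n u (Suc u) = 0" using zero less.prems m by (simp add: u_def)
    let ?\<delta>1 = "x (g n (Suc u)) - x (g n u)" and ?\<delta>2 = "x (g n (i + d)) - x (g n (Suc u))"
    let ?Hd = "\<lambda>k v. H (g n k) (Y n k) v - H (g n i) (Y n i) v"
    have xle: "norm (x (g n (p + e)) - x (g n p)) \<le> K * ?D powr \<alpha>" if "i \<le> p" "p + e \<le> i + d" for p e
    proof -
      have "real e * step n \<le> ?D" using that step_pos[of n] by (intro mult_right_mono) auto
      then have "K * (real e * step n) powr \<alpha> \<le> K * ?D powr \<alpha>"
        using alpha K step_pos[of n] by (intro mult_left_mono powr_mono2) auto
      then show ?thesis using x_g[of p e n] that less.prems N by simp
    qed
    \<comment> \<open>The defect of additivity: the coefficient is frozen at two different grid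
      points. Time contributes 1 and the state K * K + 1 to the variation, and the increment of the
      driver another factor K, whence K * K * (K * K + 2).\<close>
    have Hdb: "norm (?Hd (i + e) v) \<le> K * K * (K * K + 2) * ?D powr ?\<theta>"
      if e: "e < d" and v: "norm v \<le> K * ?D powr \<alpha>" for e v
    proof -
      have eD: "(real e * step n) powr \<alpha> \<le> ?D powr \<alpha>"
        using e step_pos[of n] alpha by (intro powr_mono2 mult_right_mono) auto
      have "norm (R n i (i + e)) \<le> L * (real e * step n) powr ?\<theta>"
        using less.IH[OF e, of i] less.prems e by simp
      then have "norm (Y n (i + e) - Y n i) \<le> (K * K + 1) * (real e * step n) powr \<alpha>"
        using less.prems N e ball by (intro Y_of_R) auto
      also have "\<dots> \<le> (K * K + 1) * ?D powr \<alpha>" using eD by (intro mult_left_mono) auto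
      finally have Yd: "norm (Y n (i + e) - Y n i) \<le> (K * K + 1) * ?D powr \<alpha>" .
      have "norm (?Hd (i + e) v) \<le> K * (\<bar>g n (i + e) - g n i\<bar> powr \<alpha> + norm (Y n (i + e) - Y n i)) * norm v"
        using less.prems N e ball g_in by (intro HLip) auto
      also have "\<dots> \<le> K * (?D powr \<alpha> + (K * K + 1) * ?D powr \<alpha>) * (K * ?D powr \<alpha>)"
        using Yd eD v K step_pos[of n] by (intro mult_mono mult_left_mono add_mono) (auto simp: g_diff)
      also have "\<dots> = K * K * (K * K + 2) * (?D powr \<alpha> * ?D powr \<alpha>)" by (simp add: algebra_simps)
      also have "?D powr \<alpha> * ?D powr \<alpha> = ?D powr ?\<theta>" by (simp flip: powr_add)
      finally show ?thesis .
    qed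
    have H1: "norm (?Hd u ?\<delta>1) \<le> K * K * (K * K + 2) * ?D powr ?\<theta>"
      unfolding u_def using xle[of "i + m" 1] m by (intro Hdb) auto
    \<comment> \<open>If no cell is left behind the middle one, then \<open>Suc m\<close> = d and
      the induction hypothesis does not reach that far, but the increment of x is 0.\<close>
    have H2: "norm (?Hd (Suc u) ?\<delta>2) \<le> K * K * (K * K + 2) * ?D powr ?\<theta>"
    proof (cases "Suc m = d")
      case True
      then have "i + d = Suc u" by (simp add: u_def)
      then have "?\<delta>2 = 0" by simp
      moreover have "H (g n (Suc u)) (Y n (Suc u)) 0 = 0" "H (g n i) (Y n i) 0 = 0"
        using lin[of "Suc u"] lin[of i] less.prems m
        by (auto intro!: linear_0 simp: u_def simp del: Y.simps)
      ultimately show ?thesis by simp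
    next
      case False
      then have Sm: "Suc m < d" using m by simp
      have eq: "Suc u = i + Suc m" by (simp add: u_def)
      have "norm ?\<delta>2 \<le> K * ?D powr \<alpha>"
        using xle[of "Suc u" d2, folded j] by (simp add: u_def)
      then show ?thesis unfolding eq by (rule Hdb[OF Sm])
    qed
    have "R n i (i + d) = R n i u + R n u (Suc u) + R n (Suc u) (i + d) + ?Hd u ?\<delta>1 + ?Hd (Suc u) ?\<delta>2"
    proof -
      have "H (g n i) (Y n i) (x (g n (i + d)) - x (g n i)) =
          H (g n i) (Y n i) (x (g n u) - x (g n i)) + H (g n i) (Y n i) ?\<delta>1 + H (g n i) (Y n i) ?\<delta>2"
        using linear_add[OF lin[of i], symmetric] less.prems by simp
      then show ?thesis unfolding R_def by (simp add: algebra_simps del: Y.simps)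
    qed
    then have "norm (R n i (i + d)) \<le> 2 * (L * (?D / 2) powr ?\<theta>) + 2 * (K * K * (K * K + 2) * ?D powr ?\<theta>)"
      using R1 R2 R3 H1 H2 by (smt (verit) norm_triangle_ineq add_0_right)
    also have "2 * (L * (?D / 2) powr ?\<theta>) = (2 powr (1 - ?\<theta>) * L) * ?D powr ?\<theta>"
      using D0 by (simp add: powr_divide powr_diff)
    also have "(2 powr (1 - ?\<theta>) * L) * ?D powr ?\<theta> + 2 * (K * K * (K * K + 2) * ?D powr ?\<theta>)
        = (2 powr (1 - ?\<theta>) * L + 2 * (K * K * (K * K + 2))) * ?D powr ?\<theta>" by (simp add: algebra_simps)
    also have "\<dots> \<le> L * ?D powr ?\<theta>" using L(2) by (intro mult_right_mono) auto
    finally show ?thesis .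
  qed
qed

text \<open>The coefficient is controlled only inside the ball, and the polygon is confined only by
  this control; induction over the grid resolves the circle. The steps before the last one move by K
  * K + 1 and the last one by K * K, in units of (b - a) powr \<alpha>; \<open>small\<close> makes
  this at most r / 2, and the start lies within r / 2 of the centre.\<close>

lemma Y_ball: "k \<le> Suc n \<Longrightarrow> Y n k \<in> cball z0 r"
proof (induction k rule: less_induct)
  case (less k)
  have pw: "(real d * step n) powr \<alpha> \<le> (b - a) powr \<alpha>" if "d \<le> Suc n" for d
    using D_le[OF that] step_pos[of n] alpha by (intro powr_mono2) auto
  show ?case
  proof (cases k)
    case 0
    then show ?thesis using z1 norm_ge_zero[of "z1 - z0"]
      by (simp add: dist_norm norm_minus_commute del: norm_ge_zero)
  next
    case (Suc j)
    have bj: "\<And>i. i \<le> j \<Longrightarrow> Y n i \<in> cball z0 r" using less Suc by simp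
    have "norm (Y n (0 + j) - Y n 0) \<le> (K * K + 1) * (real j * step n) powr \<alpha>"
      using less.prems Suc bj bj[of 0] by (intro Y_of_R R_bound[where N=j]) auto
    also have "\<dots> \<le> (K * K + 1) * (b - a) powr \<alpha>"
      using pw[of j] less.prems Suc by (intro mult_left_mono) auto
    finally have 1: "norm (Y n j - z1) \<le> (K * K + 1) * (b - a) powr \<alpha>" by simp
    have "norm (H (g n j) (Y n j) (x (g n (j + 1)) - x (g n j))) \<le> K * (K * (real 1 * step n) powr \<alpha>)"
      using less.prems Suc bj g_in by (intro order_trans[OF Hbd] mult_left_mono x_g K) auto
    also have "\<dots> \<le> K * (K * (b - a) powr \<alpha>)" using pw[of 1] K by (intro mult_left_mono) auto
    finally have 2: "norm (Y n (Suc j) - Y n j) \<le> K * K * (b - a) powr \<alpha>" by simp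
    have "norm (Y n (Suc j) - z0) \<le> norm (Y n (Suc j) - Y n j) + norm (Y n j - z1) + norm (z1 - z0)"
      using norm_triangle_ineq[of "Y n (Suc j) - Y n j + (Y n j - z1)" "z1 - z0"]
        norm_triangle_ineq[of "Y n (Suc j) - Y n j" "Y n j - z1"] by (simp del: Y.simps)
    also have "\<dots> \<le> (2 * (K * K) + 1) * (b - a) powr \<alpha> + r / 2"
      using 1 2 z1 by (simp add: algebra_simps)
    also have "\<dots> \<le> (3 * (K * K) + 1) * (b - a) powr \<alpha> + r / 2"
      by (intro add_mono mult_right_mono) auto
    also have "\<dots> \<le> r" using small(2) by simp
    finally show ?thesis unfolding Suc by (simp add: dist_norm norm_minus_commute)
  qed
qed

lemma Y_increment: "i \<le> j \<Longrightarrow> j \<le> Suc n \<Longrightarrow> norm (Y n j - Y n i) \<le> (K * K + 1) * (g n j - g n i) powr \<alpha>"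
  using Y_of_R[of n i "j - i"] R_bound[of "Suc n" n i "j - i"] Y_ball g_diff[of n i "j - i"] by simp

lemma R_increment: "i \<le> j \<Longrightarrow> j \<le> Suc n \<Longrightarrow> norm (R n i j) \<le> L * (g n j - g n i) powr (2 * \<alpha>)"
  using R_bound[of "Suc n" n i "j - i"] Y_ball g_diff[of n i "j - i"] by simp

section \<open>Interpolation of the polygons and passage to the limit\<close>

definition cell :: "nat \<Rightarrow> real \<Rightarrow> nat" where "cell n t = nat \<lfloor>(t - a) / step n\<rfloor>"

text \<open>Inside a cell the polygon follows the driver x instead of a straight line, so that it
  inherits the Hoelder bound of x. At the time b the cell is \<open>Suc n\<close>, whose left end is
  b itself.\<close>

definition y :: "nat \<Rightarrow> real \<Rightarrow> 'k" where
  "y n t = Y n (cell n t) + H (g n (cell n t)) (Y n (cell n t)) (x t - x (g n (cell n t)))"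

lemma cell:
  assumes "t \<in> {a..b}"
  shows "cell n t \<le> Suc n" "g n (cell n t) \<le> t" "t < g n (Suc (cell n t))"
proof -
  have q: "0 \<le> (t - a) / step n" using assms step_pos[of n] by simp
  have "(t - a) / step n \<le> real (Suc n)"
    using assms step_pos[of n] g_Suc_n[of n] by (simp add: pos_divide_le_eq g_def del: of_nat_Suc)
  then show "cell n t \<le> Suc n" unfolding cell_def using q by linarith
  have "real (cell n t) \<le> (t - a) / step n" "(t - a) / step n < real (Suc (cell n t))"
    unfolding cell_def using q by linarith+
  then show "g n (cell n t) \<le> t" "t < g n (Suc (cell n t))"
    using step_pos[of n] by (simp_all add: g_def pos_le_divide_eq pos_divide_less_eq del: of_nat_Suc)
qed

lemma cell_mono: "s \<le> t \<Longrightarrow> cell n s \<le> cell n t"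
  unfolding cell_def using step_pos[of n] by (intro nat_mono floor_mono divide_right_mono) auto

lemma g_mono: "i \<le> j \<Longrightarrow> g n i \<le> g n j"
  unfolding g_def using step_pos[of n] by (intro add_left_mono mult_right_mono) auto

lemma cell_Suc_le:
  assumes "t \<in> {a..b}" "s \<in> {a..b}" "cell n s \<noteq> cell n t" "s \<le> t"
  shows "Suc (cell n s) \<le> cell n t" "cell n s \<le> n"
  using cell_mono[OF assms(4), of n] assms(3) cell(1)[OF assms(1), of n] by linarith+

text \<open>The rest of the first cell, the whole cells in between and the beginning of the last
  cell contribute K * K, K * K + 1 and K * K.\<close>

lemma y_holder:
  assumes "s \<in> {a..b}" "t \<in> {a..b}" "s \<le> t"
  shows "norm (y n t - y n s) \<le> (3 * (K * K) + 1) * (t - s) powr \<alpha>"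
proof -
  define i j where "i = cell n s" and "j = cell n t"
  have i: "i \<le> Suc n" "g n i \<le> s" "s < g n (Suc i)" and j: "j \<le> Suc n" "g n j \<le> t"
    unfolding i_def j_def using cell assms by auto
  have gin: "g n i \<in> {a..b}" "g n j \<in> {a..b}" using g_in i j by auto
  have lin: "linear (H (g n k) (Y n k))" if "k \<le> Suc n" for k
    using Y_ball that g_in by (intro Hlin) auto
  have Hx: "norm (H (g n k) (Y n k) (x q - x p)) \<le> K * K * (t - s) powr \<alpha>"
    if "k \<le> Suc n" "p \<in> {a..b}" "q \<in> {a..b}" "p \<le> q" "q - p \<le> t - s" for k p q
  proof -
    have "norm (H (g n k) (Y n k) (x q - x p)) \<le> K * (K * \<bar>q - p\<bar> powr \<alpha>)"
      using that Y_ball g_in by (intro order_trans[OF Hbd] mult_left_mono x K) auto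
    also have "\<dots> \<le> K * (K * (t - s) powr \<alpha>)"
      using that K alpha by (intro mult_left_mono powr_mono2) auto
    finally show ?thesis by (simp add: mult.assoc)
  qed
  show ?thesis
  proof (cases "i = j")
    case True
    have "y n t - y n s = H (g n i) (Y n i) (x t - x (g n i)) - H (g n i) (Y n i) (x s - x (g n i))"
      unfolding y_def using True by (simp add: i_def j_def)
    also have "\<dots> = H (g n i) (Y n i) (x t - x s)"
      using linear_diff[OF lin[OF i(1)], symmetric] by simp
    finally have "norm (y n t - y n s) \<le> K * K * (t - s) powr \<alpha>" using Hx[of i s t] assms i by simp
    also have "\<dots> \<le> (3 * (K * K) + 1) * (t - s) powr \<alpha>" by (intro mult_right_mono) auto
    finally show ?thesis .
  next
    case False
    then have ij: "Suc i \<le> j" "i \<le> n" unfolding i_def j_def using cell_Suc_le assms by blast+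
    have gij: "g n (Suc i) \<le> g n j" using g_mono ij by blast
    have gS: "g n (Suc i) \<in> {a..b}" using g_in ij by auto
    have "Y n (Suc i) - y n s = H (g n i) (Y n i) (x (g n (Suc i)) - x (g n i)) - H (g n i) (Y n i) (x s - x (g n i))"
      unfolding y_def by (simp add: i_def)
    also have "\<dots> = H (g n i) (Y n i) (x (g n (Suc i)) - x s)"
      using linear_diff[OF lin[OF i(1)], symmetric] by simp
    finally have 1: "norm (Y n (Suc i) - y n s) \<le> K * K * (t - s) powr \<alpha>"
      using Hx[of i s "g n (Suc i)"] assms i j gS gij by simp
    have "norm (Y n j - Y n (Suc i)) \<le> (K * K + 1) * (g n j - g n (Suc i)) powr \<alpha>"
      using Y_increment ij j by blast
    also have "\<dots> \<le> (K * K + 1) * (t - s) powr \<alpha>"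
      using gij i j alpha by (intro mult_left_mono powr_mono2) auto
    finally have 2: "norm (Y n j - Y n (Suc i)) \<le> (K * K + 1) * (t - s) powr \<alpha>" .
    have 3: "norm (y n t - Y n j) \<le> K * K * (t - s) powr \<alpha>"
      using Hx[of j "g n j" t] assms i j gin gij by (simp add: y_def flip: j_def)
    have "norm (y n t - y n s) \<le> norm (y n t - Y n j) + norm (Y n j - Y n (Suc i)) + norm (Y n (Suc i) - y n s)"
      by (rule order_trans[OF _ add_mono[OF norm_triangle_ineq order_refl]])
        (rule order_trans[OF _ norm_triangle_ineq], simp)
    then show ?thesis using 1 2 3 by (simp add: algebra_simps)
  qed
qed

lemma y_holder': "s \<in> {a..b} \<Longrightarrow> t \<in> {a..b} \<Longrightarrow> norm (y n t - y n s) \<le> (3 * (K * K) + 1) * \<bar>t - s\<bar> powr \<alpha>"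
  using y_holder[of s t n] y_holder[of t s n] by (cases "s \<le> t") (auto simp: norm_minus_commute)

lemma y_g: "k \<le> Suc n \<Longrightarrow> y n (g n k) = Y n k"
proof -
  assume k: "k \<le> Suc n"
  have "cell n (g n k) = k" unfolding cell_def g_def using step_pos[of n] by simp
  then show ?thesis using linear_0[OF Hlin[of "g n k" "Y n k"]] Y_ball k g_in by (simp add: y_def)
qed

lemma solution:
  "\<exists>w. w a = z1 \<and> (\<forall>t\<in>{a..b}. w t \<in> cball z0 r) \<and> (\<exists>C. \<forall>s\<in>{a..b}. \<forall>t\<in>{a..b}.
     norm (w t - w s) \<le> C * \<bar>t - s\<bar> powr \<alpha> \<and>
     norm (w t - w s - H s (w s) (x t - x s)) \<le> C * \<bar>t - s\<bar> powr (2 * \<alpha>))"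
proof -
  let ?M = "3 * (K * K) + 1"
  have M: "?M > 0" by (metis add_nonneg_pos mult_nonneg_nonneg zero_le_numeral zero_le_square zero_less_one)
  have ya: "y n a = z1" for n using y_g[of 0 n] by (simp add: g_def)
  have bnd: "norm (y n t - z1) \<le> ?M * (b - a) powr \<alpha>" if "t \<in> {a..b}" for n t
    using order_trans[OF y_holder[of a t n] mult_left_mono[OF powr_mono2, of \<alpha> "t - a" "b - a"]]
      that M alpha ya by simp
  obtain w k where w: "strict_mono (k :: nat \<Rightarrow> nat)"
    "\<And>e. 0 < e \<Longrightarrow> \<exists>N. \<forall>n t. n \<ge> N \<and> t \<in> {a..b} \<longrightarrow> norm (y (k n) t - w t) < e"
  proof (rule Arzela_Ascoli[of "{a..b}" y "norm z1 + ?M * (b - a) powr \<alpha>"])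
    show "norm (y n t) \<le> norm z1 + ?M * (b - a) powr \<alpha>" if "t \<in> {a..b}" for n t
      using bnd[OF that, of n] norm_triangle_sub[of "y n t" z1] by linarith
    fix t e :: real assume t: "t \<in> {a..b}" "0 < e"
    obtain d where d: "d > 0" "?M * d powr \<alpha> < e"
      using small_powr[of \<alpha> e ?M 1] alpha M t(2) by auto
    show "\<exists>d. 0 < d \<and> (\<forall>n s. s \<in> {a..b} \<and> norm (t - s) < d \<longrightarrow> norm (y n t - y n s) < e)"
    proof (intro exI[of _ d] conjI allI impI)
      fix n s assume s: "s \<in> {a..b} \<and> norm (t - s) < d"
      have "norm (y n t - y n s) \<le> ?M * \<bar>t - s\<bar> powr \<alpha>" using y_holder' s t by blast
      also have "\<dots> \<le> ?M * d powr \<alpha>" using s M alpha by (intro mult_left_mono powr_mono2) auto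
      finally show "norm (y n t - y n s) < e" using d by simp
    qed (use d in auto)
  qed auto
  have lim: "(\<lambda>n. y (k n) t) \<longlonglongrightarrow> w t" if "t \<in> {a..b}" for t
    unfolding LIMSEQ_iff using w(2) that by blast
  have "(\<lambda>n. y (k n) a) \<longlonglongrightarrow> w a" using ab by (intro lim) auto
  then have wa: "w a = z1" unfolding ya by (simp add: LIMSEQ_const_iff)
  have wH: "norm (w t - w s) \<le> ?M * \<bar>t - s\<bar> powr \<alpha>" if "s \<in> {a..b}" "t \<in> {a..b}" for s t
    by (rule tendsto_upperbound[OF tendsto_norm[OF tendsto_diff[OF lim[OF that(2)] lim[OF that(1)]]]])
      (use y_holder' that in auto)
  have wball: "w t \<in> cball z0 r" if "t \<in> {a..b}" for t
  proof -
    have "norm (w t - w a) \<le> ?M * \<bar>t - a\<bar> powr \<alpha>" using wH[of a t] that ab by simp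
    also have "\<dots> \<le> ?M * (b - a) powr \<alpha>" using that M alpha by (intro mult_left_mono powr_mono2) auto
    also have "\<dots> \<le> r / 2" by (rule small(2))
    finally have "norm (w t - z1) \<le> r / 2" using wa by simp
    then have "norm (w t - z0) \<le> r"
      using z1 norm_triangle_ineq[of "w t - z1" "z1 - z0"] by simp
    then show ?thesis by (simp add: dist_norm norm_minus_commute)
  qed
  \<comment> \<open>The error bound \<open>R_increment\<close> holds at grid points only. For each t
    it is used at the grid point to the left of t, which tends to t, and every term of it
    converges.\<close>
  define gt where "gt t n = g (k n) (cell (k n) t)" for t n
  have gt_in: "gt t n \<in> {a..b}" if "t \<in> {a..b}" for t n
    unfolding gt_def using that cell g_in by blast
  have gt_lim: "gt t \<longlonglongrightarrow> t" if t: "t \<in> {a..b}" for t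
  proof (rule LIM_zero_cancel, rule Lim_null_comparison)
    have "(\<lambda>n. (b - a) * inverse (real (Suc n))) \<longlonglongrightarrow> (b - a) * 0"
      by (intro tendsto_mult tendsto_const LIMSEQ_inverse_real_of_nat)
    then have "step \<longlonglongrightarrow> 0" unfolding step_def[abs_def] by (simp add: divide_inverse)
    then show "(\<lambda>n. step (k n)) \<longlonglongrightarrow> 0" using LIMSEQ_subseq_LIMSEQ[OF _ w(1)] by (auto simp: o_def)
    have "norm (gt t n - t) \<le> step (k n)" for n
      using cell(2,3)[OF t, of "k n"] g_diff[of "k n" "cell (k n) t" 1] by (simp add: gt_def)
    then show "\<forall>\<^sub>F n in sequentially. norm (gt t n - t) \<le> step (k n)" by simp
  qed
  have gt_pow: "(\<lambda>n. C * \<bar>gt t n - t\<bar> powr \<alpha>) \<longlonglongrightarrow> 0" if "t \<in> {a..b}" for t C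
  proof -
    have "(\<lambda>n. \<bar>gt t n - t\<bar> powr \<alpha>) \<longlonglongrightarrow> 0"
      using alpha gt_lim[OF that]
      by (intro tendsto_zero_powrI[where b=\<alpha>] tendsto_rabs_zero LIM_zero tendsto_const) auto
    from tendsto_mult_right_zero[OF this, of C] show ?thesis by (simp add: mult.commute)
  qed
  have ylim: "(\<lambda>n. y (k n) (gt t n)) \<longlonglongrightarrow> w t" if t: "t \<in> {a..b}" for t
  proof -
    have "(\<lambda>n. y (k n) (gt t n) - y (k n) t) \<longlonglongrightarrow> 0"
      by (rule Lim_null_comparison[OF _ gt_pow[OF t, of ?M]])
        (use y_holder'[OF t gt_in[OF t]] in auto)
    from tendsto_add[OF this lim[OF t]] show ?thesis by simp
  qed
  have xlim: "(\<lambda>n. x (gt t n)) \<longlonglongrightarrow> x t" if t: "t \<in> {a..b}" for t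
    by (rule LIM_zero_cancel, rule Lim_null_comparison[OF _ gt_pow[OF t, of K]])
      (use x[OF t gt_in[OF t]] in auto)
  have Hlim: "(\<lambda>n. H (gt s n) (y (k n) (gt s n)) (x (gt t n) - x (gt s n))) \<longlonglongrightarrow> H s (w s) (x t - x s)"
    if s: "s \<in> {a..b}" and t: "t \<in> {a..b}" for s t
  proof (rule LIM_zero_cancel, rule Lim_null_comparison)
    let ?v = "\<lambda>n. x (gt t n) - x (gt s n)"
    have yb: "y (k n) (gt s n) \<in> cball z0 r" for n
      unfolding gt_def using y_g[of "cell (k n) s" "k n"] cell(1)[OF s] Y_ball by simp
    show "\<forall>\<^sub>F n in sequentially. norm (H (gt s n) (y (k n) (gt s n)) (?v n) - H s (w s) (x t - x s))
        \<le> K * (\<bar>gt s n - s\<bar> powr \<alpha> + norm (y (k n) (gt s n) - w s)) * norm (?v n)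
          + K * norm (?v n - (x t - x s))"
    proof (rule always_eventually, rule allI)
      fix n
      have "H (gt s n) (y (k n) (gt s n)) (?v n) - H s (w s) (x t - x s) =
          (H (gt s n) (y (k n) (gt s n)) (?v n) - H s (w s) (?v n)) + H s (w s) (?v n - (x t - x s))"
        using linear_diff[OF Hlin[OF s wball[OF s]]] by simp
      also have "norm \<dots> \<le> K * (\<bar>gt s n - s\<bar> powr \<alpha> + norm (y (k n) (gt s n) - w s)) * norm (?v n)
          + K * norm (?v n - (x t - x s))"
        by (intro norm_triangle_le add_mono HLip Hbd s wball gt_in yb)
      finally show "norm (H (gt s n) (y (k n) (gt s n)) (?v n) - H s (w s) (x t - x s)) \<le> \<dots>" .
    qed
    have "(\<lambda>n. K * (\<bar>gt s n - s\<bar> powr \<alpha> + norm (y (k n) (gt s n) - w s)) * norm (?v n)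
          + K * norm (?v n - (x t - x s))) \<longlonglongrightarrow> K * (0 + norm (w s - w s)) * norm (x t - x s)
          + K * norm (x t - x s - (x t - x s))"
      using gt_pow[OF s, of 1] by (intro tendsto_intros ylim xlim s t) simp
    then show "(\<lambda>n. K * (\<bar>gt s n - s\<bar> powr \<alpha> + norm (y (k n) (gt s n) - w s)) * norm (?v n)
          + K * norm (?v n - (x t - x s))) \<longlonglongrightarrow> 0" by simp
  qed
  have ord: "norm (w t - w s - H s (w s) (x t - x s)) \<le> L * (t - s) powr (2 * \<alpha>)"
    if s: "s \<in> {a..b}" and t: "t \<in> {a..b}" and st: "s \<le> t" for s t
  proof (rule tendsto_le[OF _ _ tendsto_norm[OF tendsto_diff[OF tendsto_diff[OF ylim[OF t] ylim[OF s]] Hlim[OF s t]]]])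
    have le: "gt s n \<le> gt t n" for n unfolding gt_def using g_mono cell_mono st by blast
    show "(\<lambda>n. L * (gt t n - gt s n) powr (2 * \<alpha>)) \<longlonglongrightarrow> L * (t - s) powr (2 * \<alpha>)"
      using alpha le by (intro tendsto_mult tendsto_const tendsto_powr2 tendsto_diff gt_lim s t) auto
    have "norm (y (k n) (gt t n) - y (k n) (gt s n) - H (gt s n) (y (k n) (gt s n)) (x (gt t n) - x (gt s n)))
        \<le> L * (gt t n - gt s n) powr (2 * \<alpha>)" for n
      using R_increment[of "cell (k n) s" "cell (k n) t" "k n"] cell(1)[OF s, of "k n"] cell(1)[OF t, of "k n"]
        cell_mono[OF st, of "k n"] by (simp add: R_def gt_def y_g)
    then show "\<forall>\<^sub>F n in sequentially. norm (y (k n) (gt t n) - y (k n) (gt s n)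
        - H (gt s n) (y (k n) (gt s n)) (x (gt t n) - x (gt s n))) \<le> L * (gt t n - gt s n) powr (2 * \<alpha>)"
      by simp
  qed auto
  \<comment> \<open>The limit of the error bound covers s \<le> t. For t < s the coefficient is
    moved from t to s, at the cost of its variation along the solution, which is K * (1 + ?M) * K in
    units of order 2 * \<alpha>.\<close>
  define C where "C = L + K * (1 + ?M) * K + ?M"
  have C: "?M \<le> C" "L \<le> C" "L + K * (1 + ?M) * K \<le> C"
    using M L(1) K by (auto simp: C_def)
  have "norm (w t - w s - H s (w s) (x t - x s)) \<le> C * \<bar>t - s\<bar> powr (2 * \<alpha>)"
    if s: "s \<in> {a..b}" and t: "t \<in> {a..b}" for s t
  proof (cases "s \<le> t")
    case True
    then show ?thesis using order_trans[OF ord[OF s t True] mult_right_mono[OF C(2)]] by simp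
  next
    case False
    let ?A = "\<bar>t - s\<bar> powr \<alpha>"
    have pw: "\<bar>t - s\<bar> powr (2 * \<alpha>) = ?A * ?A" by (simp flip: powr_add)
    have 1: "norm (w s - w t - H t (w t) (x s - x t)) \<le> L * \<bar>t - s\<bar> powr (2 * \<alpha>)"
      using ord[OF t s] False by simp
    have "norm (H t (w t) (x t - x s) - H s (w s) (x t - x s))
        \<le> K * (\<bar>t - s\<bar> powr \<alpha> + norm (w t - w s)) * norm (x t - x s)"
      using s t wball by (intro HLip)
    also have "\<dots> \<le> K * (?A + ?M * ?A) * (K * ?A)"
      using wH[OF s t] x[OF s t] K by (intro mult_mono mult_left_mono add_mono) auto
    also have "\<dots> = K * (1 + ?M) * K * \<bar>t - s\<bar> powr (2 * \<alpha>)" unfolding pw by (simp add: algebra_simps)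
    finally have 2: "norm (H t (w t) (x t - x s) - H s (w s) (x t - x s)) \<le> K * (1 + ?M) * K * \<bar>t - s\<bar> powr (2 * \<alpha>)" .
    have "H t (w t) (x s - x t) = - H t (w t) (x t - x s)"
      using linear_neg[OF Hlin[OF t wball[OF t]], of "x t - x s"] by simp
    then have "w t - w s - H s (w s) (x t - x s) =
        - (w s - w t - H t (w t) (x s - x t)) + (H t (w t) (x t - x s) - H s (w s) (x t - x s))"
      by simp
    then have "norm (w t - w s - H s (w s) (x t - x s)) \<le> L * \<bar>t - s\<bar> powr (2 * \<alpha>) + K * (1 + ?M) * K * \<bar>t - s\<bar> powr (2 * \<alpha>)"
      using 1 2 norm_triangle_le by (metis (no_types, lifting) add_mono norm_minus_cancel)
    also have "\<dots> = (L + K * (1 + ?M) * K) * \<bar>t - s\<bar> powr (2 * \<alpha>)" by (simp add: algebra_simps)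
    also have "\<dots> \<le> C * \<bar>t - s\<bar> powr (2 * \<alpha>)" using C(3) by (intro mult_right_mono) auto
    finally show ?thesis .
  qed
  moreover have "norm (w t - w s) \<le> C * \<bar>t - s\<bar> powr \<alpha>" if "s \<in> {a..b}" "t \<in> {a..b}" for s t
    using order_trans[OF wH[OF that] mult_right_mono[OF C(1)]] by simp
  ultimately show ?thesis using wa wball by blast
qed

end

text \<open>The order of the quantifiers is the point: \<delta> is chosen before the equation, its
  driver, the interval and the initial value. It can thus be used for all intervals around a given
  time.\<close>

lemma davie_exists:
  fixes z0 :: "'k::finite_dim_normed"
  assumes alpha: "1/2 < \<alpha>" "\<alpha> \<le> 1" and K: "K \<ge> 0" and r: "r > 0"
  shows "\<exists>\<delta>>0. \<forall>(H :: real \<Rightarrow> 'k \<Rightarrow> 'v::real_normed_vector \<Rightarrow> 'k) x a b z1.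
    a \<le> b \<longrightarrow> b - a < \<delta> \<longrightarrow> norm (z1 - z0) \<le> r / 2 \<longrightarrow>
    (\<forall>s\<in>{a..b}. \<forall>t\<in>{a..b}. norm (x t - x s) \<le> K * \<bar>t - s\<bar> powr \<alpha>) \<longrightarrow>
    (\<forall>s\<in>{a..b}. \<forall>z\<in>cball z0 r. linear (H s z) \<and> (\<forall>v. norm (H s z v) \<le> K * norm v)) \<longrightarrow>
    (\<forall>s\<in>{a..b}. \<forall>u\<in>{a..b}. \<forall>z\<in>cball z0 r. \<forall>w\<in>cball z0 r. \<forall>v.
      norm (H u w v - H s z v) \<le> K * (\<bar>u - s\<bar> powr \<alpha> + norm (w - z)) * norm v) \<longrightarrow>
    (\<exists>w. w a = z1 \<and> (\<forall>t\<in>{a..b}. w t \<in> cball z0 r) \<and> (\<exists>C. \<forall>s\<in>{a..b}. \<forall>t\<in>{a..b}.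
       norm (w t - w s) \<le> C * \<bar>t - s\<bar> powr \<alpha> \<and>
       norm (w t - w s - H s (w s) (x t - x s)) \<le> C * \<bar>t - s\<bar> powr (2 * \<alpha>)))"
proof -
  \<comment> \<open>Two halves cost a factor 2 and gain 2 powr (- 2 * \<alpha>). As 2 * \<alpha> >
    1, the product q is below 1, and L is the fixed point of q * L + 2 * (K * K * (K * K + 2)), as
    the locale demands.\<close>
  define q where "q = 2 powr (1 - 2 * \<alpha>)"
  have q: "q < 1" unfolding q_def using powr_less_mono[of "1 - 2 * \<alpha>" 0 2] alpha by simp
  define L where "L = 2 * (K * K * (K * K + 2)) / (1 - q)"
  have L0: "L \<ge> 0" unfolding L_def using q by (intro divide_nonneg_pos mult_nonneg_nonneg add_nonneg_nonneg) (auto simp: K)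
  have "(1 - q) * L = 2 * (K * K * (K * K + 2))" unfolding L_def using q by simp
  with L0 have L: "L \<ge> 0" "q * L + 2 * (K * K * (K * K + 2)) \<le> L"
    by (auto simp: left_diff_distrib)
  obtain \<delta>1 where \<delta>1: "\<delta>1 > 0" "L * \<delta>1 powr \<alpha> < 1"
    using small_powr[of \<alpha> 1 L 1] L alpha by auto
  obtain \<delta>2 where \<delta>2: "\<delta>2 > 0" "(3 * (K * K) + 1) * \<delta>2 powr \<alpha> < r / 2"
    using small_powr[of \<alpha> "r / 2" "3 * (K * K) + 1" 1] r alpha by auto
  show ?thesis
  proof (intro exI[of _ "min \<delta>1 \<delta>2"] conjI allI impI)
    fix H :: "real \<Rightarrow> 'k \<Rightarrow> 'v \<Rightarrow> 'k" and x :: "real \<Rightarrow> 'v" and a b z1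
    assume A: "a \<le> b" "b - a < min \<delta>1 \<delta>2" "norm (z1 - z0) \<le> r / 2"
      "\<forall>s\<in>{a..b}. \<forall>t\<in>{a..b}. norm (x t - x s) \<le> K * \<bar>t - s\<bar> powr \<alpha>"
      "\<forall>s\<in>{a..b}. \<forall>z\<in>cball z0 r. linear (H s z) \<and> (\<forall>v. norm (H s z v) \<le> K * norm v)"
      "\<forall>s\<in>{a..b}. \<forall>u\<in>{a..b}. \<forall>z\<in>cball z0 r. \<forall>w\<in>cball z0 r. \<forall>v.
      norm (H u w v - H s z v) \<le> K * (\<bar>u - s\<bar> powr \<alpha> + norm (w - z)) * norm v"
    show "\<exists>w. w a = z1 \<and> (\<forall>t\<in>{a..b}. w t \<in> cball z0 r) \<and> (\<exists>C. \<forall>s\<in>{a..b}. \<forall>t\<in>{a..b}.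
       norm (w t - w s) \<le> C * \<bar>t - s\<bar> powr \<alpha> \<and>
       norm (w t - w s - H s (w s) (x t - x s)) \<le> C * \<bar>t - s\<bar> powr (2 * \<alpha>))"
    \<comment> \<open>The grid of the locale needs a < b; on a single point the constant path is a
      solution.\<close>
    proof (cases "a = b")
      case True
      have "norm (z1 - z0) \<le> r" using A(3) r by linarith
      moreover have "linear (H b z1)"
        using A(5) True calculation by (auto simp: dist_norm norm_minus_commute)
      ultimately show ?thesis using True linear_0[of "H b z1"]
        by (intro exI[of _ "\<lambda>_. z1"]) (auto simp: dist_norm norm_minus_commute)
    next
      case False
      have "L * (b - a) powr \<alpha> \<le> L * \<delta>1 powr \<alpha>"
        using A L alpha by (intro mult_left_mono powr_mono2) auto
      moreover have "(3 * (K * K) + 1) * (b - a) powr \<alpha> \<le> (3 * (K * K) + 1) * \<delta>2 powr \<alpha>"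
        using A alpha by (intro mult_left_mono powr_mono2) auto
      ultimately have small: "L * (b - a) powr \<alpha> \<le> 1" "(3 * (K * K) + 1) * (b - a) powr \<alpha> \<le> r / 2"
        using \<delta>1 \<delta>2 by linarith+
      interpret davie H x a b K L r \<alpha> z0 z1
      proof (rule davie.intro)
        show "a < b" using A(1) False by linarith
        show "2 powr (1 - 2 * \<alpha>) * L + 2 * (K * K * (K * K + 2)) \<le> L" using L unfolding q_def by blast
      qed ((use A(3) alpha K L small in blast) | (use A(4) in blast) | (use A(5) in blast) | (use A(6) in blast))+
      show ?thesis by (rule solution)
    qed
  qed (use \<delta>1 \<delta>2 in auto)
qed

section \<open>Charts and tangent vectors\<close>

context
  fixes A :: "('a::t2_space, 'e::finite_dim_normed) chart set"
  assumes A: "smooth_atlas A"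
begin

lemma chart_cover: "\<exists>c\<in>A. p \<in> fst c"
  using A unfolding smooth_atlas_def by (metis UN_E UNIV_I)

lemma chart_open: "c \<in> A \<Longrightarrow> open (fst c)" "c \<in> A \<Longrightarrow> open (snd c ` fst c)"
  and chart_homeo: "c \<in> A \<Longrightarrow> homeomorphism (fst c) (snd c ` fst c) (snd c) (inv_chart c)"
  and transition_smooth: "c \<in> A \<Longrightarrow> d \<in> A \<Longrightarrow>
    smooth_on (snd c ` (fst c \<inter> fst d)) (\<lambda>z. snd d (inv_chart c z))"
  using A unfolding smooth_atlas_def by blast+

lemma chart_inv: "c \<in> A \<Longrightarrow> p \<in> fst c \<Longrightarrow> inv_chart c (snd c p) = p"
  using chart_homeo homeomorphism_apply1 by metis

lemma chart_cont: "c \<in> A \<Longrightarrow> continuous_on (fst c) (snd c)"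
  and chart_inv_cont: "c \<in> A \<Longrightarrow> continuous_on (snd c ` fst c) (inv_chart c)"
  using chart_homeo homeomorphism_cont1 homeomorphism_cont2 by blast+

lemma chart_inj: "c \<in> A \<Longrightarrow> inj_on (snd c) (fst c)"
  using chart_inv by (metis inj_onI)

lemma chart_image_open: "c \<in> A \<Longrightarrow> open W \<Longrightarrow> open (snd c ` (fst c \<inter> W))"
  using homeomorphism_imp_open_map[OF chart_homeo, of c "fst c \<inter> W"] chart_open
  by (simp add: openin_open_eq open_Int)

lemma chart_preimage_open: "c \<in> A \<Longrightarrow> open V \<Longrightarrow> open (fst c \<inter> snd c -` V)"
  using continuous_open_preimage[OF chart_cont chart_open(1)] by blast

lemma smooth_near_chart:
  assumes "smooth_near A p f" "c \<in> A" "p \<in> fst c"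
  shows "((\<lambda>z. f (inv_chart c z)) has_derivative (\<lambda>v. coord_vec A c p v f)) (at (snd c p))"
proof -
  obtain W where W: "open W" "p \<in> W" "smooth_on (snd c ` (fst c \<inter> W)) (\<lambda>z. f (inv_chart c z))"
    using assms unfolding smooth_near_def by blast
  have "(\<lambda>v. coord_vec A c p v f) = frechet_derivative (\<lambda>z. f (inv_chart c z)) (at (snd c p))"
    using assms(1) by (simp add: coord_vec_def)
  then show ?thesis
    using smooth_on_has_derivative[OF W(3), of "snd c p"] W(2) assms(3) by simp
qed

lemma coord_vec_not_smooth: "\<not> smooth_near A p f \<Longrightarrow> coord_vec A c p v f = 0"
  by (simp add: coord_vec_def)

lemma linear_coord_vec: "c \<in> A \<Longrightarrow> p \<in> fst c \<Longrightarrow> linear (\<lambda>v. coord_vec A c p v f)"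
  using has_derivative_linear[OF smooth_near_chart[of p f c]] coord_vec_not_smooth[of p f c]
    linear_zero by (cases "smooth_near A p f") auto

lemma coord_vec_in: "c \<in> A \<Longrightarrow> p \<in> fst c \<Longrightarrow> coord_vec A c p v \<in> tangent_space A p"
  unfolding tangent_space_def by blast

lemma coord_vec_add:
  "c \<in> A \<Longrightarrow> p \<in> fst c \<Longrightarrow> (\<lambda>f. coord_vec A c p v f + coord_vec A c p w f) = coord_vec A c p (v + w)"
  using linear_add[OF linear_coord_vec] by fastforce

lemma coord_vec_scale:
  "c \<in> A \<Longrightarrow> p \<in> fst c \<Longrightarrow> (\<lambda>f. r * coord_vec A c p v f) = coord_vec A c p (r *\<^sub>R v)"
  using linear_scale[OF linear_coord_vec] by fastforce

lemma coord_vec_zero: "c \<in> A \<Longrightarrow> p \<in> fst c \<Longrightarrow> coord_vec A c p 0 = (\<lambda>_. 0)"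
  using linear_0[OF linear_coord_vec] by fastforce

lemma smooth_near_linear:
  assumes "c \<in> A" "p \<in> fst c" "bounded_linear l"
  shows "smooth_near A p (\<lambda>q. l (snd c q) :: real)"
  unfolding smooth_near_def
proof (intro exI[of _ "fst c"] conjI ballI)
  fix d assume d: "d \<in> A"
  show "smooth_on (snd d ` (fst d \<inter> fst c)) (\<lambda>z. l (snd c (inv_chart d z)))"
    by (rule smooth_on_linear[OF assms(3) chart_image_open[OF d chart_open(1)[OF assms(1)]]
          transition_smooth[OF d assms(1)]])
qed (use assms chart_open in auto)

lemma coord_vec_linear:
  assumes "c \<in> A" "p \<in> fst c" "bounded_linear l"
  shows "coord_vec A c p v (\<lambda>q. l (snd c q)) = l v"
proof -
  have "(l has_derivative l) (at (snd c p))"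
    using assms(3) by (rule bounded_linear_imp_has_derivative)
  then have "((\<lambda>z. l (snd c (inv_chart c z))) has_derivative l) (at (snd c p))"
    using assms f_inv_into_f[of _ "snd c" "fst c"]
    by (subst has_derivative_cong_open[OF chart_open(2)[OF assms(1)]]) auto
  from has_derivative_unique[OF smooth_near_chart[OF smooth_near_linear[OF assms] assms(1,2)] this]
  show ?thesis by metis
qed

text \<open>The coordinates of a tangent vector, obtained by applying it to the coordinate functions
  of the chart. This inverts \<open>coord_vec\<close> at every point of the chart, and so takes no
  base point.\<close>

definition cvec :: "('a, 'e) chart \<Rightarrow> 'a tangent \<Rightarrow> 'e" where
  "cvec c X = (\<Sum>i\<in>coord_basis. X (\<lambda>q. crd (snd c q) i) *\<^sub>R i)"

lemma cvec_coord_vec: "c \<in> A \<Longrightarrow> p \<in> fst c \<Longrightarrow> cvec c (coord_vec A c p v) = v"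
  unfolding cvec_def by (simp add: coord_vec_linear[OF _ _ bounded_linear_crd] crd_expand)

lemma smooth_near_chain:
  assumes "c \<in> A" "p \<in> fst c" "smooth_near A p f" "\<zeta> x0 = snd c p" "(\<zeta> has_derivative D) (at x0)"
  shows "((\<lambda>x. f (inv_chart c (\<zeta> x))) has_derivative (\<lambda>h. coord_vec A c p (D h) f)) (at x0)"
  using has_derivative_compose[OF assms(5), of "\<lambda>z. f (inv_chart c z)"] smooth_near_chart[OF assms(3,1,2)] assms(4)
  by simp

text \<open>On test functions that are smooth near p this is the chain rule through the chart d; on
  all others both sides are 0.\<close>

lemma coord_vec_transition:
  assumes "c \<in> A" "d \<in> A" "p \<in> fst c" "p \<in> fst d"
  shows "coord_vec A c p v = coord_vec A d p (frechet_derivative (\<lambda>z. snd d (inv_chart c z)) (at (snd c p)) v)"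
proof (rule ext)
  fix f
  let ?\<phi> = "\<lambda>z. snd d (inv_chart c z)" and ?S = "snd c ` (fst c \<inter> fst d)"
  show "coord_vec A c p v f = coord_vec A d p (frechet_derivative ?\<phi> (at (snd c p)) v) f"
  proof (cases "smooth_near A p f")
    case True
    have S: "open ?S" "snd c p \<in> ?S" using assms chart_image_open chart_open by auto
    have "(?\<phi> has_derivative frechet_derivative ?\<phi> (at (snd c p))) (at (snd c p))"
      using smooth_on_has_derivative[OF transition_smooth[OF assms(1,2)] S(2)] .
    from smooth_near_chain[OF assms(2,4) True _ this]
    have "((\<lambda>z. f (inv_chart d (?\<phi> z))) has_derivative
        (\<lambda>h. coord_vec A d p (frechet_derivative ?\<phi> (at (snd c p)) h) f)) (at (snd c p))"
      using assms chart_inv by auto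
    then have "((\<lambda>z. f (inv_chart c z)) has_derivative
        (\<lambda>h. coord_vec A d p (frechet_derivative ?\<phi> (at (snd c p)) h) f)) (at (snd c p))"
      using assms chart_inv by (subst has_derivative_cong_open[OF S]) auto
    from has_derivative_unique[OF smooth_near_chart[OF True assms(1,3)] this] show ?thesis by metis
  qed (simp add: coord_vec_not_smooth)
qed

lemma tangent_space_coord_vec:
  assumes "X \<in> tangent_space A p" "c \<in> A" "p \<in> fst c"
  shows "X = coord_vec A c p (cvec c X)"
proof -
  obtain d v where d: "X = coord_vec A d p v" "d \<in> A" "p \<in> fst d"
    using assms(1) unfolding tangent_space_def by blast
  then obtain w where "X = coord_vec A c p w" using coord_vec_transition assms by blast
  then show ?thesis using cvec_coord_vec assms by metis
qed

lemma tangent_not_smooth: "X \<in> tangent_space A p \<Longrightarrow> \<not> smooth_near A p f \<Longrightarrow> X f = 0"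
  unfolding tangent_space_def using coord_vec_not_smooth by blast

lemma tangent_scale: "X \<in> tangent_space A p \<Longrightarrow> (\<lambda>f. r * X f) \<in> tangent_space A p"
  unfolding tangent_space_def using coord_vec_scale by blast

lemma zero_tangent: "(\<lambda>_. 0) \<in> tangent_space A p"
  using chart_cover[of p] coord_vec_zero coord_vec_in by metis

section \<open>Velocities\<close>

text \<open>The coordinate map has arbitrary values off its domain, so a derivative of the
  coordinates alone does not keep the curve in the chart. Continuity does.\<close>

lemma has_velocity_chart:
  assumes "c \<in> A" "\<gamma> t \<in> fst c" "isCont \<gamma> t"
    and "((\<lambda>s. snd c (\<gamma> s)) has_vector_derivative w) (at t)"
  shows "has_velocity A \<gamma> (coord_vec A c (\<gamma> t) w) t"
  unfolding has_velocity_def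
proof (intro conjI allI impI)
  show "coord_vec A c (\<gamma> t) w \<in> tangent_space A (\<gamma> t)" using assms coord_vec_in by blast
  fix f assume f: "smooth_near A (\<gamma> t) f"
  have ev: "\<forall>\<^sub>F s in nhds t. \<gamma> s \<in> fst c"
    using assms(3) chart_open(1)[OF assms(1)] assms(2) topological_tendstoD[of \<gamma> "\<gamma> t" "at t"]
    by (auto simp: isCont_def eventually_nhds_conv_at)
  have "((\<lambda>s. f (inv_chart c (snd c (\<gamma> s)))) has_derivative (\<lambda>h. coord_vec A c (\<gamma> t) (h *\<^sub>R w) f)) (at t)"
    using assms f by (intro smooth_near_chain) (auto simp: has_vector_derivative_def)
  moreover have "coord_vec A c (\<gamma> t) (h *\<^sub>R w) f = coord_vec A c (\<gamma> t) w f * h" for h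
    using linear_scale[OF linear_coord_vec[OF assms(1,2)]] by simp
  ultimately have "((\<lambda>s. f (inv_chart c (snd c (\<gamma> s)))) has_real_derivative coord_vec A c (\<gamma> t) w f) (at t)"
    by (simp add: has_field_derivative_def)
  moreover have "\<forall>\<^sub>F s in nhds t. f (inv_chart c (snd c (\<gamma> s))) = f (\<gamma> s)"
    using ev by eventually_elim (simp add: chart_inv assms)
  ultimately show "((\<lambda>s. f (\<gamma> s)) has_real_derivative coord_vec A c (\<gamma> t) w f) (at t)"
    by (subst DERIV_cong_ev[OF refl _ refl, symmetric])
qed

lemma has_velocity_unique:
  assumes "has_velocity A \<gamma> X t" "has_velocity A \<gamma> Y t" shows "X = Y"
proof
  fix f show "X f = Y f"
    using assms DERIV_unique[of "\<lambda>s. f (\<gamma> s)" "X f" t "Y f"] tangent_not_smooth[of X "\<gamma> t" f]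
      tangent_not_smooth[of Y "\<gamma> t" f]
    unfolding has_velocity_def by (cases "smooth_near A (\<gamma> t) f") auto
qed

lemma velocity_eq: "has_velocity A \<gamma> X t \<Longrightarrow> velocity A \<gamma> t = X"
  unfolding velocity_def using has_velocity_unique by blast

lemma has_velocity_isCont:
  assumes "has_velocity A \<gamma> X t" shows "isCont \<gamma> t"
  unfolding isCont_def
proof (rule topological_tendstoI)
  fix W assume W: "open W" "\<gamma> t \<in> W"
  define f where "f q = (if q \<in> W then 0 else 1 :: real)" for q
  have "smooth_on (snd c ` (fst c \<inter> W)) (\<lambda>z. f (inv_chart c z))" if "c \<in> A" for c
  proof (subst smooth_on_cong[OF chart_image_open[OF that W(1)]])
    show "f (inv_chart c z) = 0" if "z \<in> snd c ` (fst c \<inter> W)" for z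
      using that chart_inv[OF \<open>c \<in> A\<close>] by (auto simp: f_def)
  qed (rule smooth_on_const[OF chart_image_open[OF that W(1)]])
  then have "smooth_near A (\<gamma> t) f" unfolding smooth_near_def using W by blast
  then have "((\<lambda>s. f (\<gamma> s)) has_real_derivative X f) (at t)" using assms unfolding has_velocity_def by blast
  then have "((\<lambda>s. f (\<gamma> s)) \<longlongrightarrow> f (\<gamma> t)) (at t)" using DERIV_isCont isCont_def by blast
  then have "\<forall>\<^sub>F s in at t. f (\<gamma> s) < 1"
    by (rule order_tendstoD) (use W in \<open>simp add: f_def\<close>)
  then show "\<forall>\<^sub>F s in at t. \<gamma> s \<in> W"
    by eventually_elim (simp add: f_def split: if_splits)
qed

lemma has_velocity_derivative:
  assumes "has_velocity A \<gamma> X t" "c \<in> A" "\<gamma> t \<in> fst c"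
  shows "((\<lambda>s. snd c (\<gamma> s)) has_vector_derivative cvec c X) (at t)"
proof -
  have "((\<lambda>s. crd (snd c (\<gamma> s)) i) has_real_derivative X (\<lambda>q. crd (snd c q) i)) (at t)" for i
    using assms smooth_near_linear[OF assms(2,3) bounded_linear_crd] unfolding has_velocity_def by blast
  then have "((\<lambda>s. \<Sum>i\<in>coord_basis. crd (snd c (\<gamma> s)) i *\<^sub>R i) has_vector_derivative
      (\<Sum>i\<in>coord_basis. X (\<lambda>q. crd (snd c q) i) *\<^sub>R i)) (at t)"
    by (intro has_vector_derivative_sum has_vector_derivative_scaleR[where g'=0, simplified])
      (auto intro: has_vector_derivative_const)
  then show ?thesis by (simp only: crd_expand cvec_def)
qed

lemma has_velocity_affine:
  assumes "has_velocity A \<gamma> X (k * t + b)"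
  shows "has_velocity A (\<lambda>t. \<gamma> (k * t + b)) (\<lambda>f. k * X f) t"
  unfolding has_velocity_def
proof (intro conjI allI impI)
  show "(\<lambda>f. k * X f) \<in> tangent_space A (\<gamma> (k * t + b))"
    using assms unfolding has_velocity_def by (intro tangent_scale) blast
  fix f assume "smooth_near A (\<gamma> (k * t + b)) f"
  then have "((\<lambda>s. f (\<gamma> s)) has_real_derivative X f) (at (k * t + b))"
    using assms unfolding has_velocity_def by blast
  moreover have "((\<lambda>t. k * t + b) has_real_derivative k) (at t)"
    by (auto intro!: derivative_eq_intros)
  ultimately have "((\<lambda>s. f (\<gamma> (k * s + b))) has_real_derivative X f * k) (at t)"
    by (rule DERIV_chain2[where f="\<lambda>s. f (\<gamma> s)" and g="\<lambda>t. k * t + b"])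
  then show "((\<lambda>s. f (\<gamma> (k * s + b))) has_real_derivative k * X f) (at t)"
    by (simp only: mult.commute)
qed

lemma has_velocity_cong:
  assumes "has_velocity A \<gamma> X t" "\<forall>\<^sub>F s in nhds t. \<gamma> s = \<gamma>' s"
  shows "has_velocity A \<gamma>' X t"
proof -
  have t: "\<gamma>' t = \<gamma> t" using eventually_nhds_x_imp_x[OF assms(2)] by simp
  have "((\<lambda>s. f (\<gamma>' s)) has_real_derivative D) (at t)"
    if "((\<lambda>s. f (\<gamma> s)) has_real_derivative D) (at t)" for f D
    using that by (subst DERIV_cong_ev[OF refl eventually_mono[OF assms(2)] refl, symmetric]) auto
  then show ?thesis using assms(1) unfolding has_velocity_def t by blast
qed

end

section \<open>Smooth maps in charts\<close>

lemma smooth_map_chart: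
  fixes A :: "('a::t2_space, 'e::finite_dim_normed) chart set"
    and B :: "('b::t2_space, 'f::finite_dim_normed) chart set"
  assumes "smooth_atlas A" "smooth_map_on W A B F" "c \<in> A" "d \<in> B" "open (fst d)"
  shows "open (snd c ` (fst c \<inter> W \<inter> F -` fst d))"
    and "smooth_on (snd c ` (fst c \<inter> W \<inter> F -` fst d)) (\<lambda>z. snd d (F (inv_chart c z)))"
proof -
  have "open (W \<inter> F -` fst d)"
    using assms unfolding smooth_map_on_def by (intro continuous_open_preimage) auto
  then show "open (snd c ` (fst c \<inter> W \<inter> F -` fst d))"
    using chart_image_open[OF assms(1,3)] by (simp add: Int_assoc)
  show "smooth_on (snd c ` (fst c \<inter> W \<inter> F -` fst d)) (\<lambda>z. snd d (F (inv_chart c z)))"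
    using assms unfolding smooth_map_on_def by blast
qed

text \<open>The neighbourhood is shrunk until F maps it into the chart d and into the set on which
  the test function is smooth. Then f o F is a test function at p, and the chain rule applies. All
  charts c' occur since \<open>smooth_near\<close> ranges over the whole atlas.\<close>

lemma differential_coord_vec:
  fixes A :: "('a::t2_space, 'e::finite_dim_normed) chart set"
    and B :: "('b::t2_space, 'f::finite_dim_normed) chart set"
  assumes A: "smooth_atlas A" and B: "smooth_atlas B"
    and W: "open W" "continuous_on W F" "p \<in> W"
    and c: "c \<in> A" "p \<in> fst c" and d: "d \<in> B" "F p \<in> fst d"
    and sm: "\<And>c'. c' \<in> A \<Longrightarrow> smooth_on (snd c' ` (fst c' \<inter> W \<inter> F -` fst d)) (\<lambda>z. snd d (F (inv_chart c' z)))"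
    and D: "((\<lambda>z. snd d (F (inv_chart c z))) has_derivative D) (at (snd c p))"
  shows "differential A B F p (coord_vec A c p v) = coord_vec B d (F p) (D v)"
proof
  fix f
  show "differential A B F p (coord_vec A c p v) f = coord_vec B d (F p) (D v) f"
  proof (cases "smooth_near B (F p) f")
    case False
    then show ?thesis using coord_vec_not_smooth[OF B] by (simp add: differential_def)
  next
    case True
    obtain Wf where Wf: "open Wf" "F p \<in> Wf" "smooth_on (snd d ` (fst d \<inter> Wf)) (\<lambda>z. f (inv_chart d z))"
      using True d unfolding smooth_near_def by blast
    let ?W = "W \<inter> F -` (fst d \<inter> Wf)"
    have oW: "open ?W"
      using W(1,2) Wf(1) chart_open(1)[OF B d(1)] by (intro continuous_open_preimage open_Int) auto
    have "smooth_on (snd c' ` (fst c' \<inter> ?W)) (\<lambda>z. f (F (inv_chart c' z)))" if c': "c' \<in> A" for c'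
    proof -
      let ?S = "snd c' ` (fst c' \<inter> ?W)"
      have S: "open ?S" using chart_image_open[OF A c' oW] .
      have "smooth_on ?S (\<lambda>z. snd d (F (inv_chart c' z)))"
        by (rule smooth_on_subset[OF sm[OF c']]) blast
      then have "smooth_on ?S (\<lambda>z. f (inv_chart d (snd d (F (inv_chart c' z)))))"
        using S chart_image_open[OF B d(1) Wf(1)] Wf(3)
        by (rule_tac smooth_on_comp[of ?S "snd d ` (fst d \<inter> Wf)"]) (auto simp: chart_inv[OF A c'])
      then show ?thesis
        by (subst smooth_on_cong[OF S]) (auto simp: chart_inv[OF A c'] chart_inv[OF B d(1)])
    qed
    then have smFf: "smooth_near A p (\<lambda>q. f (F q))"
      unfolding smooth_near_def using oW W(3) d(2) Wf(2) by (intro exI[of _ ?W]) auto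
    have op: "open (snd c ` (fst c \<inter> ?W))" "snd c p \<in> snd c ` (fst c \<inter> ?W)"
      using chart_image_open[OF A c(1) oW] W(3) d(2) Wf(2) c(2) by auto
    have "((\<lambda>z. f (inv_chart d (snd d (F (inv_chart c z))))) has_derivative (\<lambda>h. coord_vec B d (F p) (D h) f)) (at (snd c p))"
      using chart_inv[OF A c] by (intro smooth_near_chain[OF B d True] D) simp
    then have "((\<lambda>z. f (F (inv_chart c z))) has_derivative (\<lambda>h. coord_vec B d (F p) (D h) f)) (at (snd c p))"
      by (subst has_derivative_cong_open[OF op]) (auto simp: chart_inv[OF A c(1)] chart_inv[OF B d(1)])
    from has_derivative_unique[OF smooth_near_chart[OF A smFf c] this]
    have "coord_vec A c p v (\<lambda>q. f (F q)) = coord_vec B d (F p) (D v) f" by metis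
    then show ?thesis using True by (simp add: differential_def)
  qed
qed

lemma prod_chart_in: "c \<in> A \<Longrightarrow> d \<in> B \<Longrightarrow> (fst c \<times> fst d, map_prod (snd c) (snd d)) \<in> prod_atlas A B"
  unfolding prod_atlas_def by blast

lemma prod_chart_inv:
  assumes "smooth_atlas A" "smooth_atlas B" "c \<in> A" "d \<in> B" "z \<in> snd c ` fst c" "w \<in> snd d ` fst d"
  shows "inv_into (fst c \<times> fst d) (map_prod (snd c) (snd d)) (z, w) = (inv_chart c z, inv_chart d w)"
proof (rule inv_into_f_eq)
  show "inj_on (map_prod (snd c) (snd d)) (fst c \<times> fst d)"
    using chart_inj[OF assms(1,3)] chart_inj[OF assms(2,4)] by (rule map_prod_inj_on)
  show "(inv_chart c z, inv_chart d w) \<in> fst c \<times> fst d" using assms(5,6) by (auto simp: inv_into_into)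
  show "map_prod (snd c) (snd d) (inv_chart c z, inv_chart d w) = (z, w)"
    using assms(5,6) by (simp add: f_inv_into_f)
qed

text \<open>The coordinates at which F, restricted to W, can be expressed in the charts c, d and
  e.\<close>

definition pair_dom where
  "pair_dom c d e W F = {zw \<in> snd c ` fst c \<times> snd d ` fst d.
     (inv_chart c (fst zw), inv_chart d (snd zw)) \<in> W \<and>
     F (inv_chart c (fst zw), inv_chart d (snd zw)) \<in> fst e}"

text \<open>The inverse of a product chart is an \<open>inv_into\<close> on a product set; here it
  is replaced by the pair of the inverse charts.\<close>

lemma smooth_map_pair:
  fixes A :: "('a::t2_space, 'e::finite_dim_normed) chart set"
    and B :: "('b::t2_space, 'f::finite_dim_normed) chart set"
    and C :: "('c::t2_space, 'h::finite_dim_normed) chart set"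
  assumes A: "smooth_atlas A" and B: "smooth_atlas B" and C: "smooth_atlas C"
    and F: "smooth_map_on W (prod_atlas A B) C F"
    and c: "c \<in> A" and d: "d \<in> B" and e: "e \<in> C"
  shows "open (pair_dom c d e W F)"
    and "smooth_on (pair_dom c d e W F) (\<lambda>zw. snd e (F (inv_chart c (fst zw), inv_chart d (snd zw))))"
proof -
  let ?cd = "(fst c \<times> fst d, map_prod (snd c) (snd d))"
  let ?I = "\<lambda>zw. (inv_chart c (fst zw), inv_chart d (snd zw))"
  have W: "open W" "continuous_on W F" using F unfolding smooth_map_on_def by auto
  have oWF: "open (W \<inter> F -` fst e)"
    using W chart_open(1)[OF C e] by (intro continuous_open_preimage) auto
  have contI: "continuous_on (snd c ` fst c \<times> snd d ` fst d) ?I"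
    by (intro continuous_on_Pair continuous_on_compose2[OF chart_inv_cont[OF A c]]
        continuous_on_compose2[OF chart_inv_cont[OF B d]] continuous_intros) auto
  have "pair_dom c d e W F = (snd c ` fst c \<times> snd d ` fst d) \<inter> ?I -` (W \<inter> F -` fst e)"
    unfolding pair_dom_def by auto
  then show op: "open (pair_dom c d e W F)"
    using continuous_open_preimage[OF contI open_Times[OF chart_open(2)[OF A c] chart_open(2)[OF B d]] oWF] by simp
  have sub: "pair_dom c d e W F \<subseteq> snd ?cd ` (fst ?cd \<inter> W \<inter> F -` fst e)"
  proof
    fix zw assume zw: "zw \<in> pair_dom c d e W F"
    then have "zw = map_prod (snd c) (snd d) (?I zw)" "?I zw \<in> fst c \<times> fst d"
      unfolding pair_dom_def by (auto simp: f_inv_into_f inv_into_into)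
    then show "zw \<in> snd ?cd ` (fst ?cd \<inter> W \<inter> F -` fst e)"
      using zw unfolding pair_dom_def by (intro image_eqI[of _ _ "?I zw"]) auto
  qed
  have "smooth_on (snd ?cd ` (fst ?cd \<inter> W \<inter> F -` fst e)) (\<lambda>z. snd e (F (inv_chart ?cd z)))"
    using F prod_chart_in[OF c d] e unfolding smooth_map_on_def by blast
  from smooth_on_subset[OF this sub]
  have "smooth_on (pair_dom c d e W F) (\<lambda>z. snd e (F (inv_chart ?cd z)))" .
  then show "smooth_on (pair_dom c d e W F) (\<lambda>zw. snd e (F (?I zw)))"
  proof (subst smooth_on_cong[OF op])
    fix zw assume "zw \<in> pair_dom c d e W F"
    then show "snd e (F (?I zw)) = snd e (F (inv_chart ?cd zw))"
      using prod_chart_inv[OF A B c d, of "fst zw" "snd zw"] unfolding pair_dom_def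
      by (simp add: mem_Times_iff)
  qed
qed

section \<open>Hoelder paths and integrals of one-forms\<close>

definition pairs_tends :: "real \<Rightarrow> real set \<Rightarrow> (real \<Rightarrow> 'a::topological_space) \<Rightarrow> 'a \<Rightarrow> bool" where
  "pairs_tends \<tau> I z z0 \<longleftrightarrow>
     (\<forall>V. open V \<longrightarrow> z0 \<in> V \<longrightarrow> (\<forall>\<^sub>F p in pairs \<tau> I. z (fst p) \<in> V \<and> z (snd p) \<in> V))"

lemma pairs_tendsD:
  "pairs_tends \<tau> I z z0 \<Longrightarrow> open V \<Longrightarrow> z0 \<in> V \<Longrightarrow> \<forall>\<^sub>F p in pairs \<tau> I. z (fst p) \<in> V \<and> z (snd p) \<in> V"
  unfolding pairs_tends_def by blast

lemma pairs_tends_ball: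
  assumes "pairs_tends \<tau> I z z0" "r > 0"
  shows "\<forall>\<^sub>F p in pairs \<tau> I. z (fst p) \<in> cball z0 r \<and> z (snd p) \<in> cball z0 r"
  by (rule eventually_mono[OF pairs_tendsD[OF assms(1) open_ball[of z0 r]]]) (use assms in auto)

lemma pairs_tends_chart:
  assumes "smooth_atlas A" "continuous_on I y" "\<tau> \<in> I" "c \<in> A" "y \<tau> \<in> fst c"
  shows "pairs_tends \<tau> I (\<lambda>t. snd c (y t)) (snd c (y \<tau>))"
  unfolding pairs_tends_def
proof (intro allI impI)
  fix V assume "open V" "snd c (y \<tau>) \<in> V"
  then have "\<forall>\<^sub>F p in pairs \<tau> I. y (fst p) \<in> fst c \<inter> snd c -` V \<and> y (snd p) \<in> fst c \<inter> snd c -` V"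
    using assms chart_preimage_open[OF assms(1,4)] by (intro eventually_pairs_continuous) auto
  then show "\<forall>\<^sub>F p in pairs \<tau> I. snd c (y (fst p)) \<in> V \<and> snd c (y (snd p)) \<in> V"
    by eventually_elim auto
qed

lemma pairs_tends_Pair:
  assumes "pairs_tends \<tau> I z z0" "pairs_tends \<tau> I h h0"
  shows "pairs_tends \<tau> I (\<lambda>t. (z t, h t)) (z0, h0)"
  unfolding pairs_tends_def
proof (intro allI impI)
  fix V assume "open V" "(z0, h0) \<in> V"
  then obtain S T where ST: "open S" "open T" "z0 \<in> S" "h0 \<in> T" "S \<times> T \<subseteq> V"
    by (auto elim!: open_prod_elim)
  show "\<forall>\<^sub>F p in pairs \<tau> I. (z (fst p), h (fst p)) \<in> V \<and> (z (snd p), h (snd p)) \<in> V"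
    using pairs_tendsD[OF assms(1) ST(1,3)] pairs_tendsD[OF assms(2) ST(2,4)]
    by eventually_elim (use ST(5) in auto)
qed

text \<open>Locally \<phi> is Lipschitz, which preserves the order \<alpha>. Its linearisation error
  is quadratic, and squaring an increment of order \<alpha> is the origin of the order 2 * \<alpha>
  used throughout.\<close>

lemma germO_smooth:
  fixes \<phi> :: "'e::finite_dim_normed \<Rightarrow> 'f::real_normed_vector"
  assumes S: "open S" "z0 \<in> S" "smooth_on S \<phi>" and z: "pairs_tends \<tau> I z z0"
    and h: "germO \<tau> I \<alpha> (\<lambda>s t. z t - z s)"
  shows "germO \<tau> I \<alpha> (\<lambda>s t. \<phi> (z t) - \<phi> (z s))"
    and "germO \<tau> I (2 * \<alpha>) (\<lambda>s t. \<phi> (z t) - \<phi> (z s) - frechet_derivative \<phi> (at (z s)) (z t - z s))"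
proof -
  obtain r where r: "r > 0" "cball z0 r \<subseteq> S" using S open_contains_cball by blast
  obtain K where K: "\<And>z z'. z \<in> cball z0 r \<Longrightarrow> z' \<in> cball z0 r \<Longrightarrow> norm (\<phi> z' - \<phi> z) \<le> K * norm (z' - z)"
    "\<And>z z'. z \<in> cball z0 r \<Longrightarrow> z' \<in> cball z0 r \<Longrightarrow>
      norm (\<phi> z' - \<phi> z - frechet_derivative \<phi> (at z) (z' - z)) \<le> K * (norm (z' - z))\<^sup>2"
    using smooth_on_taylor[OF S(3) r(2)] by blast
  note ev = pairs_tends_ball[OF z r(1)]
  show "germO \<tau> I \<alpha> (\<lambda>s t. \<phi> (z t) - \<phi> (z s))"
    by (rule germO_le[OF h, of _ K], rule eventually_mono[OF ev]) (use K in blast)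
  have "\<forall>\<^sub>F p in pairs \<tau> I. norm (\<phi> (z (snd p)) - \<phi> (z (fst p)) - frechet_derivative \<phi> (at (z (fst p))) (z (snd p) - z (fst p)))
        \<le> K * (norm (z (snd p) - z (fst p)) * norm (z (snd p) - z (fst p)))"
    using ev by eventually_elim (use K(2) in \<open>simp only: power2_eq_square[symmetric]\<close>)
  then have "germO \<tau> I (\<alpha> + \<alpha>) (\<lambda>s t. \<phi> (z t) - \<phi> (z s) - frechet_derivative \<phi> (at (z s)) (z t - z s))"
    by (rule germO_mult[OF h h])
  then show "germO \<tau> I (2 * \<alpha>) (\<lambda>s t. \<phi> (z t) - \<phi> (z s) - frechet_derivative \<phi> (at (z s)) (z t - z s))"
    by (simp only: mult_2)
qed

lemma germO_Pair:
  assumes "germO \<tau> I \<alpha> (\<lambda>s t. z t - z s)" "germO \<tau> I \<alpha> (\<lambda>s t. h t - h s)"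
  shows "germO \<tau> I \<alpha> (\<lambda>s t. (z t, h t) - (z s, h s))"
proof -
  have "germO \<tau> I \<alpha> (\<lambda>s t. (z t - z s, 0) + (0, h t - h s))"
    by (intro germO_add germO_le1[OF assms(1)] germO_le1[OF assms(2)]) (auto simp: norm_Pair)
  then show ?thesis by simp
qed

text \<open>The counterpart of \<open>smooth_on_taylor\<close> for linear maps that depend smoothly
  on a point without being derivatives, such as the coefficients of a form.\<close>

lemma smooth_family_bound:
  fixes b :: "'e::finite_dim_normed \<Rightarrow> 'h::finite_dim_normed \<Rightarrow> 'f::real_normed_vector"
  assumes S: "open S" "z0 \<in> S" and lin: "\<And>z. z \<in> S \<Longrightarrow> linear (b z)"
    and sm: "\<And>v. smooth_on S (\<lambda>z. b z v)"
  shows "\<exists>K\<ge>0. \<exists>r>0. cball z0 r \<subseteq> S \<and> (\<forall>z\<in>cball z0 r. \<forall>v. norm (b z v) \<le> K * norm v) \<and>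
    (\<forall>z\<in>cball z0 r. \<forall>z'\<in>cball z0 r. \<forall>v. norm (b z' v - b z v) \<le> K * norm (z' - z) * norm v)"
proof -
  obtain r where r: "r > 0" "cball z0 r \<subseteq> S" using S open_contains_cball by blast
  have "\<exists>K\<ge>0. \<forall>z\<in>cball z0 r. \<forall>v. norm (b z v) \<le> K * 1 * norm v"
  proof (rule linear_family_bound)
    fix v
    have "compact ((\<lambda>z. b z v) ` cball z0 r)"
      using smooth_on_continuous[OF sm[of v]] r(2) continuous_on_subset
      by (intro compact_continuous_image compact_cball) blast
    then have "bounded ((\<lambda>z. b z v) ` cball z0 r)" by (rule compact_imp_bounded)
    then show "\<exists>K. \<forall>z\<in>cball z0 r. norm (b z v) \<le> K * 1" by (auto simp: bounded_iff)
  qed (use lin r in auto)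
  then obtain K1 where K1: "K1 \<ge> 0" "\<And>z v. z \<in> cball z0 r \<Longrightarrow> norm (b z v) \<le> K1 * norm v"
    by auto
  have "\<exists>K\<ge>0. \<forall>p\<in>cball z0 r \<times> cball z0 r. \<forall>v. norm (b (fst p) v - b (snd p) v)
      \<le> K * norm (fst p - snd p) * norm v"
  proof (rule linear_family_bound)
    show "linear (\<lambda>v. b (fst p) v - b (snd p) v)" if "p \<in> cball z0 r \<times> cball z0 r" for p
      using that lin r(2) by (intro linear_compose_sub) auto
    show "\<exists>K. \<forall>p\<in>cball z0 r \<times> cball z0 r. norm (b (fst p) v - b (snd p) v) \<le> K * norm (fst p - snd p)" for v
      using smooth_on_Lipschitz[OF sm[of v] r(2)] unfolding Ball_def mem_Times_iff by blast
  qed auto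
  then obtain K2 where K2: "K2 \<ge> 0" "\<And>z z' v. z \<in> cball z0 r \<Longrightarrow> z' \<in> cball z0 r \<Longrightarrow>
      norm (b z' v - b z v) \<le> K2 * norm (z' - z) * norm v"
    unfolding Ball_def mem_Times_iff by (metis fst_conv snd_conv)
  show ?thesis
  proof (rule exI[of _ "K1 + K2"], rule conjI, use K1(1) K2(1) in simp, rule exI[of _ r],
      intro conjI ballI allI)
    fix z :: 'e and v :: 'h assume z: "z \<in> cball z0 r"
    show "norm (b z v) \<le> (K1 + K2) * norm v"
      using K1(2)[OF z, of v] mult_right_mono[of K1 "K1 + K2" "norm v"] K2(1) by simp
  next
    fix z z' :: 'e and v :: 'h assume z: "z \<in> cball z0 r" and z': "z' \<in> cball z0 r"
    have "K2 * (norm (z' - z) * norm v) \<le> (K1 + K2) * (norm (z' - z) * norm v)"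
      using K1(1) by (intro mult_right_mono) auto
    then show "norm (b z' v - b z v) \<le> (K1 + K2) * norm (z' - z) * norm v"
      using K2(2)[OF z z', of v] by (simp add: mult.assoc)
  qed (use K1 K2 r in auto)
qed

text \<open>Hoelder continuity in charts, without any metric. On compact intervals it is equivalent
  to \<open>holder_path\<close>, by \<open>holder_path_lhol\<close> and
  \<open>lhol_holder_path\<close>.\<close>

definition lhol :: "('a::t2_space, 'e::finite_dim_normed) chart set \<Rightarrow> real \<Rightarrow> real set \<Rightarrow> (real \<Rightarrow> 'a) \<Rightarrow> bool" where
  "lhol A \<alpha> I y \<longleftrightarrow> continuous_on I y \<and>
     (\<forall>\<tau>\<in>I. \<forall>c\<in>A. y \<tau> \<in> fst c \<longrightarrow> germO \<tau> I \<alpha> (\<lambda>s t. snd c (y t) - snd c (y s)))"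

text \<open>\<open>F\<close> is an indefinite Young integral of \<open>\<beta>\<close> along \<open>y\<close>; as \<open>2\<alpha> > 1\<close>, it is determined up to a
  constant by this estimate.\<close>

definition prim :: "('a::t2_space, 'e::finite_dim_normed) chart set \<Rightarrow> ('a \<Rightarrow> 'a tangent \<Rightarrow> real) \<Rightarrow> real \<Rightarrow>
    real set \<Rightarrow> (real \<Rightarrow> 'a) \<Rightarrow> (real \<Rightarrow> real) \<Rightarrow> bool" where
  "prim A \<beta> \<alpha> I y F \<longleftrightarrow> (\<forall>\<tau>\<in>I. \<forall>c\<in>A. y \<tau> \<in> fst c \<longrightarrow>
     germO \<tau> I (2 * \<alpha>) (\<lambda>s t. F t - F s - \<beta> (y s) (coord_vec A c (y s) (snd c (y t) - snd c (y s)))))"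

lemma has_form_integral_le: "has_form_integral A \<beta> y a b I \<Longrightarrow> a \<le> b"
  by (induction rule: has_form_integral.induct) auto

lemma lholD:
  "lhol A \<alpha> I y \<Longrightarrow> continuous_on I y"
  "lhol A \<alpha> I y \<Longrightarrow> \<tau> \<in> I \<Longrightarrow> c \<in> A \<Longrightarrow> y \<tau> \<in> fst c \<Longrightarrow> germO \<tau> I \<alpha> (\<lambda>s t. snd c (y t) - snd c (y s))"
  unfolding lhol_def by blast+

lemma primD:
  "prim A \<beta> \<alpha> I y F \<Longrightarrow> \<tau> \<in> I \<Longrightarrow> c \<in> A \<Longrightarrow> y \<tau> \<in> fst c \<Longrightarrow>
   germO \<tau> I (2 * \<alpha>) (\<lambda>s t. F t - F s - \<beta> (y s) (coord_vec A c (y s) (snd c (y t) - snd c (y s))))"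
  unfolding prim_def by blast

lemma lhol_subset: "lhol A \<alpha> I y \<Longrightarrow> J \<subseteq> I \<Longrightarrow> lhol A \<alpha> J y"
  unfolding lhol_def by (meson continuous_on_subset germO_subset subset_iff)

lemma prim_subset: "prim A \<beta> \<alpha> I y F \<Longrightarrow> J \<subseteq> I \<Longrightarrow> prim A \<beta> \<alpha> J y F"
  unfolding prim_def by (meson germO_subset subset_iff)

context
  fixes A :: "('a::t2_space, 'e::finite_dim_normed) chart set"
  assumes A: "smooth_atlas A"
begin

lemma eventually_pairs_chart:
  assumes "continuous_on I y" "\<tau> \<in> I" "c \<in> A" "y \<tau> \<in> fst c"
  shows "\<forall>\<^sub>F p in pairs \<tau> I. y (fst p) \<in> fst c \<and> y (snd p) \<in> fst c"
  by (rule eventually_pairs_continuous[OF assms(1,2) chart_open(1)[OF A assms(3)] assms(4)])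

lemma transition_at:
  assumes "c \<in> A" "d \<in> A" "p \<in> fst c" "p \<in> fst d"
  shows "open (snd c ` (fst c \<inter> fst d))" "snd c p \<in> snd c ` (fst c \<inter> fst d)"
    "smooth_on (snd c ` (fst c \<inter> fst d)) (\<lambda>z. snd d (inv_chart c z))"
  using chart_image_open[OF A assms(1) chart_open(1)[OF A assms(2)]] transition_smooth[OF A assms(1,2)] assms(3,4)
  by auto

text \<open>One chart at each time is enough, since transition maps preserve the order
  \<alpha>.\<close>

lemma lholI:
  assumes cont: "continuous_on I y"
    and ex: "\<And>\<tau>. \<tau> \<in> I \<Longrightarrow> \<exists>c\<in>A. y \<tau> \<in> fst c \<and> germO \<tau> I \<alpha> (\<lambda>s t. snd c (y t) - snd c (y s))"
  shows "lhol A \<alpha> I y"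
  unfolding lhol_def
proof (intro conjI cont ballI impI)
  fix \<tau> d assume \<tau>: "\<tau> \<in> I" and d: "d \<in> A" "y \<tau> \<in> fst d"
  obtain c where c: "c \<in> A" "y \<tau> \<in> fst c" "germO \<tau> I \<alpha> (\<lambda>s t. snd c (y t) - snd c (y s))"
    using ex[OF \<tau>] by blast
  have "germO \<tau> I \<alpha> (\<lambda>s t. snd d (inv_chart c (snd c (y t))) - snd d (inv_chart c (snd c (y s))))"
    by (rule germO_smooth(1)[OF transition_at[OF c(1) d(1) c(2) d(2)] pairs_tends_chart[OF A cont \<tau> c(1,2)] c(3)])
  then show "germO \<tau> I \<alpha> (\<lambda>s t. snd d (y t) - snd d (y s))"
    by (rule germO_cong, intro eventually_mono[OF eventually_pairs_chart[OF cont \<tau> c(1,2)]])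
      (simp add: chart_inv[OF A c(1)])
qed

context
  fixes \<beta> :: "'a \<Rightarrow> 'a tangent \<Rightarrow> real"
  assumes \<beta>: "one_form A \<beta>"
begin

lemma linear_form: "c \<in> A \<Longrightarrow> p \<in> fst c \<Longrightarrow> linear (\<lambda>v. \<beta> p (coord_vec A c p v))"
proof (rule linearI)
  fix v w and r :: real assume c: "c \<in> A" "p \<in> fst c"
  have l: "linear_functional_on (tangent_space A p) (\<beta> p)" using \<beta> unfolding one_form_def by blast
  show "\<beta> p (coord_vec A c p (v + w)) = \<beta> p (coord_vec A c p v) + \<beta> p (coord_vec A c p w)"
    using l coord_vec_in[OF A c] coord_vec_add[OF A c] unfolding linear_functional_on_def by metis
  show "\<beta> p (coord_vec A c p (r *\<^sub>R v)) = r *\<^sub>R \<beta> p (coord_vec A c p v)"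
    using l coord_vec_in[OF A c] coord_vec_scale[OF A c] unfolding linear_functional_on_def
    by (metis real_scaleR_def)
qed

lemma form_bound:
  assumes c: "c \<in> A" "p \<in> fst c"
  obtains K V where "K \<ge> 0" "open V" "p \<in> V" "V \<subseteq> fst c"
    "\<And>q v. q \<in> V \<Longrightarrow> \<bar>\<beta> q (coord_vec A c q v)\<bar> \<le> K * norm v"
    "\<And>q q' v. q \<in> V \<Longrightarrow> q' \<in> V \<Longrightarrow> \<bar>\<beta> q' (coord_vec A c q' v) - \<beta> q (coord_vec A c q v)\<bar>
       \<le> K * norm (snd c q' - snd c q) * norm v"
proof -
  let ?b = "\<lambda>z v. \<beta> (inv_chart c z) (coord_vec A c (inv_chart c z) v)"
  obtain K r where K: "K \<ge> 0" "r > 0" "cball (snd c p) r \<subseteq> snd c ` fst c"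
    "\<And>z v. z \<in> cball (snd c p) r \<Longrightarrow> norm (?b z v) \<le> K * norm v"
    "\<And>z z' v. z \<in> cball (snd c p) r \<Longrightarrow> z' \<in> cball (snd c p) r \<Longrightarrow>
       norm (?b z' v - ?b z v) \<le> K * norm (z' - z) * norm v"
  proof -
    have "\<exists>K\<ge>0. \<exists>r>0. cball (snd c p) r \<subseteq> snd c ` fst c \<and>
        (\<forall>z\<in>cball (snd c p) r. \<forall>v. norm (?b z v) \<le> K * norm v) \<and>
        (\<forall>z\<in>cball (snd c p) r. \<forall>z'\<in>cball (snd c p) r. \<forall>v. norm (?b z' v - ?b z v) \<le> K * norm (z' - z) * norm v)"
    proof (rule smooth_family_bound)
      show "smooth_on (snd c ` fst c) (\<lambda>z. ?b z v)" for v
        using \<beta> c(1) unfolding one_form_def by blast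
      show "linear (?b z)" if "z \<in> snd c ` fst c" for z
        using linear_form[OF c(1)] that by (auto simp: inv_into_into)
    qed (use chart_open(2)[OF A c(1)] c(2) in auto)
    then show ?thesis using that by blast
  qed
  let ?V = "fst c \<inter> snd c -` ball (snd c p) r"
  show ?thesis
  proof (rule that[of K ?V])
    show "open ?V" using chart_preimage_open[OF A c(1)] by blast
    fix q v assume q: "q \<in> ?V"
    then have qb: "snd c q \<in> cball (snd c p) r" "inv_chart c (snd c q) = q" using chart_inv[OF A c(1)] by auto
    show "\<bar>\<beta> q (coord_vec A c q v)\<bar> \<le> K * norm v" using K(4)[OF qb(1), of v] qb(2) by simp
    fix q' assume q': "q' \<in> ?V"
    have qb': "snd c q' \<in> cball (snd c p) r" "inv_chart c (snd c q') = q'" using q' chart_inv[OF A c(1)] by auto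
    show "\<bar>\<beta> q' (coord_vec A c q' v) - \<beta> q (coord_vec A c q v)\<bar> \<le> K * norm (snd c q' - snd c q) * norm v"
      using K(5)[OF qb(1) qb'(1), of v] qb(2) qb'(2) by simp
  qed (use K c in auto)
qed

text \<open>Again one chart at each time is enough. Coordinate vectors transform by the derivative
  of the transition map, and coordinate increments do so up to its linearisation error, which is of
  order 2 * \<alpha> and stays so under the locally bounded form.\<close>

lemma primI:
  assumes y: "lhol A \<alpha> I y"
    and ex: "\<And>\<tau>. \<tau> \<in> I \<Longrightarrow> \<exists>c\<in>A. y \<tau> \<in> fst c \<and> germO \<tau> I (2 * \<alpha>)
      (\<lambda>s t. F t - F s - \<beta> (y s) (coord_vec A c (y s) (snd c (y t) - snd c (y s))))"
  shows "prim A \<beta> \<alpha> I y F"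
  unfolding prim_def
proof (intro ballI impI)
  fix \<tau> d assume \<tau>: "\<tau> \<in> I" and d: "d \<in> A" "y \<tau> \<in> fst d"
  obtain c where c: "c \<in> A" "y \<tau> \<in> fst c" "germO \<tau> I (2 * \<alpha>)
      (\<lambda>s t. F t - F s - \<beta> (y s) (coord_vec A c (y s) (snd c (y t) - snd c (y s))))"
    using ex[OF \<tau>] by blast
  let ?\<phi> = "\<lambda>z. snd d (inv_chart c z)" and ?z = "\<lambda>t. snd c (y t)"
  let ?e = "\<lambda>s t. ?\<phi> (?z t) - ?\<phi> (?z s) - frechet_derivative ?\<phi> (at (?z s)) (?z t - ?z s)"
  have e: "germO \<tau> I (2 * \<alpha>) ?e"
    by (rule germO_smooth(2)[OF transition_at[OF c(1) d(1) c(2) d(2)] pairs_tends_chart[OF A lholD(1)[OF y] \<tau> c(1,2)]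
          lholD(2)[OF y \<tau> c(1,2)]])
  obtain K V where K: "K \<ge> 0" "open V" "y \<tau> \<in> V" "V \<subseteq> fst d"
    "\<And>q v. q \<in> V \<Longrightarrow> \<bar>\<beta> q (coord_vec A d q v)\<bar> \<le> K * norm v"
    "\<And>q q' v. q \<in> V \<Longrightarrow> q' \<in> V \<Longrightarrow> \<bar>\<beta> q' (coord_vec A d q' v) - \<beta> q (coord_vec A d q v)\<bar>
       \<le> K * norm (snd d q' - snd d q) * norm v"
    by (rule form_bound[OF d]) (rule that)
  have "germO \<tau> I (2 * \<alpha>) (\<lambda>s t. \<beta> (y s) (coord_vec A d (y s) (?e s t)))"
    by (rule germO_le[OF e, of _ K], rule eventually_mono[OF eventually_pairs_continuous[OF lholD(1)[OF y] \<tau> K(2,3)]])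
      (use K(5) in auto)
  from germO_diff[OF c(3) this]
  show "germO \<tau> I (2 * \<alpha>) (\<lambda>s t. F t - F s - \<beta> (y s) (coord_vec A d (y s) (snd d (y t) - snd d (y s))))"
  proof (rule germO_cong, intro eventually_mono[OF eventually_conj[OF eventually_pairs_chart[OF lholD(1)[OF y] \<tau> c(1,2)]
          eventually_pairs_chart[OF lholD(1)[OF y] \<tau> d]]])
    fix p assume p: "(y (fst p) \<in> fst c \<and> y (snd p) \<in> fst c) \<and> y (fst p) \<in> fst d \<and> y (snd p) \<in> fst d"
    let ?s = "fst p" and ?t = "snd p"
    have ee: "?e ?s ?t = (snd d (y ?t) - snd d (y ?s)) - frechet_derivative ?\<phi> (at (?z ?s)) (?z ?t - ?z ?s)"
      using p chart_inv[OF A c(1)] by simp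
    have "\<beta> (y ?s) (coord_vec A d (y ?s) (?e ?s ?t)) = \<beta> (y ?s) (coord_vec A d (y ?s) (snd d (y ?t) - snd d (y ?s)))
        - \<beta> (y ?s) (coord_vec A d (y ?s) (frechet_derivative ?\<phi> (at (?z ?s)) (?z ?t - ?z ?s)))"
      unfolding ee using linear_diff[OF linear_form[OF d(1)]] p by blast
    also have "coord_vec A d (y ?s) (frechet_derivative ?\<phi> (at (?z ?s)) (?z ?t - ?z ?s)) = coord_vec A c (y ?s) (?z ?t - ?z ?s)"
      using coord_vec_transition[OF A c(1) d(1)] p by simp
    finally show "F ?t - F ?s - \<beta> (y ?s) (coord_vec A d (y ?s) (snd d (y ?t) - snd d (y ?s))) =
        F ?t - F ?s - \<beta> (y ?s) (coord_vec A c (y ?s) (snd c (y ?t) - snd c (y ?s))) -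
        \<beta> (y ?s) (coord_vec A d (y ?s) (?e ?s ?t))" by simp
  qed
qed

lemma form_expand:
  assumes "c \<in> A" "p \<in> fst c"
  shows "\<beta> p (coord_vec A c p (v - w)) = (\<Sum>i\<in>coord_basis. \<beta> p (coord_vec A c p i) * (crd v i - crd w i))"
  by (subst linear_expand[OF linear_form[OF assms]])
    (simp add: linear_diff[OF linear_crd] mult.commute)

text \<open>For each coordinate i the indefinite integral of \<open>f i\<close> against
  \<open>h i\<close> solves a Young equation with state-independent coefficient, so
  \<open>davie_exists\<close> yields it; the sum over i is the primitive. Quantifying over all small
  intervals around \<tau> prepares the use of \<open>Bolzano\<close>.\<close>

lemma young_local:
  assumes alpha: "1/2 < \<alpha>" "\<alpha> \<le> 1" and y: "lhol A \<alpha> {a..b} y" and \<tau>: "\<tau> \<in> {a..b}"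
  shows "\<exists>d>0. \<forall>s t. a \<le> s \<and> s \<le> \<tau> \<and> \<tau> \<le> t \<and> t \<le> b \<and> t - s < d \<longrightarrow>
    (\<exists>F. prim A \<beta> \<alpha> {s..t} y F \<and> has_form_integral A \<beta> y s t (F t - F s))"
proof -
  obtain c where c: "c \<in> A" "y \<tau> \<in> fst c" using chart_cover[OF A] by blast
  let ?z = "\<lambda>t. snd c (y t)"
  obtain K V where K: "K \<ge> 0" "open V" "y \<tau> \<in> V" "V \<subseteq> fst c"
    "\<And>q v. q \<in> V \<Longrightarrow> \<bar>\<beta> q (coord_vec A c q v)\<bar> \<le> K * norm v"
    "\<And>q q' v. q \<in> V \<Longrightarrow> q' \<in> V \<Longrightarrow> \<bar>\<beta> q' (coord_vec A c q' v) - \<beta> q (coord_vec A c q v)\<bar>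
       \<le> K * norm (snd c q' - snd c q) * norm v"
    by (rule form_bound[OF c]) (rule that)
  obtain C where C: "C \<ge> 0" "\<forall>\<^sub>F p in pairs \<tau> {a..b}. norm (?z (snd p) - ?z (fst p)) \<le> C * \<bar>snd p - fst p\<bar> powr \<alpha>"
    using germO_pos[OF lholD(2)[OF y \<tau> c]] by blast
  have "\<forall>\<^sub>F p in pairs \<tau> {a..b}. (y (fst p) \<in> V \<and> y (snd p) \<in> V) \<and>
      norm (?z (snd p) - ?z (fst p)) \<le> C * \<bar>snd p - fst p\<bar> powr \<alpha>"
    by (rule eventually_conj[OF eventually_pairs_continuous[OF lholD(1)[OF y] \<tau> K(2,3)] C(2)])
  then obtain d0 where d0: "d0 > 0" "\<And>s t. s \<in> {a..b} \<Longrightarrow> t \<in> {a..b} \<Longrightarrow> \<bar>s - \<tau>\<bar> < d0 \<Longrightarrow> \<bar>t - \<tau>\<bar> < d0 \<Longrightarrow>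
      (y s \<in> V \<and> y t \<in> V) \<and> norm (?z t - ?z s) \<le> C * \<bar>t - s\<bar> powr \<alpha>"
    unfolding eventually_pairs fst_conv snd_conv by blast
  obtain M where M: "\<And>i (x::'e). \<bar>crd x i\<bar> \<le> M i * norm x" using crd_bound by metis
  \<comment> \<open>Since \<open>davie_exists\<close> has a single constant, N dominates for every i
    the Hoelder constant of \<open>h i\<close>, the Hoelder constant of \<open>f i\<close> and the
    bound of \<open>f i\<close>.\<close>
  define N where "N = (\<Sum>i\<in>(coord_basis :: 'e set). \<bar>M i\<bar> * C + K * C * norm i + K * norm i)"
  have N: "\<bar>M i\<bar> * C \<le> N" "K * C * norm i \<le> N" "K * norm i \<le> N" if "i \<in> (coord_basis :: 'e set)" for i
  proof -
    have "\<bar>M i\<bar> * C + K * C * norm i + K * norm i \<le> N"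
      unfolding N_def by (rule member_le_sum[OF that]) (use C K coord_basis(1) in auto)
    moreover have "0 \<le> \<bar>M i\<bar> * C" "0 \<le> K * C * norm i" "0 \<le> K * norm i" using C K by auto
    ultimately show "\<bar>M i\<bar> * C \<le> N" "K * C * norm i \<le> N" "K * norm i \<le> N" by linarith+
  qed
  have N0: "N \<ge> 0" unfolding N_def using C K by (intro sum_nonneg) auto
  define f h where "f i t = \<beta> (y t) (coord_vec A c (y t) i)" and "h i t = crd (?z t) i" for i t
  obtain \<delta> where \<delta>: "\<delta> > 0" and dav: "\<forall>(H :: real \<Rightarrow> real \<Rightarrow> real \<Rightarrow> real) x a b z1.
    a \<le> b \<longrightarrow> b - a < \<delta> \<longrightarrow> norm (z1 - 0) \<le> 1 / 2 \<longrightarrow>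
    (\<forall>s\<in>{a..b}. \<forall>t\<in>{a..b}. norm (x t - x s) \<le> N * \<bar>t - s\<bar> powr \<alpha>) \<longrightarrow>
    (\<forall>s\<in>{a..b}. \<forall>z\<in>cball 0 1. linear (H s z) \<and> (\<forall>v. norm (H s z v) \<le> N * norm v)) \<longrightarrow>
    (\<forall>s\<in>{a..b}. \<forall>u\<in>{a..b}. \<forall>z\<in>cball 0 1. \<forall>w\<in>cball 0 1. \<forall>v.
      norm (H u w v - H s z v) \<le> N * (\<bar>u - s\<bar> powr \<alpha> + norm (w - z)) * norm v) \<longrightarrow>
    (\<exists>w. w a = z1 \<and> (\<forall>t\<in>{a..b}. w t \<in> cball 0 1) \<and> (\<exists>C. \<forall>s\<in>{a..b}. \<forall>t\<in>{a..b}.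
       norm (w t - w s) \<le> C * \<bar>t - s\<bar> powr \<alpha> \<and>
       norm (w t - w s - H s (w s) (x t - x s)) \<le> C * \<bar>t - s\<bar> powr (2 * \<alpha>)))"
    using davie_exists[OF alpha N0 zero_less_one, of 0] by blast
  show ?thesis
  proof (intro exI[of _ "min \<delta> d0"] conjI allI impI)
    fix s t assume st: "a \<le> s \<and> s \<le> \<tau> \<and> \<tau> \<le> t \<and> t \<le> b \<and> t - s < min \<delta> d0"
    have near: "y p \<in> V" "y q \<in> V" "norm (?z q - ?z p) \<le> C * \<bar>q - p\<bar> powr \<alpha>" if "p \<in> {s..t}" "q \<in> {s..t}" for p q
      using d0(2)[of p q] that st by auto
    have "\<exists>w C. C \<ge> 0 \<and> (\<forall>p\<in>{s..t}. \<forall>q\<in>{s..t}. \<bar>w q - w p - f i p * (h i q - h i p)\<bar> \<le> C * \<bar>q - p\<bar> powr (2 * \<alpha>))"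
      if i: "i \<in> (coord_basis :: 'e set)" for i
    proof -
      have h1: "\<forall>p\<in>{s..t}. \<forall>q\<in>{s..t}. norm (h i q - h i p) \<le> N * \<bar>q - p\<bar> powr \<alpha>"
      proof (intro ballI)
        fix p q assume pq: "p \<in> {s..t}" "q \<in> {s..t}"
        have "\<bar>h i q - h i p\<bar> \<le> M i * norm (?z q - ?z p)"
          unfolding h_def linear_diff[OF linear_crd, symmetric] by (rule M)
        also have "\<dots> \<le> \<bar>M i\<bar> * (C * \<bar>q - p\<bar> powr \<alpha>)" using near(3)[OF pq] by (intro mult_mono) auto
        also have "\<dots> \<le> N * \<bar>q - p\<bar> powr \<alpha>" using mult_right_mono[OF N(1)[OF i], of "\<bar>q - p\<bar> powr \<alpha>"] by (simp add: mult.assoc)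
        finally show "norm (h i q - h i p) \<le> N * \<bar>q - p\<bar> powr \<alpha>" by simp
      qed
      have h2: "\<forall>p\<in>{s..t}. \<forall>z\<in>cball (0::real) 1. linear ((*) (f i p)) \<and> (\<forall>v. norm (f i p * v) \<le> N * norm v)"
      proof (intro ballI conjI allI)
        fix p v assume p: "p \<in> {s..t}"
        have "\<bar>f i p\<bar> \<le> N" unfolding f_def using K(5)[OF near(1)[OF p p], of i] N(3)[OF i] by linarith
        then show "norm (f i p * v) \<le> N * norm v" by (simp add: abs_mult mult_right_mono)
      qed (rule linear_times)
      have h3: "\<forall>p\<in>{s..t}. \<forall>q\<in>{s..t}. \<forall>z\<in>cball (0::real) 1. \<forall>w\<in>cball 0 1. \<forall>v.
          norm (f i q * v - f i p * v) \<le> N * (\<bar>q - p\<bar> powr \<alpha> + norm (w - z)) * norm v"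
      proof (intro ballI allI)
        fix p q z w v assume pq: "p \<in> {s..t}" "q \<in> {s..t}"
        have "\<bar>f i q - f i p\<bar> \<le> K * norm (?z q - ?z p) * norm i"
          unfolding f_def by (rule K(6)[OF near(1,2)[OF pq]])
        also have "\<dots> \<le> K * (C * \<bar>q - p\<bar> powr \<alpha>) * norm i"
          using near(3)[OF pq] K(1) by (intro mult_right_mono mult_left_mono) auto
        also have "\<dots> \<le> N * \<bar>q - p\<bar> powr \<alpha>" using mult_right_mono[OF N(2)[OF i], of "\<bar>q - p\<bar> powr \<alpha>"] by (simp add: mult_ac)
        also have "\<dots> \<le> N * (\<bar>q - p\<bar> powr \<alpha> + norm (w - z))" using N0 by (intro mult_left_mono) auto
        finally have "\<bar>f i q - f i p\<bar> * \<bar>v\<bar> \<le> N * (\<bar>q - p\<bar> powr \<alpha> + norm (w - z)) * \<bar>v\<bar>" by (rule mult_right_mono) simp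
        then show "norm (f i q * v - f i p * v) \<le> N * (\<bar>q - p\<bar> powr \<alpha> + norm (w - z)) * norm v"
          by (simp add: abs_mult flip: left_diff_distrib)
      qed
      note D = dav[THEN spec[where x="\<lambda>p _. (*) (f i p)"], THEN spec[where x="h i"], THEN spec[where x=s],
          THEN spec[where x=t], THEN spec[where x=0]]
      have st': "s \<le> t" "t - s < \<delta>" "norm (0 - 0 :: real) \<le> 1 / 2" using st by auto
      obtain w C' where "\<forall>p\<in>{s..t}. \<forall>q\<in>{s..t}. norm (w q - w p) \<le> C' * \<bar>q - p\<bar> powr \<alpha> \<and>
          norm (w q - w p - f i p * (h i q - h i p)) \<le> C' * \<bar>q - p\<bar> powr (2 * \<alpha>)"
        using mp[OF mp[OF mp[OF mp[OF mp[OF mp[OF D st'(1)] st'(2)] st'(3)] h1] h2] h3] by blast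
      then have w: "\<bar>w q - w p - f i p * (h i q - h i p)\<bar> \<le> C' * \<bar>q - p\<bar> powr (2 * \<alpha>)"
        if "p \<in> {s..t}" "q \<in> {s..t}" for p q using that unfolding real_norm_def by blast
      have "\<forall>p\<in>{s..t}. \<forall>q\<in>{s..t}. \<bar>w q - w p - f i p * (h i q - h i p)\<bar> \<le> \<bar>C'\<bar> * \<bar>q - p\<bar> powr (2 * \<alpha>)"
        by (intro ballI order_trans[OF w]) (auto intro: mult_right_mono)
      then show ?thesis by (intro exI[of _ w] exI[of _ "\<bar>C'\<bar>"]) auto
    qed
    then have ex: "\<forall>i\<in>(coord_basis :: 'e set). \<exists>w C. C \<ge> 0 \<and>
        (\<forall>p\<in>{s..t}. \<forall>q\<in>{s..t}. \<bar>w q - w p - f i p * (h i q - h i p)\<bar> \<le> C * \<bar>q - p\<bar> powr (2 * \<alpha>))" by blast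
    from bchoice[OF ex] obtain W where "\<forall>i\<in>(coord_basis :: 'e set). \<exists>C. C \<ge> 0 \<and>
        (\<forall>p\<in>{s..t}. \<forall>q\<in>{s..t}. \<bar>W i q - W i p - f i p * (h i q - h i p)\<bar> \<le> C * \<bar>q - p\<bar> powr (2 * \<alpha>))" by blast
    from bchoice[OF this] obtain D where D: "\<forall>i\<in>(coord_basis :: 'e set). D i \<ge> 0 \<and>
        (\<forall>p\<in>{s..t}. \<forall>q\<in>{s..t}. \<bar>W i q - W i p - f i p * (h i q - h i p)\<bar> \<le> D i * \<bar>q - p\<bar> powr (2 * \<alpha>))" by blast
    have WD: "D i \<ge> 0" "\<And>p q. p \<in> {s..t} \<Longrightarrow> q \<in> {s..t} \<Longrightarrow>
        \<bar>W i q - W i p - f i p * (h i q - h i p)\<bar> \<le> D i * \<bar>q - p\<bar> powr (2 * \<alpha>)"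
      if "i \<in> (coord_basis :: 'e set)" for i
      using D that by blast+
    define F where "F p = (\<Sum>i\<in>coord_basis. W i p)" for p
    have "has_form_integral A \<beta> y s t (\<Sum>i\<in>coord_basis. W i t - W i s)"
    proof (rule has_form_integral.in_chart[OF c(1)])
      show "y ` {s..t} \<subseteq> fst c" using near(1) K(4) by blast
      fix i :: 'e assume i: "i \<in> coord_basis"
      have "has_RS_integral (f i) (h i) s t (W i t - W i s)"
        by (rule has_RS_integralI[of "2 * \<alpha>" 1 _ _ "D i"]) (use alpha st WD[OF i] in auto)
      then show "has_RS_integral (\<lambda>t. \<beta> (y t) (coord_vec A c (y t) i)) (\<lambda>t. crd (?z t) i) s t (W i t - W i s)"
        unfolding f_def[abs_def] h_def[abs_def] .
    qed (use st in auto)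
    then have int: "has_form_integral A \<beta> y s t (F t - F s)" by (simp add: F_def sum_subtractf)
    have ylh: "lhol A \<alpha> {s..t} y" by (rule lhol_subset[OF y]) (use st in auto)
    have "prim A \<beta> \<alpha> {s..t} y F"
    proof (rule primI[OF ylh])
      fix \<sigma> assume \<sigma>: "\<sigma> \<in> {s..t}"
      have yc: "y p \<in> fst c" if "p \<in> {s..t}" for p using near(1)[OF that that] K(4) by blast
      have "norm (F q - F p - \<beta> (y p) (coord_vec A c (y p) (?z q - ?z p))) \<le> (\<Sum>i\<in>coord_basis. D i) * \<bar>q - p\<bar> powr (2 * \<alpha>)"
        if pq: "p \<in> {s..t}" "q \<in> {s..t}" for p q
      proof -
        have "F q - F p - \<beta> (y p) (coord_vec A c (y p) (?z q - ?z p)) =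
            (\<Sum>i\<in>coord_basis. W i q - W i p - f i p * (h i q - h i p))"
          unfolding F_def form_expand[OF c(1) yc[OF pq(1)]] f_def h_def by (simp add: sum_subtractf)
        also have "norm \<dots> \<le> (\<Sum>i\<in>coord_basis. D i * \<bar>q - p\<bar> powr (2 * \<alpha>))"
          by (rule sum_norm_le) (use WD(2) pq in simp)
        finally show ?thesis by (simp add: sum_distrib_right)
      qed
      then have "germO \<sigma> {s..t} (2 * \<alpha>) (\<lambda>p q. F q - F p - \<beta> (y p) (coord_vec A c (y p) (?z q - ?z p)))"
        unfolding germO_def
        by (intro exI[of _ "\<Sum>i\<in>coord_basis. D i"] eventually_mono[OF eventually_pairs_in]) auto
      then show "\<exists>c\<in>A. y \<sigma> \<in> fst c \<and> germO \<sigma> {s..t} (2 * \<alpha>)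
          (\<lambda>s t. F t - F s - \<beta> (y s) (coord_vec A c (y s) (snd c (y t) - snd c (y s))))"
        using c(1) yc[OF \<sigma>] by blast
    qed
    with int show "\<exists>F. prim A \<beta> \<alpha> {s..t} y F \<and> has_form_integral A \<beta> y s t (F t - F s)" by blast
  qed (use \<delta> d0 in auto)
qed

lemma germO_local:
  assumes "germO \<tau> J \<theta> f" "d > 0" "\<And>s. s \<in> I \<Longrightarrow> \<bar>s - \<tau>\<bar> < d \<Longrightarrow> s \<in> J"
  shows "germO \<tau> I \<theta> f"
proof -
  obtain C e where e: "e > 0" "\<And>s t. s \<in> J \<Longrightarrow> t \<in> J \<Longrightarrow> \<bar>s - \<tau>\<bar> < e \<Longrightarrow> \<bar>t - \<tau>\<bar> < e \<Longrightarrow>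
      norm (f s t) \<le> C * \<bar>t - s\<bar> powr \<theta>"
    using assms(1) unfolding germO_def eventually_pairs fst_conv snd_conv by blast
  have "\<forall>s\<in>I. \<forall>t\<in>I. \<bar>s - \<tau>\<bar> < min d e \<longrightarrow> \<bar>t - \<tau>\<bar> < min d e \<longrightarrow> norm (f s t) \<le> C * \<bar>t - s\<bar> powr \<theta>"
    using e(2) assms(3) by simp
  moreover have "min d e > 0" using e(1) assms(2) by simp
  ultimately show ?thesis unfolding germO_def eventually_pairs fst_conv snd_conv by blast
qed

text \<open>Away from b only one of the primitives matters. At b an increment across b is split
  there, and the defect of additivity is of order 2 * \<alpha>. Normalising both functions to vanish
  at b makes them fit together.\<close>

lemma prim_concat:
  assumes y: "lhol A \<alpha> {a..e} y" and ab: "a \<le> b" "b \<le> e" and alpha: "0 < \<alpha>"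
    and F1: "prim A \<beta> \<alpha> {a..b} y F1" and F2: "prim A \<beta> \<alpha> {b..e} y F2"
  shows "prim A \<beta> \<alpha> {a..e} y (\<lambda>t. if t \<le> b then F1 t - F1 b else F2 t - F2 b)" (is "prim A \<beta> \<alpha> _ y ?F")
proof (rule primI[OF y])
  fix \<tau> assume \<tau>: "\<tau> \<in> {a..e}"
  obtain c where c: "c \<in> A" "y \<tau> \<in> fst c" using chart_cover[OF A] by blast
  let ?z = "\<lambda>t. snd c (y t)"
  let ?e = "\<lambda>F s t. F t - F s - \<beta> (y s) (coord_vec A c (y s) (?z t - ?z s))"
  have G1: "germO \<sigma> {a..b} (2 * \<alpha>) (?e ?F)" if "germO \<sigma> {a..b} (2 * \<alpha>) (?e F1)" for \<sigma>
    by (rule germO_cong[OF that], rule eventually_mono[OF eventually_pairs_in]) simp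
  have G2: "germO \<sigma> {b..e} (2 * \<alpha>) (?e ?F)" if "germO \<sigma> {b..e} (2 * \<alpha>) (?e F2)" for \<sigma>
    by (rule germO_cong[OF that], rule eventually_mono[OF eventually_pairs_in]) auto
  consider "\<tau> < b" | "\<tau> > b" | "\<tau> = b" by linarith
  then have "germO \<tau> {a..e} (2 * \<alpha>) (?e ?F)"
  proof cases
    case 1
    show ?thesis
      by (rule germO_local[OF G1[OF primD[OF F1 _ c]], of "b - \<tau>"]) (use 1 \<tau> in auto)
  next
    case 2
    show ?thesis
      by (rule germO_local[OF G2[OF primD[OF F2 _ c]], of "\<tau> - b"]) (use 2 \<tau> in auto)
  next
    case 3
    obtain C1 d1 where C1: "d1 > 0" "\<And>s t. s \<in> {a..b} \<Longrightarrow> t \<in> {a..b} \<Longrightarrow> \<bar>s - b\<bar> < d1 \<Longrightarrow> \<bar>t - b\<bar> < d1 \<Longrightarrow>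
        norm (?e ?F s t) \<le> C1 * \<bar>t - s\<bar> powr (2 * \<alpha>)"
      using G1[OF primD[OF F1 _ c]] 3 ab unfolding germO_def eventually_pairs fst_conv snd_conv
      by (metis atLeastAtMost_iff order_refl)
    obtain C2 d2 where C2: "d2 > 0" "\<And>s t. s \<in> {b..e} \<Longrightarrow> t \<in> {b..e} \<Longrightarrow> \<bar>s - b\<bar> < d2 \<Longrightarrow> \<bar>t - b\<bar> < d2 \<Longrightarrow>
        norm (?e ?F s t) \<le> C2 * \<bar>t - s\<bar> powr (2 * \<alpha>)"
      using G2[OF primD[OF F2 _ c]] 3 ab unfolding germO_def eventually_pairs fst_conv snd_conv
      by (metis atLeastAtMost_iff order_refl)
    obtain C3 where C3: "C3 \<ge> 0" "\<forall>\<^sub>F p in pairs \<tau> {a..e}. norm (?z (snd p) - ?z (fst p)) \<le> C3 * \<bar>snd p - fst p\<bar> powr \<alpha>"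
      using germO_pos[OF lholD(2)[OF y \<tau> c]] by blast
    obtain K V where K: "K \<ge> 0" "open V" "y \<tau> \<in> V" "V \<subseteq> fst c"
    "\<And>q v. q \<in> V \<Longrightarrow> \<bar>\<beta> q (coord_vec A c q v)\<bar> \<le> K * norm v"
    "\<And>q q' v. q \<in> V \<Longrightarrow> q' \<in> V \<Longrightarrow> \<bar>\<beta> q' (coord_vec A c q' v) - \<beta> q (coord_vec A c q v)\<bar>
       \<le> K * norm (snd c q' - snd c q) * norm v"
    by (rule form_bound[OF c]) (rule that)
    have "\<forall>\<^sub>F p in pairs \<tau> {a..e}. (y (fst p) \<in> V \<and> y (snd p) \<in> V) \<and>
        norm (?z (snd p) - ?z (fst p)) \<le> C3 * \<bar>snd p - fst p\<bar> powr \<alpha>"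
      by (rule eventually_conj[OF eventually_pairs_continuous[OF lholD(1)[OF y] \<tau> K(2,3)] C3(2)])
    then obtain d3 where d3: "d3 > 0" "\<And>s t. s \<in> {a..e} \<Longrightarrow> t \<in> {a..e} \<Longrightarrow> \<bar>s - b\<bar> < d3 \<Longrightarrow> \<bar>t - b\<bar> < d3 \<Longrightarrow>
        (y s \<in> V \<and> y t \<in> V) \<and> norm (?z t - ?z s) \<le> C3 * \<bar>t - s\<bar> powr \<alpha>"
      unfolding eventually_pairs fst_conv snd_conv 3 by blast
    let ?C = "\<bar>C1\<bar> + \<bar>C2\<bar>"
    have half: "norm (?e ?F s t) \<le> ?C * \<bar>t - s\<bar> powr (2 * \<alpha>)"
      if "s \<in> {a..e}" "t \<in> {a..e}" "\<bar>s - b\<bar> < min d1 d2" "\<bar>t - b\<bar> < min d1 d2" "(s \<le> b \<and> t \<le> b) \<or> (b \<le> s \<and> b \<le> t)" for s t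
    proof (cases "s \<le> b \<and> t \<le> b")
      case True
      then have "norm (?e ?F s t) \<le> C1 * \<bar>t - s\<bar> powr (2 * \<alpha>)" using that by (intro C1(2)) auto
      also have "\<dots> \<le> ?C * \<bar>t - s\<bar> powr (2 * \<alpha>)" by (intro mult_right_mono) auto
      finally show ?thesis .
    next
      case False
      then have "norm (?e ?F s t) \<le> C2 * \<bar>t - s\<bar> powr (2 * \<alpha>)" using that by (intro C2(2)) auto
      also have "\<dots> \<le> ?C * \<bar>t - s\<bar> powr (2 * \<alpha>)" by (intro mult_right_mono) auto
      finally show ?thesis .
    qed
    have "norm (?e ?F s t) \<le> (2 * ?C + K * C3 * C3) * \<bar>t - s\<bar> powr (2 * \<alpha>)"
      if s: "s \<in> {a..e}" "\<bar>s - b\<bar> < min (min d1 d2) d3" and t: "t \<in> {a..e}" "\<bar>t - b\<bar> < min (min d1 d2) d3" for s t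
    proof (cases "(s \<le> b \<and> t \<le> b) \<or> (b \<le> s \<and> b \<le> t)")
      case True
      then have "norm (?e ?F s t) \<le> ?C * \<bar>t - s\<bar> powr (2 * \<alpha>)" using s t by (intro half) auto
      also have "\<dots> \<le> (2 * ?C + K * C3 * C3) * \<bar>t - s\<bar> powr (2 * \<alpha>)" using K(1) C3(1) by (intro mult_right_mono) auto
      finally show ?thesis .
    next
      case False
      have bin: "b \<in> {a..e}" "\<bar>b - b\<bar> < min (min d1 d2) d3" using ab C1 C2 d3 by auto
      have V: "y s \<in> V" "y t \<in> V" "y b \<in> V" using d3(2) s t bin by auto
      have le: "\<bar>b - s\<bar> \<le> \<bar>t - s\<bar>" "\<bar>t - b\<bar> \<le> \<bar>t - s\<bar>" using False by linarith+
      let ?p = "\<bar>t - s\<bar> powr (2 * \<alpha>)" and ?q = "\<bar>t - s\<bar> powr \<alpha>"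
      have e1: "norm (?e ?F s b) \<le> ?C * \<bar>b - s\<bar> powr (2 * \<alpha>)" using s bin by (intro half) auto
      have e2: "norm (?e ?F b t) \<le> ?C * \<bar>t - b\<bar> powr (2 * \<alpha>)" using t bin by (intro half) auto
      have e12: "?C * \<bar>b - s\<bar> powr (2 * \<alpha>) \<le> ?C * ?p" "?C * \<bar>t - b\<bar> powr (2 * \<alpha>) \<le> ?C * ?p"
        using le alpha by (auto intro!: mult_left_mono powr_mono2)
      have zz: "norm (?z b - ?z s) \<le> C3 * ?q" "norm (?z t - ?z b) \<le> C3 * ?q"
      proof -
        have "norm (?z b - ?z s) \<le> C3 * \<bar>b - s\<bar> powr \<alpha>" "norm (?z t - ?z b) \<le> C3 * \<bar>t - b\<bar> powr \<alpha>"
          using d3(2) s t bin by auto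
        moreover have "C3 * \<bar>b - s\<bar> powr \<alpha> \<le> C3 * ?q" "C3 * \<bar>t - b\<bar> powr \<alpha> \<le> C3 * ?q"
          using le alpha C3(1) by (auto intro!: mult_left_mono powr_mono2)
        ultimately show "norm (?z b - ?z s) \<le> C3 * ?q" "norm (?z t - ?z b) \<le> C3 * ?q" by linarith+
      qed
      \<comment> \<open>The second piece is evaluated with the form at y b instead of y s; the
        difference is bounded by a product of two Hoelder increments.\<close>
      let ?D = "\<beta> (y b) (coord_vec A c (y b) (?z t - ?z b)) - \<beta> (y s) (coord_vec A c (y s) (?z t - ?z b))"
      have "\<bar>?D\<bar> \<le> K * norm (?z b - ?z s) * norm (?z t - ?z b)" by (rule K(6)[OF V(1) V(3)])
      also have "\<dots> \<le> K * (C3 * ?q) * (C3 * ?q)" using zz K(1) C3(1) by (intro mult_mono mult_left_mono) auto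
      also have "\<dots> = K * C3 * C3 * (?q * ?q)" by (simp only: mult_ac)
      also have "?q * ?q = ?p" by (simp flip: powr_add)
      finally have D: "\<bar>?D\<bar> \<le> K * C3 * C3 * ?p" .
      have "\<beta> (y s) (coord_vec A c (y s) (?z t - ?z s)) =
          \<beta> (y s) (coord_vec A c (y s) (?z b - ?z s)) + \<beta> (y s) (coord_vec A c (y s) (?z t - ?z b))"
        using linear_add[OF linear_form[OF c(1), of "y s"], of "?z b - ?z s" "?z t - ?z b"] V(1) K(4) by auto
      then have "?e ?F s t = ?e ?F s b + ?e ?F b t + ?D" by (simp only: algebra_simps)
      then have "\<bar>?e ?F s t\<bar> \<le> \<bar>?e ?F s b\<bar> + \<bar>?e ?F b t\<bar> + \<bar>?D\<bar>" by linarith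
      also have "\<dots> \<le> ?C * ?p + ?C * ?p + K * C3 * C3 * ?p"
        using e1 e2 e12 D unfolding real_norm_def by linarith
      also have "\<dots> = (2 * ?C + K * C3 * C3) * ?p" by (simp only: algebra_simps)
      finally show ?thesis unfolding real_norm_def .
    qed
    moreover have "min (min d1 d2) d3 > 0" using C1 C2 d3 by simp
    ultimately show ?thesis unfolding germO_def eventually_pairs fst_conv snd_conv 3 by blast
  qed
  with c show "\<exists>c\<in>A. y \<tau> \<in> fst c \<and> germO \<tau> {a..e} (2 * \<alpha>)
      (\<lambda>s t. ?F t - ?F s - \<beta> (y s) (coord_vec A c (y s) (snd c (y t) - snd c (y s))))" by blast
qed

text \<open>By \<open>Bolzano\<close>, existence near every time passes to the whole interval, since
  primitives can be concatenated.\<close>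

lemma prim_exists:
  assumes alpha: "1/2 < \<alpha>" "\<alpha> \<le> 1" and y: "lhol A \<alpha> {a..b} y" and "a \<le> b"
  shows "\<exists>F. prim A \<beta> \<alpha> {a..b} y F"
proof -
  define P where "P s t \<longleftrightarrow> (a \<le> s \<and> t \<le> b \<longrightarrow> (\<exists>F. prim A \<beta> \<alpha> {s..t} y F))" for s t
  have "P a b"
    using \<open>a \<le> b\<close>
  proof (induction rule: Bolzano)
    case (trans r s t)
    show ?case unfolding P_def
    proof
      assume rt: "a \<le> r \<and> t \<le> b"
      then obtain F1 F2 where "prim A \<beta> \<alpha> {r..s} y F1" "prim A \<beta> \<alpha> {s..t} y F2"
        using trans unfolding P_def by auto
      then show "\<exists>F. prim A \<beta> \<alpha> {r..t} y F"
        using prim_concat[OF lhol_subset[OF y] trans(3,4)] alpha rt by fastforce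
    qed
  next
    case (local \<tau>)
    then obtain d where "d > 0" "\<And>s t. a \<le> s \<and> s \<le> \<tau> \<and> \<tau> \<le> t \<and> t \<le> b \<and> t - s < d \<Longrightarrow> (\<exists>F. prim A \<beta> \<alpha> {s..t} y F)"
      using young_local[OF alpha y, of \<tau>] by (metis atLeastAtMost_iff)
    then show ?case unfolding P_def by blast
  qed
  then show ?thesis unfolding P_def by simp
qed

text \<open>Whatever charts and subdivisions a derivation of \<open>has_form_integral\<close> uses,
  its value is the increment of the primitive. In particular the value of the integral is
  unique.\<close>

lemma has_form_integral_prim:
  assumes alpha: "1/2 < \<alpha>"
  shows "has_form_integral A \<beta> y a b I \<Longrightarrow> lhol A \<alpha> {a..b} y \<Longrightarrow> prim A \<beta> \<alpha> {a..b} y F \<Longrightarrow> I = F b - F a"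
proof (induction rule: has_form_integral.induct)
  case (in_chart c a b I)
  let ?e = "\<lambda>s t. F t - F s - \<beta> (y s) (coord_vec A c (y s) (snd c (y t) - snd c (y s)))"
  have yc: "y t \<in> fst c" if "t \<in> {a..b}" for t using in_chart(3) that by blast
  \<comment> \<open>On a piece inside one chart the germs at all times refer to that chart, so
    compactness gives one constant, as Riemann-Stieltjes sums require.\<close>
  obtain C \<delta> where C: "C \<ge> 0" "\<delta> > 0" "\<And>s t. s \<in> {a..b} \<Longrightarrow> t \<in> {a..b} \<Longrightarrow> \<bar>t - s\<bar> < \<delta> \<Longrightarrow>
      norm (?e s t) \<le> C * \<bar>t - s\<bar> powr (2 * \<alpha>)"
    using germO_uniform[of a b "2 * \<alpha>" ?e] primD[OF in_chart(6) _ in_chart(1) yc] by blast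
  show ?case
  proof (rule has_RS_integral_sum_eq[of "2 * \<alpha>" \<delta> a b C])
    fix s t assume st: "s \<in> {a..b}" "t \<in> {a..b}" "\<bar>t - s\<bar> < \<delta>"
    show "\<bar>F t - F s - (\<Sum>i\<in>coord_basis. \<beta> (y s) (coord_vec A c (y s) i) * (crd (snd c (y t)) i - crd (snd c (y s)) i))\<bar>
        \<le> C * \<bar>t - s\<bar> powr (2 * \<alpha>)"
      using C(3)[OF st] unfolding form_expand[OF in_chart(1) yc[OF st(1)]] real_norm_def .
  qed (use in_chart alpha C in auto)
next
  case (join a b I c J)
  have le: "a \<le> b" "b \<le> c" using join has_form_integral_le by blast+
  have "I = F b - F a"
    by (rule join.IH(1)) (use le join.prems in \<open>auto intro: lhol_subset prim_subset\<close>)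
  moreover have "J = F c - F b"
    by (rule join.IH(2)) (use le join.prems in \<open>auto intro: lhol_subset prim_subset\<close>)
  ultimately show ?case by simp
qed

text \<open>Near each time \<open>young_local\<close> provides some primitive together with an
  integral; uniqueness of the value identifies its increment with that of F. The pieces are joined
  by \<open>Bolzano\<close>.\<close>

lemma prim_has_form_integral:
  assumes alpha: "1/2 < \<alpha>" "\<alpha> \<le> 1" and y: "lhol A \<alpha> {a..b} y" and "a \<le> b" and F: "prim A \<beta> \<alpha> {a..b} y F"
  shows "has_form_integral A \<beta> y a b (F b - F a)"
proof -
  define P where "P s t \<longleftrightarrow> (a \<le> s \<and> t \<le> b \<longrightarrow> has_form_integral A \<beta> y s t (F t - F s))" for s t
  have "P a b"
    using \<open>a \<le> b\<close>
  proof (induction rule: Bolzano)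
    case (trans r s t)
    then show ?case unfolding P_def
      using has_form_integral.join[of A \<beta> y r s "F s - F r" t "F t - F s"] by auto
  next
    case (local \<tau>)
    then obtain d where d: "d > 0" "\<And>s t. a \<le> s \<and> s \<le> \<tau> \<and> \<tau> \<le> t \<and> t \<le> b \<and> t - s < d \<Longrightarrow>
        (\<exists>F. prim A \<beta> \<alpha> {s..t} y F \<and> has_form_integral A \<beta> y s t (F t - F s))"
      using young_local[OF alpha y, of \<tau>] by (metis atLeastAtMost_iff)
    have "has_form_integral A \<beta> y s t (F t - F s)" if st: "a \<le> s \<and> s \<le> \<tau> \<and> \<tau> \<le> t \<and> t \<le> b \<and> t - s < d" for s t
    proof -
      obtain F' where F': "has_form_integral A \<beta> y s t (F' t - F' s)" using d(2)[OF st] by blast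
      have "F' t - F' s = F t - F s"
        by (rule has_form_integral_prim[OF alpha(1) F'])
          (use st in \<open>auto intro: lhol_subset[OF y] prim_subset[OF F]\<close>)
      with F' show ?thesis by simp
    qed
    then show ?case unfolding P_def using d(1) by blast
  qed
  then show ?thesis unfolding P_def by simp
qed

text \<open>A primitive exists, and by hypothesis its increments from a vanish. It is therefore
  constant, and 0 satisfies the same estimate.\<close>

lemma prim_zeroI:
  assumes alpha: "1/2 < \<alpha>" "\<alpha> \<le> 1" and y: "lhol A \<alpha> {a..b} y" and "a \<le> b"
    and int: "\<And>t. t \<in> {a..b} \<Longrightarrow> has_form_integral A \<beta> y a t 0"
  shows "prim A \<beta> \<alpha> {a..b} y (\<lambda>_. 0)"
proof -
  obtain F where F: "prim A \<beta> \<alpha> {a..b} y F" using prim_exists[OF alpha y \<open>a \<le> b\<close>] by blast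
  have Fa: "F t = F a" if "t \<in> {a..b}" for t
  proof -
    have "0 = F t - F a"
      by (rule has_form_integral_prim[OF alpha(1) int[OF that]])
        (use that in \<open>auto intro: lhol_subset[OF y] prim_subset[OF F]\<close>)
    then show ?thesis by simp
  qed
  show ?thesis
    unfolding prim_def
  proof (intro ballI impI)
    fix \<tau> c assume c: "\<tau> \<in> {a..b}" "c \<in> A" "y \<tau> \<in> fst c"
    show "germO \<tau> {a..b} (2 * \<alpha>) (\<lambda>s t. 0 - 0 - \<beta> (y s) (coord_vec A c (y s) (snd c (y t) - snd c (y s))))"
    proof (rule germO_cong[OF primD[OF F c]], rule eventually_mono[OF eventually_pairs_in])
      fix p assume "fst p \<in> {a..b} \<and> snd p \<in> {a..b}"
      then have "F (snd p) = F (fst p)" using Fa[of "fst p"] Fa[of "snd p"] by linarith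
      then show "0 - 0 - \<beta> (y (fst p)) (coord_vec A c (y (fst p)) (snd c (y (snd p)) - snd c (y (fst p)))) =
          F (snd p) - F (fst p) - \<beta> (y (fst p)) (coord_vec A c (y (fst p)) (snd c (y (snd p)) - snd c (y (fst p))))"
        by simp
    qed
  qed
qed

end

end

section \<open>Integrals along paths that agree on the interval of integration\<close>

lemma has_RS_integral_cong:
  assumes "has_RS_integral f h a b I" "\<And>t. t \<in> {a..b} \<Longrightarrow> f t = f' t \<and> h t = h' t"
  shows "has_RS_integral f' h' a b I"
  unfolding has_RS_integral_def
proof (intro allI impI)
  fix \<epsilon> :: real assume "\<epsilon> > 0"
  then obtain \<delta> where \<delta>: "\<delta> > 0" "\<And>(n::nat) t \<xi>. t 0 = a \<and> t n = b \<and>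
      (\<forall>k<n. t k \<le> \<xi> k \<and> \<xi> k \<le> t (Suc k) \<and> t (Suc k) - t k < \<delta>) \<Longrightarrow>
      \<bar>(\<Sum>k<n. f (\<xi> k) * (h (t (Suc k)) - h (t k))) - I\<bar> < \<epsilon>"
    using assms(1) unfolding has_RS_integral_def by blast
  show "\<exists>\<delta>>0. \<forall>n t \<xi>. t 0 = a \<and> t n = b \<and> (\<forall>k<n. t k \<le> \<xi> k \<and> \<xi> k \<le> t (Suc k) \<and> t (Suc k) - t k < \<delta>) \<longrightarrow>
      \<bar>(\<Sum>k<n. f' (\<xi> k) * (h' (t (Suc k)) - h' (t k))) - I\<bar> < \<epsilon>"
  proof (intro exI[of _ \<delta>] conjI allI impI)
    fix n :: nat and t \<xi> :: "nat \<Rightarrow> real"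
    assume P: "t 0 = a \<and> t n = b \<and> (\<forall>k<n. t k \<le> \<xi> k \<and> \<xi> k \<le> t (Suc k) \<and> t (Suc k) - t k < \<delta>)"
    then have mono: "t k \<le> t (Suc k)" if "k < n" for k using that order_trans by blast
    have tin: "t k \<in> {a..b}" if "k \<le> n" for k
      using partition_in[of t a n b k] P mono that by blast
    have "(\<Sum>k<n. f' (\<xi> k) * (h' (t (Suc k)) - h' (t k))) = (\<Sum>k<n. f (\<xi> k) * (h (t (Suc k)) - h (t k)))"
    proof (rule sum.cong[OF refl])
      fix k assume "k \<in> {..<n}"
      then have "t k \<in> {a..b}" "t (Suc k) \<in> {a..b}" "t k \<le> \<xi> k" "\<xi> k \<le> t (Suc k)"
        using tin[of k] tin[of "Suc k"] P by auto
      moreover from this have "\<xi> k \<in> {a..b}" by auto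
      ultimately show "f' (\<xi> k) * (h' (t (Suc k)) - h' (t k)) = f (\<xi> k) * (h (t (Suc k)) - h (t k))"
        using assms(2) by metis
    qed
    then show "\<bar>(\<Sum>k<n. f' (\<xi> k) * (h' (t (Suc k)) - h' (t k))) - I\<bar> < \<epsilon>" using \<delta>(2)[OF P] by simp
  qed (use \<delta> in auto)
qed

text \<open>Moves integrals from local lifts to the path that is glued from them.\<close>

lemma has_form_integral_cong:
  "has_form_integral A \<beta> y a b I \<Longrightarrow> (\<And>t. t \<in> {a..b} \<Longrightarrow> y t = y' t) \<Longrightarrow> has_form_integral A \<beta> y' a b I \<and> a \<le> b"
proof (induction rule: has_form_integral.induct)
  case (in_chart c a b I)
  have "y' ` {a..b} \<subseteq> fst c" using in_chart(3,5) by (metis image_cong)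
  moreover have "has_RS_integral (\<lambda>t. \<beta> (y' t) (coord_vec A c (y' t) i)) (\<lambda>t. crd (snd c (y' t)) i) a b (I i)"
    if "i \<in> coord_basis" for i
    by (rule has_RS_integral_cong[OF in_chart(4)[OF that]]) (simp add: in_chart(5))
  ultimately show ?case
    using has_form_integral.in_chart[OF in_chart(1,2), of y' \<beta> I] in_chart(2) by blast
next
  case (join a b I c J)
  have "a \<le> b" "b \<le> c" using join.hyps has_form_integral_le by blast+
  then show ?case using join has_form_integral.join[of A \<beta> y' a b I c J] by auto
qed

section \<open>The Riemannian distance in charts\<close>

text \<open>Equality on the interval says nothing about two-sided derivatives at its end points, so
  a and b join the finite exceptional set.\<close>

lemma piecewise_C1_cong:
  assumes f: "f piecewise_C1_differentiable_on {a..b}" and eq: "\<And>t. t \<in> {a..b} \<Longrightarrow> f t = g t"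
  shows "g piecewise_C1_differentiable_on {a..b::real}"
proof -
  obtain S D where S: "finite S" "\<And>t. t \<in> {a..b} - S \<Longrightarrow> (f has_vector_derivative D t) (at t)"
    "continuous_on ({a..b} - S) D"
    using f unfolding piecewise_C1_differentiable_on_def C1_differentiable_on_def by blast
  have "(g has_vector_derivative D t) (at t)" if t: "t \<in> {a..b} - (S \<union> {a, b})" for t
  proof -
    have op: "open {a<..<b}" "t \<in> {a<..<b}" using t by auto
    have "(f has_vector_derivative D t) (at t)" using S(2) t by blast
    then show ?thesis
      by (rule has_vector_derivative_transform_within_open[OF _ op]) (use eq in auto)
  qed
  moreover have "continuous_on ({a..b} - (S \<union> {a, b})) D" by (rule continuous_on_subset[OF S(3)]) auto
  ultimately have "g C1_differentiable_on ({a..b} - (S \<union> {a, b}))"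
    unfolding C1_differentiable_on_def by blast
  moreover have "continuous_on {a..b} g"
  proof -
    have "continuous_on {a..b} f = continuous_on {a..b} g" using eq by (intro continuous_on_cong) auto
    then show ?thesis using f unfolding piecewise_C1_differentiable_on_def by blast
  qed
  moreover have "finite (S \<union> {a, b})" using S(1) by simp
  ultimately show ?thesis unfolding piecewise_C1_differentiable_on_def by (intro conjI exI)
qed

lemma integral_speed_bound:
  fixes z :: "real \<Rightarrow> 'e::finite_dim_normed"
  assumes "s \<le> t" "m \<ge> 0" "continuous_on {s..t} z" "finite S"
    and der: "\<And>r. r \<in> {s<..<t} - S \<Longrightarrow> (z has_vector_derivative D r) (at r)"
    and le: "\<And>r. r \<in> {s<..<t} - S \<Longrightarrow> m * norm (D r) \<le> v r" and v: "v integrable_on {s..t}"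
  shows "m * norm (z t - z s) \<le> integral {s..t} v"
proof -
  have D: "(D has_integral (z t - z s)) {s..t}"
    by (rule fundamental_theorem_of_calculus_interior_strong[OF \<open>finite S\<close> \<open>s \<le> t\<close> der assms(3)])
  have mD: "((\<lambda>r. m *\<^sub>R D r) has_integral m *\<^sub>R (z t - z s)) {s..t}" by (rule has_integral_cmul[OF D])
  let ?S = "S \<union> {s, t}"
  define w where "w r = (if r \<in> ?S then norm (m *\<^sub>R D r) else v r)" for r
  have eq: "w r = v r" if "r \<in> {s..t} - ?S" for r using that by (simp add: w_def)
  have fin: "finite ?S" using \<open>finite S\<close> by simp
  have w: "w integrable_on {s..t}" by (rule integrable_spike_finite[OF fin eq v])
  have "norm (integral {s..t} (\<lambda>r. m *\<^sub>R D r)) \<le> integral {s..t} w"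
  proof (rule integral_norm_bound_integral[OF _ w])
    show "(\<lambda>r. m *\<^sub>R D r) integrable_on {s..t}" using mD by blast
    show "norm (m *\<^sub>R D r) \<le> w r" if "r \<in> {s..t}" for r
      using le[of r] that \<open>m \<ge> 0\<close> by (auto simp: w_def)
  qed
  also have "integral {s..t} (\<lambda>r. m *\<^sub>R D r) = m *\<^sub>R (z t - z s)" using mD by (rule integral_unique)
  also have "integral {s..t} w = integral {s..t} v"
    by (rule integral_spike[OF negligible_finite[OF fin], symmetric]) (use eq in auto)
  finally show ?thesis using \<open>m \<ge> 0\<close> by simp
qed

context
  fixes A :: "('a::t2_space, 'e::finite_dim_normed) chart set"
    and g :: "'a \<Rightarrow> 'a tangent \<Rightarrow> 'a tangent \<Rightarrow> real"
  assumes A: "smooth_atlas A" and g: "riemannian_metric A g"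
begin

section \<open>The metric tensor in a chart\<close>

definition gram :: "('a, 'e) chart \<Rightarrow> 'a \<Rightarrow> 'e \<Rightarrow> 'e \<Rightarrow> real" where
  "gram c p v w = g p (coord_vec A c p v) (coord_vec A c p w)"

lemma gram_sym: "c \<in> A \<Longrightarrow> p \<in> fst c \<Longrightarrow> gram c p v w = gram c p w v"
  unfolding gram_def using g coord_vec_in[OF A] unfolding riemannian_metric_def by blast

lemma metric_linear: "X \<in> tangent_space A p \<Longrightarrow> linear_functional_on (tangent_space A p) (g p X)"
  using g unfolding riemannian_metric_def by blast

lemma gram_linear: "c \<in> A \<Longrightarrow> p \<in> fst c \<Longrightarrow> linear (gram c p v)"
proof (rule linearI)
  fix w w' and r :: real assume c: "c \<in> A" "p \<in> fst c"
  note l = metric_linear[OF coord_vec_in[OF A c], of v]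
  show "gram c p v (w + w') = gram c p v w + gram c p v w'"
    using l coord_vec_in[OF A c] coord_vec_add[OF A c, of w w'] unfolding linear_functional_on_def gram_def by metis
  show "gram c p v (r *\<^sub>R w) = r *\<^sub>R gram c p v w"
    using l coord_vec_in[OF A c] coord_vec_scale[OF A c, of r w] unfolding linear_functional_on_def gram_def
    by (metis real_scaleR_def)
qed

lemma gram_linear': "c \<in> A \<Longrightarrow> p \<in> fst c \<Longrightarrow> linear (\<lambda>v. gram c p v w)"
  using gram_linear[of c p w] gram_sym[of c p _ w] by (metis (no_types, lifting) ext)

lemma gram_pos: "c \<in> A \<Longrightarrow> p \<in> fst c \<Longrightarrow> v \<noteq> 0 \<Longrightarrow> gram c p v v > 0"
proof -
  assume c: "c \<in> A" "p \<in> fst c" "v \<noteq> 0"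
  have "coord_vec A c p v \<noteq> (\<lambda>_. 0)"
    using cvec_coord_vec[OF A c(1,2), of v] cvec_coord_vec[OF A c(1,2), of 0] coord_vec_zero[OF A c(1,2)] c(3) by metis
  then show ?thesis unfolding gram_def using g coord_vec_in[OF A c(1,2)] unfolding riemannian_metric_def by blast
qed

lemma gram_nonneg: "c \<in> A \<Longrightarrow> p \<in> fst c \<Longrightarrow> gram c p v v \<ge> 0"
  using gram_pos[of c p v] linear_0[OF gram_linear[of c p 0]] by (cases "v = 0") auto

lemma gram_smooth: "c \<in> A \<Longrightarrow> smooth_on (snd c ` fst c) (\<lambda>z. gram c (inv_chart c z) v w)"
  using g unfolding riemannian_metric_def gram_def by blast

lemma metric_self_scale:
  assumes "X \<in> tangent_space A p" shows "g p (\<lambda>f. k * X f) (\<lambda>f. k * X f) = k * k * g p X X"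
proof -
  have kX: "(\<lambda>f. k * X f) \<in> tangent_space A p" by (rule tangent_scale[OF A assms])
  have "g p (\<lambda>f. k * X f) (\<lambda>f. k * X f) = k * g p (\<lambda>f. k * X f) X"
    using metric_linear[OF kX] assms unfolding linear_functional_on_def by blast
  also have "g p (\<lambda>f. k * X f) X = g p X (\<lambda>f. k * X f)"
    using g kX assms unfolding riemannian_metric_def by blast
  also have "\<dots> = k * g p X X" using metric_linear[OF assms] assms unfolding linear_functional_on_def by blast
  finally show ?thesis by simp
qed

lemma speed_chart:
  assumes "c \<in> A" "\<gamma> t \<in> fst c" "isCont \<gamma> t" "((\<lambda>s. snd c (\<gamma> s)) has_vector_derivative w) (at t)"
  shows "speed A g \<gamma> t = sqrt (gram c (\<gamma> t) w w)"
  using velocity_eq[OF A has_velocity_chart[OF A assms]] by (simp add: speed_def gram_def)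

text \<open>The quadratic form is continuous and positive on the compact product of K and the unit
  sphere, hence lies between two positive numbers there; homogeneity extends this to all
  vectors.\<close>

lemma gram_bounds:
  assumes c: "c \<in> A" and K: "compact K" "K \<subseteq> snd c ` fst c"
  shows "\<exists>m>0. \<forall>z\<in>K. \<forall>v. m * norm v \<le> sqrt (gram c (inv_chart c z) v v)"
    and "\<exists>M\<ge>0. \<forall>z\<in>K. \<forall>v. sqrt (gram c (inv_chart c z) v v) \<le> M * norm v"
proof -
  let ?G = "\<lambda>z. gram c (inv_chart c z)"
  have inv: "inv_chart c z \<in> fst c" if "z \<in> K" for z using K(2) that by (auto simp: inv_into_into)
  have cont: "continuous_on K (\<lambda>z. ?G z v w)" for v w
    using smooth_on_continuous[OF gram_smooth[OF c]] K(2) continuous_on_subset by blast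
  have expand: "?G z v v = (\<Sum>i\<in>coord_basis. \<Sum>j\<in>coord_basis. crd v i * (crd v j * ?G z i j))" if "z \<in> K" for z v
    by (subst linear_expand[OF gram_linear'[OF c inv[OF that]]], subst linear_expand[OF gram_linear[OF c inv[OF that]]])
      (simp add: sum_distrib_left)
  \<comment> \<open>Smoothness of the metric gives continuity in the point for fixed vectors. Joint
    continuity follows from the expansion in the basis.\<close>
  have cont2: "continuous_on (K \<times> sphere 0 1) (\<lambda>q. ?G (fst q) (snd q) (snd q))"
  proof -
    have "continuous_on (K \<times> sphere 0 1) (\<lambda>q. \<Sum>i\<in>coord_basis. \<Sum>j\<in>coord_basis.
        crd (snd q) i * (crd (snd q) j * ?G (fst q) i j))"
      by (intro continuous_on_sum continuous_on_mult bounded_linear.continuous_on[OF bounded_linear_crd]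
          continuous_on_snd continuous_on_compose2[OF cont] continuous_on_fst continuous_on_id) auto
    then show ?thesis
      by (rule continuous_on_eq) (simp add: expand mem_Times_iff)
  qed
  have scale: "?G z v v = (norm v)\<^sup>2 * ?G z (v /\<^sub>R norm v) (v /\<^sub>R norm v)" if "z \<in> K" "v \<noteq> 0" for z v
  proof -
    define u k where "u = v /\<^sub>R norm v" and "k = norm v"
    have "?G z (k *\<^sub>R u) (k *\<^sub>R u) = k * ?G z (k *\<^sub>R u) u"
      using linear_scale[OF gram_linear[OF c inv[OF that(1)]]] by (simp only: real_scaleR_def)
    also have "?G z (k *\<^sub>R u) u = k * ?G z u u"
      using linear_scale[OF gram_linear'[OF c inv[OF that(1)]]] by (simp only: real_scaleR_def)
    finally have "?G z (k *\<^sub>R u) (k *\<^sub>R u) = k\<^sup>2 * ?G z u u" by (simp add: power2_eq_square)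
    moreover have "k *\<^sub>R u = v" using that(2) by (simp add: u_def k_def)
    ultimately show ?thesis by (simp add: u_def k_def)
  qed
  have sph: "v /\<^sub>R norm v \<in> sphere 0 1" if "v \<noteq> 0" for v :: 'e using that by simp
  have zero: "?G z 0 0 = 0" if "z \<in> K" for z using linear_0[OF gram_linear[OF c inv[OF that]]] .
  have "\<exists>\<mu>>0. \<exists>M\<ge>0. \<forall>z\<in>K. \<forall>v\<in>sphere 0 1. \<mu> \<le> ?G z v v \<and> ?G z v v \<le> M"
  proof (cases "K \<times> (sphere 0 1 :: 'e set) = {}")
    \<comment> \<open>K is empty or the model space has dimension 0, where the unit sphere is
      empty.\<close>
    case True
    then show ?thesis by (intro exI[of _ 1]) auto
  next
    case False
    have "compact (cball 0 1 \<inter> {v :: 'e. norm v = 1})"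
      by (intro compact_Int_closed compact_cball closed_Collect_eq continuous_intros)
    moreover have "cball 0 1 \<inter> {v :: 'e. norm v = 1} = sphere 0 1" by auto
    ultimately have comp: "compact (K \<times> (sphere 0 1 :: 'e set))"
      using K(1) by (intro compact_Times) auto
    obtain q where q: "q \<in> K \<times> sphere 0 1" "\<forall>q'\<in>K \<times> sphere 0 1. ?G (fst q) (snd q) (snd q) \<le> ?G (fst q') (snd q') (snd q')"
      using continuous_attains_inf[OF comp False cont2] by blast
    obtain u where u: "u \<in> K \<times> sphere 0 1" "\<forall>q'\<in>K \<times> sphere 0 1. ?G (fst q') (snd q') (snd q') \<le> ?G (fst u) (snd u) (snd u)"
      using continuous_attains_sup[OF comp False cont2] by blast
    have "?G (fst q) (snd q) (snd q) > 0" "?G (fst u) (snd u) (snd u) > 0"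
      using q(1) u(1) inv by (auto intro!: gram_pos[OF c] simp: mem_Times_iff)
    moreover have "?G (fst q) (snd q) (snd q) \<le> ?G z v v \<and> ?G z v v \<le> ?G (fst u) (snd u) (snd u)"
      if "z \<in> K" "v \<in> sphere 0 1" for z v
      using bspec[OF q(2), of "(z, v)"] bspec[OF u(2), of "(z, v)"] that by simp
    ultimately show ?thesis by (meson less_imp_le)
  qed
  then obtain \<mu> M where \<mu>: "\<mu> > 0" "M \<ge> 0" and b: "\<And>z v. z \<in> K \<Longrightarrow> v \<in> sphere 0 1 \<Longrightarrow> \<mu> \<le> ?G z v v \<and> ?G z v v \<le> M"
    by auto
  have "sqrt \<mu> * norm v \<le> sqrt (?G z v v) \<and> sqrt (?G z v v) \<le> sqrt M * norm v" if z: "z \<in> K" for z v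
  proof (cases "v = 0")
    case False
    have "sqrt (?G z v v) = norm v * sqrt (?G z (v /\<^sub>R norm v) (v /\<^sub>R norm v))"
      by (subst scale[OF z False]) (simp add: real_sqrt_mult)
    then show ?thesis using b[OF z sph[OF False]] by (simp add: mult.commute[of _ "norm v"] mult_left_mono)
  qed (simp add: zero[OF z])
  then show "\<exists>m>0. \<forall>z\<in>K. \<forall>v. m * norm v \<le> sqrt (?G z v v)" "\<exists>M\<ge>0. \<forall>z\<in>K. \<forall>v. sqrt (?G z v v) \<le> M * norm v"
    using \<mu> by (meson real_sqrt_gt_zero real_sqrt_ge_zero)+
qed

section \<open>Comparison of the Riemannian distance with chart norms\<close>

lemma curve_isCont: "continuous_on {0..1} \<gamma> \<Longrightarrow> 0 < r \<Longrightarrow> r < (1::real) \<Longrightarrow> isCont \<gamma> r"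
  using continuous_on_interior[of "{0..1}" \<gamma> r] by (simp add: interior_atLeastAtMost_real)

lemma curve_chart:
  assumes \<gamma>: "piecewise_C1_curve A g \<gamma>" and st: "0 \<le> s" "s \<le> t" "t \<le> 1" and c: "c \<in> A" "\<gamma> ` {s..t} \<subseteq> fst c"
  obtains S D where "finite S" "continuous_on {s..t} (\<lambda>r. snd c (\<gamma> r))"
    "\<And>r. r \<in> {s<..<t} - S \<Longrightarrow> ((\<lambda>r. snd c (\<gamma> r)) has_vector_derivative D r) (at r)"
    "\<And>r. r \<in> {s<..<t} - S \<Longrightarrow> isCont \<gamma> r"
proof -
  have cont: "continuous_on {0..1} \<gamma>" using \<gamma> unfolding piecewise_C1_curve_def by blast
  have "(\<lambda>r. snd c (\<gamma> r)) piecewise_C1_differentiable_on {s..t}"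
    using \<gamma> st c unfolding piecewise_C1_curve_def by blast
  then obtain S D where S: "finite S" "continuous_on {s..t} (\<lambda>r. snd c (\<gamma> r))"
    "\<And>r. r \<in> {s..t} - S \<Longrightarrow> ((\<lambda>r. snd c (\<gamma> r)) has_vector_derivative D r) (at r)"
    unfolding piecewise_C1_differentiable_on_def C1_differentiable_on_def by blast
  show ?thesis
    by (rule that[OF S(1,2), of D]) (use S(3) st curve_isCont[OF cont] in auto)
qed

lemma speed_chart_bound:
  assumes \<gamma>: "piecewise_C1_curve A g \<gamma>" and st: "0 \<le> s" "s \<le> t" "t \<le> 1" and c: "c \<in> A" "\<gamma> ` {s..t} \<subseteq> fst c"
    and m: "m \<ge> 0" "\<And>r v. r \<in> {s..t} \<Longrightarrow> m * norm v \<le> sqrt (gram c (\<gamma> r) v v)"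
  shows "m * norm (snd c (\<gamma> t) - snd c (\<gamma> s)) \<le> integral {s..t} (speed A g \<gamma>)"
proof (rule curve_chart[OF \<gamma> st c])
  fix S D assume S: "finite S" "continuous_on {s..t} (\<lambda>r. snd c (\<gamma> r))"
    "\<And>r. r \<in> {s<..<t} - S \<Longrightarrow> ((\<lambda>r. snd c (\<gamma> r)) has_vector_derivative D r) (at r)"
    "\<And>r. r \<in> {s<..<t} - S \<Longrightarrow> isCont \<gamma> r"
  have "speed A g \<gamma> integrable_on {0..1}" using \<gamma> unfolding piecewise_C1_curve_def by blast
  then have int: "speed A g \<gamma> integrable_on {s..t}" by (rule integrable_subinterval_real) (use st in auto)
  show ?thesis
  proof (rule integral_speed_bound[OF st(2) m(1) S(2,1,3) _ int])
    fix r assume r: "r \<in> {s<..<t} - S"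
    then have "\<gamma> r \<in> fst c" using c(2) by auto
    from speed_chart[where \<gamma>=\<gamma>, OF c(1) this S(4)[OF r] S(3)[OF r]]
    show "m * norm (D r) \<le> speed A g \<gamma> r" using m(2)[of r "D r"] r by simp
  qed
qed

lemma curve_near:
  fixes \<gamma> :: "real \<Rightarrow> 'a"
  assumes \<gamma>: "continuous_on {0..1} \<gamma>" and t: "t \<in> {0..1}" and W: "open W" "\<gamma> t \<in> W"
  shows "\<exists>d>0. \<forall>a b. 0 \<le> a \<and> a \<le> t \<and> t \<le> b \<and> b \<le> 1 \<and> b - a < d \<longrightarrow> \<gamma> ` {a..b} \<subseteq> W"
proof -
  obtain d where d: "d > 0" "\<And>s. s \<in> {0..1} \<Longrightarrow> \<bar>s - t\<bar> < d \<Longrightarrow> \<gamma> s \<in> W"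
    using eventually_pairs_continuous[OF \<gamma> t W] unfolding eventually_pairs fst_conv snd_conv by blast
  show ?thesis by (intro exI[of _ d]) (use d in auto)
qed

text \<open>\<open>\<Phi>\<close> is the coordinate distance from zp, cut off at r, and thereby
  defined on the whole manifold. Near each time the curve is either inside the large chart ball,
  where its speed dominates m times its coordinate speed, or outside the small one, where \<Phi> is
  constant. A curve from the centre that leaves the chart therefore has length at least m *
  r.\<close>

lemma integral_speed_lower:
  assumes c: "c \<in> A" and r: "r > 0" and ball: "cball z0 (2 * r) \<subseteq> snd c ` fst c"
    and m: "m \<ge> 0" "\<And>z v. z \<in> cball z0 (2 * r) \<Longrightarrow> m * norm v \<le> sqrt (gram c (inv_chart c z) v v)"
    and p: "dist z0 zp < r" and \<gamma>: "piecewise_C1_curve A g \<gamma>"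
    and \<Phi>: "\<Phi> = (\<lambda>q. if q \<in> fst c then min (norm (snd c q - zp)) r else r)"
  shows "m * \<bar>\<Phi> (\<gamma> 1) - \<Phi> (\<gamma> 0)\<bar> \<le> integral {0..1} (speed A g \<gamma>)"
proof -
  have cont: "continuous_on {0..1} \<gamma>" using \<gamma> unfolding piecewise_C1_curve_def by blast
  have int: "speed A g \<gamma> integrable_on {0..1}" using \<gamma> unfolding piecewise_C1_curve_def by blast
  define P where "P s t \<longleftrightarrow> (0 \<le> s \<and> t \<le> 1 \<longrightarrow> m * \<bar>\<Phi> (\<gamma> t) - \<Phi> (\<gamma> s)\<bar> \<le> integral {s..t} (speed A g \<gamma>))" for s t
  have "(0::real) \<le> 1" by simp
  then have "P 0 1"
  proof (induction rule: Bolzano)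
    case (trans a b d)
    show ?case unfolding P_def
    proof
      assume ad: "0 \<le> a \<and> d \<le> 1"
      have "integral {a..b} (speed A g \<gamma>) + integral {b..d} (speed A g \<gamma>) = integral {a..d} (speed A g \<gamma>)"
        by (rule Henstock_Kurzweil_Integration.integral_combine[OF trans(3,4)], rule integrable_subinterval_real[OF int]) (use ad in auto)
      moreover have "m * \<bar>\<Phi> (\<gamma> d) - \<Phi> (\<gamma> a)\<bar> \<le> m * \<bar>\<Phi> (\<gamma> b) - \<Phi> (\<gamma> a)\<bar> + m * \<bar>\<Phi> (\<gamma> d) - \<Phi> (\<gamma> b)\<bar>"
        unfolding distrib_left[symmetric] using m(1) by (intro mult_left_mono) auto
      ultimately show "m * \<bar>\<Phi> (\<gamma> d) - \<Phi> (\<gamma> a)\<bar> \<le> integral {a..d} (speed A g \<gamma>)"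
        using trans ad unfolding P_def by auto
    qed
  next
    case (local t0)
    then have t0: "t0 \<in> {0..1}" by simp
    show ?case
    proof (cases "\<gamma> t0 \<in> fst c \<inter> snd c -` ball z0 (2 * r)")
      case True
      obtain d where d: "d > 0" "\<And>a b. 0 \<le> a \<and> a \<le> t0 \<and> t0 \<le> b \<and> b \<le> 1 \<and> b - a < d \<Longrightarrow>
          \<gamma> ` {a..b} \<subseteq> fst c \<inter> snd c -` ball z0 (2 * r)"
        using curve_near[OF cont t0 chart_preimage_open[OF A c open_ball] True] by blast
      have "P a b" if ab: "a \<le> t0 \<and> t0 \<le> b \<and> b - a < d" for a b
        unfolding P_def
      proof
        assume ab01: "0 \<le> a \<and> b \<le> 1"
        have sub: "\<gamma> ` {a..b} \<subseteq> fst c \<inter> snd c -` ball z0 (2 * r)" using d(2) ab ab01 by blast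
        have ends: "\<gamma> a \<in> fst c" "\<gamma> b \<in> fst c" using sub ab by auto
        have "m * norm (snd c (\<gamma> b) - snd c (\<gamma> a)) \<le> integral {a..b} (speed A g \<gamma>)"
        proof (rule speed_chart_bound[OF \<gamma> _ _ _ c])
          fix q v assume "q \<in> {a..b}"
          then have "\<gamma> q \<in> fst c \<inter> snd c -` ball z0 (2 * r)" using sub by blast
          then have "snd c (\<gamma> q) \<in> cball z0 (2 * r)" "\<gamma> q \<in> fst c" by auto
          from m(2)[OF this(1), of v] show "m * norm v \<le> sqrt (gram c (\<gamma> q) v v)"
            using chart_inv[OF A c \<open>\<gamma> q \<in> fst c\<close>] by simp
        qed (use ab ab01 sub m in auto)
        moreover have "\<bar>\<Phi> (\<gamma> b) - \<Phi> (\<gamma> a)\<bar> \<le> norm (snd c (\<gamma> b) - snd c (\<gamma> a))"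
        proof -
          have "\<bar>min x r - min x' r\<bar> \<le> \<bar>x - x'\<bar>" for x x' :: real by (auto simp: min_def)
          then have "\<bar>\<Phi> (\<gamma> b) - \<Phi> (\<gamma> a)\<bar> \<le> \<bar>norm (snd c (\<gamma> b) - zp) - norm (snd c (\<gamma> a) - zp)\<bar>"
            using ends unfolding \<Phi> by simp
          also have "\<dots> \<le> norm (snd c (\<gamma> b) - snd c (\<gamma> a))"
            using norm_triangle_ineq3[of "snd c (\<gamma> b) - zp" "snd c (\<gamma> a) - zp"] by simp
          finally show ?thesis .
        qed
        ultimately show "m * \<bar>\<Phi> (\<gamma> b) - \<Phi> (\<gamma> a)\<bar> \<le> integral {a..b} (speed A g \<gamma>)"
          using m(1) mult_left_mono order_trans by blast
      qed
      then show ?thesis using d(1) by blast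
    next
      case False
      \<comment> \<open>This set is compact, hence closed in a Hausdorff space, so a curve that is
        outside it at t0 stays outside for a while.\<close>
      let ?K = "inv_chart c ` cball zp r"
      have sub: "cball zp r \<subseteq> cball z0 (2 * r)"
      proof
        fix z assume "z \<in> cball zp r"
        then show "z \<in> cball z0 (2 * r)" using p dist_triangle[of z0 z zp] by (simp add: dist_commute)
      qed
      have "compact ?K"
        by (rule compact_continuous_image[OF continuous_on_subset[OF chart_inv_cont[OF A c]] compact_cball])
          (use sub ball in auto)
      then have oK: "open (- ?K)" using compact_imp_closed by auto
      have nK: "\<gamma> t0 \<in> - ?K"
      proof
        assume "\<gamma> t0 \<in> ?K"
        then obtain z where z: "z \<in> cball zp r" "\<gamma> t0 = inv_chart c z" by blast
        then have "z \<in> snd c ` fst c" using sub ball by blast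
        then have "\<gamma> t0 \<in> fst c" "snd c (\<gamma> t0) = z" using z(2) by (auto simp: inv_into_into f_inv_into_f)
        moreover have "z \<in> ball z0 (2 * r)"
          using z(1) p dist_triangle[of z0 z zp] by (simp add: dist_commute)
        ultimately show False using False by simp
      qed
      obtain c' where c': "c' \<in> A" "\<gamma> t0 \<in> fst c'" using chart_cover[OF A] by blast
      have "open (fst c' \<inter> - ?K)" "\<gamma> t0 \<in> fst c' \<inter> - ?K" using oK nK c' chart_open(1)[OF A c'(1)] by (blast intro: open_Int)+
      from curve_near[OF cont t0 this] obtain d where d: "d > 0"
        "\<And>a b. 0 \<le> a \<and> a \<le> t0 \<and> t0 \<le> b \<and> b \<le> 1 \<and> b - a < d \<Longrightarrow> \<gamma> ` {a..b} \<subseteq> fst c' \<inter> - ?K" by blast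
      have \<Phi>r: "\<Phi> q = r" if "q \<notin> ?K" for q
      proof (cases "q \<in> fst c")
        case True
        then have "snd c q \<notin> cball zp r" using that chart_inv[OF A c True] by (metis imageI)
        then show ?thesis using True unfolding \<Phi> by (simp add: dist_norm norm_minus_commute)
      qed (simp add: \<Phi>)
      have "P a b" if ab: "a \<le> t0 \<and> t0 \<le> b \<and> b - a < d" for a b
        unfolding P_def
      proof
        assume ab01: "0 \<le> a \<and> b \<le> 1"
        have sub: "\<gamma> ` {a..b} \<subseteq> fst c' \<inter> - ?K" using d(2) ab ab01 by blast
        \<comment> \<open>The factor 0 turns the chart bound into nonnegativity of the integral of
          the speed, which is known to be a chart expression only off finitely many times.\<close>
        have "0 * norm (snd c' (\<gamma> b) - snd c' (\<gamma> a)) \<le> integral {a..b} (speed A g \<gamma>)"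
        proof (rule speed_chart_bound[OF \<gamma> _ _ _ c'(1)])
          fix q v assume "q \<in> {a..b}"
          then have "\<gamma> q \<in> fst c'" using sub by blast
          then show "0 * norm v \<le> sqrt (gram c' (\<gamma> q) v v)" using gram_nonneg[OF c'(1)] by simp
        qed (use ab ab01 sub in auto)
        moreover have "\<gamma> a \<notin> ?K" "\<gamma> b \<notin> ?K" using sub ab by (auto simp: image_subset_iff)
        then have "\<Phi> (\<gamma> a) = r" "\<Phi> (\<gamma> b) = r" using \<Phi>r by blast+
        ultimately show "m * \<bar>\<Phi> (\<gamma> b) - \<Phi> (\<gamma> a)\<bar> \<le> integral {a..b} (speed A g \<gamma>)" by simp
      qed
      then show ?thesis using d(1) by blast
    qed
  qed
  then show ?thesis unfolding P_def by simp
qed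

text \<open>Half of a coordinate ball around p0 is reserved for the points p, so that a ball of
  radius r about each p still lies in the chart. A distance below m * r forces q into this ball by
  \<open>integral_speed_lower\<close>.\<close>

lemma riemannian_dist_lower:
  assumes c: "c \<in> A" "p0 \<in> fst c"
  obtains r m where "r > 0" "m > 0"
    "\<And>p q. p \<in> fst c \<Longrightarrow> dist (snd c p0) (snd c p) < r \<Longrightarrow> riemannian_dist A g p q < ereal (m * r) \<Longrightarrow>
      q \<in> fst c \<and> ereal (m * norm (snd c q - snd c p)) \<le> riemannian_dist A g p q"
proof -
  obtain R where R: "R > 0" "cball (snd c p0) R \<subseteq> snd c ` fst c"
    using chart_open(2)[OF A c(1)] c(2) open_contains_cball by (metis imageI)
  define r where "r = R / 2"
  have r: "r > 0" "cball (snd c p0) (2 * r) \<subseteq> snd c ` fst c" using R by (auto simp: r_def)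
  obtain m where m: "m > 0" "\<And>z v. z \<in> cball (snd c p0) (2 * r) \<Longrightarrow> m * norm v \<le> sqrt (gram c (inv_chart c z) v v)"
    using gram_bounds(1)[OF c(1) compact_cball r(2)] by blast
  show ?thesis
  proof (rule that[OF r(1) m(1)])
    fix p q assume p: "p \<in> fst c" "dist (snd c p0) (snd c p) < r" and d: "riemannian_dist A g p q < ereal (m * r)"
    define \<Phi> where "\<Phi> = (\<lambda>q. if q \<in> fst c then min (norm (snd c q - snd c p)) r else r)"
    have "ereal (m * \<Phi> q) \<le> riemannian_dist A g p q"
      unfolding riemannian_dist_def le_INF_iff
    proof
      fix \<gamma> assume \<gamma>: "\<gamma> \<in> {\<gamma>. piecewise_C1_curve A g \<gamma> \<and> \<gamma> 0 = p \<and> \<gamma> 1 = q}"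
      then have "m * \<bar>\<Phi> (\<gamma> 1) - \<Phi> (\<gamma> 0)\<bar> \<le> integral {0..1} (speed A g \<gamma>)"
        by (intro integral_speed_lower[OF c(1) r less_imp_le[OF m(1)] m(2) p(2) _ \<Phi>_def]) auto
      moreover have "\<Phi> p = 0" "\<Phi> q \<ge> 0" using p(1) r(1) by (auto simp: \<Phi>_def)
      ultimately show "ereal (m * \<Phi> q) \<le> ereal (integral {0..1} (speed A g \<gamma>))" using \<gamma> by simp
    qed
    moreover from this d have "ereal (m * \<Phi> q) < ereal (m * r)" by (rule le_less_trans)
    then have "\<Phi> q < r" using m(1) by simp
    then have "q \<in> fst c" "\<Phi> q = norm (snd c q - snd c p)" by (auto simp: \<Phi>_def split: if_splits)
    ultimately show "q \<in> fst c \<and> ereal (m * norm (snd c q - snd c p)) \<le> riemannian_dist A g p q" by simp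
  qed
qed

text \<open>A bound on distances does not presuppose continuity of the path. The lower bound on the
  distance supplies both: the path stays in a chart for a short time, and its coordinates are
  Hoelder there.\<close>

lemma holder_path_lhol:
  assumes y: "holder_path A g \<alpha> I y" and \<alpha>: "\<alpha> > 0"
  shows "lhol A \<alpha> I y"
proof -
  obtain C0 where C0: "\<And>s t. s \<in> I \<Longrightarrow> t \<in> I \<Longrightarrow> riemannian_dist A g (y s) (y t) \<le> ereal (C0 * \<bar>t - s\<bar> powr \<alpha>)"
    using y unfolding holder_path_def by blast
  define C where "C = max C0 0"
  have C: "C \<ge> 0" "\<And>s t. s \<in> I \<Longrightarrow> t \<in> I \<Longrightarrow> riemannian_dist A g (y s) (y t) \<le> ereal (C * \<bar>t - s\<bar> powr \<alpha>)"
    unfolding C_def using C0 by (auto intro!: order_trans[OF C0] mult_right_mono)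
  have key: "\<exists>d>0. \<exists>M. \<forall>s\<in>I. \<forall>t\<in>I. \<bar>s - \<tau>\<bar> < d \<longrightarrow> \<bar>t - \<tau>\<bar> < d \<longrightarrow>
      y s \<in> fst c \<and> y t \<in> fst c \<and> norm (snd c (y t) - snd c (y s)) \<le> M * \<bar>t - s\<bar> powr \<alpha>"
    if \<tau>: "\<tau> \<in> I" and c: "c \<in> A" "y \<tau> \<in> fst c" for \<tau> c
  proof (rule riemannian_dist_lower[OF c])
    fix r m :: real assume r: "r > 0" "m > 0"
      and low: "\<And>p q. p \<in> fst c \<Longrightarrow> dist (snd c (y \<tau>)) (snd c p) < r \<Longrightarrow> riemannian_dist A g p q < ereal (m * r) \<Longrightarrow>
        q \<in> fst c \<and> ereal (m * norm (snd c q - snd c p)) \<le> riemannian_dist A g p q"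
    \<comment> \<open>Within time e the distance stays below m * r, the threshold of
      \<open>riemannian_dist_lower\<close>.\<close>
    obtain e where e: "e > 0" "C * e powr \<alpha> < m * r" using small_powr[OF \<alpha> _ C(1) zero_less_one, of "m * r"] r by auto
    have step: "y t \<in> fst c \<and> m * norm (snd c (y t) - snd c (y s)) \<le> C * \<bar>t - s\<bar> powr \<alpha>"
      if "s \<in> I" "t \<in> I" "\<bar>t - s\<bar> < e" "y s \<in> fst c" "dist (snd c (y \<tau>)) (snd c (y s)) < r" for s t
    proof -
      have "C * \<bar>t - s\<bar> powr \<alpha> \<le> C * e powr \<alpha>" using that C(1) \<alpha> by (intro mult_left_mono powr_mono2) auto
      then have "riemannian_dist A g (y s) (y t) < ereal (m * r)"
        using e(2) by (intro le_less_trans[OF C(2)[OF that(1,2)]]) simp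
      from low[OF that(4,5) this]
      have l: "y t \<in> fst c" "ereal (m * norm (snd c (y t) - snd c (y s))) \<le> riemannian_dist A g (y s) (y t)"
        by blast+
      from order_trans[OF l(2) C(2)[OF that(1,2)]] l(1) show ?thesis by simp
    qed
    have near: "y s \<in> fst c \<and> dist (snd c (y \<tau>)) (snd c (y s)) < r" if "s \<in> I" "\<bar>s - \<tau>\<bar> < e" for s
    proof -
      have 1: "y s \<in> fst c \<and> m * norm (snd c (y s) - snd c (y \<tau>)) \<le> C * \<bar>s - \<tau>\<bar> powr \<alpha>"
        using step[of \<tau> s] that \<tau> c r by simp
      have "C * \<bar>s - \<tau>\<bar> powr \<alpha> \<le> C * e powr \<alpha>" using that C(1) \<alpha> by (intro mult_left_mono powr_mono2) auto
      then have "m * norm (snd c (y s) - snd c (y \<tau>)) < m * r" using 1 e(2) by linarith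
      then show ?thesis using 1 r(2) by (simp add: dist_norm norm_minus_commute)
    qed
    show ?thesis
    proof (rule exI[of _ "e / 2"], rule conjI, use e in simp, rule exI[of _ "C / m"],
        intro conjI ballI impI)
      fix s t assume st: "s \<in> I" "t \<in> I" "\<bar>s - \<tau>\<bar> < e / 2" "\<bar>t - \<tau>\<bar> < e / 2"
      have "\<bar>s - \<tau>\<bar> < e" "\<bar>t - \<tau>\<bar> < e" using st e(1) by linarith+
      then show "y s \<in> fst c" "y t \<in> fst c" using near st by blast+
      have "\<bar>t - s\<bar> < e" using st by linarith
      then have "m * norm (snd c (y t) - snd c (y s)) \<le> C * \<bar>t - s\<bar> powr \<alpha>"
        using step[of s t] near[of s] st \<open>\<bar>s - \<tau>\<bar> < e\<close> by blast
      then show "norm (snd c (y t) - snd c (y s)) \<le> C / m * \<bar>t - s\<bar> powr \<alpha>" using r(2) by (simp add: field_simps)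
    qed
  qed
  have cont: "continuous_on I y"
    unfolding continuous_on_topological
  proof (intro ballI allI impI)
    fix \<tau> W assume \<tau>: "\<tau> \<in> I" and W: "open W" "y \<tau> \<in> W"
    obtain c where c: "c \<in> A" "y \<tau> \<in> fst c" using chart_cover[OF A] by blast
    have "open (snd c ` (fst c \<inter> W))" "snd c (y \<tau>) \<in> snd c ` (fst c \<inter> W)"
      using chart_image_open[OF A c(1) W(1)] c W by auto
    then obtain \<epsilon> where \<epsilon>: "\<epsilon> > 0" "ball (snd c (y \<tau>)) \<epsilon> \<subseteq> snd c ` (fst c \<inter> W)"
      using open_contains_ball by blast
    obtain d M where d: "d > 0" "\<And>s t. s \<in> I \<Longrightarrow> t \<in> I \<Longrightarrow> \<bar>s - \<tau>\<bar> < d \<Longrightarrow> \<bar>t - \<tau>\<bar> < d \<Longrightarrow>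
      y s \<in> fst c \<and> y t \<in> fst c \<and> norm (snd c (y t) - snd c (y s)) \<le> M * \<bar>t - s\<bar> powr \<alpha>"
      using key[OF \<tau> c] by blast
    obtain e where e: "e > 0" "\<bar>M\<bar> * e powr \<alpha> < \<epsilon>" using small_powr[OF \<alpha> \<epsilon>(1), of "\<bar>M\<bar>" 1] by auto
    show "\<exists>V. open V \<and> \<tau> \<in> V \<and> (\<forall>s\<in>I. s \<in> V \<longrightarrow> y s \<in> W)"
    proof (intro exI[of _ "ball \<tau> (min d e)"] conjI ballI impI)
      fix s assume s: "s \<in> I" "s \<in> ball \<tau> (min d e)"
      then have s': "\<bar>s - \<tau>\<bar> < d" "\<bar>s - \<tau>\<bar> < e" by (auto simp: dist_real_def)
      have 1: "y s \<in> fst c" "norm (snd c (y s) - snd c (y \<tau>)) \<le> M * \<bar>s - \<tau>\<bar> powr \<alpha>"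
        using d(2)[of \<tau> s] \<tau> s(1) s'(1) d(1) by auto
      have "M * \<bar>s - \<tau>\<bar> powr \<alpha> \<le> \<bar>M\<bar> * e powr \<alpha>" using s' \<alpha> by (intro mult_mono powr_mono2) auto
      then have "snd c (y s) \<in> ball (snd c (y \<tau>)) \<epsilon>" using 1(2) e(2) by (simp add: dist_norm norm_minus_commute)
      then obtain q where "q \<in> fst c \<inter> W" "snd c (y s) = snd c q" using \<epsilon>(2) by blast
      then show "y s \<in> W" using chart_inj[OF A c(1)] 1(1) by (metis IntD1 IntD2 inj_onD)
    qed (use d e in auto)
  qed
  show ?thesis
    unfolding lhol_def
  proof (intro conjI cont ballI impI)
    fix \<tau> c assume "\<tau> \<in> I" "c \<in> A" "y \<tau> \<in> fst c"
    then obtain d M where d: "d > 0" "\<forall>s\<in>I. \<forall>t\<in>I. \<bar>s - \<tau>\<bar> < d \<longrightarrow> \<bar>t - \<tau>\<bar> < d \<longrightarrow>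
      y s \<in> fst c \<and> y t \<in> fst c \<and> norm (snd c (y t) - snd c (y s)) \<le> M * \<bar>t - s\<bar> powr \<alpha>"
      using key by blast
    then show "germO \<tau> I \<alpha> (\<lambda>s t. snd c (y t) - snd c (y s))"
      unfolding germO_def eventually_pairs fst_conv snd_conv by blast
  qed
qed

text \<open>The straight segment in coordinates competes in the infimum, and its speed is at most M
  times the coordinate distance.\<close>

lemma riemannian_dist_line:
  assumes c: "c \<in> A" and r: "cball z0 r \<subseteq> snd c ` fst c"
    and M: "\<And>z v. z \<in> cball z0 r \<Longrightarrow> sqrt (gram c (inv_chart c z) v v) \<le> M * norm v"
    and p: "p \<in> fst c" "snd c p \<in> cball z0 r" and q: "q \<in> fst c" "snd c q \<in> cball z0 r"
  shows "riemannian_dist A g p q \<le> ereal (M * norm (snd c q - snd c p))"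
proof -
  let ?v = "snd c q - snd c p"
  define z where "z t = snd c p + t *\<^sub>R ?v" for t
  define \<gamma> where "\<gamma> t = inv_chart c (z t)" for t
  have zb: "z t \<in> cball z0 r" if "t \<in> {0..1}" for t
  proof -
    have "z t = (1 - t) *\<^sub>R snd c p + t *\<^sub>R snd c q" by (simp add: z_def algebra_simps)
    then show ?thesis using convexD[OF convex_cball p(2) q(2), of "1 - t" t] that by simp
  qed
  have zc: "z t \<in> snd c ` fst c" if "t \<in> {0..1}" for t using zb[OF that] r by blast
  have \<gamma>c: "\<gamma> t \<in> fst c" "snd c (\<gamma> t) = z t" if "t \<in> {0..1}" for t
    using zc[OF that] unfolding \<gamma>_def by (auto simp: inv_into_into f_inv_into_f)
  have zcont: "continuous_on S z" for S unfolding z_def by (intro continuous_intros)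
  have zder: "(z has_vector_derivative ?v) (at t)" for t
    unfolding z_def by (auto intro!: derivative_eq_intros)
  have cont: "continuous_on {0..1} \<gamma>"
    unfolding \<gamma>_def by (rule continuous_on_compose2[OF chart_inv_cont[OF A c] zcont]) (use zc in auto)
  have ends: "\<gamma> 0 = p" "\<gamma> 1 = q" unfolding \<gamma>_def z_def using chart_inv[OF A c] p q by auto
  have C1: "(\<lambda>t. snd d (\<gamma> t)) piecewise_C1_differentiable_on {a..b}"
    if d: "d \<in> A" and ab: "0 \<le> a" "a \<le> b" "b \<le> 1" "\<gamma> ` {a..b} \<subseteq> fst d" for d a b
  proof -
    let ?\<phi> = "\<lambda>w. snd d (inv_chart c w)" and ?S = "snd c ` (fst c \<inter> fst d)"
    have S: "open ?S" using chart_image_open[OF A c chart_open(1)[OF A d]] .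
    have zS: "z t \<in> ?S" if "t \<in> {a..b}" for t
      using \<gamma>c[of t] ab that by (intro image_eqI[of _ _ "\<gamma> t"]) auto
    have sm: "smooth_on ?S ?\<phi>" by (rule transition_smooth[OF A c d])
    have "((\<lambda>t. snd d (\<gamma> t)) has_vector_derivative frechet_derivative ?\<phi> (at (z t)) ?v) (at t)" if "t \<in> {a..b}" for t
    proof -
      have "(?\<phi> has_derivative frechet_derivative ?\<phi> (at (z t))) (at (z t))"
        by (rule smooth_on_has_derivative[OF sm zS[OF that]])
      from has_derivative_compose[OF zder[unfolded has_vector_derivative_def, of t] this]
      have "((\<lambda>t. ?\<phi> (z t)) has_derivative (\<lambda>h. frechet_derivative ?\<phi> (at (z t)) (h *\<^sub>R ?v))) (at t)" .
      then show ?thesis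
        using linear_scale[OF has_derivative_linear[OF smooth_on_has_derivative[OF sm zS[OF that]]]]
        unfolding has_vector_derivative_def \<gamma>_def by simp
    qed
    moreover have "continuous_on {a..b} (\<lambda>t. frechet_derivative ?\<phi> (at (z t)) ?v)"
      by (rule continuous_on_compose2[OF smooth_on_continuous[OF smooth_on_derivative[OF sm]] zcont]) (use zS in auto)
    ultimately have "(\<lambda>t. snd d (\<gamma> t)) C1_differentiable_on {a..b}"
      unfolding C1_differentiable_on_def
      by (intro exI[of _ "\<lambda>t. frechet_derivative ?\<phi> (at (z t)) ?v"] conjI ballI)
    then show ?thesis by (rule C1_differentiable_imp_piecewise)
  qed
  let ?s = "\<lambda>t. sqrt (gram c (inv_chart c (z t)) ?v ?v)"
  \<comment> \<open>At 0 and 1 a velocity would depend on \<gamma> outside the unit interval; these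
    two times do not affect the integral.\<close>
  have sp: "?s t = speed A g \<gamma> t" if t: "t \<in> {0..1} - {0, 1}" for t
  proof -
    have op: "open {0<..<1::real}" "t \<in> {0<..<1}" using t by auto
    have "((\<lambda>s. snd c (\<gamma> s)) has_vector_derivative ?v) (at t)"
      by (rule has_vector_derivative_transform_within_open[OF zder op]) (simp add: \<gamma>c)
    from speed_chart[where \<gamma>=\<gamma>, OF c _ curve_isCont[OF cont] this] show ?thesis using t \<gamma>c by (simp add: \<gamma>_def)
  qed
  have "continuous_on {0..1} ?s"
    by (intro continuous_on_real_sqrt continuous_on_compose2[OF smooth_on_continuous[OF gram_smooth[OF c]] zcont])
      (use zc in auto)
  then have sint: "?s integrable_on {0..1}" by (rule integrable_continuous_real)
  have int: "speed A g \<gamma> integrable_on {0..1}"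
    by (rule integrable_spike_finite[of "{0, 1}" _ _ ?s]) (use sp sint in auto)
  have "piecewise_C1_curve A g \<gamma>" unfolding piecewise_C1_curve_def using cont C1 int by blast
  then have "riemannian_dist A g p q \<le> ereal (integral {0..1} (speed A g \<gamma>))"
    unfolding riemannian_dist_def using ends by (intro INF_lower) auto
  also have "integral {0..1} (speed A g \<gamma>) = integral {0..1} ?s"
    by (rule integral_spike[of "{0, 1}"]) (use sp in auto)
  also have "\<dots> \<le> M * norm ?v"
  proof (rule has_integral_le[OF integrable_integral[OF sint]])
    show "((\<lambda>_. M * norm ?v) has_integral M * norm ?v) {0..1::real}"
      using has_integral_const_real[of "M * norm ?v" 0 1] by simp
  qed (use M zb in blast)
  finally show ?thesis by simp
qed

text \<open>The exceptional times in the definition of \<open>piecewise_C1_curve\<close> belong to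
  single charts; \<open>Bolzano\<close> shows that finitely many remain altogether. The speed of a
  reparametrised curve is computed at the other times.\<close>

lemma curve_velocity_finite:
  assumes \<gamma>: "piecewise_C1_curve A g \<gamma>"
  shows "finite {t \<in> {0<..<1}. \<nexists>X. has_velocity A \<gamma> X t}"
proof -
  have cont: "continuous_on {0..1} \<gamma>" using \<gamma> unfolding piecewise_C1_curve_def by blast
  define P where "P a b \<longleftrightarrow> finite {t \<in> {0<..<1} \<inter> {a..b}. \<nexists>X. has_velocity A \<gamma> X t}" for a b
  have "(0::real) \<le> 1" by simp
  then have "P 0 1"
  proof (induction rule: Bolzano)
    case (trans a b c)
    have "{t \<in> {0<..<1} \<inter> {a..c}. \<nexists>X. has_velocity A \<gamma> X t} \<subseteq>
        {t \<in> {0<..<1} \<inter> {a..b}. \<nexists>X. has_velocity A \<gamma> X t} \<union> {t \<in> {0<..<1} \<inter> {b..c}. \<nexists>X. has_velocity A \<gamma> X t}"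
      by auto
    then show ?case using trans(1,2) unfolding P_def by (meson finite_UnI finite_subset)
  next
    case (local t0)
    then have t0: "t0 \<in> {0..1}" by simp
    obtain c where c: "c \<in> A" "\<gamma> t0 \<in> fst c" using chart_cover[OF A] by blast
    obtain d where d: "d > 0" "\<And>a b. 0 \<le> a \<and> a \<le> t0 \<and> t0 \<le> b \<and> b \<le> 1 \<and> b - a < d \<Longrightarrow> \<gamma> ` {a..b} \<subseteq> fst c"
      using curve_near[OF cont t0 chart_open(1)[OF A c(1)] c(2)] by blast
    have "P a b" if ab: "a \<le> t0 \<and> t0 \<le> b \<and> b - a < d" for a b
    proof -
      let ?a = "max a 0" and ?b = "min b 1"
      have ab': "0 \<le> ?a" "?a \<le> ?b" "?b \<le> 1" using ab t0 by auto
      have "0 \<le> ?a \<and> ?a \<le> t0 \<and> t0 \<le> ?b \<and> ?b \<le> 1 \<and> ?b - ?a < d" using ab t0 by auto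
      then have sub: "\<gamma> ` {?a..?b} \<subseteq> fst c" by (rule d(2))
      show ?thesis
      proof (rule curve_chart[OF \<gamma> ab' c(1) sub])
        fix S D assume S: "finite S"
          "\<And>r. r \<in> {?a<..<?b} - S \<Longrightarrow> ((\<lambda>r. snd c (\<gamma> r)) has_vector_derivative D r) (at r)"
          "\<And>r. r \<in> {?a<..<?b} - S \<Longrightarrow> isCont \<gamma> r"
        have "\<exists>X. has_velocity A \<gamma> X t" if t: "t \<in> {?a<..<?b} - S" for t
        proof -
          have "t \<in> {?a..?b}" using t by auto
          then have "\<gamma> t \<in> fst c" using sub by blast
          from has_velocity_chart[where \<gamma>=\<gamma>, OF A c(1) this S(3)[OF t] S(2)[OF t]] show ?thesis by blast
        qed
        moreover have "t \<in> {?a<..<?b}" if "t \<in> {0<..<1} \<inter> {a..b}" "t \<noteq> a" "t \<noteq> b" for t using that by auto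
        ultimately have "{t \<in> {0<..<1} \<inter> {a..b}. \<nexists>X. has_velocity A \<gamma> X t} \<subseteq> S \<union> {a, b}" by blast
        then show "P a b" unfolding P_def using S(1) by (meson finite.emptyI finite_UnI finite_insert finite_subset)
      qed
    qed
    then show ?case using d(1) by blast
  qed
  moreover have "{0<..<1} \<inter> {0..1} = {0<..<1::real}" by auto
  ultimately show ?thesis unfolding P_def by simp
qed

section \<open>Joined curves, the triangle inequality and global Hoelder bounds\<close>

lemma speed_affine:
  assumes "has_velocity A \<gamma> X (k * t + b)" "k > 0" "\<forall>\<^sub>F s in nhds t. \<gamma>' s = \<gamma> (k * s + b)"
  shows "speed A g \<gamma>' t = k * speed A g \<gamma> (k * t + b)"
proof -
  have v: "has_velocity A \<gamma>' (\<lambda>f. k * X f) t"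
    by (rule has_velocity_cong[OF A has_velocity_affine[OF A assms(1)]]) (use assms(3) in \<open>simp add: eq_commute\<close>)
  have p: "\<gamma>' t = \<gamma> (k * t + b)" using eventually_nhds_x_imp_x[OF assms(3)] .
  have "X \<in> tangent_space A (\<gamma> (k * t + b))" using assms(1) unfolding has_velocity_def by blast
  from metric_self_scale[OF this, of k]
  show ?thesis
    unfolding speed_def velocity_eq[OF A v] velocity_eq[OF A assms(1)] p
    using assms(2) by (simp add: real_sqrt_mult)
qed

lemma has_integral_affine:
  assumes "(f has_integral i) {0..1}" "k > 0"
  shows "((\<lambda>t. k * f (k * t + b)) has_integral i) {- b / k..(1 - b) / k :: real}"
proof -
  have "((\<lambda>x. f (k *\<^sub>R x + b)) has_integral (1 / \<bar>k\<bar> ^ DIM(real)) *\<^sub>R i) ((\<lambda>x. (1 / k) *\<^sub>R x + - ((1 / k) *\<^sub>R b)) ` cbox 0 1)"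
    using assms by (intro has_integral_affinity) auto
  also have "(\<lambda>x. (1 / k) *\<^sub>R x + - ((1 / k) *\<^sub>R b)) ` cbox 0 1 = {- b / k..(1 - b) / k}"
    using assms(2) image_affinity_atLeastAtMost[of "1 / k" "- (b / k)" 0 1] by (simp add: field_simps)
  finally have "((\<lambda>x. k * f (k *\<^sub>R x + b)) has_integral (k * ((1 / \<bar>k\<bar> ^ DIM(real)) *\<^sub>R i))) {- b / k..(1 - b) / k}"
    by (rule has_integral_mult_right)
  then show ?thesis using assms(2) by simp
qed

text \<open>Each half runs at double speed over half the time, so its length is unchanged. A chart
  interval that contains 1/2 in its interior is treated by the gluing lemma for piecewise C1
  functions.\<close>

lemma curve_join:
  assumes \<gamma>1: "piecewise_C1_curve A g \<gamma>1" and \<gamma>2: "piecewise_C1_curve A g \<gamma>2" and eq: "\<gamma>1 1 = \<gamma>2 0"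
  defines "\<gamma> \<equiv> \<gamma>1 +++ \<gamma>2"
  shows "piecewise_C1_curve A g \<gamma>"
    and "integral {0..1} (speed A g \<gamma>) = integral {0..1} (speed A g \<gamma>1) + integral {0..1} (speed A g \<gamma>2)"
proof -
  have cont1: "continuous_on {0..1} \<gamma>1" and cont2: "continuous_on {0..1} \<gamma>2"
    using \<gamma>1 \<gamma>2 unfolding piecewise_C1_curve_def by auto
  have cont: "continuous_on {0..1} \<gamma>"
    using path_join_imp[of \<gamma>1 \<gamma>2] cont1 cont2 eq unfolding \<gamma>_def path_def pathfinish_def pathstart_def by blast
  have e1: "\<gamma> t = \<gamma>1 (2 * t)" if "t \<le> 1/2" for t using that by (simp add: \<gamma>_def joinpaths_def)
  have e2: "\<gamma> t = \<gamma>2 (2 * t - 1)" if "1/2 \<le> t" for t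
  proof (cases "t = 1/2")
    case True
    show ?thesis unfolding True \<gamma>_def joinpaths_def using eq by simp
  qed (use that in \<open>simp add: \<gamma>_def joinpaths_def\<close>)
  have aff: "(\<lambda>t. snd c (\<gamma>' (2 * t + k))) piecewise_C1_differentiable_on {a..b}"
    if \<gamma>': "piecewise_C1_curve A g \<gamma>'" and c: "c \<in> A" and ab: "a \<le> b" "0 \<le> 2 * a + k" "2 * b + k \<le> 1"
      and sub: "(\<lambda>t. \<gamma>' (2 * t + k)) ` {a..b} \<subseteq> fst c" for \<gamma>' c and a b k :: real
  proof -
    have im: "(\<lambda>t. 2 * t + k) ` {a..b} = {2 * a + k..2 * b + k}"
      using ab(1) by (simp add: image_affinity_atLeastAtMost)
    have "\<gamma>' ` {2 * a + k..2 * b + k} \<subseteq> fst c" using sub im by (metis image_image)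
    then have "(\<lambda>t. snd c (\<gamma>' t)) piecewise_C1_differentiable_on ((\<lambda>t. 2 * t + k) ` {a..b})"
      unfolding im using \<gamma>' c ab unfolding piecewise_C1_curve_def by simp
    from piecewise_C1_differentiable_affine[of "\<lambda>t. snd c (\<gamma>' t)" 2 k "{a..b}"] this
    show ?thesis by (simp add: o_def)
  qed
  have C1: "(\<lambda>t. snd c (\<gamma> t)) piecewise_C1_differentiable_on {a..b}"
    if c: "c \<in> A" and ab: "0 \<le> a" "a \<le> b" "b \<le> 1" and sub: "\<gamma> ` {a..b} \<subseteq> fst c" for c a b
  proof -
    have first: "(\<lambda>t. snd c (\<gamma>1 (2 * t))) piecewise_C1_differentiable_on {a..b'}" if "a \<le> b'" "b' \<le> b" "b' \<le> 1/2" for b'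
    proof -
      have "(\<lambda>t. \<gamma>1 (2 * t + 0)) ` {a..b'} \<subseteq> fst c"
      proof (rule image_subsetI)
        fix t assume t: "t \<in> {a..b'}"
        then have "\<gamma> t \<in> fst c" using sub that by auto
        then show "\<gamma>1 (2 * t + 0) \<in> fst c" using e1[of t] t that by auto
      qed
      from aff[OF \<gamma>1 c that(1) _ _ this] show ?thesis using ab that by simp
    qed
    have second: "(\<lambda>t. snd c (\<gamma>2 (2 * t - 1))) piecewise_C1_differentiable_on {a'..b}" if "a \<le> a'" "a' \<le> b" "1/2 \<le> a'" for a'
    proof -
      have "(\<lambda>t. \<gamma>2 (2 * t + - 1)) ` {a'..b} \<subseteq> fst c"
      proof (rule image_subsetI)
        fix t assume t: "t \<in> {a'..b}"
        then have "\<gamma> t \<in> fst c" using sub that by auto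
        then show "\<gamma>2 (2 * t + - 1) \<in> fst c" using e2[of t] t that by auto
      qed
      from aff[OF \<gamma>2 c that(2) _ _ this] show ?thesis using ab that by simp
    qed
    consider "b \<le> 1/2" | "1/2 \<le> a" | "a \<le> 1/2" "1/2 \<le> b" by linarith
    then show ?thesis
    proof cases
      case 1
      show ?thesis by (rule piecewise_C1_cong[OF first[of b]]) (use 1 ab e1 in auto)
    next
      case 2
      show ?thesis by (rule piecewise_C1_cong[OF second[of a]]) (use 2 ab e2 in auto)
    next
      case 3
      have "(\<lambda>t. if t \<le> 1/2 then snd c (\<gamma>1 (2 * t)) else snd c (\<gamma>2 (2 * t - 1))) piecewise_C1_differentiable_on {a..b}"
        by (rule piecewise_C1_differentiable_cases[OF first second]) (use 3 eq in auto)
      then show ?thesis by (rule piecewise_C1_cong) (use e1 e2 in auto)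
    qed
  qed
  have int1: "(speed A g \<gamma>1 has_integral integral {0..1} (speed A g \<gamma>1)) {0..1}"
    and int2: "(speed A g \<gamma>2 has_integral integral {0..1} (speed A g \<gamma>2)) {0..1}"
    using \<gamma>1 \<gamma>2 unfolding piecewise_C1_curve_def by (auto intro: integrable_integral)
  \<comment> \<open>The times without velocity. Their preimages under the two affine parameter
    changes are finite, and so are negligible for the integrals below.\<close>
  define N where "N \<gamma>' = {t \<in> {0<..<1::real}. \<nexists>X. has_velocity A \<gamma>' X t}" for \<gamma>'
  have finN: "finite ((\<lambda>t::real. 2 * t + k) -` N \<gamma>')" if "piecewise_C1_curve A g \<gamma>'" for \<gamma>' k
    using curve_velocity_finite[OF that] unfolding N_def by (intro finite_vimageI) (auto intro!: injI)
  have i1: "(speed A g \<gamma> has_integral integral {0..1} (speed A g \<gamma>1)) {0..1/2}"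
  proof (rule has_integral_spike_finite)
    show "finite ((\<lambda>t. 2 * t + 0) -` N \<gamma>1 \<union> {0, 1/2})" using finN[OF \<gamma>1] by blast
    show "((\<lambda>t. 2 * speed A g \<gamma>1 (2 * t + 0)) has_integral integral {0..1} (speed A g \<gamma>1)) {0..1/2}"
      using has_integral_affine[OF int1, of 2 0] by simp
    fix t :: real assume t: "t \<in> {0..1/2} - ((\<lambda>t. 2 * t + 0) -` N \<gamma>1 \<union> {0, 1/2})"
    then obtain X where X: "has_velocity A \<gamma>1 X (2 * t + 0)" unfolding N_def by auto
    have "\<forall>\<^sub>F s in nhds t. \<gamma> s = \<gamma>1 (2 * s + 0)"
      using eventually_nhds_in_open[of "{..<1/2}" t] t by (auto elim!: eventually_mono simp: e1)
    from speed_affine[OF X _ this] show "speed A g \<gamma> t = 2 * speed A g \<gamma>1 (2 * t + 0)" by simp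
  qed
  have i2: "(speed A g \<gamma> has_integral integral {0..1} (speed A g \<gamma>2)) {1/2..1}"
  proof (rule has_integral_spike_finite)
    show "finite ((\<lambda>t. 2 * t + - 1) -` N \<gamma>2 \<union> {1/2, 1})" using finN[OF \<gamma>2] by blast
    show "((\<lambda>t. 2 * speed A g \<gamma>2 (2 * t + - 1)) has_integral integral {0..1} (speed A g \<gamma>2)) {1/2..1}"
      using has_integral_affine[OF int2, of 2 "- 1"] by simp
    fix t :: real assume t: "t \<in> {1/2..1} - ((\<lambda>t. 2 * t + - 1) -` N \<gamma>2 \<union> {1/2, 1})"
    then obtain X where X: "has_velocity A \<gamma>2 X (2 * t + - 1)" unfolding N_def by auto
    have "\<forall>\<^sub>F s in nhds t. \<gamma> s = \<gamma>2 (2 * s + - 1)"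
      using eventually_nhds_in_open[of "{1/2<..}" t] t by (auto elim!: eventually_mono simp: e2)
    from speed_affine[OF X _ this] show "speed A g \<gamma> t = 2 * speed A g \<gamma>2 (2 * t + - 1)" by simp
  qed
  have i: "(speed A g \<gamma> has_integral (integral {0..1} (speed A g \<gamma>1) + integral {0..1} (speed A g \<gamma>2))) {0..1}"
    by (rule has_integral_combine[OF _ _ i1 i2]) auto
  show "piecewise_C1_curve A g \<gamma>" unfolding piecewise_C1_curve_def using cont C1 i by blast
  show "integral {0..1} (speed A g \<gamma>) = integral {0..1} (speed A g \<gamma>1) + integral {0..1} (speed A g \<gamma>2)"
    using i by (rule integral_unique)
qed

text \<open>Curves that are optimal up to e / 2 are joined. Real bounds a and b appear instead of a
  sum of distances because distances may be infinite.\<close>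

lemma riemannian_dist_triangle:
  assumes "riemannian_dist A g p q \<le> ereal a" "riemannian_dist A g q r \<le> ereal b"
  shows "riemannian_dist A g p r \<le> ereal (a + b)"
proof (rule ereal_le_epsilon2)
  fix e :: real assume e: "0 < e"
  have "riemannian_dist A g p q < ereal (a + e / 2)" "riemannian_dist A g q r < ereal (b + e / 2)"
    using assms e by (auto intro: le_less_trans)
  then obtain \<gamma>1 \<gamma>2 where \<gamma>1: "piecewise_C1_curve A g \<gamma>1" "\<gamma>1 0 = p" "\<gamma>1 1 = q" "integral {0..1} (speed A g \<gamma>1) < a + e / 2"
    and \<gamma>2: "piecewise_C1_curve A g \<gamma>2" "\<gamma>2 0 = q" "\<gamma>2 1 = r" "integral {0..1} (speed A g \<gamma>2) < b + e / 2"
    unfolding riemannian_dist_def INF_less_iff by auto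
  have eq: "\<gamma>1 1 = \<gamma>2 0" using \<gamma>1 \<gamma>2 by simp
  have "riemannian_dist A g p r \<le> ereal (integral {0..1} (speed A g (\<gamma>1 +++ \<gamma>2)))"
    unfolding riemannian_dist_def
    using curve_join(1)[OF \<gamma>1(1) \<gamma>2(1) eq] \<gamma>1 \<gamma>2 by (intro INF_lower) (auto simp: joinpaths_def)
  also have "\<dots> \<le> ereal (a + b) + ereal e"
    unfolding curve_join(2)[OF \<gamma>1(1) \<gamma>2(1) eq] using \<gamma>1(4) \<gamma>2(4) by simp
  finally show "riemannian_dist A g p r \<le> ereal (a + b) + ereal e" .
qed

text \<open>\<open>holder_path\<close> on a compact interval with a nonnegative constant, which is
  the form that can be concatenated.\<close>

definition holder_bound :: "real \<Rightarrow> (real \<Rightarrow> 'a) \<Rightarrow> real \<Rightarrow> real \<Rightarrow> bool" where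
  "holder_bound \<alpha> y a b \<longleftrightarrow> (\<exists>C\<ge>0. \<forall>s\<in>{a..b}. \<forall>t\<in>{a..b}. riemannian_dist A g (y s) (y t) \<le> ereal (C * \<bar>t - s\<bar> powr \<alpha>))"

lemma holder_bound_iff: "holder_bound \<alpha> y a b \<longleftrightarrow> holder_path A g \<alpha> {a..b} y"
proof
  assume "holder_path A g \<alpha> {a..b} y"
  then obtain C where C: "\<And>s t. s \<in> {a..b} \<Longrightarrow> t \<in> {a..b} \<Longrightarrow> riemannian_dist A g (y s) (y t) \<le> ereal (C * \<bar>t - s\<bar> powr \<alpha>)"
    unfolding holder_path_def by blast
  have "riemannian_dist A g (y s) (y t) \<le> ereal (\<bar>C\<bar> * \<bar>t - s\<bar> powr \<alpha>)" if "s \<in> {a..b}" "t \<in> {a..b}" for s t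
    by (rule order_trans[OF C[OF that]]) (auto intro: mult_right_mono)
  then show "holder_bound \<alpha> y a b" unfolding holder_bound_def by (intro exI[of _ "\<bar>C\<bar>"]) auto
qed (auto simp: holder_bound_def holder_path_def)

lemma holder_bound_trans:
  assumes "holder_bound \<alpha> y a b" "holder_bound \<alpha> y b c" "a \<le> b" "b \<le> c" "\<alpha> > 0"
  shows "holder_bound \<alpha> y a c"
proof -
  obtain C where C: "C \<ge> 0" "\<And>s t. s \<in> {a..b} \<Longrightarrow> t \<in> {a..b} \<Longrightarrow> riemannian_dist A g (y s) (y t) \<le> ereal (C * \<bar>t - s\<bar> powr \<alpha>)"
    using assms(1) unfolding holder_bound_def by blast
  obtain D where D: "D \<ge> 0" "\<And>s t. s \<in> {b..c} \<Longrightarrow> t \<in> {b..c} \<Longrightarrow> riemannian_dist A g (y s) (y t) \<le> ereal (D * \<bar>t - s\<bar> powr \<alpha>)"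
    using assms(2) unfolding holder_bound_def by blast
  have "riemannian_dist A g (y s) (y t) \<le> ereal ((C + D) * \<bar>t - s\<bar> powr \<alpha>)" if st: "s \<in> {a..c}" "t \<in> {a..c}" for s t
  proof -
    consider "s \<le> b \<and> t \<le> b" | "b \<le> s \<and> b \<le> t" | "s \<le> b \<and> b \<le> t" | "t \<le> b \<and> b \<le> s" by linarith
    then show ?thesis
    proof cases
      case 1
      show ?thesis by (rule order_trans[OF C(2)]) (use 1 st D(1) in \<open>auto intro: mult_right_mono\<close>)
    next
      case 2
      show ?thesis by (rule order_trans[OF D(2)]) (use 2 st C(1) in \<open>auto intro: mult_right_mono\<close>)
    next
      case 3
      have "riemannian_dist A g (y s) (y t) \<le> ereal (C * \<bar>b - s\<bar> powr \<alpha> + D * \<bar>t - b\<bar> powr \<alpha>)"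
        by (rule riemannian_dist_triangle[OF C(2) D(2)]) (use 3 st in auto)
      also have "C * \<bar>b - s\<bar> powr \<alpha> + D * \<bar>t - b\<bar> powr \<alpha> \<le> C * \<bar>t - s\<bar> powr \<alpha> + D * \<bar>t - s\<bar> powr \<alpha>"
        using 3 C(1) D(1) assms(5) by (intro add_mono mult_left_mono powr_mono2) auto
      finally show ?thesis by (simp add: algebra_simps)
    next
      case 4
      have "riemannian_dist A g (y s) (y t) \<le> ereal (D * \<bar>b - s\<bar> powr \<alpha> + C * \<bar>t - b\<bar> powr \<alpha>)"
        by (rule riemannian_dist_triangle[OF D(2) C(2)]) (use 4 st in auto)
      also have "D * \<bar>b - s\<bar> powr \<alpha> + C * \<bar>t - b\<bar> powr \<alpha> \<le> D * \<bar>t - s\<bar> powr \<alpha> + C * \<bar>t - s\<bar> powr \<alpha>"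
        using 4 C(1) D(1) assms(5) by (intro add_mono mult_left_mono powr_mono2) auto
      finally show ?thesis by (simp add: algebra_simps)
    qed
  qed
  then show ?thesis unfolding holder_bound_def using C(1) D(1) by (intro exI[of _ "C + D"]) auto
qed

text \<open>Locally the distance is at most a multiple of the chart norm; the triangle inequality
  and \<open>Bolzano\<close> carry the bound over to the whole interval.\<close>

lemma lhol_holder_path:
  assumes y: "lhol A \<alpha> {a..b} y" and "a \<le> b" and \<alpha>: "\<alpha> > 0"
  shows "holder_path A g \<alpha> {a..b} y"
proof -
  define P where "P s t \<longleftrightarrow> (a \<le> s \<and> t \<le> b \<longrightarrow> holder_bound \<alpha> y s t)" for s t
  have "P a b"
    using \<open>a \<le> b\<close>
  proof (induction rule: Bolzano)
    case (trans r s t)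
    then show ?case unfolding P_def using holder_bound_trans[OF _ _ _ _ \<alpha>, of y r s t] by auto
  next
    case (local \<tau>)
    then have \<tau>: "\<tau> \<in> {a..b}" by simp
    obtain c where c: "c \<in> A" "y \<tau> \<in> fst c" using chart_cover[OF A] by blast
    obtain r where r: "r > 0" "cball (snd c (y \<tau>)) r \<subseteq> snd c ` fst c"
      using chart_open(2)[OF A c(1)] c(2) open_contains_cball by (metis imageI)
    obtain M where M: "M \<ge> 0" "\<And>z v. z \<in> cball (snd c (y \<tau>)) r \<Longrightarrow> sqrt (gram c (inv_chart c z) v v) \<le> M * norm v"
      using gram_bounds(2)[OF c(1) compact_cball r(2)] by blast
    obtain C where C: "C \<ge> 0" "\<forall>\<^sub>F p in pairs \<tau> {a..b}. norm (snd c (y (snd p)) - snd c (y (fst p))) \<le> C * \<bar>snd p - fst p\<bar> powr \<alpha>"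
      using germO_pos[OF lholD(2)[OF y \<tau> c]] by blast
    have "\<forall>\<^sub>F p in pairs \<tau> {a..b}. riemannian_dist A g (y (fst p)) (y (snd p)) \<le> ereal ((M * C) * \<bar>snd p - fst p\<bar> powr \<alpha>)"
      using C(2) eventually_pairs_chart[OF A lholD(1)[OF y] \<tau> c]
        pairs_tends_ball[OF pairs_tends_chart[OF A lholD(1)[OF y] \<tau> c] r(1)]
    proof eventually_elim
      case (elim p)
      have "riemannian_dist A g (y (fst p)) (y (snd p)) \<le> ereal (M * norm (snd c (y (snd p)) - snd c (y (fst p))))"
        by (rule riemannian_dist_line[OF c(1) r(2) M(2)]) (use elim in auto)
      also have "\<dots> \<le> ereal (M * (C * \<bar>snd p - fst p\<bar> powr \<alpha>))" using elim(1) M(1) by (simp add: mult_left_mono)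
      finally show ?case by (simp add: mult.assoc)
    qed
    then obtain d where d: "d > 0" "\<And>s t. s \<in> {a..b} \<Longrightarrow> t \<in> {a..b} \<Longrightarrow> \<bar>s - \<tau>\<bar> < d \<Longrightarrow> \<bar>t - \<tau>\<bar> < d \<Longrightarrow>
        riemannian_dist A g (y s) (y t) \<le> ereal ((M * C) * \<bar>t - s\<bar> powr \<alpha>)"
      unfolding eventually_pairs fst_conv snd_conv by blast
    have "P s t" if "s \<le> \<tau> \<and> \<tau> \<le> t \<and> t - s < d" for s t
      unfolding P_def holder_bound_def
    proof (intro impI exI[of _ "M * C"] conjI ballI)
      fix p q assume "a \<le> s \<and> t \<le> b" "p \<in> {s..t}" "q \<in> {s..t}"
      then show "riemannian_dist A g (y p) (y q) \<le> ereal (M * C * \<bar>q - p\<bar> powr \<alpha>)"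
        using that by (intro d(2)) auto
    qed (use M C in auto)
    then show ?case using d(1) by blast
  qed
  then show ?thesis unfolding P_def holder_bound_iff[symmetric] by simp
qed

end

section \<open>One-parameter subgroups\<close>

text \<open>The axiom on the fundamental vector fields refers to \<open>lie_exp\<close>, a definite description, which
  means nothing before one-parameter subgroups are known to exist and to be unique.\<close>

lemma has_vector_derivative_chain:
  assumes "(f has_derivative f') (at (\<zeta> t))" "(\<zeta> has_vector_derivative v) (at t within S)"
  shows "((\<lambda>t. f (\<zeta> t)) has_vector_derivative f' v) (at t within S)"
  using has_derivative_compose[OF assms(2)[unfolded has_vector_derivative_def] assms(1)]
    linear_scale[OF has_derivative_linear[OF assms(1)]]
  unfolding has_vector_derivative_def by simp

lemma has_vector_derivative_cong_nhds:
  assumes "(f has_vector_derivative D) (at t)" "\<forall>\<^sub>F s in nhds t. f s = g s"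
  shows "(g has_vector_derivative D) (at t)"
proof -
  obtain T where "open T" "t \<in> T" "\<And>s. s \<in> T \<Longrightarrow> f s = g s"
    using assms(2) unfolding eventually_nhds by blast
  then show ?thesis using has_vector_derivative_transform_within_open[OF assms(1)] by blast
qed

lemma isCont_eventually: "isCont f t \<Longrightarrow> open W \<Longrightarrow> f t \<in> W \<Longrightarrow> \<forall>\<^sub>F s in nhds t. f s \<in> W"
  unfolding isCont_def eventually_nhds_conv_at using topological_tendstoD by blast

text \<open>At the point q where the difference is largest, the mean value inequality bounds it by L
  * \<rho> times itself. With L * \<rho> < 1 it vanishes.\<close>

lemma ode_unique:
  fixes u w :: "real \<Rightarrow> 'k::real_normed_vector"
  assumes L: "L \<ge> 0" "L * \<rho> < 1" "0 \<le> \<rho>" and B: "\<And>t. t \<in> {0..\<rho>} \<Longrightarrow> u t \<in> B \<and> w t \<in> B"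
    and V: "\<And>x y. x \<in> B \<Longrightarrow> y \<in> B \<Longrightarrow> norm (V x - V y) \<le> L * norm (x - y)"
    and u: "\<And>t. t \<in> {0..\<rho>} \<Longrightarrow> (u has_vector_derivative V (u t)) (at t within {0..\<rho>})"
    and w: "\<And>t. t \<in> {0..\<rho>} \<Longrightarrow> (w has_vector_derivative V (w t)) (at t within {0..\<rho>})"
    and "u 0 = w 0" and t: "t \<in> {0..\<rho>}"
  shows "u t = w t"
proof -
  let ?D = "\<lambda>t. u t - w t"
  have der: "(?D has_derivative (\<lambda>h. h *\<^sub>R (V (u s) - V (w s)))) (at s within {0..\<rho>})" if "s \<in> {0..\<rho>}" for s
    using has_vector_derivative_diff[OF u[OF that] w[OF that]] unfolding has_vector_derivative_def .
  have cont: "continuous_on {0..\<rho>} (\<lambda>t. norm (?D t))"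
    using der by (intro continuous_on_norm) (meson has_derivative_continuous continuous_on_eq_continuous_within)
  obtain q where q: "q \<in> {0..\<rho>}" "\<forall>s\<in>{0..\<rho>}. norm (?D s) \<le> norm (?D q)"
    using continuous_attains_sup[OF compact_Icc _ cont] L(3) by auto
  have "norm (?D q - ?D 0) \<le> (L * norm (?D q)) * norm (q - 0)"
  proof (rule differentiable_bound[OF convex_real_interval(5) der])
    fix s assume s: "s \<in> {0..\<rho>}"
    show "onorm (\<lambda>h. h *\<^sub>R (V (u s) - V (w s))) \<le> L * norm (?D q)"
    proof (rule onorm_bound)
      fix h :: real
      have "norm (V (u s) - V (w s)) \<le> L * norm (?D q)"
        using V[of "u s" "w s"] B[OF s] mult_left_mono[OF bspec[OF q(2) s] L(1)] by linarith
      then show "norm (h *\<^sub>R (V (u s) - V (w s))) \<le> L * norm (?D q) * norm h"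
        by (simp add: mult.commute[of _ "\<bar>h\<bar>"] mult_left_mono)
    qed (use L in auto)
  qed (use q L in auto)
  then have "norm (?D q) \<le> L * norm (?D q) * q" using \<open>u 0 = w 0\<close> q(1) by simp
  also have "\<dots> \<le> L * norm (?D q) * \<rho>" using q(1) L(1) by (intro mult_left_mono) auto
  finally have "norm (?D q) * (1 - L * \<rho>) \<le> 0" by (simp add: algebra_simps)
  then have "norm (?D q) \<le> 0" using L(2) by (simp add: mult_le_0_iff)
  then have "norm (?D t) \<le> 0" using q(2) t by fastforce
  then show ?thesis by simp
qed

section \<open>Extension of partially defined homomorphisms from the reals\<close>

context group
begin

definition pw :: "nat \<Rightarrow> 'a \<Rightarrow> 'a" where "pw n a = (f a ^^ n) \<^bold>1"

lemma pw_0: "pw 0 a = \<^bold>1" and pw_Suc: "pw (Suc n) a = a \<^bold>* pw n a" and pw_1: "pw (Suc 0) a = a"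
  by (simp_all add: pw_def)

lemma pw_add: "pw (m + n) a = pw m a \<^bold>* pw n a"
  by (induction m) (simp_all add: pw_0 pw_Suc assoc)

lemma pw_mult: "pw (m * n) a = pw m (pw n a)"
  by (induction m) (simp_all add: pw_0 pw_Suc pw_add)

lemma pw_comm: "a \<^bold>* b = b \<^bold>* a \<Longrightarrow> b \<^bold>* pw n a = pw n a \<^bold>* b"
proof (induction n)
  case (Suc n)
  have "b \<^bold>* (a \<^bold>* pw n a) = a \<^bold>* (b \<^bold>* pw n a)" using Suc.prems by (metis assoc)
  also have "\<dots> = a \<^bold>* (pw n a \<^bold>* b)" using Suc by simp
  finally show ?case by (simp add: pw_Suc assoc)
qed (simp add: pw_0)

lemma pw_mult_comm: "a \<^bold>* b = b \<^bold>* a \<Longrightarrow> pw n (a \<^bold>* b) = pw n a \<^bold>* pw n b"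
proof (induction n)
  case (Suc n)
  have "a \<^bold>* b \<^bold>* (pw n a \<^bold>* pw n b) = a \<^bold>* (b \<^bold>* pw n a) \<^bold>* pw n b" by (simp add: assoc)
  also have "\<dots> = a \<^bold>* (pw n a \<^bold>* b) \<^bold>* pw n b" using pw_comm[OF Suc.prems] by simp
  finally show ?case using Suc by (simp add: pw_Suc assoc)
qed (simp add: pw_0)

lemma inverse_comm: "a \<^bold>* b = b \<^bold>* a \<Longrightarrow> a \<^bold>* inverse b = inverse b \<^bold>* a"
proof -
  assume ab: "a \<^bold>* b = b \<^bold>* a"
  have "inverse b \<^bold>* (a \<^bold>* b) \<^bold>* inverse b = inverse b \<^bold>* (b \<^bold>* a) \<^bold>* inverse b" using ab by simp
  also have "inverse b \<^bold>* (b \<^bold>* a) \<^bold>* inverse b = a \<^bold>* inverse b" by (simp add: assoc[symmetric])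
  also have "inverse b \<^bold>* (a \<^bold>* b) \<^bold>* inverse b = inverse b \<^bold>* a" by (simp add: assoc)
  finally show ?thesis by simp
qed

text \<open>The values commute because addition does, so fractions \<tau> p (\<tau> q)^-1 depend
  only on p - q and multiply as expected.\<close>

lemma half_line_hom_extend:
  fixes \<tau> :: "real \<Rightarrow> 'a"
  assumes hom: "\<And>s t. 0 \<le> s \<Longrightarrow> 0 \<le> t \<Longrightarrow> \<tau> (s + t) = \<tau> s \<^bold>* \<tau> t"
  shows "\<exists>\<sigma>. (\<forall>s t. \<sigma> (s + t) = \<sigma> s \<^bold>* \<sigma> t) \<and> (\<forall>t\<ge>0. \<sigma> t = \<tau> t)"
proof -
  have comm: "\<tau> s \<^bold>* \<tau> t = \<tau> t \<^bold>* \<tau> s" if "0 \<le> s" "0 \<le> t" for s t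
    using hom[OF that] hom[OF that(2,1)] by (simp add: add.commute)
  have t0: "\<tau> 0 = \<^bold>1" using hom[of 0 0] left_cancel[of "\<tau> 0" "\<tau> 0" "\<^bold>1"] by simp
  \<comment> \<open>Cross-multiplication: p - q = p' - q' means p + q' = p' + q, and commuting
    values allow the factors to be regrouped.\<close>
  have wd: "\<tau> p \<^bold>* inverse (\<tau> q) = \<tau> p' \<^bold>* inverse (\<tau> q')"
    if "0 \<le> p" "0 \<le> q" "0 \<le> p'" "0 \<le> q'" "p - q = p' - q'" for p q p' q'
  proof -
    have "p + q' = p' + q" using that by simp
    then have e: "\<tau> p \<^bold>* \<tau> q' = \<tau> p' \<^bold>* \<tau> q" using hom that by metis
    have "\<tau> p \<^bold>* inverse (\<tau> q) = \<tau> p \<^bold>* (\<tau> q' \<^bold>* inverse (\<tau> q')) \<^bold>* inverse (\<tau> q)"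
      by (simp only: right_inverse right_neutral)
    also have "\<dots> = \<tau> p \<^bold>* \<tau> q' \<^bold>* (inverse (\<tau> q') \<^bold>* inverse (\<tau> q))" by (simp only: assoc)
    also have "\<dots> = \<tau> p' \<^bold>* \<tau> q \<^bold>* (inverse (\<tau> q) \<^bold>* inverse (\<tau> q'))"
      using e comm[OF that(2,4)] by (simp add: inverse_distrib_swap[symmetric])
    also have "\<dots> = \<tau> p' \<^bold>* (\<tau> q \<^bold>* inverse (\<tau> q)) \<^bold>* inverse (\<tau> q')" by (simp only: assoc)
    finally show ?thesis by (simp only: right_inverse right_neutral)
  qed
  define \<sigma> where "\<sigma> t = \<tau> (max t 0) \<^bold>* inverse (\<tau> (max (- t) 0))" for t
  have \<sigma>: "\<sigma> t = \<tau> p \<^bold>* inverse (\<tau> q)" if "0 \<le> p" "0 \<le> q" "t = p - q" for t p q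
    unfolding \<sigma>_def by (rule wd) (use that in auto)
  have "\<sigma> (s + t) = \<sigma> s \<^bold>* \<sigma> t" for s t
  proof -
    let ?p = "max s 0" and ?q = "max (- s) 0" and ?p' = "max t 0" and ?q' = "max (- t) 0"
    have "\<sigma> (s + t) = \<tau> (?p + ?p') \<^bold>* inverse (\<tau> (?q + ?q'))" by (rule \<sigma>) auto
    also have "\<dots> = \<tau> ?p \<^bold>* \<tau> ?p' \<^bold>* (inverse (\<tau> ?q) \<^bold>* inverse (\<tau> ?q'))"
      using comm[of ?q ?q'] by (simp add: hom inverse_distrib_swap[symmetric])
    also have "\<dots> = \<tau> ?p \<^bold>* (\<tau> ?p' \<^bold>* inverse (\<tau> ?q)) \<^bold>* inverse (\<tau> ?q')" by (simp only: assoc)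
    also have "\<tau> ?p' \<^bold>* inverse (\<tau> ?q) = inverse (\<tau> ?q) \<^bold>* \<tau> ?p'" by (rule inverse_comm) (rule comm, auto)
    finally show ?thesis unfolding \<sigma>_def by (simp only: assoc)
  qed
  moreover have "\<sigma> t = \<tau> t" if "t \<ge> 0" for t using \<sigma>[of t 0 t] that t0 by simp
  ultimately show ?thesis by blast
qed

text \<open>The value at a large t has to be the n-th power of \<sigma>0 (t / n) for any n with t /
  n \<le> \<delta>; negative times are reached through \<open>half_line_hom_extend\<close>.\<close>

lemma local_hom_extend:
  fixes \<sigma>0 :: "real \<Rightarrow> 'a"
  assumes \<delta>: "\<delta> > 0" and hom: "\<And>s t. 0 \<le> s \<Longrightarrow> 0 \<le> t \<Longrightarrow> s + t \<le> \<delta> \<Longrightarrow> \<sigma>0 (s + t) = \<sigma>0 s \<^bold>* \<sigma>0 t"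
  shows "\<exists>\<sigma>. (\<forall>s t. \<sigma> (s + t) = \<sigma> s \<^bold>* \<sigma> t) \<and> (\<forall>t\<in>{0..\<delta>}. \<sigma> t = \<sigma>0 t)"
proof -
  have s0: "\<sigma>0 0 = \<^bold>1" using hom[of 0 0] left_cancel[of "\<sigma>0 0" "\<sigma>0 0" "\<^bold>1"] \<delta> by simp
  have pws: "pw n (\<sigma>0 a) = \<sigma>0 (real n * a)" if "0 \<le> a" "real n * a \<le> \<delta>" for n a
    using that
  proof (induction n)
    case (Suc n)
    have e: "real (Suc n) * a = a + real n * a" by (simp add: algebra_simps)
    then have "real n * a \<le> \<delta>" using Suc.prems by linarith
    then show ?case using Suc hom[of a "real n * a"] unfolding e by (simp add: pw_Suc)
  qed (simp add: pw_0 s0)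
  define N where "N t = Suc (nat \<lceil>t / \<delta>\<rceil>)" for t
  have N: "t / real (N t) \<le> \<delta>" for t
  proof -
    have "t / \<delta> \<le> real (N t)" unfolding N_def by linarith
    then have "t \<le> real (N t) * \<delta>" using \<delta> by (simp add: pos_divide_le_eq)
    moreover have "real (N t) > 0" by (simp add: N_def)
    ultimately show ?thesis by (simp add: pos_divide_le_eq mult.commute)
  qed
  define \<tau> where "\<tau> t = pw (N t) (\<sigma>0 (t / real (N t)))" for t
  \<comment> \<open>Independence of n: both candidates are powers of the value at t / (N t * n), the
    common refinement.\<close>
  have \<tau>: "\<tau> t = pw n (\<sigma>0 (t / real n))" if t: "0 \<le> t" and n: "0 < n" "t / real n \<le> \<delta>" for t n
  proof -
    have Np: "N t > 0" by (simp add: N_def)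
    let ?a = "\<sigma>0 (t / (real (N t) * real n))"
    have "pw n ?a = \<sigma>0 (t / real (N t))"
      using pws[of "t / (real (N t) * real n)" n] t n N[of t] Np by simp
    moreover have "pw (N t) ?a = \<sigma>0 (t / real n)"
      using pws[of "t / (real (N t) * real n)" "N t"] t n Np by simp
    ultimately show ?thesis
      unfolding \<tau>_def using pw_mult[of "N t" n ?a] pw_mult[of n "N t" ?a] by (simp add: mult.commute)
  qed
  have "\<tau> (s + t) = \<tau> s \<^bold>* \<tau> t" if st: "0 \<le> s" "0 \<le> t" for s t
  proof -
    let ?n = "N (s + t)"
    have n: "0 < ?n" by (simp add: N_def)
    have le: "(s + t) / real ?n \<le> \<delta>" by (rule N)
    have parts: "s / real ?n \<le> \<delta>" "t / real ?n \<le> \<delta>" "s / real ?n + t / real ?n \<le> \<delta>"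
    proof -
      have "0 \<le> s / real ?n" "0 \<le> t / real ?n" using st by auto
      then show "s / real ?n \<le> \<delta>" "t / real ?n \<le> \<delta>" "s / real ?n + t / real ?n \<le> \<delta>"
        using le by (auto simp: add_divide_distrib)
    qed
    have "\<sigma>0 (s / real ?n) \<^bold>* \<sigma>0 (t / real ?n) = \<sigma>0 (t / real ?n) \<^bold>* \<sigma>0 (s / real ?n)"
      using hom[of "s / real ?n" "t / real ?n"] hom[of "t / real ?n" "s / real ?n"] st parts by (simp add: add.commute)
    from pw_mult_comm[OF this, of ?n]
    show ?thesis
      using \<tau>[OF _ n le] \<tau>[OF st(1) n parts(1)] \<tau>[OF st(2) n parts(2)] hom[of "s / real ?n" "t / real ?n"] st parts
      by (simp add: add_divide_distrib)
  qed
  from half_line_hom_extend[of \<tau>, OF this]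
  obtain \<sigma> where \<sigma>: "\<forall>s t. \<sigma> (s + t) = \<sigma> s \<^bold>* \<sigma> t" "\<forall>t\<ge>0. \<sigma> t = \<tau> t" by blast
  have "\<sigma> t = \<sigma>0 t" if "t \<in> {0..\<delta>}" for t
    using \<sigma>(2) \<tau>[of t 1] that by (simp add: pw_1)
  with \<sigma>(1) show ?thesis by blast
qed

lemma hom_pw:
  assumes "\<And>s t. \<sigma> (s + t) = \<sigma> s \<^bold>* \<sigma> (t :: real)"
  shows "\<sigma> 0 = \<^bold>1" "\<sigma> (real n * t) = pw n (\<sigma> t)" "\<sigma> (- t) = inverse (\<sigma> t)"
proof -
  show z: "\<sigma> 0 = \<^bold>1" using assms[of 0 0] left_cancel[of "\<sigma> 0" "\<sigma> 0" "\<^bold>1"] by simp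
  show "\<sigma> (real n * t) = pw n (\<sigma> t)"
    by (induction n) (simp_all add: pw_0 pw_Suc z distrib_right assms)
  have "\<sigma> t \<^bold>* \<sigma> (- t) = \<^bold>1" using assms[of t "- t"] z by simp
  then show "\<sigma> (- t) = inverse (\<sigma> t)" using inverse_unique by metis
qed

end

section \<open>Left-invariant vector fields and their integral curves\<close>

context lie_group
begin

lemma mul_rep:
  assumes "c \<in> A" "d \<in> A" "e \<in> A"
  shows "open (pair_dom c d e UNIV (\<lambda>(a, b). mul a b))"
    "smooth_on (pair_dom c d e UNIV (\<lambda>(a, b). mul a b)) (\<lambda>zw. snd e (mul (inv_chart c (fst zw)) (inv_chart d (snd zw))))"
  using smooth_map_pair[OF atlas atlas atlas smooth_mul assms] by (simp_all add: case_prod_unfold)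

end

text \<open>\<open>V \<kappa>\<close> is, in the chart \<open>e\<close>, the left-invariant vector field with the value \<open>\<kappa>\<close> at the unit.\<close>

locale lie_group_chart = lie_group A mul one ginv
  for A :: "('g::t2_space, 'k::finite_dim_normed) chart set"
  and mul :: "'g \<Rightarrow> 'g \<Rightarrow> 'g" and one :: 'g and ginv :: "'g \<Rightarrow> 'g" +
  fixes e :: "('g, 'k) chart"
  assumes e: "e \<in> A" "one \<in> fst e"
begin

abbreviation h0 :: 'k where "h0 \<equiv> snd e one"

definition S :: "('k \<times> 'k) set" where "S = pair_dom e e e UNIV (\<lambda>(a, b). mul a b)"

definition m :: "'k \<times> 'k \<Rightarrow> 'k" where "m zw = snd e (mul (inv_chart e (fst zw)) (inv_chart e (snd zw)))"

definition V :: "'k \<Rightarrow> 'k \<Rightarrow> 'k" where "V \<kappa> h = frechet_derivative m (at (h, h0)) (0, \<kappa>)"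

lemma S: "open S" "smooth_on S m"
  unfolding S_def m_def[abs_def] by (rule mul_rep[OF e(1) e(1) e(1)])+

lemma inv_h0: "inv_chart e h0 = one" by (rule chart_inv[OF atlas e])

lemma h0_in: "h0 \<in> snd e ` fst e" using e(2) by blast

lemma S_iff: "(h, k) \<in> S \<longleftrightarrow> h \<in> snd e ` fst e \<and> k \<in> snd e ` fst e \<and> mul (inv_chart e h) (inv_chart e k) \<in> fst e"
  unfolding S_def pair_dom_def by auto

lemma S_unit: "h \<in> snd e ` fst e \<Longrightarrow> (h, h0) \<in> S" "h \<in> snd e ` fst e \<Longrightarrow> (h0, h) \<in> S"
  unfolding S_iff using h0_in by (auto simp: inv_h0 inv_into_into)

lemma m_unit: "h \<in> snd e ` fst e \<Longrightarrow> m (h, h0) = h" "h \<in> snd e ` fst e \<Longrightarrow> m (h0, h) = h"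
  unfolding m_def by (auto simp: inv_h0 f_inv_into_f)

lemma m_in: "(h, k) \<in> S \<Longrightarrow> m (h, k) \<in> snd e ` fst e"
  and inv_m: "(h, k) \<in> S \<Longrightarrow> inv_chart e (m (h, k)) = mul (inv_chart e h) (inv_chart e k)"
  unfolding S_iff m_def using chart_inv[OF atlas e(1)] by auto

lemma m_deriv: "q \<in> S \<Longrightarrow> (m has_derivative frechet_derivative m (at q)) (at q)"
  by (rule smooth_on_has_derivative[OF S(2)])

lemma m_deriv2:
  assumes "(h, \<zeta> t) \<in> S" "(\<zeta> has_vector_derivative v) (at t within T)"
  shows "((\<lambda>t. m (h, \<zeta> t)) has_vector_derivative frechet_derivative m (at (h, \<zeta> t)) (0, v)) (at t within T)"
  using has_vector_derivative_chain[where f=m and \<zeta>="\<lambda>t. (h, \<zeta> t)", OF m_deriv[OF assms(1)]]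
    has_vector_derivative_Pair[OF has_vector_derivative_const assms(2)] by blast

text \<open>Associativity, h (k \<zeta>) = (h k) \<zeta>, differentiated with respect to \<zeta> at
  the unit in the direction \<kappa>.\<close>

lemma V_invariant:
  assumes hk: "(h, k) \<in> S"
  shows "frechet_derivative m (at (h, k)) (0, V \<kappa> k) = V \<kappa> (m (h, k))"
proof -
  let ?\<zeta> = "\<lambda>t. h0 + t *\<^sub>R \<kappa>"
  have \<zeta>: "(?\<zeta> has_vector_derivative \<kappa>) (at 0)" by (auto intro!: derivative_eq_intros)
  have k: "k \<in> snd e ` fst e" using hk S_iff by blast
  have 1: "((\<lambda>t. m (k, ?\<zeta> t)) has_vector_derivative V \<kappa> k) (at 0)"
    using m_deriv2[of k ?\<zeta> 0, OF _ \<zeta>] S_unit(1)[OF k] by (simp add: V_def)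
  have 2: "((\<lambda>t. m (h, m (k, ?\<zeta> t))) has_vector_derivative frechet_derivative m (at (h, k)) (0, V \<kappa> k)) (at 0)"
    using m_deriv2[of h "\<lambda>t. m (k, ?\<zeta> t)" 0, OF _ 1] hk m_unit(1)[OF k] by simp
  have 3: "((\<lambda>t. m (m (h, k), ?\<zeta> t)) has_vector_derivative V \<kappa> (m (h, k))) (at 0)"
    using m_deriv2[of "m (h, k)" ?\<zeta> 0, OF _ \<zeta>] S_unit(1)[OF m_in[OF hk]] by (simp add: V_def)
  have ev: "\<forall>\<^sub>F t in nhds (0::real). m (h, m (k, ?\<zeta> t)) = m (m (h, k), ?\<zeta> t)"
  proof -
    have "isCont (\<lambda>t. (k, ?\<zeta> t)) 0" by (intro continuous_intros)
    then have "\<forall>\<^sub>F t in nhds 0. (k, ?\<zeta> t) \<in> S"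
      by (rule isCont_eventually) (use S(1) S_unit(1)[OF k] in auto)
    moreover have "isCont (\<lambda>t. (h, m (k, ?\<zeta> t))) 0"
      using has_vector_derivative_continuous[OF 1] by (intro continuous_intros) auto
    then have "\<forall>\<^sub>F t in nhds 0. (h, m (k, ?\<zeta> t)) \<in> S"
      by (rule isCont_eventually) (use S(1) hk m_unit(1)[OF k] in auto)
    ultimately show ?thesis
    proof eventually_elim
      case (elim t)
      have "m (h, m (k, ?\<zeta> t)) = snd e (mul (inv_chart e h) (mul (inv_chart e k) (inv_chart e (?\<zeta> t))))"
        using inv_m[OF elim(1)] unfolding m_def[of "(h, m (k, ?\<zeta> t))"] by simp
      also have "\<dots> = m (m (h, k), ?\<zeta> t)"
        using inv_m[OF hk] unfolding m_def[of "(m (h, k), ?\<zeta> t)"] by (simp add: assoc)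
      finally show ?case .
    qed
  qed
  have "((\<lambda>t. m (m (h, k), ?\<zeta> t)) has_vector_derivative frechet_derivative m (at (h, k)) (0, V \<kappa> k)) (at 0)"
    by (rule has_vector_derivative_cong_nhds[OF 2 ev])
  then show ?thesis using vector_derivative_unique_at 3 by blast
qed

text \<open>The field is a partial derivative of the smooth multiplication, hence locally bounded
  and Lipschitz. The same ball is kept so small that products of its points stay in the
  chart.\<close>

lemma V_local:
  "\<exists>r>0. \<exists>L\<ge>0. cball h0 r \<subseteq> snd e ` fst e \<and> cball h0 r \<times> cball h0 r \<subseteq> S \<and>
     (\<forall>x\<in>cball h0 r. \<forall>y\<in>cball h0 r. norm (V \<kappa> x - V \<kappa> y) \<le> L * norm (x - y)) \<and>
     (\<forall>x\<in>cball h0 r. norm (V \<kappa> x) \<le> L)"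
proof -
  have "(h0, h0) \<in> S" using S_unit h0_in by blast
  then obtain R where R: "R > 0" "cball (h0, h0) R \<subseteq> S" using S(1) open_contains_cball by blast
  obtain K where K: "K \<ge> 0" and T: "\<forall>z\<in>cball (h0, h0) R. \<forall>z'\<in>cball (h0, h0) R.
     norm (m z' - m z) \<le> K * norm (z' - z) \<and>
     (\<forall>v. norm (frechet_derivative m (at z) v) \<le> K * norm v) \<and>
     (\<forall>v. norm (frechet_derivative m (at z') v - frechet_derivative m (at z) v) \<le> K * norm (z' - z) * norm v) \<and>
     norm (m z' - m z - frechet_derivative m (at z) (z' - z)) \<le> K * (norm (z' - z))\<^sup>2"
    using smooth_on_taylor[OF S(2) R(2)] by blast
  obtain r0 where r0: "r0 > 0" "cball h0 r0 \<subseteq> snd e ` fst e"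
    using chart_open(2)[OF atlas e(1)] h0_in open_contains_cball by blast
  define r where "r = min r0 (R / 2)"
  have pair: "(x, y) \<in> cball (h0, h0) R" if "x \<in> cball h0 r" "y \<in> cball h0 r" for x y
  proof -
    have "dist (h0, h0) (x, y) \<le> dist h0 x + dist h0 y"
      unfolding dist_Pair_Pair by (rule sqrt_sum_squares_le_sum) auto
    then show ?thesis using that by (simp add: r_def)
  qed
  have rpos: "r > 0" using r0 R by (simp add: r_def)
  have c0: "h0 \<in> cball h0 r" using rpos by simp
  show ?thesis
  proof (rule exI[of _ r], rule conjI[OF rpos], rule exI[of _ "K * norm \<kappa>"], intro conjI ballI)
    show "cball h0 r \<subseteq> snd e ` fst e" using r0 by (auto simp: r_def)
    show "cball h0 r \<times> cball h0 r \<subseteq> S" using pair R(2) by auto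
    fix x assume x: "x \<in> cball h0 r"
    have "norm (frechet_derivative m (at (x, h0)) (0, \<kappa>)) \<le> K * norm (0 :: 'k, \<kappa>)"
      using bspec[OF bspec[OF T pair[OF x c0]] pair[OF x c0]] by blast
    then show "norm (V \<kappa> x) \<le> K * norm \<kappa>" unfolding V_def by (simp add: norm_Pair)
    fix y assume y: "y \<in> cball h0 r"
    have "norm (frechet_derivative m (at (x, h0)) (0, \<kappa>) - frechet_derivative m (at (y, h0)) (0, \<kappa>))
        \<le> K * norm ((x, h0) - (y, h0)) * norm (0 :: 'k, \<kappa>)"
      using bspec[OF bspec[OF T pair[OF y c0]] pair[OF x c0]] by blast
    then show "norm (V \<kappa> x - V \<kappa> y) \<le> K * norm \<kappa> * norm (x - y)"
      unfolding V_def by (simp add: norm_Pair mult_ac)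
  qed (use K in auto)
qed

lemma inv_chart_continuous: "continuous_on (snd e ` fst e) (inv_chart e)"
  by (rule chart_inv_cont[OF atlas e(1)])

text \<open>The integral curve through the unit exists by \<open>davie_exists\<close> with exponent
  1 and driver t. It is multiplicative because the curves with values h (s + t) and m (h s, h t)
  solve the same equation, the second one by \<open>V_invariant\<close>, with the same value at t =
  0.\<close>

lemma local_one_parameter:
  "\<exists>\<delta>>0. \<exists>h. h 0 = h0 \<and> (\<forall>t\<in>{0..\<delta>}. h t \<in> snd e ` fst e \<and> (h has_vector_derivative V \<kappa> (h t)) (at t within {0..\<delta>})) \<and>
     (\<forall>s t. 0 \<le> s \<longrightarrow> 0 \<le> t \<longrightarrow> s + t \<le> \<delta> \<longrightarrow> (h s, h t) \<in> S \<and> h (s + t) = m (h s, h t))"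
proof -
  obtain r L where r: "r > 0" "L \<ge> 0" "cball h0 r \<subseteq> snd e ` fst e" "cball h0 r \<times> cball h0 r \<subseteq> S"
    "\<And>x y. x \<in> cball h0 r \<Longrightarrow> y \<in> cball h0 r \<Longrightarrow> norm (V \<kappa> x - V \<kappa> y) \<le> L * norm (x - y)"
    "\<And>x. x \<in> cball h0 r \<Longrightarrow> norm (V \<kappa> x) \<le> L"
    using V_local[of \<kappa>] by auto
  have "isCont m (h0, h0)"
    using has_derivative_continuous[OF m_deriv] S_unit(1)[OF h0_in] by auto
  then have "\<forall>\<^sub>F q in nhds (h0, h0). m q \<in> ball h0 r"
    using topological_tendstoD[OF _ open_ball, of m "m (h0, h0)" "at (h0, h0)" h0 r] m_unit(1)[OF h0_in] r(1)
    by (simp add: isCont_def eventually_nhds_conv_at)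
  then obtain W where W: "open W" "(h0, h0) \<in> W" "\<And>q. q \<in> W \<Longrightarrow> m q \<in> ball h0 r"
    unfolding eventually_nhds by blast
  obtain X Y where XY: "open X" "open Y" "h0 \<in> X" "h0 \<in> Y" "X \<times> Y \<subseteq> W"
    using open_prod_elim[OF W(1,2)] by (metis mem_Sigma_iff)
  \<comment> \<open>Products of points of this smaller ball lie in the ball of radius r, where the
    field is Lipschitz; \<open>ode_unique\<close> compares solutions there.\<close>
  obtain r1 where r1: "r1 > 0" "cball h0 r1 \<subseteq> X \<inter> Y \<inter> ball h0 r"
  proof -
    have "open (X \<inter> Y \<inter> ball h0 r)" "h0 \<in> X \<inter> Y \<inter> ball h0 r" using XY r(1) by auto
    then show ?thesis using that open_contains_cball by metis
  qed
  have sub: "cball h0 r1 \<subseteq> cball h0 r" using r1 by auto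
  have mball: "m (x, y) \<in> cball h0 r" if "x \<in> cball h0 r1" "y \<in> cball h0 r1" for x y
  proof -
    have "x \<in> X" "y \<in> Y" using r1(2) that by blast+
    then have "(x, y) \<in> W" using XY(5) by blast
    from W(3)[OF this] show ?thesis by simp
  qed
  define K where "K = L + 1"
  have K: "K \<ge> 0" "L \<le> K" "1 \<le> K" using r(2) by (auto simp: K_def)
  have a1: "1 / 2 < (1::real)" "(1::real) \<le> 1" by auto
  obtain \<delta>0 where \<delta>0: "\<delta>0 > 0" and dav: "\<forall>(H :: real \<Rightarrow> 'k \<Rightarrow> real \<Rightarrow> 'k) x a b z1.
    a \<le> b \<longrightarrow> b - a < \<delta>0 \<longrightarrow> norm (z1 - h0) \<le> r1 / 2 \<longrightarrow>
    (\<forall>s\<in>{a..b}. \<forall>t\<in>{a..b}. norm (x t - x s) \<le> K * \<bar>t - s\<bar> powr 1) \<longrightarrow>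
    (\<forall>s\<in>{a..b}. \<forall>z\<in>cball h0 r1. linear (H s z) \<and> (\<forall>v. norm (H s z v) \<le> K * norm v)) \<longrightarrow>
    (\<forall>s\<in>{a..b}. \<forall>u\<in>{a..b}. \<forall>z\<in>cball h0 r1. \<forall>w\<in>cball h0 r1. \<forall>v.
      norm (H u w v - H s z v) \<le> K * (\<bar>u - s\<bar> powr 1 + norm (w - z)) * norm v) \<longrightarrow>
    (\<exists>w. w a = z1 \<and> (\<forall>t\<in>{a..b}. w t \<in> cball h0 r1) \<and> (\<exists>C. \<forall>s\<in>{a..b}. \<forall>t\<in>{a..b}.
       norm (w t - w s) \<le> C * \<bar>t - s\<bar> powr 1 \<and>
       norm (w t - w s - H s (w s) (x t - x s)) \<le> C * \<bar>t - s\<bar> powr (2 * 1)))"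
    using davie_exists[OF a1 K(1) r1(1), of h0] by blast
  \<comment> \<open>Below \<delta>0 for existence, and with L * \<delta> < 1 for
    \<open>ode_unique\<close>.\<close>
  define \<delta> where "\<delta> = min (\<delta>0 / 2) (1 / (2 * (L + 1)))"
  have \<delta>: "\<delta> > 0" "\<delta> < \<delta>0" "L * \<delta> < 1"
  proof -
    show "\<delta> > 0" "\<delta> < \<delta>0" using \<delta>0 r(2) by (auto simp: \<delta>_def)
    have "L * \<delta> \<le> L * (1 / (2 * (L + 1)))" using r(2) by (intro mult_left_mono) (auto simp: \<delta>_def)
    also have "\<dots> < 1" using r(2) by (simp add: field_simps)
    finally show "L * \<delta> < 1" .
  qed
  let ?H = "\<lambda>(s::real) z v. v *\<^sub>R V \<kappa> z"
  note D = dav[THEN spec[where x="?H"], THEN spec[where x="\<lambda>t. t"], THEN spec[where x=0], THEN spec[where x=\<delta>], THEN spec[where x=h0]]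
  have c: "0 \<le> \<delta>" "\<delta> - 0 < \<delta>0" "norm (h0 - h0) \<le> r1 / 2" using \<delta> r1 by auto
  have c1: "\<forall>s\<in>{0..\<delta>}. \<forall>t\<in>{0..\<delta>}. norm (t - s) \<le> K * \<bar>t - s\<bar> powr 1"
  proof (intro ballI)
    fix s t show "norm (t - s) \<le> K * \<bar>t - s\<bar> powr 1" for s t :: real
      using mult_right_mono[OF K(3), of "\<bar>t - s\<bar>"] by (cases "t = s") auto
  qed
  have c2: "\<forall>s\<in>{0..\<delta>}. \<forall>z\<in>cball h0 r1. linear (?H s z) \<and> (\<forall>v. norm (?H s z v) \<le> K * norm v)"
  proof (intro ballI conjI allI)
    fix z v assume "z \<in> cball h0 r1"
    then have "norm (V \<kappa> z) \<le> K" using r(6)[of z] sub K(2) by auto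
    then show "norm (v *\<^sub>R V \<kappa> z) \<le> K * norm v" for v by (simp add: mult.commute[of K] mult_left_mono)
    show "linear (\<lambda>v. v *\<^sub>R V \<kappa> z)" by (rule linearI) (auto simp: scaleR_add_left)
  qed
  have c3: "\<forall>s\<in>{0..\<delta>}. \<forall>u\<in>{0..\<delta>}. \<forall>z\<in>cball h0 r1. \<forall>w\<in>cball h0 r1. \<forall>v.
      norm (?H u w v - ?H s z v) \<le> K * (\<bar>u - s\<bar> powr 1 + norm (w - z)) * norm v"
  proof (intro ballI allI)
    fix s u z w and v :: real assume zw: "z \<in> cball h0 r1" "w \<in> cball h0 r1"
    have "norm (V \<kappa> w - V \<kappa> z) \<le> L * norm (w - z)" using r(5) zw sub by blast
    also have "\<dots> \<le> K * (\<bar>u - s\<bar> powr 1 + norm (w - z))" using K r(2) by (intro mult_mono) auto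
    finally have "norm (V \<kappa> w - V \<kappa> z) * \<bar>v\<bar> \<le> K * (\<bar>u - s\<bar> powr 1 + norm (w - z)) * \<bar>v\<bar>"
      by (rule mult_right_mono) simp
    then show "norm (?H u w v - ?H s z v) \<le> K * (\<bar>u - s\<bar> powr 1 + norm (w - z)) * norm v"
      by (simp add: scaleR_diff_right[symmetric] mult.commute[of "\<bar>v\<bar>"])
  qed
  obtain h C where h: "h 0 = h0" "\<And>t. t \<in> {0..\<delta>} \<Longrightarrow> h t \<in> cball h0 r1"
    "\<And>s t. s \<in> {0..\<delta>} \<Longrightarrow> t \<in> {0..\<delta>} \<Longrightarrow> norm (h t - h s - (t - s) *\<^sub>R V \<kappa> (h s)) \<le> C * \<bar>t - s\<bar> powr (2 * 1)"
    using mp[OF mp[OF mp[OF mp[OF mp[OF mp[OF D c(1)] c(2)] c(3)] c1] c2] c3] by blast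
  \<comment> \<open>With exponent 1 the error of a step is quadratic in t - s, which is
    differentiability, one-sided at the ends of the interval.\<close>
  have der: "(h has_vector_derivative V \<kappa> (h s)) (at s within {0..\<delta>})" if s: "s \<in> {0..\<delta>}" for s
    unfolding has_vector_derivative_def has_derivative_within'
  proof (intro conjI allI impI bounded_linear_scaleR_left)
    fix \<epsilon> :: real assume \<epsilon>: "\<epsilon> > 0"
    show "\<exists>d>0. \<forall>t\<in>{0..\<delta>}. 0 < norm (t - s) \<and> norm (t - s) < d \<longrightarrow>
        norm (h t - h s - (t - s) *\<^sub>R V \<kappa> (h s)) / norm (t - s) < \<epsilon>"
    proof (intro exI[of _ "\<epsilon> / (\<bar>C\<bar> + 1)"] conjI ballI impI)
      fix t assume t: "t \<in> {0..\<delta>}" "0 < norm (t - s) \<and> norm (t - s) < \<epsilon> / (\<bar>C\<bar> + 1)"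
      have "norm (h t - h s - (t - s) *\<^sub>R V \<kappa> (h s)) \<le> C * \<bar>t - s\<bar> powr (2 * 1)" by (rule h(3)[OF s t(1)])
      also have "\<bar>t - s\<bar> powr (2 * 1) = \<bar>t - s\<bar> * \<bar>t - s\<bar>" using t by (simp add: powr_numeral power2_eq_square)
      also have "C * (\<bar>t - s\<bar> * \<bar>t - s\<bar>) \<le> (\<bar>C\<bar> + 1) * (\<bar>t - s\<bar> * \<bar>t - s\<bar>)" by (intro mult_right_mono) auto
      finally have "norm (h t - h s - (t - s) *\<^sub>R V \<kappa> (h s)) / norm (t - s) \<le> (\<bar>C\<bar> + 1) * \<bar>t - s\<bar>"
        using t by (simp add: pos_divide_le_eq mult.assoc)
      also have "\<dots> < \<epsilon>" using t by (simp add: pos_less_divide_eq mult.commute)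
      finally show "norm (h t - h s - (t - s) *\<^sub>R V \<kappa> (h s)) / norm (t - s) < \<epsilon>" .
    qed (use \<epsilon> in \<open>simp add: add_nonneg_pos\<close>)
  qed
  have hom: "h (s + t) = m (h s, h t)" if st: "0 \<le> s" "0 \<le> t" "s + t \<le> \<delta>" for s t
  proof -
    let ?\<rho> = "\<delta> - s"
    have "h (s + t) = m (h s, h t)"
    proof (rule ode_unique[where u="\<lambda>t. h (s + t)" and w="\<lambda>t. m (h s, h t)" and L=L and \<rho>="?\<rho>" and B="cball h0 r" and V="V \<kappa>"])
      show "L * ?\<rho> < 1" using \<delta>(3) st r(2) mult_left_mono[of ?\<rho> \<delta> L] by linarith
      show "h (s + t) \<in> cball h0 r \<and> m (h s, h t) \<in> cball h0 r" if "t \<in> {0..?\<rho>}" for t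
        using h(2)[of "s + t"] h(2)[of s] h(2)[of t] mball[of "h s" "h t"] sub that st by auto
      show "((\<lambda>t. h (s + t)) has_vector_derivative V \<kappa> (h (s + t))) (at t within {0..?\<rho>})" if t: "t \<in> {0..?\<rho>}" for t
      proof -
        have "((\<lambda>t. s + t) has_vector_derivative 1) (at t within {0..?\<rho>})" by (auto intro!: derivative_eq_intros)
        moreover have "(\<lambda>t. s + t) ` {0..?\<rho>} \<subseteq> {0..\<delta>}" using st by auto
        then have "(h has_vector_derivative V \<kappa> (h (s + t))) (at (s + t) within (\<lambda>t. s + t) ` {0..?\<rho>})"
          using der[of "s + t"] t st by (intro has_vector_derivative_within_subset[OF der]) auto
        ultimately show ?thesis using vector_diff_chain_within[of "\<lambda>t. s + t" 1 t "{0..?\<rho>}" h] by (simp add: o_def)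
      qed
      show "((\<lambda>t. m (h s, h t)) has_vector_derivative V \<kappa> (m (h s, h t))) (at t within {0..?\<rho>})" if t: "t \<in> {0..?\<rho>}" for t
      proof -
        have "h s \<in> cball h0 r1" "h t \<in> cball h0 r1" using h(2)[of s] h(2)[of t] t st by auto
        then have hS: "(h s, h t) \<in> S" using sub r(4) by blast
        have "(h has_vector_derivative V \<kappa> (h t)) (at t within {0..?\<rho>})"
          by (rule has_vector_derivative_within_subset[OF der]) (use t st in auto)
        from m_deriv2[OF hS this] show ?thesis unfolding V_invariant[OF hS] .
      qed
      show "h (s + 0) = m (h s, h 0)" using h(1) h(2)[of s] sub r(3) st by (simp add: m_unit(1) subset_iff)
    qed (use r st in auto)
    then show ?thesis .
  qed
  show ?thesis
  proof (intro exI[of _ \<delta>] exI[of _ h] conjI ballI allI impI)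
    fix t assume t: "t \<in> {0..\<delta>}"
    show "h t \<in> snd e ` fst e" using h(2)[OF t] sub r(3) by blast
  next
    fix s t :: real assume st: "0 \<le> s" "0 \<le> t" "s + t \<le> \<delta>"
    then have "h s \<in> cball h0 r1" "h t \<in> cball h0 r1" using h(2)[of s] h(2)[of t] by auto
    then show "(h s, h t) \<in> S" using sub r(4) by blast
  qed (use \<delta> h hom der in auto)
qed

lemma isCont_inv_chart:
  fixes u :: "real \<Rightarrow> 'k"
  assumes "isCont u t" "u t \<in> snd e ` fst e" "\<forall>\<^sub>F s in nhds t. \<gamma> s = inv_chart e (u s)"
  shows "isCont \<gamma> t"
proof -
  have "isCont (inv_chart e) (u t)"
    using inv_chart_continuous chart_open(2)[OF atlas e(1)] assms(2) continuous_on_eq_continuous_at by blast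
  then have "isCont (\<lambda>s. inv_chart e (u s)) t" using assms(1) isCont_o2 by blast
  then show ?thesis using isCont_cong[OF assms(3)] by simp
qed

text \<open>By \<sigma> (t + k) = \<sigma> t \<sigma> k the derivative at t is the left translate of
  the derivative at 0, so a homomorphism with velocity \<kappa> is an integral curve of V
  \<kappa>.\<close>

lemma hom_velocity_field:
  assumes hom: "\<And>s t. \<sigma> (s + t) = mul (\<sigma> s) (\<sigma> t)" and v: "has_velocity A \<sigma> (coord_vec A e one \<kappa>) 0"
    and r: "r > 0" "cball h0 r \<times> cball h0 r \<subseteq> S"
  shows "\<exists>\<rho>>0. \<forall>t\<in>{0..\<rho>}. \<sigma> t \<in> fst e \<and> snd e (\<sigma> t) \<in> cball h0 r \<and>
    ((\<lambda>t. snd e (\<sigma> t)) has_vector_derivative V \<kappa> (snd e (\<sigma> t))) (at t)"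
proof -
  let ?u = "\<lambda>t. snd e (\<sigma> t)"
  have s0: "\<sigma> 0 = one" by (rule hom_pw(1)[OF hom])
  have op: "open (fst e \<inter> snd e -` ball h0 r)" by (rule chart_preimage_open[OF atlas e(1) open_ball])
  have "\<forall>\<^sub>F t in nhds 0. \<sigma> t \<in> fst e \<inter> snd e -` ball h0 r"
    by (rule isCont_eventually[OF has_velocity_isCont[OF atlas v] op]) (use s0 e(2) r(1) in auto)
  then obtain d where d: "d > 0" "\<And>t. \<bar>t\<bar> < d \<Longrightarrow> \<sigma> t \<in> fst e \<inter> snd e -` ball h0 r"
    unfolding eventually_nhds_metric by (auto simp: dist_real_def)
  have u0: "(?u has_vector_derivative \<kappa>) (at 0)"
    using has_velocity_derivative[OF atlas v e(1)] s0 e(2) cvec_coord_vec[OF atlas e] by simp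
  have "\<sigma> t \<in> fst e \<and> ?u t \<in> cball h0 r \<and> (?u has_vector_derivative V \<kappa> (?u t)) (at t)" if t: "t \<in> {0..d / 2}" for t
  proof -
    have ut: "\<sigma> t \<in> fst e" "?u t \<in> cball h0 r" using d(2)[of t] t d(1) by auto
    have inS: "(?u t, ?u k) \<in> S" if "\<bar>k\<bar> < d" for k using ut(2) d(2)[OF that] r(2) by auto
    have "((\<lambda>k. m (?u t, ?u k)) has_vector_derivative frechet_derivative m (at (?u t, ?u 0)) (0, \<kappa>)) (at 0)"
      by (rule m_deriv2[OF inS u0]) (use d(1) in simp)
    then have 1: "((\<lambda>k. m (?u t, ?u k)) has_vector_derivative V \<kappa> (?u t)) (at 0)" by (simp add: V_def s0)
    have "\<forall>\<^sub>F k in nhds 0. m (?u t, ?u k) = ?u (t + k)"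
      unfolding eventually_nhds_metric
    proof (intro exI[of _ d] conjI allI impI)
      fix k :: real assume "dist k 0 < d"
      then have "\<sigma> k \<in> fst e" using d(2)[of k] by (simp add: dist_real_def)
      then show "m (?u t, ?u k) = ?u (t + k)"
        unfolding m_def using ut(1) chart_inv[OF atlas e(1)] hom by simp
    qed (use d in auto)
    from has_vector_derivative_cong_nhds[OF 1 this]
    have 2: "((\<lambda>k. ?u (t + k)) has_vector_derivative V \<kappa> (?u t)) (at (t - t))" by simp
    have "((\<lambda>s. s - t) has_vector_derivative 1) (at t)" by (auto intro!: derivative_eq_intros)
    from vector_diff_chain_at[OF this 2] have "(?u has_vector_derivative V \<kappa> (?u t)) (at t)" by (simp add: o_def)
    with ut show ?thesis by blast
  qed
  then show ?thesis using d(1) by (intro exI[of _ "d / 2"]) auto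
qed

text \<open>Near 0, for positive times, both are integral curves of the same field and agree by
  \<open>ode_unique\<close>. Powers and inverses carry the agreement to all times.\<close>

lemma one_parameter_unique:
  assumes hom: "\<And>s t. \<sigma> (s + t) = mul (\<sigma> s) (\<sigma> t)" and v: "has_velocity A \<sigma> (coord_vec A e one \<kappa>) 0"
    and hom': "\<And>s t. \<sigma>' (s + t) = mul (\<sigma>' s) (\<sigma>' t)" and v': "has_velocity A \<sigma>' (coord_vec A e one \<kappa>) 0"
  shows "\<sigma> = \<sigma>'"
proof -
  obtain r L where r: "r > 0" "L \<ge> 0" "cball h0 r \<times> cball h0 r \<subseteq> S"
    "\<And>x y. x \<in> cball h0 r \<Longrightarrow> y \<in> cball h0 r \<Longrightarrow> norm (V \<kappa> x - V \<kappa> y) \<le> L * norm (x - y)"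
    using V_local[of \<kappa>] by auto
  obtain \<rho>1 where \<rho>1: "\<rho>1 > 0" "\<And>t. t \<in> {0..\<rho>1} \<Longrightarrow> \<sigma> t \<in> fst e \<and> snd e (\<sigma> t) \<in> cball h0 r \<and>
    ((\<lambda>t. snd e (\<sigma> t)) has_vector_derivative V \<kappa> (snd e (\<sigma> t))) (at t)"
    using hom_velocity_field[OF hom v r(1,3)] by blast
  obtain \<rho>2 where \<rho>2: "\<rho>2 > 0" "\<And>t. t \<in> {0..\<rho>2} \<Longrightarrow> \<sigma>' t \<in> fst e \<and> snd e (\<sigma>' t) \<in> cball h0 r \<and>
    ((\<lambda>t. snd e (\<sigma>' t)) has_vector_derivative V \<kappa> (snd e (\<sigma>' t))) (at t)"
    using hom_velocity_field[OF hom' v' r(1,3)] by blast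
  define \<rho> where "\<rho> = min (min \<rho>1 \<rho>2) (1 / (2 * (L + 1)))"
  have \<rho>: "\<rho> > 0" "\<rho> \<le> \<rho>1" "\<rho> \<le> \<rho>2" "L * \<rho> < 1"
  proof -
    show "\<rho> > 0" "\<rho> \<le> \<rho>1" "\<rho> \<le> \<rho>2" using \<rho>1 \<rho>2 r(2) by (auto simp: \<rho>_def)
    have "L * \<rho> \<le> L * (1 / (2 * (L + 1)))" using r(2) by (intro mult_left_mono) (auto simp: \<rho>_def)
    also have "\<dots> < 1" using r(2) by (simp add: field_simps)
    finally show "L * \<rho> < 1" .
  qed
  have near: "\<sigma> t = \<sigma>' t" if t: "t \<in> {0..\<rho>}" for t
  proof -
    have "snd e (\<sigma> t) = snd e (\<sigma>' t)"
    proof (rule ode_unique[where u="\<lambda>t. snd e (\<sigma> t)" and w="\<lambda>t. snd e (\<sigma>' t)" and B="cball h0 r" and V="V \<kappa>", OF r(2) \<rho>(4)])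
      show "snd e (\<sigma> 0) = snd e (\<sigma>' 0)" using hom_pw(1)[OF hom] hom_pw(1)[OF hom'] by simp
      fix s assume s: "s \<in> {0..\<rho>}"
      have s12: "s \<in> {0..\<rho>1}" "s \<in> {0..\<rho>2}" using s \<rho> by auto
      show "snd e (\<sigma> s) \<in> cball h0 r \<and> snd e (\<sigma>' s) \<in> cball h0 r" using \<rho>1(2)[OF s12(1)] \<rho>2(2)[OF s12(2)] by blast
      show "((\<lambda>t. snd e (\<sigma> t)) has_vector_derivative V \<kappa> (snd e (\<sigma> s))) (at s within {0..\<rho>})"
        "((\<lambda>t. snd e (\<sigma>' t)) has_vector_derivative V \<kappa> (snd e (\<sigma>' s))) (at s within {0..\<rho>})"
        using \<rho>1(2)[OF s12(1)] \<rho>2(2)[OF s12(2)] has_vector_derivative_at_within by blast+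
    qed (use r \<rho> t in auto)
    moreover have "\<sigma> t \<in> fst e" "\<sigma>' t \<in> fst e" using \<rho>1(2)[of t] \<rho>2(2)[of t] t \<rho> by auto
    ultimately show ?thesis using chart_inj[OF atlas e(1)] by (meson inj_onD)
  qed
  have pos: "\<sigma> t = \<sigma>' t" if "t \<ge> 0" for t
  proof -
    define n where "n = Suc (nat \<lceil>t / \<rho>\<rceil>)"
    have n: "real n > 0" by (simp add: n_def)
    have "t / \<rho> \<le> real n" unfolding n_def by linarith
    then have "t \<le> \<rho> * real n" using \<rho>(1) by (simp add: pos_divide_le_eq mult.commute)
    then have "t / real n \<in> {0..\<rho>}" using n that by (simp add: pos_divide_le_eq)
    then have "pw n (\<sigma> (t / real n)) = pw n (\<sigma>' (t / real n))" using near by simp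
    then show ?thesis using hom_pw(2)[of \<sigma>, OF hom, of n "t / real n"] hom_pw(2)[of \<sigma>', OF hom', of n "t / real n"] n by simp
  qed
  show ?thesis
  proof
    fix t show "\<sigma> t = \<sigma>' t"
      using pos[of t] pos[of "- t"] hom_pw(3)[of \<sigma>, OF hom, of "- t"] hom_pw(3)[of \<sigma>', OF hom', of "- t"] by (cases "t \<ge> 0") auto
  qed
qed

text \<open>The integral curve is available to the right of 0 only, so its derivative at 0 is
  one-sided, while a velocity is two-sided. At an interior time t0 the derivative is two-sided; left
  translation by \<sigma> (- t0) brings it to 0.\<close>

lemma one_parameter_exists:
  "\<exists>\<sigma>. (\<forall>s t. \<sigma> (s + t) = mul (\<sigma> s) (\<sigma> t)) \<and> has_velocity A \<sigma> (coord_vec A e one \<kappa>) 0"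
proof -
  obtain \<delta> h where \<delta>: "\<delta> > 0" and h: "h 0 = h0" "\<And>t. t \<in> {0..\<delta>} \<Longrightarrow> h t \<in> snd e ` fst e"
    "\<And>t. t \<in> {0..\<delta>} \<Longrightarrow> (h has_vector_derivative V \<kappa> (h t)) (at t within {0..\<delta>})"
    "\<And>s t. 0 \<le> s \<Longrightarrow> 0 \<le> t \<Longrightarrow> s + t \<le> \<delta> \<Longrightarrow> (h s, h t) \<in> S"
    "\<And>s t. 0 \<le> s \<Longrightarrow> 0 \<le> t \<Longrightarrow> s + t \<le> \<delta> \<Longrightarrow> h (s + t) = m (h s, h t)"
    using local_one_parameter[of \<kappa>] by blast
  have "inv_chart e (h (s + t)) = mul (inv_chart e (h s)) (inv_chart e (h t))" if "0 \<le> s" "0 \<le> t" "s + t \<le> \<delta>" for s t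
    using h(4,5)[OF that] inv_m by simp
  from local_hom_extend[of \<delta> "\<lambda>t. inv_chart e (h t)", OF \<delta> this]
  obtain \<sigma> where \<sigma>: "\<And>s t. \<sigma> (s + t) = mul (\<sigma> s) (\<sigma> t)" "\<And>t. t \<in> {0..\<delta>} \<Longrightarrow> \<sigma> t = inv_chart e (h t)" by blast
  \<comment> \<open>The midpoint of the interval on which \<sigma> is known in coordinates.\<close>
  define t0 where "t0 = \<delta> / 2"
  have t0: "t0 \<in> {0..\<delta>}" "t0 > 0" "t0 + t0 = \<delta>" using \<delta> by (auto simp: t0_def)
  define b where "b = \<sigma> (- t0)"
  \<comment> \<open>The inverse b of \<sigma> t0 may lie outside the chart e, so the translation by
    b is written in another chart.\<close>
  obtain d where d: "d \<in> A" "b \<in> fst d" using chart_cover[OF atlas] by blast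
  define Q where "Q = pair_dom d e e UNIV (\<lambda>(a, b). mul a b)"
  define \<mu> where "\<mu> zw = snd e (mul (inv_chart d (fst zw)) (inv_chart e (snd zw)))" for zw
  have Q: "open Q" "smooth_on Q \<mu>" unfolding Q_def \<mu>_def[abs_def] by (rule mul_rep[OF d(1) e(1) e(1)])+
  have s0: "\<sigma> 0 = one" by (rule hom_pw(1)[OF \<sigma>(1)])
  have bt: "mul b (\<sigma> (t0 + t)) = \<sigma> t" for t using \<sigma>(1)[of "- t0" "t0 + t"] by (simp add: b_def)
  have inQ: "(snd d b, h t0) \<in> Q"
    unfolding Q_def pair_dom_def
    using d h(2)[OF t0(1)] chart_inv[OF atlas d] \<sigma>(2)[OF t0(1)] bt[of 0] s0 e(2) by auto
  have \<mu>b: "\<mu> (snd d b, w) = snd e (mul b (inv_chart e w))" for w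
    unfolding \<mu>_def using chart_inv[OF atlas d] by simp
  let ?D = "frechet_derivative \<mu> (at (snd d b, h t0))"
  have \<mu>der: "(\<mu> has_derivative ?D) (at (snd d b, h t0))" by (rule smooth_on_has_derivative[OF Q(2) inQ])
  have \<mu>chain: "((\<lambda>t. \<mu> (snd d b, \<zeta> t)) has_vector_derivative ?D (0, v)) (at t)"
    if "(\<zeta> has_vector_derivative v) (at t)" "\<zeta> t = h t0" for \<zeta> v and t :: real
    using has_vector_derivative_chain[where f=\<mu> and \<zeta>="\<lambda>t. (snd d b, \<zeta> t)" and t=t and S=UNIV and f'="?D"]
      \<mu>der has_vector_derivative_Pair[OF has_vector_derivative_const that(1), of "snd d b"] that(2) by simp
  have hder: "((\<lambda>t. h (t0 + t)) has_vector_derivative V \<kappa> (h t0)) (at 0)"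
  proof -
    have "at t0 within {0..\<delta>} = at t0" by (rule at_within_interior) (use t0 \<delta> in \<open>auto simp: interior_atLeastAtMost_real t0_def\<close>)
    then have 1: "(h has_vector_derivative V \<kappa> (h t0)) (at (t0 + 0))" using h(3)[OF t0(1)] by simp
    have "((\<lambda>t. t0 + t) has_vector_derivative 1) (at 0)" by (auto intro!: derivative_eq_intros)
    from vector_diff_chain_at[OF this 1] show ?thesis by (simp add: o_def)
  qed
  \<comment> \<open>V \<kappa> (h t0) is \<kappa> translated by \<sigma> t0, and translation by b
    undoes this.\<close>
  have D\<kappa>: "?D (0, V \<kappa> (h t0)) = \<kappa>"
  proof -
    let ?\<zeta> = "\<lambda>t. h0 + t *\<^sub>R \<kappa>"
    have \<zeta>: "(?\<zeta> has_vector_derivative \<kappa>) (at 0)" by (auto intro!: derivative_eq_intros)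
    have hS: "(h t0, h0) \<in> S" by (rule S_unit(1)[OF h(2)[OF t0(1)]])
    have 1: "((\<lambda>t. m (h t0, ?\<zeta> t)) has_vector_derivative V \<kappa> (h t0)) (at 0)"
      using m_deriv2[of "h t0" ?\<zeta> 0, OF _ \<zeta>] hS by (simp add: V_def)
    have 2: "((\<lambda>t. \<mu> (snd d b, m (h t0, ?\<zeta> t))) has_vector_derivative ?D (0, V \<kappa> (h t0))) (at 0)"
      by (rule \<mu>chain[OF 1]) (simp add: m_unit(1)[OF h(2)[OF t0(1)]])
    have "isCont (\<lambda>t. (h t0, ?\<zeta> t)) 0" by (intro continuous_intros)
    then have "\<forall>\<^sub>F t in nhds 0. (h t0, ?\<zeta> t) \<in> S" by (rule isCont_eventually) (use S(1) hS in auto)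
    then have "\<forall>\<^sub>F t in nhds 0. \<mu> (snd d b, m (h t0, ?\<zeta> t)) = ?\<zeta> t"
    proof eventually_elim
      case (elim t)
      have "mul b (inv_chart e (h t0)) = one" using bt[of 0] \<sigma>(2)[OF t0(1)] s0 by simp
      then have "\<mu> (snd d b, m (h t0, ?\<zeta> t)) = snd e (inv_chart e (?\<zeta> t))"
        unfolding \<mu>b inv_m[OF elim] by (simp add: assoc[symmetric])
      also have "\<dots> = ?\<zeta> t" using elim unfolding S_iff by (simp add: f_inv_into_f)
      finally show ?case .
    qed
    from has_vector_derivative_cong_nhds[OF 2 this] show ?thesis using \<zeta> vector_derivative_unique_at by blast
  qed
  let ?u = "\<lambda>t. \<mu> (snd d b, h (t0 + t))"
  have uder: "(?u has_vector_derivative \<kappa>) (at 0)" using \<mu>chain[OF hder] D\<kappa> by simp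
  have ev1: "\<forall>\<^sub>F t in nhds 0. t0 + t \<in> {0..\<delta>}"
    unfolding eventually_nhds_metric by (intro exI[of _ t0]) (use t0 in \<open>auto simp: dist_real_def\<close>)
  have "isCont (\<lambda>t. (snd d b, h (t0 + t))) 0"
    using has_vector_derivative_continuous[OF hder] by (intro continuous_intros) auto
  then have ev2: "\<forall>\<^sub>F t in nhds 0. (snd d b, h (t0 + t)) \<in> Q" by (rule isCont_eventually) (use Q(1) inQ in auto)
  have ev3: "\<forall>\<^sub>F t in nhds 0. ?u t = snd e (\<sigma> t) \<and> \<sigma> t = inv_chart e (?u t)"
    using ev1 ev2
  proof eventually_elim
    case (elim t)
    have 1: "?u t = snd e (\<sigma> t)" unfolding \<mu>b \<sigma>(2)[OF elim(1), symmetric] bt ..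
    have "mul b (inv_chart e (h (t0 + t))) \<in> fst e"
      using elim(2) chart_inv[OF atlas d] unfolding Q_def pair_dom_def by simp
    then have "\<sigma> t \<in> fst e" unfolding \<sigma>(2)[OF elim(1), symmetric] bt .
    with 1 show ?case using chart_inv[OF atlas e(1)] by simp
  qed
  have u0: "?u 0 = h0" using eventually_nhds_x_imp_x[OF ev3] unfolding s0 by blast
  have cont: "isCont \<sigma> 0"
  proof (rule isCont_inv_chart[where u="?u"])
    show "isCont ?u 0" by (rule has_vector_derivative_continuous[OF uder])
    show "?u 0 \<in> snd e ` fst e" unfolding u0 by (rule h0_in)
    show "\<forall>\<^sub>F t in nhds 0. \<sigma> t = inv_chart e (?u t)" by (rule eventually_mono[OF ev3]) blast
  qed
  have "((\<lambda>t. snd e (\<sigma> t)) has_vector_derivative \<kappa>) (at 0)"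
    by (rule has_vector_derivative_cong_nhds[OF uder eventually_mono[OF ev3]]) blast
  from has_velocity_chart[where \<gamma>=\<sigma>, OF atlas e(1) _ cont this] have "has_velocity A \<sigma> (coord_vec A e one \<kappa>) 0"
    using e(2) s0 by simp
  with \<sigma>(1) show ?thesis by blast
qed

text \<open>The one-parameter subgroup of t Z is s to \<sigma> (t s), so its value at 1 is \<sigma>
  t. Uniqueness is what evaluates the definite description.\<close>

lemma lie_exp_curve:
  "\<exists>\<sigma>. (\<forall>t. lie_exp A mul (\<lambda>f. t * coord_vec A e one \<kappa> f) = \<sigma> t) \<and> \<sigma> 0 = one \<and>
     has_velocity A \<sigma> (coord_vec A e one \<kappa>) 0"
proof -
  obtain \<sigma> where \<sigma>: "\<And>s t. \<sigma> (s + t) = mul (\<sigma> s) (\<sigma> t)" "has_velocity A \<sigma> (coord_vec A e one \<kappa>) 0"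
    using one_parameter_exists by blast
  have "lie_exp A mul (\<lambda>f. t * coord_vec A e one \<kappa> f) = \<sigma> t" for t
  proof -
    have Z: "(\<lambda>f. t * coord_vec A e one \<kappa> f) = coord_vec A e one (t *\<^sub>R \<kappa>)" by (rule coord_vec_scale[OF atlas e])
    have "has_velocity A (\<lambda>s. \<sigma> (t * s + 0)) (\<lambda>f. t * coord_vec A e one \<kappa> f) 0"
      by (rule has_velocity_affine[OF atlas]) (use \<sigma>(2) in simp)
    then have v: "has_velocity A (\<lambda>s. \<sigma> (t * s)) (coord_vec A e one (t *\<^sub>R \<kappa>)) 0" unfolding Z by simp
    have hom: "\<sigma> (t * (r + s)) = mul (\<sigma> (t * r)) (\<sigma> (t * s))" for r s using \<sigma>(1) by (simp add: distrib_left)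
    have "(THE \<sigma>'. one_parameter_subgroup A mul (coord_vec A e one (t *\<^sub>R \<kappa>)) \<sigma>') = (\<lambda>s. \<sigma> (t * s))"
    proof (rule the_equality)
      show "one_parameter_subgroup A mul (coord_vec A e one (t *\<^sub>R \<kappa>)) (\<lambda>s. \<sigma> (t * s))"
        unfolding one_parameter_subgroup_def using hom v by blast
      fix \<sigma>' assume "one_parameter_subgroup A mul (coord_vec A e one (t *\<^sub>R \<kappa>)) \<sigma>'"
      then have "\<And>r s. \<sigma>' (r + s) = mul (\<sigma>' r) (\<sigma>' s)" "has_velocity A \<sigma>' (coord_vec A e one (t *\<^sub>R \<kappa>)) 0"
        unfolding one_parameter_subgroup_def by blast+
      from one_parameter_unique[OF this hom v] show "\<sigma>' = (\<lambda>s. \<sigma> (t * s))" .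
    qed
    then show ?thesis unfolding Z lie_exp_def by simp
  qed
  moreover have "\<sigma> 0 = one" by (rule hom_pw(1)[OF \<sigma>(1)])
  ultimately show ?thesis using \<sigma>(2) by blast
qed

end

section \<open>Locally Lipschitz families of linear maps\<close>

text \<open>A single constant bounds the norms and is the Lipschitz constant in the parameter. The
  coefficient bounds for \<open>davie_exists\<close> are made from such families.\<close>

definition lb_on :: "'p::real_normed_vector set \<Rightarrow> ('p \<Rightarrow> 'a::real_normed_vector \<Rightarrow> 'b::real_normed_vector) \<Rightarrow> real \<Rightarrow> bool" where
  "lb_on N A K \<longleftrightarrow> K \<ge> 0 \<and> (\<forall>p\<in>N. linear (A p) \<and> (\<forall>v. norm (A p v) \<le> K * norm v)) \<and>
     (\<forall>p\<in>N. \<forall>p'\<in>N. \<forall>v. norm (A p' v - A p v) \<le> K * norm (p' - p) * norm v)"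

definition lb_at :: "'p::real_normed_vector \<Rightarrow> ('p \<Rightarrow> 'a::real_normed_vector \<Rightarrow> 'b::real_normed_vector) \<Rightarrow> bool" where
  "lb_at p0 A \<longleftrightarrow> (\<exists>N K. open N \<and> p0 \<in> N \<and> lb_on N A K)"

lemma lb_onD:
  assumes "lb_on N A K"
  shows "K \<ge> 0" "p \<in> N \<Longrightarrow> linear (A p)" "p \<in> N \<Longrightarrow> norm (A p v) \<le> K * norm v"
    "p \<in> N \<Longrightarrow> p' \<in> N \<Longrightarrow> norm (A p' v - A p v) \<le> K * norm (p' - p) * norm v"
  using assms unfolding lb_on_def by blast+

lemma lb_on_subset: "lb_on N A K \<Longrightarrow> M \<subseteq> N \<Longrightarrow> lb_on M A K"
  unfolding lb_on_def by blast

text \<open>K * L bounds the norm of the composition; the product rule gives 2 * (K * L) for its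
  Lipschitz constant. The sum serves as both.\<close>

lemma lb_on_comp:
  assumes A: "lb_on N A K" and B: "lb_on N B L"
  shows "lb_on N (\<lambda>p v. A p (B p v)) (2 * (K * L) + K * L)"
  unfolding lb_on_def
proof (intro conjI ballI allI)
  note K = lb_onD[OF A] and L = lb_onD[OF B]
  have KL: "K * L \<ge> 0" using K(1) L(1) by simp
  then show "0 \<le> 2 * (K * L) + K * L" by simp
  fix p v assume p: "p \<in> N"
  show "linear (\<lambda>v. A p (B p v))" using linear_compose[OF L(2)[OF p] K(2)[OF p]] by (simp add: o_def)
  have ABp: "norm (A q (B p v)) \<le> K * (L * norm v)" if "q \<in> N" for q
    by (rule order_trans[OF K(3)[OF that] mult_left_mono[OF L(3)[OF p] K(1)]])
  have "K * (L * norm v) \<le> (2 * (K * L) + K * L) * norm v"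
    using KL mult_right_mono[of "K * L" "2 * (K * L) + K * L" "norm v"] by (simp add: mult.assoc)
  then show "norm (A p (B p v)) \<le> (2 * (K * L) + K * L) * norm v" using ABp[OF p] by linarith
  fix p' assume p': "p' \<in> N"
  have "A p' (B p' v) - A p (B p v) = A p' (B p' v - B p v) + (A p' (B p v) - A p (B p v))"
    using linear_diff[OF K(2)[OF p']] by simp
  then have "norm (A p' (B p' v) - A p (B p v)) \<le> norm (A p' (B p' v - B p v)) + norm (A p' (B p v) - A p (B p v))"
    using norm_triangle_ineq by metis
  also have "\<dots> \<le> K * (L * norm (p' - p) * norm v) + K * norm (p' - p) * (L * norm v)"
    by (intro add_mono order_trans[OF K(3)[OF p'] mult_left_mono[OF L(4)[OF p p'] K(1)]]
        order_trans[OF K(4)[OF p p'] mult_left_mono[OF L(3)[OF p]]]) (simp add: K(1))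
  also have "\<dots> = (2 * (K * L)) * (norm (p' - p) * norm v)" by (simp add: algebra_simps)
  also have "\<dots> \<le> (2 * (K * L) + K * L) * (norm (p' - p) * norm v)" using KL by (intro mult_right_mono) auto
  finally show "norm (A p' (B p' v) - A p (B p v)) \<le> (2 * (K * L) + K * L) * norm (p' - p) * norm v"
    by (simp add: mult.assoc)
qed

lemma lb_at_comp:
  assumes "lb_at p0 A" "lb_at p0 B" shows "lb_at p0 (\<lambda>p v. A p (B p v))"
proof -
  obtain N K where N: "open N" "p0 \<in> N" "lb_on N A K" using assms(1) unfolding lb_at_def by blast
  obtain M L where M: "open M" "p0 \<in> M" "lb_on M B L" using assms(2) unfolding lb_at_def by blast
  have "lb_on (N \<inter> M) (\<lambda>p v. A p (B p v)) (2 * (K * L) + K * L)"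
    by (rule lb_on_comp[OF lb_on_subset[OF N(3)] lb_on_subset[OF M(3)]]) auto
  moreover have "open (N \<inter> M)" "p0 \<in> N \<inter> M" using N M by auto
  ultimately show ?thesis unfolding lb_at_def by blast
qed

text \<open>The isometry \<iota> selects a partial derivative, such as v to (v, 0).\<close>

lemma lb_at_smooth:
  fixes F :: "'p::finite_dim_normed \<Rightarrow> 'b::real_normed_vector" and \<iota> :: "'a::real_normed_vector \<Rightarrow> 'p"
  assumes S: "open S" "p0 \<in> S" "smooth_on S F" and \<iota>: "linear \<iota>" "\<And>v. norm (\<iota> v) = norm v"
  shows "lb_at p0 (\<lambda>p v. frechet_derivative F (at p) (\<iota> v))"
proof -
  obtain r where r: "r > 0" "cball p0 r \<subseteq> S" using S open_contains_cball by blast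
  obtain K where K: "K \<ge> 0" "\<forall>z\<in>cball p0 r. \<forall>z'\<in>cball p0 r.
     norm (F z' - F z) \<le> K * norm (z' - z) \<and>
     (\<forall>v. norm (frechet_derivative F (at z) v) \<le> K * norm v) \<and>
     (\<forall>v. norm (frechet_derivative F (at z') v - frechet_derivative F (at z) v) \<le> K * norm (z' - z) * norm v) \<and>
     norm (F z' - F z - frechet_derivative F (at z) (z' - z)) \<le> K * (norm (z' - z))\<^sup>2"
    using smooth_on_taylor[OF S(3) r(2)] by blast
  have "lb_on (ball p0 r) (\<lambda>p v. frechet_derivative F (at p) (\<iota> v)) K"
    unfolding lb_on_def
  proof (intro conjI ballI allI K(1))
    fix p v assume "p \<in> ball p0 r"
    then have p: "p \<in> cball p0 r" by simp
    show "linear (\<lambda>v. frechet_derivative F (at p) (\<iota> v))"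
      using linear_compose[OF \<iota>(1) has_derivative_linear[OF smooth_on_has_derivative[OF S(3)]]] p r(2)
      by (auto simp: o_def)
    show "norm (frechet_derivative F (at p) (\<iota> v)) \<le> K * norm v"
      using bspec[OF bspec[OF K(2) p] p] \<iota>(2)[of v] by metis
    fix p' assume "p' \<in> ball p0 r"
    then have p': "p' \<in> cball p0 r" by simp
    show "norm (frechet_derivative F (at p') (\<iota> v) - frechet_derivative F (at p) (\<iota> v)) \<le> K * norm (p' - p) * norm v"
      using bspec[OF bspec[OF K(2) p] p'] \<iota>(2)[of v] by metis
  qed
  then show ?thesis unfolding lb_at_def using r(1) by (intro exI[of _ "ball p0 r"]) auto
qed

text \<open>Lets factors that depend on different expressions of the same parameter be composed. A
  Lipschitz change of parameter multiplies the Lipschitz constant.\<close>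

lemma lb_at_pull:
  fixes \<phi> :: "'p::finite_dim_normed \<Rightarrow> 'q::real_normed_vector"
  assumes S: "open S" "p0 \<in> S" "smooth_on S \<phi>" and A: "lb_at (\<phi> p0) A"
  shows "lb_at p0 (\<lambda>p. A (\<phi> p))"
proof -
  obtain N K where N: "open N" "\<phi> p0 \<in> N" "lb_on N A K" using A unfolding lb_at_def by blast
  obtain r where r: "r > 0" "cball p0 r \<subseteq> S" using S open_contains_cball by blast
  obtain L where L: "L \<ge> 0" "\<forall>z\<in>cball p0 r. \<forall>z'\<in>cball p0 r. norm (\<phi> z' - \<phi> z) \<le> L * norm (z' - z)"
    using smooth_on_Lipschitz[OF S(3) r(2)] by blast
  have oM: "open (S \<inter> \<phi> -` N)"
    by (rule continuous_open_preimage[OF smooth_on_continuous[OF S(3)] S(1) N(1)])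
  let ?M = "ball p0 r \<inter> (S \<inter> \<phi> -` N)"
  have "lb_on ?M (\<lambda>p. A (\<phi> p)) (K + K * L)"
    unfolding lb_on_def
  proof (intro conjI ballI allI)
    note K = lb_onD[OF N(3)]
    show "0 \<le> K + K * L" using K(1) L(1) by simp
    fix p v assume p: "p \<in> ?M"
    show "linear (A (\<phi> p))" using K(2) p by blast
    have "norm (A (\<phi> p) v) \<le> K * norm v" using K(3) p by blast
    also have "\<dots> \<le> (K + K * L) * norm v" using K(1) L(1) by (intro mult_right_mono) auto
    finally show "norm (A (\<phi> p) v) \<le> (K + K * L) * norm v" .
    fix p' assume p': "p' \<in> ?M"
    have "norm (A (\<phi> p') v - A (\<phi> p) v) \<le> K * norm (\<phi> p' - \<phi> p) * norm v" using K(4) p p' by blast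
    also have "\<dots> \<le> K * (L * norm (p' - p)) * norm v"
      using L(2) p p' K(1) by (intro mult_right_mono mult_left_mono) auto
    also have "\<dots> = (K * L) * (norm (p' - p) * norm v)" by simp
    also have "\<dots> \<le> (K + K * L) * (norm (p' - p) * norm v)" using K(1) by (intro mult_right_mono) auto
    finally show "norm (A (\<phi> p') v - A (\<phi> p) v) \<le> (K + K * L) * norm (p' - p) * norm v" by (simp add: mult.assoc)
  qed
  moreover have "open ?M" "p0 \<in> ?M" using oM r(1) S(2) N(2) by auto
  ultimately show ?thesis unfolding lb_at_def by blast
qed

lemma lb_at_bound:
  assumes "lb_at p0 A" "pairs_tends \<tau> I p p0"
  shows "\<exists>K\<ge>0. \<forall>\<^sub>F q in pairs \<tau> I. linear (A (p (fst q))) \<and> (\<forall>v. norm (A (p (fst q)) v) \<le> K * norm v)"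
proof -
  obtain N K where N: "open N" "p0 \<in> N" "lb_on N A K" using assms(1) unfolding lb_at_def by blast
  have "\<forall>\<^sub>F q in pairs \<tau> I. linear (A (p (fst q))) \<and> (\<forall>v. norm (A (p (fst q)) v) \<le> K * norm v)"
    by (rule eventually_mono[OF pairs_tendsD[OF assms(2) N(1,2)]]) (use lb_onD(2,3)[OF N(3)] in blast)
  then show ?thesis using lb_onD(1)[OF N(3)] by blast
qed

lemma germO_lb:
  assumes A: "lb_at p0 A" and p: "pairs_tends \<tau> I p p0" and e: "germO \<tau> I \<theta> e"
  shows "germO \<tau> I \<theta> (\<lambda>s t. A (p s) (e s t))"
proof -
  obtain K where "\<forall>\<^sub>F q in pairs \<tau> I. linear (A (p (fst q))) \<and> (\<forall>v. norm (A (p (fst q)) v) \<le> K * norm v)"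
    using lb_at_bound[OF A p] by blast
  then show ?thesis by (intro germO_le[OF e, of _ K]) (auto elim!: eventually_mono)
qed

section \<open>Paths under smooth maps\<close>

lemma germ_map:
  fixes A :: "('a::t2_space, 'e::finite_dim_normed) chart set"
    and B :: "('b::t2_space, 'f::finite_dim_normed) chart set"
  assumes A: "smooth_atlas A" and F: "smooth_map_on W A B F" and c: "c \<in> A" and d: "d \<in> B" "open (fst d)"
    and y: "continuous_on I y" "\<tau> \<in> I" "y \<tau> \<in> fst c" "y \<tau> \<in> W" "F (y \<tau>) \<in> fst d"
    and g: "germO \<tau> I \<alpha> (\<lambda>s t. snd c (y t) - snd c (y s))"
  shows "germO \<tau> I \<alpha> (\<lambda>s t. snd d (F (y t)) - snd d (F (y s)))"
proof -
  note r = smooth_map_chart[OF A F c d]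
  have "snd c (y \<tau>) \<in> snd c ` (fst c \<inter> W \<inter> F -` fst d)" using y by auto
  from germO_smooth(1)[OF r(1) this r(2) pairs_tends_chart[OF A y(1,2) c y(3)] g]
  show ?thesis
    by (rule germO_cong, intro eventually_mono[OF eventually_pairs_chart[OF A y(1,2) c y(3)]])
      (simp add: chart_inv[OF A c])
qed

lemma germ_map_pair:
  fixes A :: "('a::t2_space, 'e::finite_dim_normed) chart set"
    and B :: "('b::t2_space, 'f::finite_dim_normed) chart set"
    and C :: "('c::t2_space, 'h::finite_dim_normed) chart set"
  assumes A: "smooth_atlas A" and B: "smooth_atlas B" and C: "smooth_atlas C" and F: "smooth_map_on W (prod_atlas A B) C F"
    and c: "c \<in> A" and d: "d \<in> B" and e: "e \<in> C"
    and y: "continuous_on I y" "\<tau> \<in> I" "y \<tau> \<in> fst c" and w: "continuous_on I w" "w \<tau> \<in> fst d"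
    and yw: "(y \<tau>, w \<tau>) \<in> W" "F (y \<tau>, w \<tau>) \<in> fst e"
    and gy: "germO \<tau> I \<alpha> (\<lambda>s t. snd c (y t) - snd c (y s))" and gw: "germO \<tau> I \<alpha> (\<lambda>s t. snd d (w t) - snd d (w s))"
  shows "germO \<tau> I \<alpha> (\<lambda>s t. snd e (F (y t, w t)) - snd e (F (y s, w s)))"
proof -
  note r = smooth_map_pair[OF A B C F c d e]
  have "(snd c (y \<tau>), snd d (w \<tau>)) \<in> pair_dom c d e W F"
    unfolding pair_dom_def using y(3) w(2) yw chart_inv[OF A c] chart_inv[OF B d] by auto
  from germO_smooth(1)[OF r(1) this r(2) pairs_tends_Pair[OF pairs_tends_chart[OF A y(1,2) c y(3)]
        pairs_tends_chart[OF B w(1) y(2) d w(2)]] germO_Pair[OF gy gw]]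
  show ?thesis
    by (rule germO_cong, intro eventually_mono[OF eventually_conj[OF eventually_pairs_chart[OF A y(1,2) c y(3)]
          eventually_pairs_chart[OF B w(1) y(2) d w(2)]]])
      (simp add: chart_inv[OF A c] chart_inv[OF B d])
qed

section \<open>Connections in charts\<close>

locale bundle_connection =
  principal_bundle AP AM AG mul one ginv act proj + lie_group_chart AG mul one ginv e
  for AP :: "('p::t2_space, 'e::finite_dim_normed) chart set"
  and AM :: "('m::t2_space, 'f::finite_dim_normed) chart set"
  and AG :: "('g::t2_space, 'k::finite_dim_normed) chart set"
  and mul :: "'g \<Rightarrow> 'g \<Rightarrow> 'g" and one :: 'g and ginv :: "'g \<Rightarrow> 'g"
  and act :: "'p \<Rightarrow> 'g \<Rightarrow> 'p" and proj :: "'p \<Rightarrow> 'm" and e :: "('g, 'k) chart" +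
  fixes \<omega> :: "'p \<Rightarrow> 'p tangent \<Rightarrow> 'g tangent"
  assumes connection: "connection_form AP AG mul one ginv act \<omega>"
begin

text \<open>\<open>om c p\<close> is \<open>\<omega>\<^sub>p\<close> in the chart \<open>c\<close>, with \<open>\<gg>\<close> identified with the model space of \<open>G\<close> by the chart
  \<open>e\<close>; \<open>arep c d c'\<close> is the action of \<open>G\<close> on \<open>P\<close> in the charts \<open>c\<close>, \<open>d\<close> and \<open>c'\<close>.\<close>

definition om :: "('p, 'e) chart \<Rightarrow> 'p \<Rightarrow> 'e \<Rightarrow> 'k" where
  "om c p v = cvec e (\<omega> p (coord_vec AP c p v))"

definition arep :: "('p, 'e) chart \<Rightarrow> ('g, 'k) chart \<Rightarrow> ('p, 'e) chart \<Rightarrow> 'e \<times> 'k \<Rightarrow> 'e" where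
  "arep c d c' zh = snd c' (act (inv_chart c (fst zh)) (inv_chart d (snd zh)))"

definition adom :: "('p, 'e) chart \<Rightarrow> ('g, 'k) chart \<Rightarrow> ('p, 'e) chart \<Rightarrow> ('e \<times> 'k) set" where
  "adom c d c' = pair_dom c d c' UNIV (\<lambda>(u, a). act u a)"

lemma omega_in: "X \<in> tangent_space AP p \<Longrightarrow> \<omega> p X \<in> lie_algebra AG one"
  and omega_form: "linear_functional_on (lie_algebra AG one) l \<Longrightarrow> one_form AP (\<lambda>u X. l (\<omega> u X))"
  using connection unfolding connection_form_def lie_algebra_valued_form_def by blast+

text \<open>Evaluation at a test function is a linear functional on the Lie algebra; the coordinates
  of \<omega> in the chart e arise in this way.\<close>

lemma eval_form: "one_form AP (\<lambda>u X. (\<omega> u X) f)"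
  using omega_form[of "\<lambda>X. X f"] by (simp add: linear_functional_on_def)

lemma omega_coord: "c \<in> AP \<Longrightarrow> p \<in> fst c \<Longrightarrow> \<omega> p (coord_vec AP c p v) = coord_vec AG e one (om c p v)"
  unfolding om_def by (rule tangent_space_coord_vec[OF atlas omega_in[OF coord_vec_in[OF atlas_P]] e])

lemma om_linear: "c \<in> AP \<Longrightarrow> p \<in> fst c \<Longrightarrow> linear (om c p)"
proof -
  assume c: "c \<in> AP" "p \<in> fst c"
  have "linear (\<lambda>v. \<omega> p (coord_vec AP c p v) f *\<^sub>R i)" for f and i :: 'k
    using linear_compose[OF linear_form[OF atlas_P eval_form c] bounded_linear.linear[OF bounded_linear_scaleR_left]]
    by (simp add: o_def)
  then show ?thesis unfolding om_def[abs_def] cvec_def[OF atlas] by (intro linear_compose_sum ballI)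
qed

lemma om_smooth: "c \<in> AP \<Longrightarrow> smooth_on (snd c ` fst c) (\<lambda>z. om c (inv_chart c z) v)"
proof -
  assume c: "c \<in> AP"
  note op = chart_open(2)[OF atlas_P c]
  have "smooth_on (snd c ` fst c) (\<lambda>z. \<omega> (inv_chart c z) (coord_vec AP c (inv_chart c z) v) f *\<^sub>R i)" for f and i :: 'k
    by (rule smooth_on_linear[OF bounded_linear_scaleR_left op]) (use eval_form[of f] c in \<open>auto simp: one_form_def\<close>)
  then show ?thesis
    unfolding om_def cvec_def[OF atlas] smooth_on_def by (intro allI Ck_sum coord_basis(1) op) blast
qed

lemma om_lb: "c \<in> AP \<Longrightarrow> p \<in> fst c \<Longrightarrow> lb_at (snd c p) (\<lambda>z. om c (inv_chart c z))"
proof -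
  assume c: "c \<in> AP" "p \<in> fst c"
  have "\<exists>K\<ge>0. \<exists>r>0. cball (snd c p) r \<subseteq> snd c ` fst c \<and> (\<forall>z\<in>cball (snd c p) r. \<forall>v. norm (om c (inv_chart c z) v) \<le> K * norm v) \<and>
    (\<forall>z\<in>cball (snd c p) r. \<forall>z'\<in>cball (snd c p) r. \<forall>v.
       norm (om c (inv_chart c z') v - om c (inv_chart c z) v) \<le> K * norm (z' - z) * norm v)"
  proof (rule smooth_family_bound)
    show "linear (om c (inv_chart c z))" if "z \<in> snd c ` fst c" for z
      using om_linear[OF c(1)] that by (auto simp: inv_into_into)
  qed (use chart_open(2)[OF atlas_P c(1)] om_smooth[OF c(1)] c in auto)
  then obtain K r where K: "K \<ge> 0" "r > 0" "cball (snd c p) r \<subseteq> snd c ` fst c"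
    "\<forall>z\<in>cball (snd c p) r. \<forall>v. norm (om c (inv_chart c z) v) \<le> K * norm v"
    "\<forall>z\<in>cball (snd c p) r. \<forall>z'\<in>cball (snd c p) r. \<forall>v.
       norm (om c (inv_chart c z') v - om c (inv_chart c z) v) \<le> K * norm (z' - z) * norm v" by blast
  have "inv_chart c z \<in> fst c" if "z \<in> ball (snd c p) r" for z
  proof -
    have "z \<in> snd c ` fst c" using K(3) that by auto
    then show ?thesis by (rule inv_into_into)
  qed
  then have "lb_on (ball (snd c p) r) (\<lambda>z. om c (inv_chart c z)) K"
    unfolding lb_on_def using K om_linear[OF c(1)] by simp
  then show ?thesis unfolding lb_at_def using K(2) by (intro exI[of _ "ball (snd c p) r"]) auto
qed

lemma adom:
  assumes "c \<in> AP" "d \<in> AG" "c' \<in> AP"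
  shows "open (adom c d c')" "smooth_on (adom c d c') (arep c d c')"
  using smooth_map_pair[OF atlas_P atlas atlas_P smooth_act assms]
  unfolding adom_def arep_def[abs_def] by (simp_all add: case_prod_unfold)

lemma adom_iff: "(z, h) \<in> adom c d c' \<longleftrightarrow> z \<in> snd c ` fst c \<and> h \<in> snd d ` fst d \<and> act (inv_chart c z) (inv_chart d h) \<in> fst c'"
  unfolding adom_def pair_dom_def by auto

lemma adom_point:
  assumes "c \<in> AP" "d \<in> AG" "u \<in> fst c" "a \<in> fst d"
  shows "(snd c u, snd d a) \<in> adom c d c' \<longleftrightarrow> act u a \<in> fst c'" "arep c d c' (snd c u, snd d a) = snd c' (act u a)"
  unfolding adom_iff arep_def using chart_inv[OF atlas_P assms(1,3)] chart_inv[OF atlas assms(2,4)] assms by auto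

lemma arep_deriv:
  "c \<in> AP \<Longrightarrow> d \<in> AG \<Longrightarrow> c' \<in> AP \<Longrightarrow> zh \<in> adom c d c' \<Longrightarrow>
   (arep c d c' has_derivative frechet_derivative (arep c d c') (at zh)) (at zh)"
  using smooth_on_has_derivative adom(2) by blast

lemma act_continuous: "continuous_on UNIV (\<lambda>(u, a). act u a)"
  using smooth_act unfolding smooth_map_on_def by blast

lemma act_continuous_on: "continuous_on I y \<Longrightarrow> continuous_on I a \<Longrightarrow> continuous_on I (\<lambda>t. act (y t) (a t))"
  using continuous_on_compose2[OF act_continuous, of I "\<lambda>t. (y t, a t)"] by (auto intro!: continuous_on_Pair)

text \<open>Axiom (ii) in coordinates: by \<open>lie_exp_curve\<close> the fundamental field at u is
  the derivative of the action in the group variable at the unit.\<close>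

lemma om_fundamental:
  assumes c: "c \<in> AP" "u \<in> fst c"
  shows "om c u (frechet_derivative (arep c e c) (at (snd c u, h0)) (0, \<kappa>)) = \<kappa>"
proof -
  let ?Z = "coord_vec AG e one \<kappa>" and ?D = "frechet_derivative (arep c e c) (at (snd c u, h0))"
  obtain \<sigma> where \<sigma>: "\<And>t. lie_exp AG mul (\<lambda>f. t * ?Z f) = \<sigma> t" "\<sigma> 0 = one" "has_velocity AG \<sigma> ?Z 0"
    using lie_exp_curve[of \<kappa>] by blast
  have cont: "isCont \<sigma> 0" by (rule has_velocity_isCont[OF atlas \<sigma>(3)])
  have der: "((\<lambda>t. snd e (\<sigma> t)) has_vector_derivative \<kappa>) (at 0)"
    using has_velocity_derivative[OF atlas \<sigma>(3) e(1)] \<sigma>(2) e(2) cvec_coord_vec[OF atlas e] by simp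
  have dom: "(snd c u, h0) \<in> adom c e c" using adom_point(1)[OF c(1) e(1) c(2) e(2)] c(2) by (simp add: act_one)
  have "((\<lambda>t. arep c e c (snd c u, snd e (\<sigma> t))) has_vector_derivative ?D (0, \<kappa>)) (at 0)"
    using has_vector_derivative_chain[where f="arep c e c" and \<zeta>="\<lambda>t. (snd c u, snd e (\<sigma> t))" and t=0 and S=UNIV and f'="?D"]
      arep_deriv[OF c(1) e(1) c(1) dom] has_vector_derivative_Pair[OF has_vector_derivative_const der, of "snd c u"] \<sigma>(2)
    by simp
  moreover have "\<forall>\<^sub>F t in nhds 0. arep c e c (snd c u, snd e (\<sigma> t)) = snd c (act u (\<sigma> t))"
    by (rule eventually_mono[OF isCont_eventually[OF cont chart_open(1)[OF atlas e(1)]]])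
      (use \<sigma>(2) e(2) adom_point(2)[OF c(1) e(1) c(2)] in auto)
  ultimately have d2: "((\<lambda>t. snd c (act u (\<sigma> t))) has_vector_derivative ?D (0, \<kappa>)) (at 0)"
    by (rule has_vector_derivative_cong_nhds)
  have "isCont (\<lambda>t. (u, \<sigma> t)) 0" using cont by (intro continuous_intros) auto
  then have "isCont (\<lambda>t. act u (\<sigma> t)) 0"
    using isCont_o2[where f="\<lambda>t. (u, \<sigma> t)" and a=0 and g="\<lambda>(u, a). act u a"] act_continuous
    by (simp add: continuous_on_eq_continuous_at)
  from has_velocity_chart[where \<gamma>="\<lambda>t. act u (\<sigma> t)", OF atlas_P c(1) _ this d2]
  have "has_velocity AP (\<lambda>t. act u (\<sigma> t)) (coord_vec AP c u (?D (0, \<kappa>))) 0" using \<sigma>(2) c(2) by (simp add: act_one)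
  then have "fundamental_field AP AG mul act ?Z u = coord_vec AP c u (?D (0, \<kappa>))"
    unfolding fundamental_field_def \<sigma>(1) by (rule velocity_eq[OF atlas_P])
  moreover have "\<omega> u (fundamental_field AP AG mul act ?Z u) = ?Z"
    using connection coord_vec_in[OF atlas e] unfolding connection_form_def by blast
  ultimately show ?thesis unfolding om_def using cvec_coord_vec[OF atlas e] by simp
qed

text \<open>From u (h \<zeta>) = (u h) \<zeta>, moving the group variable from h along V \<kappa> is
  the same as moving it from the unit along \<kappa> at the point u h, where
  \<open>om_fundamental\<close> applies.\<close>

lemma om_left_invariant:
  assumes c: "c \<in> AP" and dom: "(z, h) \<in> adom c e c"
  shows "om c (act (inv_chart c z) (inv_chart e h)) (frechet_derivative (arep c e c) (at (z, h)) (0, V \<kappa> h)) = \<kappa>"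
proof -
  let ?f = "arep c e c" and ?\<zeta> = "\<lambda>t. h0 + t *\<^sub>R \<kappa>"
  let ?u = "act (inv_chart c z) (inv_chart e h)"
  have zh: "z \<in> snd c ` fst c" "h \<in> snd e ` fst e" "?u \<in> fst c" using dom unfolding adom_iff by auto
  have \<zeta>: "(?\<zeta> has_vector_derivative \<kappa>) (at 0)" by (auto intro!: derivative_eq_intros)
  have fu: "?f (z, h) = snd c ?u" by (simp add: arep_def)
  have 1: "((\<lambda>t. m (h, ?\<zeta> t)) has_vector_derivative V \<kappa> h) (at 0)"
    using m_deriv2[of h ?\<zeta> 0, OF _ \<zeta>] S_unit(1)[OF zh(2)] by (simp add: V_def)
  have 2: "((\<lambda>t. ?f (z, m (h, ?\<zeta> t))) has_vector_derivative frechet_derivative ?f (at (z, h)) (0, V \<kappa> h)) (at 0)"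
    using has_vector_derivative_chain[where f="?f" and \<zeta>="\<lambda>t. (z, m (h, ?\<zeta> t))" and t=0 and S=UNIV
        and f'="frechet_derivative ?f (at (z, h))"]
      arep_deriv[OF c e(1) c dom] has_vector_derivative_Pair[OF has_vector_derivative_const 1, of z] m_unit(1)[OF zh(2)]
    by simp
  have dom0: "(snd c ?u, h0) \<in> adom c e c" using adom_point(1)[OF c e(1) zh(3) e(2)] zh(3) by (simp add: act_one)
  have 3: "((\<lambda>t. ?f (snd c ?u, ?\<zeta> t)) has_vector_derivative frechet_derivative ?f (at (snd c ?u, h0)) (0, \<kappa>)) (at 0)"
    using has_vector_derivative_chain[where f="?f" and \<zeta>="\<lambda>t. (snd c ?u, ?\<zeta> t)" and t=0 and S=UNIV
        and f'="frechet_derivative ?f (at (snd c ?u, h0))"]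
      arep_deriv[OF c e(1) c dom0] has_vector_derivative_Pair[OF has_vector_derivative_const \<zeta>, of "snd c ?u"] by simp
  have "isCont (\<lambda>t. (h, ?\<zeta> t)) 0" by (intro continuous_intros)
  then have "\<forall>\<^sub>F t in nhds 0. (h, ?\<zeta> t) \<in> S"
    by (rule isCont_eventually) (use S(1) S_unit(1)[OF zh(2)] in auto)
  then have "\<forall>\<^sub>F t in nhds 0. ?f (z, m (h, ?\<zeta> t)) = ?f (snd c ?u, ?\<zeta> t)"
  proof eventually_elim
    case (elim t)
    show ?case unfolding arep_def using inv_m[OF elim] chart_inv[OF atlas_P c zh(3)] by (simp add: act_mul)
  qed
  from has_vector_derivative_cong_nhds[OF 2 this] 3
  have "frechet_derivative ?f (at (z, h)) (0, V \<kappa> h) = frechet_derivative ?f (at (snd c ?u, h0)) (0, \<kappa>)"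
    by (rule vector_derivative_unique_at)
  then show ?thesis using om_fundamental[OF c zh(3)] by simp
qed

text \<open>This consequence of the equivariance of \<open>\<omega>\<close> is enough; \<open>Ad\<close> is never computed.\<close>

lemma om_translate_cong:
  assumes c: "c \<in> AP" "u \<in> fst c" and d: "d \<in> AG" "a \<in> fst d" and c': "c' \<in> AP" "act u a \<in> fst c'"
    and eq: "om c u v = om c u v'"
  shows "om c' (act u a) (frechet_derivative (arep c d c') (at (snd c u, snd d a)) (v, 0)) =
    om c' (act u a) (frechet_derivative (arep c d c') (at (snd c u, snd d a)) (v', 0))"
proof -
  let ?D = "frechet_derivative (arep c d c') (at (snd c u, snd d a))"
  \<comment> \<open>The differential of a right translation is the partial derivative of the action
    in the bundle variable.\<close>
  have dif: "differential AP AP (\<lambda>w. act w a) u (coord_vec AP c u x) = coord_vec AP c' (act u a) (?D (x, 0))" for x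
  proof (rule differential_coord_vec[where F="\<lambda>w. act w a", OF atlas_P atlas_P open_UNIV _ UNIV_I c c'])
    show "continuous_on UNIV (\<lambda>w. act w a)" by (rule act_continuous_on) (auto intro: continuous_intros)
    fix c1 assume c1: "c1 \<in> AP"
    let ?S = "snd c1 ` (fst c1 \<inter> UNIV \<inter> (\<lambda>w. act w a) -` fst c')"
    have S: "open ?S"
      using chart_image_open[OF atlas_P c1, of "(\<lambda>w. act w a) -` fst c'"] chart_open(1)[OF atlas_P c'(1)]
        act_continuous_on[of UNIV "\<lambda>w. w" "\<lambda>_. a"] by (auto intro!: open_vimage continuous_intros)
    have "smooth_on ?S (\<lambda>z. arep c1 d c' (z, snd d a))"
    proof (rule smooth_on_comp[OF S adom(1)[OF c1 d(1) c'(1)] _ _ adom(2)[OF c1 d(1) c'(1)]])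
      show "(z, snd d a) \<in> adom c1 d c'" if "z \<in> ?S" for z
      proof -
        obtain p where p: "z = snd c1 p" "p \<in> fst c1" "act p a \<in> fst c'" using \<open>z \<in> ?S\<close> by blast
        show ?thesis unfolding p(1) using adom_point(1)[OF c1 d(1) p(2) d(2)] p(3) by blast
      qed
      show "smooth_on ?S (\<lambda>z. (z, snd d a))"
        by (intro smooth_on_Pair S smooth_on_const smooth_on_bounded_linear bounded_linear_ident)
    qed
    then show "smooth_on ?S (\<lambda>z. snd c' (act (inv_chart c1 z) a))"
      unfolding arep_def by (simp add: chart_inv[OF atlas d])
  next
    have "(snd c u, snd d a) \<in> adom c d c'" using adom_point(1)[OF c(1) d(1) c(2) d(2)] c'(2) by blast
    from has_derivative_compose[OF has_derivative_Pair[OF has_derivative_ident has_derivative_const] arep_deriv[OF c(1) d(1) c'(1) this]]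
    show "((\<lambda>z. snd c' (act (inv_chart c z) a)) has_derivative (\<lambda>x. ?D (x, 0))) (at (snd c u))"
      unfolding arep_def by (simp add: chart_inv[OF atlas d])
  qed
  have eq': "\<omega> u (coord_vec AP c u v) = \<omega> u (coord_vec AP c u v')" using omega_coord[OF c] eq by simp
  have "\<omega> (act u a) (differential AP AP (\<lambda>w. act w a) u X) = Ad AG mul one ginv (ginv a) (\<omega> u X)"
    if "X \<in> tangent_space AP u" for X
    using connection that unfolding connection_form_def by blast
  then have "\<omega> (act u a) (differential AP AP (\<lambda>w. act w a) u (coord_vec AP c u v)) =
      \<omega> (act u a) (differential AP AP (\<lambda>w. act w a) u (coord_vec AP c u v'))"
    using coord_vec_in[OF atlas_P c] eq' by metis
  then show ?thesis unfolding om_def dif by simp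
qed

lemma linear_inclusions: "linear (\<lambda>v::'e. (v, 0::'k))" "linear (\<lambda>\<kappa>::'k. (0::'e, \<kappa>))"
  by (auto intro!: linearI)

lemma lb_partial:
  assumes "c \<in> AP" "d \<in> AG" "c' \<in> AP" "p0 \<in> adom c d c'"
  shows "lb_at p0 (\<lambda>p v. frechet_derivative (arep c d c') (at p) (v, 0))"
    "lb_at p0 (\<lambda>p \<kappa>. frechet_derivative (arep c d c') (at p) (0, \<kappa>))"
  by (rule lb_at_smooth[OF adom(1)[OF assms(1-3)] assms(4) adom(2)[OF assms(1-3)]],
      use linear_inclusions in \<open>auto simp: norm_Pair\<close>)+

lemma lb_om_arep:
  assumes "c \<in> AP" "d \<in> AG" "c' \<in> AP" "p0 \<in> adom c d c'"
  shows "lb_at p0 (\<lambda>p. om c' (inv_chart c' (arep c d c' p)))"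
proof (rule lb_at_pull[OF adom(1)[OF assms(1-3)] assms(4) adom(2)[OF assms(1-3)]])
  have "act (inv_chart c (fst p0)) (inv_chart d (snd p0)) \<in> fst c'" using assms(4) adom_iff by (metis prod.collapse)
  from om_lb[OF assms(3) this] show "lb_at (arep c d c' p0) (\<lambda>z. om c' (inv_chart c' z))" by (simp add: arep_def)
qed

text \<open>By \<open>om_translate_cong\<close> the value after translation is unchanged when v is
  replaced by the vertical vector with the same \<omega>-value. That vector is a locally bounded
  linear function of \<open>om c u v\<close>, and so is the value after translation.\<close>

lemma om_translate_bound:
  assumes c: "c \<in> AP" and d: "d \<in> AG" and c': "c' \<in> AP" and p0: "p0 \<in> adom c d c'"
  obtains N K where "open N" "p0 \<in> N" "N \<subseteq> adom c d c'"
    "\<And>u a v. u \<in> fst c \<Longrightarrow> a \<in> fst d \<Longrightarrow> (snd c u, snd d a) \<in> N \<Longrightarrow>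
      norm (om c' (act u a) (frechet_derivative (arep c d c') (at (snd c u, snd d a)) (v, 0))) \<le> K * norm (om c u v)"
proof -
  obtain z h where zh: "p0 = (z, h)" by force
  have z: "z \<in> snd c ` fst c" using p0 unfolding zh adom_iff by blast
  have dom0: "(z, h0) \<in> adom c e c"
    unfolding adom_iff using z h0_in inv_h0 by (auto simp: act_one inv_into_into)
  have "lb_at p0 (\<lambda>p \<kappa>. frechet_derivative (arep c e c) (at (fst p, h0)) (0, \<kappa>))"
  proof (rule lb_at_pull[of UNIV _ "\<lambda>p. (fst p, h0)"])
    show "lb_at (fst p0, h0) (\<lambda>p \<kappa>. frechet_derivative (arep c e c) (at p) (0, \<kappa>))"
      unfolding zh fst_conv by (rule lb_partial(2)[OF c e(1) c dom0])
    show "smooth_on UNIV (\<lambda>p::'e \<times> 'k. (fst p, h0))"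
      by (intro smooth_on_Pair smooth_on_const smooth_on_bounded_linear bounded_linear_fst open_UNIV)
  qed auto
  from lb_at_comp[OF lb_om_arep[OF c d c' p0] lb_at_comp[OF lb_partial(1)[OF c d c' p0] this]]
  obtain N K where N: "open N" "p0 \<in> N" "lb_on N (\<lambda>p \<kappa>. om c' (inv_chart c' (arep c d c' p))
      (frechet_derivative (arep c d c') (at p) (frechet_derivative (arep c e c) (at (fst p, h0)) (0, \<kappa>), 0))) K"
    unfolding lb_at_def by blast
  show ?thesis
  proof (rule that[of "N \<inter> adom c d c'" K])
    show "open (N \<inter> adom c d c')" "p0 \<in> N \<inter> adom c d c'" using N p0 adom(1)[OF c d c'] by auto
    fix u a v assume u: "u \<in> fst c" and a: "a \<in> fst d" and n: "(snd c u, snd d a) \<in> N \<inter> adom c d c'"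
    have ua: "act u a \<in> fst c'" using adom_point(1)[OF c d u a] n by blast
    let ?v = "frechet_derivative (arep c e c) (at (snd c u, h0)) (0, om c u v)"
    have "om c u v = om c u ?v" using om_fundamental[OF c u] by simp
    from om_translate_cong[OF c u d a c' ua this]
    have "om c' (act u a) (frechet_derivative (arep c d c') (at (snd c u, snd d a)) (v, 0)) =
        om c' (inv_chart c' (arep c d c' (snd c u, snd d a)))
          (frechet_derivative (arep c d c') (at (snd c u, snd d a)) (?v, 0))"
      using adom_point(2)[OF c d u a] chart_inv[OF atlas_P c' ua] by simp
    also have "norm \<dots> \<le> K * norm (om c u v)" using lb_onD(3)[OF N(3), of "(snd c u, snd d a)"] n by simp
    finally show "norm (om c' (act u a) (frechet_derivative (arep c d c') (at (snd c u, snd d a)) (v, 0))) \<le> K * norm (om c u v)" .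
  qed auto
qed

end

section \<open>Horizontal paths\<close>

lemma germO_sum:
  assumes "finite B" "\<And>i. i \<in> B \<Longrightarrow> germO \<tau> I \<theta> (f i)"
  shows "germO \<tau> I \<theta> (\<lambda>s t. \<Sum>i\<in>B. f i s t)"
  using assms by (induction B rule: finite_induct) (auto intro: germO_zero germO_add)

context bundle_connection
begin

text \<open>Horizontality as an estimate on increments, in one chart at each time.
  \<open>hor_chart\<close> extends it to every chart; \<open>hor_lie_integral\<close> and
  \<open>lie_integral_hor\<close> relate it to vanishing integrals.\<close>

definition hor :: "real \<Rightarrow> real set \<Rightarrow> (real \<Rightarrow> 'p) \<Rightarrow> bool" where
  "hor \<alpha> I y \<longleftrightarrow> lhol AP \<alpha> I y \<and> (\<forall>\<tau>\<in>I. \<exists>c\<in>AP. y \<tau> \<in> fst c \<and>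
     germO \<tau> I (2 * \<alpha>) (\<lambda>s t. om c (y s) (snd c (y t) - snd c (y s))))"

lemma functional_bound:
  assumes l: "linear_functional_on (lie_algebra AG one) l"
  shows "\<exists>K. \<forall>\<kappa>. \<bar>l (coord_vec AG e one \<kappa>)\<bar> \<le> K * norm \<kappa>"
proof -
  have "linear (\<lambda>\<kappa>. l (coord_vec AG e one \<kappa>))"
  proof (rule linearI)
    fix v w and r :: real
    show "l (coord_vec AG e one (v + w)) = l (coord_vec AG e one v) + l (coord_vec AG e one w)"
      using l coord_vec_in[OF atlas e] coord_vec_add[OF atlas e, of v w] unfolding linear_functional_on_def by metis
    show "l (coord_vec AG e one (r *\<^sub>R v)) = r *\<^sub>R l (coord_vec AG e one v)"
      using l coord_vec_in[OF atlas e] coord_vec_scale[OF atlas e, of r v] unfolding linear_functional_on_def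
      by (metis real_scaleR_def)
  qed
  then have "bounded_linear (\<lambda>\<kappa>. l (coord_vec AG e one \<kappa>))" by (rule linear_imp_bounded_linear)
  then obtain K where "\<forall>\<kappa>. norm (l (coord_vec AG e one \<kappa>)) \<le> norm \<kappa> * K" using bounded_linear.bounded by blast
  then show ?thesis by (intro exI[of _ K]) (simp add: mult.commute)
qed

lemma functional_zero: "linear_functional_on (lie_algebra AG one) l \<Longrightarrow> l (\<lambda>_. 0) = 0"
proof -
  assume l: "linear_functional_on (lie_algebra AG one) l"
  obtain K where "\<And>\<kappa>. \<bar>l (coord_vec AG e one \<kappa>)\<bar> \<le> K * norm \<kappa>" using functional_bound[OF l] by blast
  from this[of 0] show ?thesis using coord_vec_zero[OF atlas e] by simp
qed

lemma hor_prim: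
  assumes y: "hor \<alpha> I y" and l: "linear_functional_on (lie_algebra AG one) l"
  shows "prim AP (\<lambda>u X. l (\<omega> u X)) \<alpha> I y (\<lambda>_. 0)"
proof (rule primI[OF atlas_P omega_form[OF l]])
  show lh: "lhol AP \<alpha> I y" using y unfolding hor_def by blast
  fix \<tau> assume \<tau>: "\<tau> \<in> I"
  obtain c where c: "c \<in> AP" "y \<tau> \<in> fst c"
    and g: "germO \<tau> I (2 * \<alpha>) (\<lambda>s t. om c (y s) (snd c (y t) - snd c (y s)))"
    using y \<tau> unfolding hor_def by blast
  obtain K where K: "\<And>\<kappa>. \<bar>l (coord_vec AG e one \<kappa>)\<bar> \<le> K * norm \<kappa>" using functional_bound[OF l] by blast
  have "germO \<tau> I (2 * \<alpha>) (\<lambda>s t. 0 - 0 - l (\<omega> (y s) (coord_vec AP c (y s) (snd c (y t) - snd c (y s)))))"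
    by (rule germO_le[OF g, of _ K], rule eventually_mono[OF eventually_pairs_chart[OF atlas_P lholD(1)[OF lh] \<tau> c]])
      (simp add: omega_coord[OF c(1)] K)
  then show "\<exists>c\<in>AP. y \<tau> \<in> fst c \<and> germO \<tau> I (2 * \<alpha>)
      (\<lambda>s t. 0 - 0 - l (\<omega> (y s) (coord_vec AP c (y s) (snd c (y t) - snd c (y s)))))" using c by blast
qed

lemma prim_om:
  assumes p: "\<And>l. linear_functional_on (lie_algebra AG one) l \<Longrightarrow> prim AP (\<lambda>u X. l (\<omega> u X)) \<alpha> I y (\<lambda>_. 0)"
    and \<tau>: "\<tau> \<in> I" and c: "c \<in> AP" "y \<tau> \<in> fst c"
  shows "germO \<tau> I (2 * \<alpha>) (\<lambda>s t. om c (y s) (snd c (y t) - snd c (y s)))"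
proof -
  let ?X = "\<lambda>s t. \<omega> (y s) (coord_vec AP c (y s) (snd c (y t) - snd c (y s)))"
  have "germO \<tau> I (2 * \<alpha>) (\<lambda>s t. (?X s t) f *\<^sub>R i)" for f and i :: 'k
  proof (rule germO_le[of _ _ _ "\<lambda>s t. 0 - 0 - (?X s t) f" _ "norm i"])
    show "germO \<tau> I (2 * \<alpha>) (\<lambda>s t. 0 - 0 - (?X s t) f)"
      using primD[OF p[of "\<lambda>X. X f"] \<tau> c] by (simp add: linear_functional_on_def)
  qed (simp add: mult.commute)
  then show ?thesis unfolding om_def cvec_def[OF atlas] by (intro germO_sum coord_basis(1))
qed

text \<open>The change of chart is made for the scalar components of \<omega>, where
  \<open>primI\<close> contains it; \<open>prim_om\<close> puts the components together
  again.\<close>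

lemma hor_chart:
  "hor \<alpha> I y \<Longrightarrow> \<tau> \<in> I \<Longrightarrow> c \<in> AP \<Longrightarrow> y \<tau> \<in> fst c \<Longrightarrow>
   germO \<tau> I (2 * \<alpha>) (\<lambda>s t. om c (y s) (snd c (y t) - snd c (y s)))"
  by (rule prim_om[OF hor_prim])

lemma horI_prim:
  assumes "lhol AP \<alpha> I y"
    and "\<And>l. linear_functional_on (lie_algebra AG one) l \<Longrightarrow> prim AP (\<lambda>u X. l (\<omega> u X)) \<alpha> I y (\<lambda>_. 0)"
  shows "hor \<alpha> I y"
  unfolding hor_def
proof (intro conjI ballI assms(1))
  fix \<tau> assume \<tau>: "\<tau> \<in> I"
  obtain c where c: "c \<in> AP" "y \<tau> \<in> fst c" using chart_cover[OF atlas_P] by blast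
  show "\<exists>c\<in>AP. y \<tau> \<in> fst c \<and> germO \<tau> I (2 * \<alpha>) (\<lambda>s t. om c (y s) (snd c (y t) - snd c (y s)))"
    by (rule bexI[OF _ c(1)], rule conjI[OF c(2)], rule prim_om[OF assms(2) \<tau> c])
qed

lemma hor_lhol: "hor \<alpha> I y \<Longrightarrow> lhol AP \<alpha> I y" unfolding hor_def by blast

lemma hor_lie_integral:
  assumes alpha: "1/2 < \<alpha>" "\<alpha> \<le> 1" and y: "hor \<alpha> {a..b} y" and r: "r \<in> {a..b}"
  shows "has_lie_integral AP AG one \<omega> y a r (\<lambda>_. 0)"
  unfolding has_lie_integral_def
proof (intro conjI allI impI zero_tangent[OF atlas])
  fix l assume l: "linear_functional_on (lie_algebra AG one) l"
  have sub: "{a..r} \<subseteq> {a..b}" using r by auto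
  have "has_form_integral AP (\<lambda>u X. l (\<omega> u X)) y a r (0 - 0)"
    by (rule prim_has_form_integral[OF atlas_P omega_form[OF l] alpha lhol_subset[OF hor_lhol[OF y] sub] _
          prim_subset[OF hor_prim[OF y l] sub]]) (use r in auto)
  then show "has_form_integral AP (\<lambda>u X. l (\<omega> u X)) y a r (l (\<lambda>_. 0))" using functional_zero[OF l] by simp
qed

text \<open>Vanishing integrals make 0 a primitive of every scalar component, and this is the
  estimate in \<open>hor\<close>.\<close>

lemma lie_integral_hor:
  assumes alpha: "1/2 < \<alpha>" "\<alpha> \<le> 1" and y: "lhol AP \<alpha> {a..b} y" and "a \<le> b"
    and int: "\<And>r. r \<in> {a..b} \<Longrightarrow> has_lie_integral AP AG one \<omega> y a r (\<lambda>_. 0)"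
  shows "hor \<alpha> {a..b} y"
proof (rule horI_prim[OF y])
  fix l assume l: "linear_functional_on (lie_algebra AG one) l"
  show "prim AP (\<lambda>u X. l (\<omega> u X)) \<alpha> {a..b} y (\<lambda>_. 0)"
  proof (rule prim_zeroI[OF atlas_P omega_form[OF l] alpha y \<open>a \<le> b\<close>])
    fix t assume "t \<in> {a..b}"
    then have "has_form_integral AP (\<lambda>u X. l (\<omega> u X)) y a t (l (\<lambda>_. 0))"
      using int l unfolding has_lie_integral_def by blast
    then show "has_form_integral AP (\<lambda>u X. l (\<omega> u X)) y a t 0" using functional_zero[OF l] by simp
  qed
qed

lemma hor_subset: "hor \<alpha> I y \<Longrightarrow> J \<subseteq> I \<Longrightarrow> hor \<alpha> J y"
  by (rule horI_prim, rule lhol_subset[OF hor_lhol], assumption+, rule prim_subset[OF hor_prim], assumption+)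

text \<open>Taylor expansion of the action, whose derivative splits into the two partial
  derivatives. The remainder is of order 2 * \<alpha> and keeps it under \<omega> at the moving
  point, a locally bounded family.\<close>

lemma increment_act:
  assumes y: "continuous_on I y" "\<tau> \<in> I" "c \<in> AP" "y \<tau> \<in> fst c" and a: "continuous_on I a" "d \<in> AG" "a \<tau> \<in> fst d"
    and c': "c' \<in> AP" "act (y \<tau>) (a \<tau>) \<in> fst c'"
    and gy: "germO \<tau> I \<alpha> (\<lambda>s t. snd c (y t) - snd c (y s))" and ga: "germO \<tau> I \<alpha> (\<lambda>s t. snd d (a t) - snd d (a s))"
  defines "w \<equiv> \<lambda>t. act (y t) (a t)" and "D \<equiv> \<lambda>s. frechet_derivative (arep c d c') (at (snd c (y s), snd d (a s)))"
  shows "germO \<tau> I \<alpha> (\<lambda>s t. snd c' (w t) - snd c' (w s))"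
    and "germO \<tau> I (2 * \<alpha>) (\<lambda>s t. om c' (w s) (snd c' (w t) - snd c' (w s))
      - (om c' (w s) (D s (snd c (y t) - snd c (y s), 0)) + om c' (w s) (D s (0, snd d (a t) - snd d (a s)))))"
proof -
  let ?f = "arep c d c'" and ?p = "\<lambda>t. (snd c (y t), snd d (a t))"
  have p0: "?p \<tau> \<in> adom c d c'" using adom_point(1)[OF y(3) a(2) y(4) a(3)] c'(2) by blast
  have pt: "pairs_tends \<tau> I ?p (?p \<tau>)"
    by (intro pairs_tends_Pair pairs_tends_chart[OF atlas_P y] pairs_tends_chart[OF atlas a(1) y(2) a(2,3)])
  note sm = germO_smooth[OF adom(1)[OF y(3) a(2) c'(1)] p0 adom(2)[OF y(3) a(2) c'(1)] pt germO_Pair[OF gy ga]]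
  note ev = eventually_conj[OF pairs_tendsD[OF pt adom(1)[OF y(3) a(2) c'(1)] p0]
      eventually_conj[OF eventually_pairs_chart[OF atlas_P y] eventually_pairs_chart[OF atlas a(1) y(2) a(2,3)]]]
  show "germO \<tau> I \<alpha> (\<lambda>s t. snd c' (w t) - snd c' (w s))"
    by (rule germO_cong[OF sm(1)], rule eventually_mono[OF ev]) (simp add: adom_point(2)[OF y(3) a(2)] w_def)
  let ?E = "\<lambda>s t. ?f (?p t) - ?f (?p s) - frechet_derivative ?f (at (?p s)) (?p t - ?p s)"
  have "germO \<tau> I (2 * \<alpha>) (\<lambda>s t. om c' (inv_chart c' (?f (?p s))) (?E s t))"
    by (rule germO_lb[OF lb_om_arep[OF y(3) a(2) c'(1) p0] pt sm(2)])
  then show "germO \<tau> I (2 * \<alpha>) (\<lambda>s t. om c' (w s) (snd c' (w t) - snd c' (w s))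
      - (om c' (w s) (D s (snd c (y t) - snd c (y s), 0)) + om c' (w s) (D s (0, snd d (a t) - snd d (a s)))))"
  proof (rule germO_cong, intro eventually_mono[OF ev])
    fix q assume q: "(?p (fst q) \<in> adom c d c' \<and> ?p (snd q) \<in> adom c d c') \<and>
      (y (fst q) \<in> fst c \<and> y (snd q) \<in> fst c) \<and> a (fst q) \<in> fst d \<and> a (snd q) \<in> fst d"
    let ?s = "fst q" and ?t = "snd q"
    have w: "w ?s \<in> fst c'" "?f (?p ?s) = snd c' (w ?s)" "?f (?p ?t) = snd c' (w ?t)"
      using adom_point[OF y(3) a(2)] q unfolding w_def by blast+
    have linD: "linear (D ?s)" unfolding D_def
      by (rule has_derivative_linear[OF arep_deriv[OF y(3) a(2) c'(1)]]) (use q in blast)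
    let ?u = "snd c (y ?t) - snd c (y ?s)" and ?v = "snd d (a ?t) - snd d (a ?s)"
    have "D ?s (?u, ?v) = D ?s (?u, 0) + D ?s (0, ?v)" using linear_add[OF linD, of "(?u, 0)" "(0, ?v)"] by simp
    then have "?E ?s ?t = (snd c' (w ?t) - snd c' (w ?s)) - (D ?s (?u, 0) + D ?s (0, ?v))"
      unfolding w(2,3) by (simp add: D_def)
    then have "om c' (w ?s) (?E ?s ?t) = om c' (w ?s) (snd c' (w ?t) - snd c' (w ?s)) -
        (om c' (w ?s) (D ?s (?u, 0)) + om c' (w ?s) (D ?s (0, ?v)))"
      using linear_diff[OF om_linear[OF c'(1) w(1)]] linear_add[OF om_linear[OF c'(1) w(1)]] by simp
    then show "om c' (w ?s) (snd c' (w ?t) - snd c' (w ?s)) -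
        (om c' (w ?s) (D ?s (?u, 0)) + om c' (w ?s) (D ?s (0, ?v))) = om c' (inv_chart c' (?f (?p ?s))) (?E ?s ?t)"
      unfolding w(2) chart_inv[OF atlas_P c'(1) w(1)] by simp
  qed
qed

text \<open>If y is horizontal, its contribution to the increments of a product is negligible, by
  \<open>om_translate_bound\<close>.\<close>

lemma hor_act_first:
  assumes y: "hor \<alpha> I y" "\<tau> \<in> I" and c: "c \<in> AP" "y \<tau> \<in> fst c" and a: "continuous_on I a" "d \<in> AG" "a \<tau> \<in> fst d"
    and c': "c' \<in> AP" "act (y \<tau>) (a \<tau>) \<in> fst c'"
  shows "germO \<tau> I (2 * \<alpha>) (\<lambda>s t. om c' (act (y s) (a s))
    (frechet_derivative (arep c d c') (at (snd c (y s), snd d (a s))) (snd c (y t) - snd c (y s), 0)))"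
proof -
  let ?p = "\<lambda>t. (snd c (y t), snd d (a t))"
  note cont = lholD(1)[OF hor_lhol[OF y(1)]]
  have p0: "?p \<tau> \<in> adom c d c'" using adom_point(1)[OF c(1) a(2) c(2) a(3)] c'(2) by blast
  have pt: "pairs_tends \<tau> I ?p (?p \<tau>)"
    by (intro pairs_tends_Pair pairs_tends_chart[OF atlas_P cont y(2) c] pairs_tends_chart[OF atlas a(1) y(2) a(2,3)])
  show ?thesis
  proof (rule om_translate_bound[OF c(1) a(2) c'(1) p0])
    fix N K assume N: "open N" "?p \<tau> \<in> N"
      and b: "\<And>u a v. u \<in> fst c \<Longrightarrow> a \<in> fst d \<Longrightarrow> (snd c u, snd d a) \<in> N \<Longrightarrow>
        norm (om c' (act u a) (frechet_derivative (arep c d c') (at (snd c u, snd d a)) (v, 0))) \<le> K * norm (om c u v)"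
    show ?thesis
      by (rule germO_le[OF hor_chart[OF y c], of _ K],
          rule eventually_mono[OF eventually_conj[OF pairs_tendsD[OF pt N]
            eventually_conj[OF eventually_pairs_chart[OF atlas_P cont y(2) c] eventually_pairs_chart[OF atlas a(1) y(2) a(2,3)]]]])
        (use b in blast)
  qed
qed

text \<open>For a constant group element the second contribution in \<open>increment_act\<close> is
  0, and the first is negligible.\<close>

lemma hor_translate:
  assumes y: "hor \<alpha> I y" shows "hor \<alpha> I (\<lambda>t. act (y t) g)"
proof -
  note lh = hor_lhol[OF y]
  have ca: "continuous_on I (\<lambda>_. g)" by (rule continuous_on_const)
  have key: "\<exists>c'\<in>AP. act (y \<tau>) g \<in> fst c' \<and> germO \<tau> I \<alpha> (\<lambda>s t. snd c' (act (y t) g) - snd c' (act (y s) g)) \<and>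
      germO \<tau> I (2 * \<alpha>) (\<lambda>s t. om c' (act (y s) g) (snd c' (act (y t) g) - snd c' (act (y s) g)))" if \<tau>: "\<tau> \<in> I" for \<tau>
  proof -
    obtain c where c: "c \<in> AP" "y \<tau> \<in> fst c" using chart_cover[OF atlas_P] by blast
    obtain d where d: "d \<in> AG" "g \<in> fst d" using chart_cover[OF atlas] by blast
    obtain c' where c': "c' \<in> AP" "act (y \<tau>) g \<in> fst c'" using chart_cover[OF atlas_P] by blast
    have ga: "germO \<tau> I \<alpha> (\<lambda>s t. snd d g - snd d g)" using germO_zero by simp
    let ?D = "\<lambda>s. frechet_derivative (arep c d c') (at (snd c (y s), snd d g))"
    note inc = increment_act[OF lholD(1)[OF lh] \<tau> c ca d c' lholD(2)[OF lh \<tau> c] ga]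
    have "germO \<tau> I (2 * \<alpha>) (\<lambda>s t. om c' (act (y s) g) (?D s (snd c (y t) - snd c (y s), 0)))"
      by (rule hor_act_first[OF y \<tau> c ca d c'])
    from germO_add[OF inc(2) this]
    have "germO \<tau> I (2 * \<alpha>) (\<lambda>s t. om c' (act (y s) g) (snd c' (act (y t) g) - snd c' (act (y s) g)))"
    proof (rule germO_cong)
      have "\<forall>\<^sub>F p in pairs \<tau> I. act (y (fst p)) g \<in> fst c' \<and> act (y (snd p)) g \<in> fst c'"
        by (rule eventually_pairs_chart[OF atlas_P act_continuous_on[OF lholD(1)[OF lh] ca] \<tau> c'])
      then show "\<forall>\<^sub>F p in pairs \<tau> I.
          om c' (act (y (fst p)) g) (snd c' (act (y (snd p)) g) - snd c' (act (y (fst p)) g)) =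
          om c' (act (y (fst p)) g) (snd c' (act (y (snd p)) g) - snd c' (act (y (fst p)) g)) -
          (om c' (act (y (fst p)) g) (?D (fst p) (snd c (y (snd p)) - snd c (y (fst p)), 0)) +
           om c' (act (y (fst p)) g) (?D (fst p) (0, snd d g - snd d g))) +
          om c' (act (y (fst p)) g) (?D (fst p) (snd c (y (snd p)) - snd c (y (fst p)), 0))"
        using eventually_pairs_chart[OF atlas_P lholD(1)[OF lh] \<tau> c]
      proof eventually_elim
        case (elim p)
        have "(snd c (y (fst p)), snd d g) \<in> adom c d c'" using adom_point(1)[OF c(1) d(1) _ d(2)] elim by blast
        then have "?D (fst p) (0, snd d g - snd d g) = 0"
          using linear_0[OF has_derivative_linear[OF arep_deriv[OF c(1) d(1) c'(1)]]] by (simp add: zero_prod_def)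
        then have "om c' (act (y (fst p)) g) (?D (fst p) (0, snd d g - snd d g)) = 0"
          using linear_0[OF om_linear[OF c'(1)]] elim by simp
        then show ?case by simp
      qed
    qed
    with inc(1) c' show ?thesis by blast
  qed
  have "lhol AP \<alpha> I (\<lambda>t. act (y t) g)"
    by (rule lholI[OF atlas_P act_continuous_on[OF lholD(1)[OF lh] ca]]) (use key in blast)
  then show ?thesis unfolding hor_def using key by blast
qed

section \<open>Uniqueness\<close>

text \<open>If \<open>y' = y a\<close> with \<open>y\<close> and \<open>y'\<close> horizontal, then the increments of \<open>a\<close> are of order greater
  than one, so that \<open>a\<close> is constant.\<close>

lemma hor_unique_local:
  assumes alpha: "1/2 < \<alpha>" and y: "hor \<alpha> {a..b} y" and y': "hor \<alpha> {a..b} y'"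
    and pr: "\<And>t. t \<in> {a..b} \<Longrightarrow> proj (y t) = proj (y' t)" and \<tau>: "\<tau> \<in> {a..b}" and eq: "y \<tau> = y' \<tau>"
  shows "\<exists>d>0. \<forall>t\<in>{a..b}. \<bar>t - \<tau>\<bar> < d \<longrightarrow> y t = y' t"
proof -
  note cont = lholD(1)[OF hor_lhol[OF y]] and cont' = lholD(1)[OF hor_lhol[OF y']]
  obtain U \<psi> where U: "open U" "proj (y \<tau>) \<in> U" and eqv: "\<And>u a. proj u \<in> U \<Longrightarrow> \<psi> (act u a) = mul (\<psi> u) a"
    and sm: "smooth_map_on (proj -` U) AP (prod_atlas AM AG) (\<lambda>u. (proj u, \<psi> u))"
    using locally_trivial[of "proj (y \<tau>)"] by (elim exE conjE) (rule that, auto)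
  have cpsi: "continuous_on (proj -` U) \<psi>"
    using sm continuous_on_snd[of "proj -` U" "\<lambda>u. (proj u, \<psi> u)"] unfolding smooth_map_on_def by simp
  have oW: "open (proj -` U)" using sm unfolding smooth_map_on_def by blast
  obtain d1 where d1: "d1 > 0" "\<And>t. t \<in> {a..b} \<Longrightarrow> \<bar>t - \<tau>\<bar> < d1 \<Longrightarrow> y t \<in> proj -` U"
    using eventually_pairs_continuous[OF cont \<tau> oW] U(2) unfolding eventually_pairs fst_conv snd_conv by (auto simp: vimage_def)
  define J where "J = {max a (\<tau> - d1 / 2)..min b (\<tau> + d1 / 2)}"
  have J: "J \<subseteq> {a..b}" "\<tau> \<in> J" using \<tau> d1(1) by (auto simp: J_def)
  have yU: "y t \<in> proj -` U" "y' t \<in> proj -` U" if t: "t \<in> J" for t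
  proof -
    have "\<bar>t - \<tau>\<bar> < d1" using t d1(1) unfolding J_def by auto
    then show "y t \<in> proj -` U" using d1(2) J(1) t by blast
    then show "y' t \<in> proj -` U" using pr[of t] J(1) t by auto
  qed
  \<comment> \<open>Equivariance of \<psi> identifies this with the group element that carries y t
    to y' t, and the formula shows that it is a Hoelder path.\<close>
  define q where "q t = mul (ginv (\<psi> (y t))) (\<psi> (y' t))" for t
  have act_q: "act (y t) (q t) = y' t" if t: "t \<in> J" for t
  proof -
    obtain g where g: "y' t = act (y t) g" using fibres pr[of t] J(1) t by blast
    have "proj (y t) \<in> U" using yU(1)[OF t] by simp
    then have "q t = g" unfolding q_def g eqv[OF \<open>proj (y t) \<in> U\<close>] by (simp add: assoc[symmetric])
    then show ?thesis using g by simp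
  qed
  have q\<tau>: "q \<tau> = one" unfolding q_def eq by simp
  have yJ: "hor \<alpha> J y" "hor \<alpha> J y'" using hor_subset[OF _ J(1)] y y' by blast+
  note cJ = lholD(1)[OF hor_lhol[OF yJ(1)]] and cJ' = lholD(1)[OF hor_lhol[OF yJ(2)]]
  have c\<psi>: "continuous_on J (\<lambda>t. \<psi> (y t))" "continuous_on J (\<lambda>t. \<psi> (y' t))"
    by (rule continuous_on_compose2[OF cpsi cJ], use yU in blast, rule continuous_on_compose2[OF cpsi cJ'], use yU in blast)
  have cinv: "continuous_on UNIV ginv" using smooth_inv unfolding smooth_map_on_def by blast
  have cmul: "continuous_on UNIV (\<lambda>(a, b). mul a b)" using smooth_mul unfolding smooth_map_on_def by blast
  have cgi: "continuous_on J (\<lambda>t. ginv (\<psi> (y t)))" by (rule continuous_on_compose2[OF cinv c\<psi>(1)]) auto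
  have cq: "continuous_on J q"
    using continuous_on_compose2[OF cmul continuous_on_Pair[OF cgi c\<psi>(2)]] by (simp add: q_def[abs_def])
  obtain c where c: "c \<in> AP" "y \<tau> \<in> fst c" using chart_cover[OF atlas_P] by blast
  have c2: "y' \<tau> \<in> fst c" using c eq by simp
  obtain cm where cm: "cm \<in> AM" "proj (y \<tau>) \<in> fst cm" using chart_cover[OF atlas_M] by blast
  obtain g0 where g0: "g0 \<in> AG" "\<psi> (y \<tau>) \<in> fst g0" using chart_cover[OF atlas] by blast
  obtain g1 where g1: "g1 \<in> AG" "ginv (\<psi> (y \<tau>)) \<in> fst g1" using chart_cover[OF atlas] by blast
  let ?cg = "(fst cm \<times> fst g0, map_prod (snd cm) (snd g0))"
  have ocg: "open (fst ?cg)" using chart_open(1)[OF atlas_M cm(1)] chart_open(1)[OF atlas g0(1)] by (simp add: open_Times)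
  have g\<psi>: "germO \<tau> J \<alpha> (\<lambda>s t. snd g0 (\<psi> (v t)) - snd g0 (\<psi> (v s)))"
    if v: "hor \<alpha> J v" "v \<tau> = y \<tau>" for v
  proof -
    have "germO \<tau> J \<alpha> (\<lambda>s t. snd ?cg (proj (v t), \<psi> (v t)) - snd ?cg (proj (v s), \<psi> (v s)))"
      by (rule germ_map[OF atlas_P sm c(1) prod_chart_in[OF cm(1) g0(1)] ocg lholD(1)[OF hor_lhol[OF v(1)]] J(2) _ _ _
            lholD(2)[OF hor_lhol[OF v(1)] J(2) c(1)]]) (use v(2) c U(2) cm g0 in auto)
    then show ?thesis
      by (rule germO_le1) (rule always_eventually, auto simp: norm_snd_le intro: order_trans[OF _ norm_snd_le])
  qed
  have gi: "germO \<tau> J \<alpha> (\<lambda>s t. snd g1 (ginv (\<psi> (y t))) - snd g1 (ginv (\<psi> (y s))))"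
    by (rule germ_map[OF atlas smooth_inv g0(1) g1(1) chart_open(1)[OF atlas g1(1)] c\<psi>(1) J(2) g0(2) UNIV_I g1(2) g\<psi>[OF yJ(1) refl]])
  have gq: "germO \<tau> J \<alpha> (\<lambda>s t. snd e (q t) - snd e (q s))"
    using germ_map_pair[OF atlas atlas atlas smooth_mul g1(1) g0(1) e(1) cgi J(2) g1(2) c\<psi>(2) _ UNIV_I _ gi g\<psi>[OF yJ(2) eq[symmetric]]]
      q\<tau> e(2) g0(2) eq unfolding q_def by simp
  have q\<tau>e: "q \<tau> \<in> fst e" "act (y \<tau>) (q \<tau>) \<in> fst c" using q\<tau> e(2) c(2) by (simp_all add: act_one)
  let ?D = "\<lambda>s. frechet_derivative (arep c e c) (at (snd c (y s), snd e (q s)))"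
  let ?T = "\<lambda>s t. om c (act (y s) (q s)) (?D s (0, snd e (q t) - snd e (q s)))"
  have inc: "germO \<tau> J (2 * \<alpha>) (\<lambda>s t. om c (act (y s) (q s)) (snd c (act (y t) (q t)) - snd c (act (y s) (q s)))
      - (om c (act (y s) (q s)) (?D s (snd c (y t) - snd c (y s), 0)) + ?T s t))"
    by (rule increment_act(2)[OF cJ J(2) c cq e(1) q\<tau>e(1) c(1) q\<tau>e(2) lholD(2)[OF hor_lhol[OF yJ(1)] J(2) c] gq])
  have first: "germO \<tau> J (2 * \<alpha>) (\<lambda>s t. om c (act (y s) (q s)) (?D s (snd c (y t) - snd c (y s), 0)))"
    by (rule hor_act_first[OF yJ(1) J(2) c cq e(1) q\<tau>e(1) c(1) q\<tau>e(2)])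
  have total: "germO \<tau> J (2 * \<alpha>) (\<lambda>s t. om c (act (y s) (q s)) (snd c (act (y t) (q t)) - snd c (act (y s) (q s))))"
    by (rule germO_cong[OF hor_chart[OF yJ(2) J(2) c(1) c2]], rule eventually_mono[OF eventually_pairs_in]) (simp add: act_q)
  have T: "germO \<tau> J (2 * \<alpha>) ?T"
    using germO_diff[OF germO_diff[OF total inc] first] by simp
  let ?p = "\<lambda>t. (snd c (y t), snd e (q t))"
  have p0: "?p \<tau> \<in> adom c e c" using adom_point(1)[OF c(1) e(1) c(2) q\<tau>e(1)] q\<tau>e(2) by blast
  have pt: "pairs_tends \<tau> J ?p (?p \<tau>)"
    by (intro pairs_tends_Pair pairs_tends_chart[OF atlas_P cJ J(2) c] pairs_tends_chart[OF atlas cq J(2) e(1) q\<tau>e(1)])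
  let ?A = "\<lambda>p \<kappa>. om c (inv_chart c (arep c e c p)) (frechet_derivative (arep c e c) (at p) (0, \<kappa>))"
  have lbA: "lb_at (?p \<tau>) ?A" by (rule lb_at_comp[OF lb_om_arep[OF c(1) e(1) c(1) p0] lb_partial(2)[OF c(1) e(1) c(1) p0]])
  obtain N K where N: "open N" "?p \<tau> \<in> N" "lb_on N ?A K"
    using lbA unfolding lb_at_def by blast
  \<comment> \<open>At \<tau> the group element is the unit, so this is
    \<open>om_fundamental\<close>.\<close>
  have A0: "?A (?p \<tau>) \<kappa> = \<kappa>" for \<kappa>
    using om_fundamental[OF c, of \<kappa>] adom_point(2)[OF c(1) e(1) c(2) q\<tau>e(1)] chart_inv[OF atlas_P c] q\<tau> by (simp add: act_one)
  have K0: "K \<ge> 0" by (rule lb_onD(1)[OF N(3)])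
  let ?N = "N \<inter> ball (?p \<tau>) (1 / (2 * (K + 1)))"
  \<comment> \<open>On this neighbourhood the family differs from the identity by at most 1/2, so a
    vector is at most twice its image. A bound on \<omega> of the group contribution is thus a bound
    on the increments of q.\<close>
  have A2: "norm \<kappa> \<le> 2 * norm (?A p \<kappa>)" if p: "p \<in> ?N" for p \<kappa>
  proof -
    have pN: "p \<in> N" and pb: "norm (p - ?p \<tau>) \<le> 1 / (2 * (K + 1))" using p by (auto simp: dist_norm norm_minus_commute)
    have "norm (?A p \<kappa> - \<kappa>) \<le> K * norm (p - ?p \<tau>) * norm \<kappa>" using lb_onD(4)[OF N(3) N(2) pN, of \<kappa>] A0 by metis
    also have "\<dots> \<le> K * (1 / (2 * (K + 1))) * norm \<kappa>" using pb K0 by (intro mult_right_mono mult_left_mono) auto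
    also have "\<dots> \<le> 1 / 2 * norm \<kappa>" using K0 by (intro mult_right_mono) (auto simp: field_simps)
    finally show ?thesis using norm_triangle_ineq2[of \<kappa> "\<kappa> - ?A p \<kappa>"] by (simp add: norm_minus_commute)
  qed
  have oN: "open ?N" "?p \<tau> \<in> ?N" using N K0 by auto
  have "germO \<tau> J (2 * \<alpha>) (\<lambda>s t. snd e (q t) - snd e (q s))"
  proof (rule germO_le[OF T, of _ 2], rule eventually_mono[OF eventually_conj[OF pairs_tendsD[OF pt oN]
        eventually_conj[OF pairs_tendsD[OF pt adom(1)[OF c(1) e(1) c(1)] p0]
        eventually_conj[OF eventually_pairs_chart[OF atlas_P cJ J(2) c] eventually_pairs_chart[OF atlas cq J(2) e(1) q\<tau>e(1)]]]]])
    fix r assume r: "(?p (fst r) \<in> ?N \<and> ?p (snd r) \<in> ?N) \<and> (?p (fst r) \<in> adom c e c \<and> ?p (snd r) \<in> adom c e c) \<and>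
      (y (fst r) \<in> fst c \<and> y (snd r) \<in> fst c) \<and> q (fst r) \<in> fst e \<and> q (snd r) \<in> fst e"
    have yc: "y (fst r) \<in> fst c" and qe: "q (fst r) \<in> fst e" and pN: "?p (fst r) \<in> ?N" and pa: "?p (fst r) \<in> adom c e c"
      using r by blast+
    have "act (y (fst r)) (q (fst r)) \<in> fst c" using adom_point(1)[OF c(1) e(1) yc qe] pa by blast
    then have "inv_chart c (arep c e c (?p (fst r))) = act (y (fst r)) (q (fst r))"
      using adom_point(2)[OF c(1) e(1) yc qe] chart_inv[OF atlas_P c(1)] by metis
    then show "norm (snd e (q (snd r)) - snd e (q (fst r))) \<le> 2 * norm (?T (fst r) (snd r))"
      using A2[OF pN, of "snd e (q (snd r)) - snd e (q (fst r))"] by simp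
  qed
  then obtain C where C: "\<forall>\<^sub>F r in pairs \<tau> J. norm (snd e (q (snd r)) - snd e (q (fst r))) \<le> C * \<bar>snd r - fst r\<bar> powr (2 * \<alpha>)"
    unfolding germO_def by blast
  obtain d2 where d2: "d2 > 0" "\<And>s t. s \<in> J \<Longrightarrow> t \<in> J \<Longrightarrow> \<bar>s - \<tau>\<bar> < d2 \<Longrightarrow> \<bar>t - \<tau>\<bar> < d2 \<Longrightarrow>
      norm (snd e (q t) - snd e (q s)) \<le> C * \<bar>t - s\<bar> powr (2 * \<alpha>) \<and> q s \<in> fst e \<and> q t \<in> fst e"
    using eventually_conj[OF C eventually_pairs_chart[OF atlas cq J(2) e(1) q\<tau>e(1)]]
    unfolding eventually_pairs fst_conv snd_conv by blast
  define d where "d = min (d1 / 2) (d2 / 2)"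
  have d: "d > 0" using d1 d2 by (simp add: d_def)
  have "y t = y' t" if t: "t \<in> {a..b}" "\<bar>t - \<tau>\<bar> < d" for t
  proof -
    let ?a = "max a (\<tau> - d)" and ?b = "min b (\<tau> + d)"
    have sub: "r \<in> J" "\<bar>r - \<tau>\<bar> < d2" if "r \<in> {?a..?b}" for r using that d2(1) unfolding J_def d_def by auto
    have tin: "\<tau> \<in> {?a..?b}" "t \<in> {?a..?b}" using t \<tau> d by auto
    have "snd e (q \<tau>) = snd e (q t)"
      by (rule constant_of_superlinear[of "2 * \<alpha>" 1 \<tau> ?a ?b t "\<lambda>t. snd e (q t)" C]) (use alpha tin sub d2(2) in auto)
    moreover have "q t \<in> fst e" using d2(2)[of t t] sub tin by blast
    ultimately have "q t = one" using chart_inj[OF atlas e(1)] q\<tau> e(2) by (metis inj_onD)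
    then show ?thesis using act_q[of t] sub(1)[OF tin(2)] by (simp add: act_one)
  qed
  then show ?thesis using d by blast
qed

text \<open>\<open>Bolzano\<close> is applied to the property that agreement at the left end of an
  interval spreads over all of it. This property passes to joined intervals, and at a time where the
  paths differ it holds vacuously nearby.\<close>

lemma hor_unique:
  assumes alpha: "1/2 < \<alpha>" and y: "hor \<alpha> {a..b} y" and y': "hor \<alpha> {a..b} y'"
    and pr: "\<And>t. t \<in> {a..b} \<Longrightarrow> proj (y t) = proj (y' t)" and "a \<le> b" and eq: "y a = y' a" and t: "t \<in> {a..b}"
  shows "y t = y' t"
proof -
  note cont = lholD(1)[OF hor_lhol[OF y]] and cont' = lholD(1)[OF hor_lhol[OF y']]
  define P where "P s t \<longleftrightarrow> (a \<le> s \<and> t \<le> b \<and> y s = y' s \<longrightarrow> (\<forall>r\<in>{s..t}. y r = y' r))" for s t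
  have "P a b"
    using \<open>a \<le> b\<close>
  proof (induction rule: Bolzano)
    case (trans r s t)
    show ?case unfolding P_def
    proof (intro impI ballI)
      fix p assume A: "a \<le> r \<and> t \<le> b \<and> y r = y' r" and p: "p \<in> {r..t}"
      have 1: "y p = y' p" if "p \<in> {r..s}" for p using trans A that unfolding P_def by auto
      then have "y s = y' s" using trans by simp
      then have "y p = y' p" if "p \<in> {s..t}" using trans A that unfolding P_def by auto
      then show "y p = y' p" using 1 p by (cases "p \<le> s") auto
    qed
  next
    case (local \<tau>)
    then have \<tau>: "\<tau> \<in> {a..b}" by simp
    show ?case
    proof (cases "y \<tau> = y' \<tau>")
      case True
      obtain d where d: "d > 0" "\<And>t. t \<in> {a..b} \<Longrightarrow> \<bar>t - \<tau>\<bar> < d \<Longrightarrow> y t = y' t"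
        using hor_unique_local[OF alpha y y' pr \<tau> True] by blast
      have "P s t" if "s \<le> \<tau> \<and> \<tau> \<le> t \<and> t - s < d" for s t
        unfolding P_def using that by (auto intro!: d(2))
      then show ?thesis using d(1) by blast
    next
      case False
      \<comment> \<open>Disjoint neighbourhoods keep the paths apart near \<tau>, so the premise of
        agreement at the left end fails.\<close>
      obtain U U' where U: "open U" "open U'" "y \<tau> \<in> U" "y' \<tau> \<in> U'" "U \<inter> U' = {}" using hausdorff[OF False] by (elim exE conjE) (rule that)
      obtain d where d: "d > 0" "\<And>s t. s \<in> {a..b} \<Longrightarrow> t \<in> {a..b} \<Longrightarrow> \<bar>s - \<tau>\<bar> < d \<Longrightarrow> \<bar>t - \<tau>\<bar> < d \<Longrightarrow>
          (y s \<in> U \<and> y t \<in> U) \<and> y' s \<in> U' \<and> y' t \<in> U'"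
        using eventually_conj[OF eventually_pairs_continuous[OF cont \<tau> U(1,3)] eventually_pairs_continuous[OF cont' \<tau> U(2,4)]]
        unfolding eventually_pairs fst_conv snd_conv by (elim exE conjE) (rule that, simp, simp)
      have "P s t" if st: "s \<le> \<tau> \<and> \<tau> \<le> t \<and> t - s < d" for s t
        unfolding P_def
      proof (intro impI ballI)
        fix r assume A: "a \<le> s \<and> t \<le> b \<and> y s = y' s"
        then have "s \<in> {a..b}" "\<bar>s - \<tau>\<bar> < d" using st by auto
        from d(2)[OF this(1,1) this(2,2)] A U(5) show "y r = y' r" by auto
      qed
      then show ?thesis using d(1) by blast
    qed
  qed
  then show ?thesis unfolding P_def using eq t by simp
qed

end

section \<open>Existence\<close>

lemma holder_continuous:
  fixes h :: "real \<Rightarrow> 'a::real_normed_vector"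
  assumes "\<alpha> > 0" and h: "\<And>s t. s \<in> I \<Longrightarrow> t \<in> I \<Longrightarrow> norm (h t - h s) \<le> C * \<bar>t - s\<bar> powr \<alpha>"
  shows "continuous_on I h"
  unfolding continuous_on_iff dist_norm
proof (intro ballI allI impI)
  fix s and \<epsilon> :: real assume s: "s \<in> I" and "\<epsilon> > 0"
  then obtain d where d: "d > 0" "\<bar>C\<bar> * d powr \<alpha> < \<epsilon>" using small_powr[of \<alpha> \<epsilon> "\<bar>C\<bar>" 1] assms(1) by auto
  have "norm (h t - h s) < \<epsilon>" if t: "t \<in> I" "norm (t - s) < d" for t
  proof -
    have "C * \<bar>t - s\<bar> powr \<alpha> \<le> \<bar>C\<bar> * d powr \<alpha>" using t(2) assms(1) by (intro mult_mono powr_mono2) auto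
    then show ?thesis using h[OF s t(1)] d(2) by linarith
  qed
  then show "\<exists>d>0. \<forall>t\<in>I. norm (t - s) < d \<longrightarrow> norm (h t - h s) < \<epsilon>" using d(1) by blast
qed

context bundle_connection
begin

text \<open>The lift with constant group coordinate \<open>one\<close> in a trivialisation; being a
  smooth image of x it is Hoelder. \<open>local_lift\<close> makes it horizontal.\<close>

lemma local_section:
  assumes x: "lhol AM \<alpha> I x" and \<tau>: "\<tau> \<in> I"
  shows "\<exists>d>0. \<exists>q. lhol AP \<alpha> (I \<inter> {\<tau> - d..\<tau> + d}) q \<and> (\<forall>r\<in>I \<inter> {\<tau> - d..\<tau> + d}. proj (q r) = x r)"
proof -
  note cont = lholD(1)[OF x]
  obtain U \<psi> where U: "open U" "x \<tau> \<in> U" and bij: "bij_betw (\<lambda>u. (proj u, \<psi> u)) (proj -` U) (U \<times> UNIV)"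
    and sm: "smooth_map_on (U \<times> UNIV) (prod_atlas AM AG) AP (inv_into (proj -` U) (\<lambda>u. (proj u, \<psi> u)))"
    using locally_trivial[of "x \<tau>"] by (elim exE conjE) (rule that)
  let ?\<Theta> = "inv_into (proj -` U) (\<lambda>u. (proj u, \<psi> u))"
  obtain d1 where d1: "d1 > 0" "\<And>t. t \<in> I \<Longrightarrow> \<bar>t - \<tau>\<bar> < d1 \<Longrightarrow> x t \<in> U"
    using eventually_pairs_continuous[OF cont \<tau> U] unfolding eventually_pairs fst_conv snd_conv by auto
  define J where "J = I \<inter> {\<tau> - d1 / 2..\<tau> + d1 / 2}"
  have xU: "x t \<in> U" if t: "t \<in> J" for t
  proof (rule d1(2))
    show "t \<in> I" "\<bar>t - \<tau>\<bar> < d1" using t d1(1) unfolding J_def by auto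
  qed
  have xJ: "lhol AM \<alpha> J x" by (rule lhol_subset[OF x]) (simp add: J_def)
  define q where "q t = ?\<Theta> (x t, one)" for t
  have pq: "proj (q t) = x t" if t: "t \<in> J" for t
  proof -
    have "(x t, one) \<in> (\<lambda>u. (proj u, \<psi> u)) ` (proj -` U)" using bij_betw_imp_surj_on[OF bij] xU[OF t] by simp
    from f_inv_into_f[OF this] show ?thesis unfolding q_def by simp
  qed
  have cq: "continuous_on J q"
  proof -
    have c\<Theta>: "continuous_on (U \<times> UNIV) ?\<Theta>" using sm unfolding smooth_map_on_def by blast
    show ?thesis unfolding q_def[abs_def]
      by (rule continuous_on_compose2[OF c\<Theta> continuous_on_Pair[OF lholD(1)[OF xJ] continuous_on_const]]) (use xU in auto)
  qed
  have "lhol AP \<alpha> J q"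
  proof (rule lholI[OF atlas_P cq])
    fix \<sigma> assume \<sigma>: "\<sigma> \<in> J"
    obtain c where c: "c \<in> AM" "x \<sigma> \<in> fst c" using chart_cover[OF atlas_M] by blast
    obtain c' where c': "c' \<in> AP" "q \<sigma> \<in> fst c'" using chart_cover[OF atlas_P] by blast
    have "germO \<sigma> J \<alpha> (\<lambda>s t. snd c' (?\<Theta> (x t, one)) - snd c' (?\<Theta> (x s, one)))"
      by (rule germ_map_pair[OF atlas_M atlas atlas_P sm c(1) e(1) c'(1) lholD(1)[OF xJ] \<sigma> c(2)
            continuous_on_const e(2) _ _ lholD(2)[OF xJ \<sigma> c]])
        (use xU[OF \<sigma>] c'(2) germO_zero in \<open>auto simp: q_def\<close>)
    then show "\<exists>c\<in>AP. q \<sigma> \<in> fst c \<and> germO \<sigma> J \<alpha> (\<lambda>s t. snd c (q t) - snd c (q s))"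
      unfolding q_def[symmetric] using c' by blast
  qed
  then show ?thesis using pq d1(1) unfolding J_def by (intro exI[of _ "d1 / 2"] conjI exI[of _ q]) auto
qed

text \<open>For a path \<open>q\<close> in \<open>P\<close> the horizontal path \<open>q a\<close> is found by solving, in a chart of \<open>G\<close>,
  the Young differential equation whose right hand side is the left invariant vector field of \<open>- \<omega>(dq)\<close>,
  translated by \<open>a\<close>.\<close>

lemma local_lift:
  assumes alpha: "1/2 < \<alpha>" "\<alpha> \<le> 1" and q: "lhol AP \<alpha> I q" and \<tau>: "\<tau> \<in> I"
  shows "\<exists>d>0. \<forall>s t. s \<le> \<tau> \<longrightarrow> \<tau> \<le> t \<longrightarrow> {s..t} \<subseteq> I \<longrightarrow> t - s < d \<longrightarrow> (\<exists>a. hor \<alpha> {s..t} (\<lambda>r. act (q r) (a r)))"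
proof -
  note cont = lholD(1)[OF q]
  obtain c where c: "c \<in> AP" "q \<tau> \<in> fst c" using chart_cover[OF atlas_P] by blast
  define z where "z r = snd c (q r)" for r
  let ?f = "arep c e c" and ?p0 = "(z \<tau>, h0)"
  let ?D = "\<lambda>p. frechet_derivative ?f (at p)"
  \<comment> \<open>The sign of - \<omega>(dq) is placed inside the argument, as (- v, 0), so that H
    is visibly a composition of \<open>lb_at\<close> families.\<close>
  define H where "H p v = V (om c (inv_chart c (?f p)) (?D p (- v, 0))) (snd p)" for p :: "'e \<times> 'k" and v
  have p0: "?p0 \<in> adom c e c" unfolding z_def using adom_point(1)[OF c(1) e(1) c(2) e(2)] c(2) by (simp add: act_one)
  have lbV: "lb_at ?p0 (\<lambda>p \<kappa>. V \<kappa> (snd p))"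
    unfolding V_def
  proof (rule lb_at_pull[of UNIV _ "\<lambda>p. (snd p, h0)" "\<lambda>p \<kappa>. frechet_derivative m (at p) (0, \<kappa>)"])
    have "lb_at (h0, h0) (\<lambda>p \<kappa>. frechet_derivative m (at p) (0, \<kappa>))"
      by (rule lb_at_smooth[OF S(1) S_unit(1)[OF h0_in] S(2)]) (auto intro!: linearI simp: norm_Pair)
    then show "lb_at (snd ?p0, h0) (\<lambda>p \<kappa>. frechet_derivative m (at p) (0, \<kappa>))" by simp
    show "smooth_on UNIV (\<lambda>p::'e \<times> 'k. (snd p, h0))"
      by (intro smooth_on_Pair smooth_on_const smooth_on_bounded_linear bounded_linear_snd open_UNIV)
  qed auto
  have lbD: "lb_at ?p0 (\<lambda>p v. ?D p (- v, 0))"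
    by (rule lb_at_smooth[OF adom(1)[OF c(1) e(1) c(1)] p0 adom(2)[OF c(1) e(1) c(1)]]) (auto intro!: linearI simp: norm_Pair)
  have lbH: "lb_at ?p0 H" unfolding H_def[abs_def]
    by (rule lb_at_comp[OF lbV lb_at_comp[OF lb_om_arep[OF c(1) e(1) c(1) p0] lbD]])
  then obtain N K0 where N: "open N" "?p0 \<in> N" "lb_on N H K0" unfolding lb_at_def by blast
  have "open (N \<inter> adom c e c)" "?p0 \<in> N \<inter> adom c e c" using N p0 adom(1)[OF c(1) e(1) c(1)] by auto
  \<comment> \<open>The base coordinate z moves along the path while the solver tests all h in a
    ball, so a product neighbourhood is needed.\<close>
  then obtain A B where AB: "open A" "open B" "?p0 \<in> A \<times> B" "A \<times> B \<subseteq> N \<inter> adom c e c" by (rule open_prod_elim)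
  obtain R where R: "R > 0" "cball h0 R \<subseteq> B" using AB(2,3) open_contains_cball by blast
  have pt: "pairs_tends \<tau> I z (z \<tau>)" unfolding z_def by (rule pairs_tends_chart[OF atlas_P cont \<tau> c])
  obtain C where C: "\<forall>\<^sub>F p in pairs \<tau> I. norm (z (snd p) - z (fst p)) \<le> C * \<bar>snd p - fst p\<bar> powr \<alpha>"
    using lholD(2)[OF q \<tau> c] unfolding germO_def z_def by blast
  have zA: "z \<tau> \<in> A" using AB(3) by simp
  obtain d1 where d1: "d1 > 0" "\<And>s t. s \<in> I \<Longrightarrow> t \<in> I \<Longrightarrow> \<bar>s - \<tau>\<bar> < d1 \<Longrightarrow> \<bar>t - \<tau>\<bar> < d1 \<Longrightarrow>
      norm (z t - z s) \<le> C * \<bar>t - s\<bar> powr \<alpha> \<and> (z s \<in> A \<and> z t \<in> A) \<and> q s \<in> fst c \<and> q t \<in> fst c"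
    using eventually_conj[OF C eventually_conj[OF pairs_tendsD[OF pt AB(1) zA] eventually_pairs_chart[OF atlas_P cont \<tau> c]]]
    unfolding eventually_pairs fst_conv snd_conv by (elim exE conjE) (rule that, simp, simp)
  \<comment> \<open>K dominates the Hoelder constant C of the driver z, the bound K0 and Lipschitz
    constant K0 of the coefficient in h, and the Hoelder constant K0 * |C| that it acquires in time
    through z.\<close>
  define K where "K = K0 * (\<bar>C\<bar> + 1) + \<bar>C\<bar>"
  have K0: "K0 \<ge> 0" by (rule lb_onD(1)[OF N(3)])
  then have "K0 * (\<bar>C\<bar> + 1) = K0 * \<bar>C\<bar> + K0" "0 \<le> K0 * \<bar>C\<bar>" by (simp_all add: algebra_simps)
  then have K: "K \<ge> 0" "C \<le> K" "K0 \<le> K" "K0 * \<bar>C\<bar> \<le> K" using K0 unfolding K_def by linarith+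
  obtain \<delta> where \<delta>: "\<delta> > 0" and dav: "\<forall>(H :: real \<Rightarrow> 'k \<Rightarrow> 'e \<Rightarrow> 'k) x a b z1.
    a \<le> b \<longrightarrow> b - a < \<delta> \<longrightarrow> norm (z1 - h0) \<le> R / 2 \<longrightarrow>
    (\<forall>s\<in>{a..b}. \<forall>t\<in>{a..b}. norm (x t - x s) \<le> K * \<bar>t - s\<bar> powr \<alpha>) \<longrightarrow>
    (\<forall>s\<in>{a..b}. \<forall>z\<in>cball h0 R. linear (H s z) \<and> (\<forall>v. norm (H s z v) \<le> K * norm v)) \<longrightarrow>
    (\<forall>s\<in>{a..b}. \<forall>u\<in>{a..b}. \<forall>z\<in>cball h0 R. \<forall>w\<in>cball h0 R. \<forall>v.
      norm (H u w v - H s z v) \<le> K * (\<bar>u - s\<bar> powr \<alpha> + norm (w - z)) * norm v) \<longrightarrow>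
    (\<exists>w. w a = z1 \<and> (\<forall>t\<in>{a..b}. w t \<in> cball h0 R) \<and> (\<exists>C. \<forall>s\<in>{a..b}. \<forall>t\<in>{a..b}.
       norm (w t - w s) \<le> C * \<bar>t - s\<bar> powr \<alpha> \<and>
       norm (w t - w s - H s (w s) (x t - x s)) \<le> C * \<bar>t - s\<bar> powr (2 * \<alpha>)))"
    using davie_exists[OF alpha K(1) R(1), of h0] by blast
  show ?thesis
  proof (intro exI[of _ "min \<delta> d1"] conjI allI impI)
    show "0 < min \<delta> d1" using \<delta> d1(1) by simp
    fix s t assume st: "s \<le> \<tau>" "\<tau> \<le> t" "{s..t} \<subseteq> I" "t - s < min \<delta> d1"
    have near: "r \<in> I" "\<bar>r - \<tau>\<bar> < d1" if r: "r \<in> {s..t}" for r using st r by auto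
    have zC: "norm (z v - z u) \<le> C * \<bar>v - u\<bar> powr \<alpha>" if "u \<in> {s..t}" "v \<in> {s..t}" for u v
      using d1(2)[OF near(1)[OF that(1)] near(1)[OF that(2)] near(2)[OF that(1)] near(2)[OF that(2)]] by blast
    have zA: "z r \<in> A" "q r \<in> fst c" if r: "r \<in> {s..t}" for r
      using d1(2)[OF near(1)[OF r] near(1)[OF r] near(2)[OF r] near(2)[OF r]] by blast+
    have dom: "(z r, h) \<in> N" "(z r, h) \<in> adom c e c" if "r \<in> {s..t}" "h \<in> cball h0 R" for r h
      using AB(4) zA(1)[OF that(1)] R(2) that(2) by blast+
    let ?H = "\<lambda>r h. H (z r, h)"
    note D = dav[THEN spec[where x="?H"], THEN spec[where x=z], THEN spec[where x=s], THEN spec[where x=t], THEN spec[where x=h0]]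
    have c0: "s \<le> t" "t - s < \<delta>" "norm (h0 - h0) \<le> R / 2" using st R by auto
    have c1: "\<forall>u\<in>{s..t}. \<forall>v\<in>{s..t}. norm (z v - z u) \<le> K * \<bar>v - u\<bar> powr \<alpha>"
      using order_trans[OF zC mult_right_mono[OF K(2)]] by simp
    have c2: "\<forall>u\<in>{s..t}. \<forall>h\<in>cball h0 R. linear (?H u h) \<and> (\<forall>v. norm (?H u h v) \<le> K * norm v)"
    proof (intro ballI conjI allI)
      fix u h v assume uh: "u \<in> {s..t}" "h \<in> cball h0 R"
      show "linear (?H u h)" by (rule lb_onD(2)[OF N(3) dom(1)[OF uh]])
      show "norm (?H u h v) \<le> K * norm v"
        using order_trans[OF lb_onD(3)[OF N(3) dom(1)[OF uh]] mult_right_mono[OF K(3)]] by simp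
    qed
    have c3: "\<forall>u\<in>{s..t}. \<forall>u'\<in>{s..t}. \<forall>h\<in>cball h0 R. \<forall>h'\<in>cball h0 R. \<forall>v.
        norm (?H u' h' v - ?H u h v) \<le> K * (\<bar>u' - u\<bar> powr \<alpha> + norm (h' - h)) * norm v"
    proof (intro ballI allI)
      fix u u' h h' and v :: 'e assume u: "u \<in> {s..t}" "u' \<in> {s..t}" and h: "h \<in> cball h0 R" "h' \<in> cball h0 R"
      have "norm ((z u', h') - (z u, h)) \<le> norm (z u' - z u) + norm (h' - h)"
        using norm_Pair_le[of "z u' - z u" "h' - h"] by simp
      also have "norm (z u' - z u) \<le> \<bar>C\<bar> * \<bar>u' - u\<bar> powr \<alpha>"
        by (rule order_trans[OF zC[OF u] mult_right_mono]) auto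
      finally have "K0 * norm ((z u', h') - (z u, h)) \<le> K0 * (\<bar>C\<bar> * \<bar>u' - u\<bar> powr \<alpha> + norm (h' - h))"
        using K0 by (intro mult_left_mono) auto
      also have "\<dots> = (K0 * \<bar>C\<bar>) * \<bar>u' - u\<bar> powr \<alpha> + K0 * norm (h' - h)" by (simp add: algebra_simps)
      also have "\<dots> \<le> K * \<bar>u' - u\<bar> powr \<alpha> + K * norm (h' - h)" using K by (intro add_mono mult_right_mono) auto
      finally have "K0 * norm ((z u', h') - (z u, h)) * norm v \<le> (K * \<bar>u' - u\<bar> powr \<alpha> + K * norm (h' - h)) * norm v"
        by (rule mult_right_mono) simp
      with lb_onD(4)[OF N(3) dom(1)[OF u(1) h(1)] dom(1)[OF u(2) h(2)], of v]
      show "norm (?H u' h' v - ?H u h v) \<le> K * (\<bar>u' - u\<bar> powr \<alpha> + norm (h' - h)) * norm v"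
        by (simp add: distrib_left)
    qed
    obtain h C' where h: "\<And>r. r \<in> {s..t} \<Longrightarrow> h r \<in> cball h0 R"
      "\<And>u v. u \<in> {s..t} \<Longrightarrow> v \<in> {s..t} \<Longrightarrow> norm (h v - h u) \<le> C' * \<bar>v - u\<bar> powr \<alpha>"
      "\<And>u v. u \<in> {s..t} \<Longrightarrow> v \<in> {s..t} \<Longrightarrow> norm (h v - h u - H (z u, h u) (z v - z u)) \<le> C' * \<bar>v - u\<bar> powr (2 * \<alpha>)"
      using mp[OF mp[OF mp[OF mp[OF mp[OF mp[OF D c0(1)] c0(2)] c0(3)] c1] c2] c3]
      by (elim exE conjE) (rule that, blast, blast, blast)
    define a where "a r = inv_chart e (h r)" for r
    let ?w = "\<lambda>r. act (q r) (a r)"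
    have he: "h r \<in> snd e ` fst e" if r: "r \<in> {s..t}" for r using dom(2)[OF r h(1)[OF r]] unfolding adom_iff by blast
    have a: "a r \<in> fst e" "snd e (a r) = h r" if r: "r \<in> {s..t}" for r
      unfolding a_def using he[OF r] by (auto simp: inv_into_into f_inv_into_f)
    have "continuous_on {s..t} h" by (rule holder_continuous[OF _ h(2)]) (use alpha in auto)
    then have ca: "continuous_on {s..t} a" unfolding a_def[abs_def]
      by (rule continuous_on_compose2[OF chart_inv_cont[OF atlas e(1)]]) (use he in auto)
    have qs: "lhol AP \<alpha> {s..t} q" by (rule lhol_subset[OF q st(3)])
    have w: "?w r \<in> fst c" "?f (z r, h r) = snd c (?w r)" if r: "r \<in> {s..t}" for r
      using adom_point[OF c(1) e(1) zA(2)[OF r] a(1)[OF r], of c] dom(2)[OF r h(1)[OF r]]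
      unfolding a(2)[OF r] z_def[symmetric] by blast+
    have key: "germO \<sigma> {s..t} \<alpha> (\<lambda>u v. snd c (?w v) - snd c (?w u)) \<and>
        germO \<sigma> {s..t} (2 * \<alpha>) (\<lambda>u v. om c (?w u) (snd c (?w v) - snd c (?w u)))" if \<sigma>: "\<sigma> \<in> {s..t}" for \<sigma>
    proof -
      have ga: "germO \<sigma> {s..t} \<alpha> (\<lambda>u v. snd e (a v) - snd e (a u))"
        unfolding germO_def
        by (intro exI[of _ C'], rule eventually_mono[OF eventually_pairs_in]) (use a(2) h(2) in auto)
      let ?P = "\<lambda>u. (snd c (q u), snd e (a u))"
      let ?E = "\<lambda>u v. snd e (a v) - snd e (a u) - H (?P u) (snd c (q v) - snd c (q u))"
      have gE: "germO \<sigma> {s..t} (2 * \<alpha>) ?E"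
        unfolding germO_def
        by (intro exI[of _ C'], rule eventually_mono[OF eventually_pairs_in]) (use a(2) h(3) in \<open>auto simp: z_def\<close>)
      have Pd: "?P u \<in> adom c e c" if u: "u \<in> {s..t}" for u
        using dom(2)[OF u h(1)[OF u]] unfolding a(2)[OF u] z_def .
      have ptP: "pairs_tends \<sigma> {s..t} ?P (?P \<sigma>)"
        by (intro pairs_tends_Pair pairs_tends_chart[OF atlas_P lholD(1)[OF qs] \<sigma> c(1) zA(2)[OF \<sigma>]]
            pairs_tends_chart[OF atlas ca \<sigma> e(1) a(1)[OF \<sigma>]])
      note inc = increment_act[OF lholD(1)[OF qs] \<sigma> c(1) zA(2)[OF \<sigma>] ca e(1) a(1)[OF \<sigma>] c(1) w(1)[OF \<sigma>]
          lholD(2)[OF qs \<sigma> c(1) zA(2)[OF \<sigma>]] ga]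
      \<comment> \<open>The error in the Young equation remains of order 2 * \<alpha> under the
        action and \<omega>.\<close>
      have "germO \<sigma> {s..t} (2 * \<alpha>) (\<lambda>u v. om c (inv_chart c (?f (?P u))) (?D (?P u) (0, ?E u v)))"
        by (rule germO_lb[OF lb_at_comp[OF lb_om_arep[OF c(1) e(1) c(1) Pd[OF \<sigma>]]
              lb_partial(2)[OF c(1) e(1) c(1) Pd[OF \<sigma>]]] ptP gE])
      from germO_add[OF inc(2) this]
      have "germO \<sigma> {s..t} (2 * \<alpha>) (\<lambda>u v. om c (?w u) (snd c (?w v) - snd c (?w u)))"
      proof (rule germO_cong, intro eventually_mono[OF eventually_pairs_in])
        fix r assume r: "fst r \<in> {s..t} \<and> snd r \<in> {s..t}"
        let ?u = "fst r" and ?v = "snd r"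
        have u: "?u \<in> {s..t}" using r by blast
        let ?dz = "snd c (q ?v) - snd c (q ?u)" and ?dh = "snd e (a ?v) - snd e (a ?u)"
        note linD = has_derivative_linear[OF arep_deriv[OF c(1) e(1) c(1) Pd[OF u]]]
        note linO = om_linear[OF c(1) w(1)[OF u]]
        have inv: "inv_chart c (?f (?P ?u)) = ?w ?u"
          using w(2)[OF u] chart_inv[OF atlas_P c(1) w(1)[OF u]] unfolding a(2)[OF u] z_def by simp
        let ?\<kappa> = "om c (?w ?u) (?D (?P ?u) (- ?dz, 0))"
        have "(- ?dz, 0::'k) = - (?dz, 0)" by simp
        then have \<kappa>: "?\<kappa> = - om c (?w ?u) (?D (?P ?u) (?dz, 0))" using linear_neg[OF linD] linear_neg[OF linO] by metis
        \<comment> \<open>Left invariance: the step H of the equation contributes exactly ?\<kappa>,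
          the negative of the contribution of q, so the two cancel.\<close>
        have "om c (act (inv_chart c (snd c (q ?u))) (inv_chart e (snd e (a ?u))))
            (?D (?P ?u) (0, V ?\<kappa> (snd e (a ?u)))) = ?\<kappa>"
          by (rule om_left_invariant[OF c(1) Pd[OF u]])
        then have V: "om c (?w ?u) (?D (?P ?u) (0, H (?P ?u) ?dz)) = ?\<kappa>"
          unfolding H_def snd_conv inv chart_inv[OF atlas_P c(1) zA(2)[OF u]] chart_inv[OF atlas e(1) a(1)[OF u]] .
        have "(0::'e, ?E ?u ?v) = (0, ?dh) - (0, H (?P ?u) ?dz)" by simp
        then have "?D (?P ?u) (0, ?E ?u ?v) = ?D (?P ?u) (0, ?dh) - ?D (?P ?u) (0, H (?P ?u) ?dz)"
          using linear_diff[OF linD] by metis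
        then have "om c (?w ?u) (?D (?P ?u) (0, ?E ?u ?v)) = om c (?w ?u) (?D (?P ?u) (0, ?dh)) - ?\<kappa>"
          using linear_diff[OF linO] V by metis
        then show "om c (?w ?u) (snd c (?w ?v) - snd c (?w ?u)) =
            om c (?w ?u) (snd c (?w ?v) - snd c (?w ?u)) -
            (om c (?w ?u) (?D (?P ?u) (?dz, 0)) + om c (?w ?u) (?D (?P ?u) (0, ?dh))) +
            om c (inv_chart c (?f (?P ?u))) (?D (?P ?u) (0, ?E ?u ?v))"
          unfolding inv \<kappa> by simp
      qed
      with inc(1) show ?thesis by (rule conjI)
    qed
    have "hor \<alpha> {s..t} ?w"
      unfolding hor_def
    proof (intro conjI ballI)
      show "lhol AP \<alpha> {s..t} ?w"
        by (rule lholI[OF atlas_P act_continuous_on[OF lholD(1)[OF qs] ca]], rule bexI[OF _ c(1)])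
          (use key w(1) in blast)
      show "\<exists>c\<in>AP. ?w \<sigma> \<in> fst c \<and> germO \<sigma> {s..t} (2 * \<alpha>) (\<lambda>u v. om c (?w u) (snd c (?w v) - snd c (?w u)))"
        if "\<sigma> \<in> {s..t}" for \<sigma>
        by (rule bexI[OF _ c(1)]) (use key[OF that] w(1)[OF that] in blast)
    qed
    then show "\<exists>a. hor \<alpha> {s..t} (\<lambda>r. act (q r) (a r))" by blast
  qed
qed

end

section \<open>Gluing local lifts and conclusion\<close>

context bundle_connection
begin

lemma lie_integral_join:
  assumes y1: "has_lie_integral AP AG one \<omega> y1 a b (\<lambda>_. 0)" "\<And>t. t \<in> {a..b} \<Longrightarrow> y1 t = y t"
    and y2: "has_lie_integral AP AG one \<omega> y2 b c (\<lambda>_. 0)" "\<And>t. t \<in> {b..c} \<Longrightarrow> y2 t = y t"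
  shows "has_lie_integral AP AG one \<omega> y a c (\<lambda>_. 0)"
  unfolding has_lie_integral_def
proof (intro conjI allI impI zero_tangent[OF atlas])
  fix l assume l: "linear_functional_on (lie_algebra AG one) l"
  have "has_form_integral AP (\<lambda>u X. l (\<omega> u X)) y a b (l (\<lambda>_. 0))" "has_form_integral AP (\<lambda>u X. l (\<omega> u X)) y b c (l (\<lambda>_. 0))"
    using y1 y2 l has_form_integral_cong unfolding has_lie_integral_def by blast+
  from has_form_integral.join[OF this]
  show "has_form_integral AP (\<lambda>u X. l (\<omega> u X)) y a c (l (\<lambda>_. 0))" using functional_zero[OF l] by simp
qed

lemma proj_act: "proj (act u a) = proj u"
  using fibres by metis

text \<open>The property given to \<open>Bolzano\<close> ranges over all starting points of the
  fibre, as the second of two consecutive lifts starts wherever the first one ends.\<close>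

lemma lift_exists:
  assumes alpha: "1/2 < \<alpha>" "\<alpha> \<le> 1" and gP: "riemannian_metric AP gP" and x: "lhol AM \<alpha> {a..b} x" and "a \<le> b"
    and start: "proj u = x a"
  shows "\<exists>y. y a = u \<and> (\<forall>r\<in>{a..b}. proj (y r) = x r) \<and> holder_path AP gP \<alpha> {a..b} y \<and>
    (\<forall>r\<in>{a..b}. has_lie_integral AP AG one \<omega> y a r (\<lambda>_. 0))"
proof -
  have \<alpha>0: "\<alpha> > 0" using alpha by simp
  \<comment> \<open>The lift is described by distance bounds and integrals, which pass directly to
    glued paths; \<open>hor\<close> is used only near a single time.\<close>
  define L where "L s t p y \<longleftrightarrow> y s = p \<and> (\<forall>r\<in>{s..t}. proj (y r) = x r) \<and> holder_bound AP gP \<alpha> y s t \<and>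
    (\<forall>r\<in>{s..t}. has_lie_integral AP AG one \<omega> y s r (\<lambda>_. 0))" for s t p y
  define P where "P s t \<longleftrightarrow> (a \<le> s \<longrightarrow> t \<le> b \<longrightarrow> s \<le> t \<longrightarrow> (\<forall>p. proj p = x s \<longrightarrow> (\<exists>y. L s t p y)))" for s t
  have "P a b"
    using \<open>a \<le> b\<close>
  proof (induction rule: Bolzano)
    case (trans s r t)
    show ?case unfolding P_def
    proof (intro impI allI)
      fix p assume st: "a \<le> s" "t \<le> b" "s \<le> t" and p: "proj p = x s"
      have "\<exists>y. L s r p y" using trans st p unfolding P_def by auto
      then obtain y1 where y1: "L s r p y1" by blast
      then have "proj (y1 r) = x r" using trans(3) unfolding L_def by simp
      then have "\<exists>y. L r t (y1 r) y" using trans st unfolding P_def by auto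
      then obtain y2 where y2: "L r t (y1 r) y2" by blast
      define y where "y q = (if q \<le> r then y1 q else y2 q)" for q
      have eq1: "y1 q = y q" if "q \<in> {s..r}" for q using that by (simp add: y_def)
      have eq2: "y2 q = y q" if "q \<in> {r..t}" for q using that y2 by (auto simp: y_def L_def)
      have hb: "holder_bound AP gP \<alpha> y s r" "holder_bound AP gP \<alpha> y r t"
        using y1 y2 eq1 eq2 unfolding L_def holder_bound_def[OF atlas_P gP] by simp_all
      \<comment> \<open>Joining with the trivial interval {s..s} transfers the integral from y1 to
        the glued path.\<close>
      have int1: "has_lie_integral AP AG one \<omega> y s q (\<lambda>_. 0)" if q: "q \<in> {s..r}" for q
      proof -
        have i: "has_lie_integral AP AG one \<omega> y1 s q (\<lambda>_. 0)" "has_lie_integral AP AG one \<omega> y1 s s (\<lambda>_. 0)"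
          using y1 q trans(3) unfolding L_def by auto
        show ?thesis by (rule lie_integral_join[OF i(2) _ i(1)]) (use eq1 q in auto)
      qed
      have int2: "has_lie_integral AP AG one \<omega> y s q (\<lambda>_. 0)" if q: "q \<in> {r..t}" for q
      proof -
        have i: "has_lie_integral AP AG one \<omega> y1 s r (\<lambda>_. 0)" "has_lie_integral AP AG one \<omega> y2 r q (\<lambda>_. 0)"
          using y1 y2 q trans(3) unfolding L_def by auto
        show ?thesis by (rule lie_integral_join[OF i(1) _ i(2)]) (use eq1 eq2 q in auto)
      qed
      have "L s t p y"
        unfolding L_def
      proof (intro conjI ballI)
        show "y s = p" using y1 trans(3) unfolding L_def y_def by simp
        show "holder_bound AP gP \<alpha> y s t" by (rule holder_bound_trans[OF atlas_P gP hb trans(3,4) \<alpha>0])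
        fix q assume q: "q \<in> {s..t}"
        show "proj (y q) = x q" using y1 y2 q unfolding L_def y_def by auto
        show "has_lie_integral AP AG one \<omega> y s q (\<lambda>_. 0)" using int1[of q] int2[of q] q by (cases "q \<le> r") auto
      qed
      then show "\<exists>y. L s t p y" by blast
    qed
  next
    case (local \<tau>)
    then have \<tau>: "\<tau> \<in> {a..b}" by simp
    obtain d0 q where d0: "d0 > 0" and q: "lhol AP \<alpha> ({a..b} \<inter> {\<tau> - d0..\<tau> + d0}) q"
      and pq: "\<And>r. r \<in> {a..b} \<inter> {\<tau> - d0..\<tau> + d0} \<Longrightarrow> proj (q r) = x r"
      using local_section[OF x \<tau>] by blast
    have \<tau>': "\<tau> \<in> {a..b} \<inter> {\<tau> - d0..\<tau> + d0}" using \<tau> d0 by simp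
    obtain d1 where d1: "d1 > 0" "\<And>s t. s \<le> \<tau> \<Longrightarrow> \<tau> \<le> t \<Longrightarrow> {s..t} \<subseteq> {a..b} \<inter> {\<tau> - d0..\<tau> + d0} \<Longrightarrow> t - s < d1 \<Longrightarrow>
        \<exists>g. hor \<alpha> {s..t} (\<lambda>r. act (q r) (g r))"
      using local_lift[OF alpha q \<tau>'] by blast
    show ?case
    proof (intro exI[of _ "min d0 d1"] conjI allI impI)
      show "0 < min d0 d1" using d0 d1(1) by simp
      fix s t assume st: "s \<le> \<tau> \<and> \<tau> \<le> t \<and> t - s < min d0 d1"
      show "P s t" unfolding P_def
      proof (intro impI allI)
        fix p assume ab: "a \<le> s" "t \<le> b" "s \<le> t" and p: "proj p = x s"
        have sub: "{s..t} \<subseteq> {a..b} \<inter> {\<tau> - d0..\<tau> + d0}" using st ab by auto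
        obtain g where g: "hor \<alpha> {s..t} (\<lambda>r. act (q r) (g r))" using d1(2)[OF _ _ sub] st by auto
        have pr: "proj (act (q r) (g r)) = x r" if r: "r \<in> {s..t}" for r
          unfolding proj_act using pq sub r by blast
        have "proj (act (q s) (g s)) = proj p" using pr[of s] p ab by simp
        then obtain k where k: "p = act (act (q s) (g s)) k" using fibres by blast
        define y where "y r = act (act (q r) (g r)) k" for r
        have hy: "hor \<alpha> {s..t} y" unfolding y_def[abs_def] by (rule hor_translate[OF g])
        have "L s t p y"
          unfolding L_def
        proof (intro conjI ballI)
          show "y s = p" unfolding y_def k ..
          show "holder_bound AP gP \<alpha> y s t"
            unfolding holder_bound_iff[OF atlas_P gP] by (rule lhol_holder_path[OF atlas_P gP hor_lhol[OF hy] ab(3) \<alpha>0])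
          fix r assume r: "r \<in> {s..t}"
          show "proj (y r) = x r" unfolding y_def proj_act[of _ k] by (rule pr[OF r])
          show "has_lie_integral AP AG one \<omega> y s r (\<lambda>_. 0)" by (rule hor_lie_integral[OF alpha hy r])
        qed
        then show "\<exists>y. L s t p y" by blast
      qed
    qed
  qed
  then obtain y where "L a b u y" unfolding P_def using \<open>a \<le> b\<close> start by blast
  then show ?thesis unfolding L_def holder_bound_iff[OF atlas_P gP] by blast
qed

lemma lift_unique:
  assumes alpha: "1/2 < \<alpha>" "\<alpha> \<le> 1" and gP: "riemannian_metric AP gP" and t: "0 \<le> t"
    and y: "y 0 = u" "\<And>r. r \<in> {0..t} \<Longrightarrow> proj (y r) = x r" "holder_path AP gP \<alpha> {0..t} y"
      "\<And>r. r \<in> {0..t} \<Longrightarrow> has_lie_integral AP AG one \<omega> y 0 r (\<lambda>_. 0)"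
    and y': "y' 0 = u" "\<And>r. r \<in> {0..t} \<Longrightarrow> proj (y' r) = x r" "holder_path AP gP \<alpha> {0..t} y'"
      "\<And>r. r \<in> {0..t} \<Longrightarrow> has_lie_integral AP AG one \<omega> y' 0 r (\<lambda>_. 0)"
  shows "y' t = y t"
proof (rule hor_unique[OF alpha(1)])
  have \<alpha>0: "\<alpha> > 0" using alpha by simp
  show "hor \<alpha> {0..t} y"
    by (rule lie_integral_hor[OF alpha holder_path_lhol[OF atlas_P gP y(3) \<alpha>0] t y(4)])
  show "hor \<alpha> {0..t} y'"
    by (rule lie_integral_hor[OF alpha holder_path_lhol[OF atlas_P gP y'(3) \<alpha>0] t y'(4)])
qed (use y y' t in auto)

end

theorem theorem2p6:
  fixes AP :: "('p::t2_space, 'e::finite_dim_normed) chart set"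
    and AM :: "('m::t2_space, 'f::finite_dim_normed) chart set"
    and AG :: "('g::t2_space, 'k::finite_dim_normed) chart set"
    and mul :: "'g \<Rightarrow> 'g \<Rightarrow> 'g" and one :: 'g and ginv :: "'g \<Rightarrow> 'g"
    and act :: "'p \<Rightarrow> 'g \<Rightarrow> 'p" and proj :: "'p \<Rightarrow> 'm"
    and \<omega> :: "'p \<Rightarrow> 'p tangent \<Rightarrow> 'g tangent"
    and gP :: "'p \<Rightarrow> 'p tangent \<Rightarrow> 'p tangent \<Rightarrow> real"
    and gM :: "'m \<Rightarrow> 'm tangent \<Rightarrow> 'm tangent \<Rightarrow> real"
    and \<alpha> T :: real and x :: "real \<Rightarrow> 'm" and u :: 'p
  assumes principal: "principal_bundle AP AM AG mul one ginv act proj"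
    and connection: "connection_form AP AG mul one ginv act \<omega>"
    and metric_P: "riemannian_metric AP gP"
    and metric_M: "riemannian_metric AM gM"
    and alpha: "1/2 < \<alpha>" "\<alpha> \<le> 1"
    and T: "0 < T"
    and path: "holder_path AM gM \<alpha> {0..T} x"
    and start: "proj u = x 0"
  shows "\<exists>J y. is_interval J \<and> 0 \<in> J \<and> J \<subseteq> {0..T} \<and>
           horizontal_lift_on AP AG one proj \<omega> gP \<alpha> x u J y \<and>
           (\<forall>J' y'. is_interval J' \<and> 0 \<in> J' \<and> J' \<subseteq> {0..T} \<and>
              horizontal_lift_on AP AG one proj \<omega> gP \<alpha> x u J' y' \<longrightarrow>
              J' \<subseteq> J \<and> (\<forall>t\<in>J'. y' t = y t)) \<and>
           (J = {0..T} \<or> (\<exists>\<tau>. 0 < \<tau> \<and> \<tau> \<le> T \<and> J = {0..<\<tau>} \<and> explodes_at y \<tau>))"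
proof -
  interpret pb: principal_bundle AP AM AG mul one ginv act proj by (rule principal)
  \<comment> \<open>A chart around the unit identifies the Lie algebra with the model space of the
    group.\<close>
  obtain e where e: "e \<in> AG" "one \<in> fst e" using chart_cover[OF pb.atlas] by blast
  interpret bundle_connection AP AM AG mul one ginv act proj e \<omega>
    by unfold_locales (use e connection in auto)
  have "lhol AM \<alpha> {0..T} x" by (rule holder_path_lhol[OF pb.atlas_M metric_M path]) (use alpha in simp)
  from lift_exists[OF alpha metric_P this _ start] T
  obtain y where y: "y 0 = u" "\<And>r. r \<in> {0..T} \<Longrightarrow> proj (y r) = x r" "holder_path AP gP \<alpha> {0..T} y"
    "\<And>r. r \<in> {0..T} \<Longrightarrow> has_lie_integral AP AG one \<omega> y 0 r (\<lambda>_. 0)"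
    by auto
  have hp: "holder_path AP gP \<alpha> {0..t} y" if t: "t \<in> {0..T}" for t
  proof -
    have "{0..t} \<subseteq> {0..T}" using t by auto
    then show ?thesis using y(3) unfolding holder_path_def by (meson subset_iff)
  qed
  show ?thesis
  \<comment> \<open>The maximal interval is {0..T}, so the last clause holds by its first
    alternative.\<close>
  proof (rule exI, rule exI, intro conjI allI impI)
    show "is_interval {0..T}" by (rule is_interval_cc)
    show "0 \<in> {0..T}" using T by simp
    show "{0..T} \<subseteq> {0..T}" ..
    show "horizontal_lift_on AP AG one proj \<omega> gP \<alpha> x u {0..T} y"
      unfolding horizontal_lift_on_def using y hp by blast
    show "{0..T} = {0..T} \<or> (\<exists>\<tau>. 0 < \<tau> \<and> \<tau> \<le> T \<and> {0..T} = {0..<\<tau>} \<and> explodes_at y \<tau>)" by blast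
    fix J' y' assume A: "is_interval J' \<and> 0 \<in> J' \<and> J' \<subseteq> {0..T} \<and> horizontal_lift_on AP AG one proj \<omega> gP \<alpha> x u J' y'"
    then show "J' \<subseteq> {0..T}" by blast
    show "\<forall>t\<in>J'. y' t = y t"
    proof
      fix t assume t: "t \<in> J'"
      then have tT: "t \<in> {0..T}" using A by blast
      \<comment> \<open>J' may be half-open; for each t in J' the comparison takes place on {0..t},
        which lies in J' because J' is an interval that contains 0.\<close>
      have sub: "r \<in> J'" if r: "r \<in> {0..t}" for r
        using A t r mem_is_interval_1_I[of J' 0 t r] by auto
      have subT: "r \<in> {0..T}" if r: "r \<in> {0..t}" for r using r tT by auto
      show "y' t = y t"
      proof (rule lift_unique[OF alpha metric_P _ y(1) y(2)[OF subT] hp[OF tT] y(4)[OF subT]])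
        show "0 \<le> t" using tT by simp
        show "y' 0 = u" "holder_path AP gP \<alpha> {0..t} y'" using A t unfolding horizontal_lift_on_def by blast+
        fix r assume "r \<in> {0..t}"
        from sub[OF this] show "proj (y' r) = x r" "has_lie_integral AP AG one \<omega> y' 0 r (\<lambda>_. 0)"
          using A unfolding horizontal_lift_on_def by blast+
      qed
    qed
  qed
qed

end
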